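(* Let $n,d\ge 1$, let $\alpha\in\{\mathrm D,\mathrm N,\mathrm R\}$, and suppose $u_\alpha^*\in\mathcal B^{2n+2}(\Omega)$ is a solution of $\Delta^n u=f$ in $\Omega$ satisfying the Dirichlet ($\alpha=\mathrm D$), Neumann ($\alpha=\mathrm N$) or Robin ($\alpha=\mathrm R$) boundary condition with data $\boldsymbol g_\alpha$; when $\alpha=\mathrm N$ let $\int_\Omega u^*_{\mathrm N}\,\mathrm dx=0$. Let $\mathcal F_{\mathrm{ReQU},m}$ be the class of two-layer networks associated with $u^*=u_\alpha^*$, let the number $N$ of interior sample points and the number $\widehat N$ of boundary sample points satisfy that $\widehat N$ is of order $N/d^2$, and let $$\hat{\boldsymbol u}_\theta=(\hat\phi_0,\hat{\boldsymbol\psi}_0,\dots,\hat\phi_{n-1},\hat{\boldsymbol\psi}_{n-1})\in\arg\min_{\boldsymbol u_\theta\in\mathcal F_{\mathrm{ReQU},m}}\widehat{\mathcal L}_\alpha(\boldsymbol u_\theta).$$ Then there is a constant $C>0$, independent of $m$, $N$ and $u_\alpha^*$, such that: (i) for $\alpha=\mathrm N,\mathrm R$, $$\sum_{k=0}^{n-1}\Big(\mathbb E\|\hat\phi_k-\Delta^k u_\alpha^*\|_{H^1(\Omega)}^2+\mathbb E\|\hat{\boldsymbol\psi}_k-\nabla\Delta^k u_\alpha^*\|_{H(\mathrm{div};\Omega)}^2\Big)\le C\Big(\frac{\|u_\alpha^*\|_{\mathcal B^{2n+2}(\Omega)}^2}{m}+\frac{\|u_\alpha^*\|_{\mathcal B^{2n+2}(\Omega)}^2}{\sqrt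 N}\Big);$$ (ii) for $\alpha=\mathrm D$, $$\sum_{k=0}^{n-1}\Big(\mathbb E\|\hat\phi_k-\Delta^k u_{\mathrm D}^*\|_{H^1(\Omega)}^2+\mathbb E\|\hat{\boldsymbol\psi}_k-\nabla\Delta^k u_{\mathrm D}^*\|_{H(\mathrm{div};\Omega)}^2\Big)\le C\Big(\frac{\|u_{\mathrm D}^*\|_{\mathcal B^{2n+2}(\Omega)}^2}{\sqrt m}+\frac{\|u_{\mathrm D}^*\|_{\mathcal B^{2n+2}(\Omega)}^2}{\sqrt[4]{N}}\Big).$$ Here the expectation is over the random sampling of the training points in $\Omega$ and on $\partial\Omega$.
   Context: $\Omega=[0,1]^d$, $\boldsymbol n$ is the outer unit normal of $\partial\Omega$. Boundary conditions on $\partial\Omega$. Dirichlet: $(u,\Delta u,\dots,\Delta^{n-1}u)=\boldsymbol g_{\mathrm D}$. Neumann: $(\partial_{\boldsymbol n}u,\partial_{\boldsymbol n}\Delta u,\dots,\partial_{\boldsymbol n}\Delta^{n-1}u)=\boldsymbol g_{\mathrm N}$. Robin: $(u+\partial_{\boldsymbol n}u,\dots,\Delta^{n-1}u+\partial_{\boldsymbol n}\Delta^{n-1}u)=\boldsymbol g_{\mathrm R}$. Spectral Barron space. For $\boldsymbol k\in\mathbb N_0^d$ let $\Phi_{\boldsymbol k}(x)=\prod_{i=1}^d\cos(\pi k_ix_i)$, and let $\hat u(\boldsymbol k)$ be the expansion coefficients of $u\in L^1(\Omega)$ in $\{\Phi_{\boldsymbol k}\}$; $|\boldsymbol k|_1=\sum_i|k_i|$.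 Then $\mathcal B^s(\Omega)$ is the set of $u\in L^1(\Omega)$ with $\|u\|_{\mathcal B^s(\Omega)}:=\sum_{\boldsymbol k\in\mathbb N_0^d}(1+\pi^s|\boldsymbol k|_1^s)|\hat u(\boldsymbol k)|<\infty$. Also write $\|\cdot\|_{\mathcal B^s}$. Networks. $\mathrm{ReQU}(t)=t^2$ for $t\ge0$ and $0$ for $t<0$. $\mathcal F_{\mathrm{ReQU},m}$ associated with $u^*$ is the set of functions $x\mapsto \boldsymbol c+\sum_{i=1}^m\boldsymbol a_i\,\mathrm{ReQU}(W_ix+b_i)\in\mathbb R^{n(d+1)}$, $x\in\mathbb R^d$, with $\boldsymbol c,\boldsymbol a_i\in\mathbb R^{n(d+1)}$, $W_i\in\mathbb R^{1\times d}$, $b_i\in\mathbb R$ and $|\boldsymbol c|\le2\|u^*\|_{\mathcal B^{2n+2}}$, $|W_i|_2\le1$, $|b_i|\le1$, $\sum_{i=1}^m|\boldsymbol a_i|\le4\|u^*\|_{\mathcal B^{2n+2}}$. An element is written $\boldsymbol u_\theta=(\phi_0,\boldsymbol\psi_0,\dots,\phi_{n-1},\boldsymbol\psi_{n-1})$ with $\phi_i$ scalar and $\boldsymbol\psi_i$ $\mathbb R^d$-valued. Operators. $\boldsymbol f=(0,\dots,0,f)^T\in\mathbb R^{n(d+1)}$. $\mathcal P\boldsymbol u$ has components $\nabla\phi_i-\boldsymbol\psi_i$ ($0\le i\le n-1$), $\mathrm{div}\,\boldsymbol\psi_i-\phi_{i+1}$ ($0\le i\le n-2$), in the order $\nabla\phi_0-\boldsymbol\psi_0,\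 \mathrm{div}\,\boldsymbol\psi_0-\phi_1,\dots$, and last component $\mathrm{div}\,\boldsymbol\psi_{n-1}$. Boundary operators: $S_{\mathrm D}\boldsymbol u=(\phi_0,\dots,\phi_{n-1})$, $S_{\mathrm N}\boldsymbol u=(\boldsymbol n\cdot\boldsymbol\psi_0,\dots,\boldsymbol n\cdot\boldsymbol\psi_{n-1})$, $S_{\mathrm R}=S_{\mathrm D}+S_{\mathrm N}$. Empirical loss. $\{X_j\}_{j=1}^N$ and $\{\widehat X_j\}_{j=1}^{\widehat N}$ are independent uniformly distributed random points in $\Omega$ and on $\partial\Omega$; $\lambda,\mu>0$ are fixed penalty constants. For $\alpha=\mathrm D,\mathrm R$, $$\widehat{\mathcal L}_\alpha(\boldsymbol u_\theta)=\frac{|\Omega|}{N}\sum_{j=1}^N|(\mathcal P\boldsymbol u_\theta-\boldsymbol f)(X_j)|^2+\frac{|\partial\Omega|}{\widehat N}\sum_{j=1}^{\widehat N}\lambda|(S_\alpha\boldsymbol u_\theta-\boldsymbol g_\alpha)(\widehat X_j)|^2,$$ and for $\alpha=\mathrm N$ the term $\mu\big|\frac{|\Omega|}{N}\sum_{j=1}^N\phi_0(X_j)\big|^2$ is added to this expression. Norm. $\|\boldsymbol v\|_{H(\mathrm{div};\Omega)}=(\|\boldsymbol v\|_{L^2(\Omega)}^2+\|\mathrm{div}\,\boldsymbol v\|_{L^2(\Omega)}^2)^{1/2}$. "$\widehat N$ is of order $N/d^2$" means $c_1N/d^2\le\widehat N\le c_2N/d^2$ for fixed constants $c_1,c_2>0$.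 The constant $C$ may depend on $n,d,\lambda,\mu,c_1,c_2$. *)

theory Defs
  imports "HOL-Probability.Probability"
begin

datatype bc = Dirichlet | Neumann | Robin

abbreviation cube :: "(real ^ 'd) set" where
  "cube \<equiv> cbox 0 1"

text \<open>The points of the boundary lying on exactly one face, that is, the points at which
  the outer unit normal exists. The remaining boundary points have surface measure zero.\<close>

definition smooth_boundary :: "(real ^ 'd) set" where
  "smooth_boundary = {x \<in> cube. \<exists>!i. x $ i = 0 \<or> x $ i = 1}"

text \<open>The outer unit normal at points of \<^const>\<open>smooth_boundary\<close>; its values elsewhere
  are irrelevant.\<close>

definition outer_normal :: "real ^ 'd \<Rightarrow> real ^ 'd" where
  "outer_normal x = (\<chi> i. if x $ i = 1 then 1 else if x $ i = 0 then - 1 else 0)"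

text \<open>The Lebesgue measure of dimension \<open>CARD('d) - 1\<close> on the face of the cube where
  coordinate \<open>i\<close> equals \<open>b\<close>. For \<open>CARD('d) = 1\<close> this is a point mass.\<close>

definition face_measure :: "'d::finite \<Rightarrow> real \<Rightarrow> (real ^ 'd) measure" where
  "face_measure i b =
     distr (\<Pi>\<^sub>M j\<in>UNIV - {i}. restrict_space lborel {0..1}) borel
       (\<lambda>y. \<chi> j. if j = i then b else y j)"

definition surface_measure :: "(real ^ 'd) measure" where
  "surface_measure = measure_of UNIV (sets borel)
     (\<lambda>A. \<Sum>i\<in>UNIV. \<Sum>b\<in>{0, 1}. emeasure (face_measure i b) A)"

text \<open>All derivatives are taken relative to the closed cube, so that they are the usual ones
  in the interior and one-sided ones on the boundary.\<close>

definition partial :: "'d \<Rightarrow> (real ^ 'd \<Rightarrow> real) \<Rightarrow> real ^ 'd \<Rightarrow> real" where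
  "partial i v x = frechet_derivative v (at x within cube) (axis i 1)"

definition gradient :: "(real ^ 'd \<Rightarrow> real) \<Rightarrow> real ^ 'd \<Rightarrow> real ^ 'd" where
  "gradient v x = (\<chi> i. partial i v x)"

definition divergence :: "(real ^ 'd \<Rightarrow> real ^ 'd) \<Rightarrow> real ^ 'd \<Rightarrow> real" where
  "divergence w x = (\<Sum>i\<in>UNIV. partial i (\<lambda>y. w y $ i) x)"

definition laplacian :: "(real ^ 'd \<Rightarrow> real) \<Rightarrow> real ^ 'd \<Rightarrow> real" where
  "laplacian v = divergence (gradient v)"

definition normal_deriv :: "(real ^ 'd \<Rightarrow> real) \<Rightarrow> real ^ 'd \<Rightarrow> real" where
  "normal_deriv v x = outer_normal x \<bullet> gradient v x"

text \<open>The Sobolev norms below are only used for functions that are continuously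
  differentiable up to the boundary, for which weak and classical derivatives agree.\<close>

definition L2_norm :: "(real ^ 'd \<Rightarrow> 'b::real_normed_vector) \<Rightarrow> real" where
  "L2_norm v = sqrt (LINT x:cube|lborel. (norm (v x))\<^sup>2)"

definition H1_norm :: "(real ^ 'd \<Rightarrow> real) \<Rightarrow> real" where
  "H1_norm v = sqrt ((L2_norm v)\<^sup>2 + (L2_norm (gradient v))\<^sup>2)"

definition Hdiv_norm :: "(real ^ 'd \<Rightarrow> real ^ 'd) \<Rightarrow> real" where
  "Hdiv_norm w = sqrt ((L2_norm w)\<^sup>2 + (L2_norm (divergence w))\<^sup>2)"

definition cos_basis :: "nat ^ 'd \<Rightarrow> real ^ 'd \<Rightarrow> real" where
  "cos_basis k x = (\<Prod>i\<in>UNIV. cos (pi * real (k $ i) * x $ i))"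

text \<open>The functions \<^const>\<open>cos_basis\<close> are orthogonal on the cube but not normalised,
  hence the denominator.\<close>

definition cos_coeff :: "(real ^ 'd \<Rightarrow> real) \<Rightarrow> nat ^ 'd \<Rightarrow> real" where
  "cos_coeff u k = (LINT x:cube|lborel. u x * cos_basis k x) /
                   (LINT x:cube|lborel. (cos_basis k x)\<^sup>2)"

definition barron_term :: "nat \<Rightarrow> (real ^ 'd \<Rightarrow> real) \<Rightarrow> nat ^ 'd \<Rightarrow> real" where
  "barron_term s u k = (1 + pi ^ s * real (\<Sum>i\<in>UNIV. k $ i) ^ s) * \<bar>cos_coeff u k\<bar>"

definition barron_space :: "nat \<Rightarrow> (real ^ 'd \<Rightarrow> real) set" where
  "barron_space s = {u. set_integrable lborel cube u \<and> barron_term s u summable_on UNIV}"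

definition barron_norm :: "nat \<Rightarrow> (real ^ 'd \<Rightarrow> real) \<Rightarrow> real" where
  "barron_norm s u = (\<Sum>\<^sub>\<infinity>k. barron_term s u k)"

fun bc_trace :: "bc \<Rightarrow> (real ^ 'd \<Rightarrow> real) \<Rightarrow> real ^ 'd \<Rightarrow> real" where
  "bc_trace Dirichlet v x = v x"
| "bc_trace Neumann v x = normal_deriv v x"
| "bc_trace Robin v x = v x + normal_deriv v x"

text \<open>Conditions involving the normal are imposed where the normal exists.\<close>

definition bc_points :: "bc \<Rightarrow> (real ^ 'd) set" where
  "bc_points \<alpha> = (if \<alpha> = Dirichlet then frontier cube else smooth_boundary)"

text \<open>Elements of \<^const>\<open>barron_space\<close> are determined up to null sets only;
  continuity selects the representative that equals its cosine series at every point of the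
  cube, and which therefore has the \<open>2 * n + 2\<close> continuous derivatives needed for the
  pointwise equations.\<close>

definition is_solution ::
    "bc \<Rightarrow> nat \<Rightarrow> (real ^ 'd \<Rightarrow> real) \<Rightarrow> (real ^ 'd \<Rightarrow> nat \<Rightarrow> real) \<Rightarrow> (real ^ 'd \<Rightarrow> real) \<Rightarrow> bool" where
  "is_solution \<alpha> n f g u \<longleftrightarrow>
     u \<in> barron_space (2 * n + 2) \<and> continuous_on cube u \<and>
     (\<forall>x\<in>interior cube. (laplacian ^^ n) u x = f x) \<and>
     (\<forall>k<n. \<forall>x\<in>bc_points \<alpha>. bc_trace \<alpha> ((laplacian ^^ k) u) x = g x k) \<and>
     (\<alpha> = Neumann \<longrightarrow> (LINT x:cube|lborel. u x) = 0)"

text \<open>A vector in dimension \<open>n (d + 1)\<close> is a family, indexed by \<open>i < n\<close>, of pairs of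
  a scalar and a \<open>d\<close>-dimensional vector. The norm on pairs is Euclidean, so
  \<open>vec_norm\<close> is the Euclidean norm.\<close>

type_synonym 'd state = "nat \<Rightarrow> real \<times> (real ^ 'd)"

definition states :: "nat \<Rightarrow> 'd::finite state set" where
  "states n = {c. \<forall>i\<ge>n. c i = 0}"

definition vec_norm :: "nat \<Rightarrow> (nat \<Rightarrow> 'b::real_normed_vector) \<Rightarrow> real" where
  "vec_norm n c = L2_set (\<lambda>i. norm (c i)) {..<n}"

definition ReQU :: "real \<Rightarrow> real" where
  "ReQU t = (if t \<ge> 0 then t\<^sup>2 else 0)"

definition network ::
    "nat \<Rightarrow> 'd state \<Rightarrow> (nat \<Rightarrow> 'd::finite state) \<Rightarrow> (nat \<Rightarrow> real ^ 'd) \<Rightarrow> (nat \<Rightarrow> real) \<Rightarrow> real ^ 'd \<Rightarrow> 'd state" where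
  "network m c a W b x = (\<lambda>i. c i + (\<Sum>j<m. ReQU (W j \<bullet> x + b j) *\<^sub>R a j i))"

definition ReQU_class :: "nat \<Rightarrow> nat \<Rightarrow> (real ^ 'd \<Rightarrow> real) \<Rightarrow> (real ^ 'd \<Rightarrow> 'd state) set" where
  "ReQU_class n m u = {network m c a W b | c a W b.
     c \<in> states n \<and> (\<forall>j<m. a j \<in> states n) \<and>
     vec_norm n c \<le> 2 * barron_norm (2 * n + 2) u \<and>
     (\<forall>j<m. norm (W j) \<le> 1 \<and> \<bar>b j\<bar> \<le> 1) \<and>
     (\<Sum>j<m. vec_norm n (a j)) \<le> 4 * barron_norm (2 * n + 2) u}"

abbreviation phi :: "(real ^ 'd \<Rightarrow> 'd state) \<Rightarrow> nat \<Rightarrow> real ^ 'd \<Rightarrow> real" where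
  "phi v i \<equiv> \<lambda>x. fst (v x i)"

abbreviation psi :: "(real ^ 'd \<Rightarrow> 'd state) \<Rightarrow> nat \<Rightarrow> real ^ 'd \<Rightarrow> real ^ 'd" where
  "psi v i \<equiv> \<lambda>x. snd (v x i)"

definition P_op :: "nat \<Rightarrow> (real ^ 'd \<Rightarrow> 'd state) \<Rightarrow> real ^ 'd \<Rightarrow> nat \<Rightarrow> (real ^ 'd) \<times> real" where
  "P_op n v x = (\<lambda>i.
     (gradient (phi v i) x - psi v i x,
      divergence (psi v i) x - (if Suc i < n then phi v (Suc i) x else 0)))"

definition rhs :: "nat \<Rightarrow> (real ^ 'd \<Rightarrow> real) \<Rightarrow> real ^ 'd \<Rightarrow> nat \<Rightarrow> (real ^ 'd) \<times> real" where
  "rhs n f x = (\<lambda>i. (0, if Suc i = n then f x else 0))"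

fun S_op :: "bc \<Rightarrow> (real ^ 'd \<Rightarrow> 'd state) \<Rightarrow> real ^ 'd \<Rightarrow> nat \<Rightarrow> real" where
  "S_op Dirichlet v x i = phi v i x"
| "S_op Neumann v x i = outer_normal x \<bullet> psi v i x"
| "S_op Robin v x i = phi v i x + outer_normal x \<bullet> psi v i x"

text \<open>\<open>X\<close> are the \<open>N\<close> interior and \<open>Y\<close> the \<open>N'\<close> boundary sample points.\<close>

definition empirical_loss ::
    "bc \<Rightarrow> nat \<Rightarrow> real \<Rightarrow> real \<Rightarrow> (real ^ 'd \<Rightarrow> real) \<Rightarrow> (real ^ 'd \<Rightarrow> nat \<Rightarrow> real) \<Rightarrow>
     nat \<Rightarrow> nat \<Rightarrow> (nat \<Rightarrow> real ^ 'd) \<Rightarrow> (nat \<Rightarrow> real ^ 'd) \<Rightarrow> (real ^ 'd \<Rightarrow> 'd state) \<Rightarrow> real" where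
  "empirical_loss \<alpha> n lam mu f g N N' X Y v =
     measure lborel (cube :: (real ^ 'd) set) / real N *
       (\<Sum>j<N. (vec_norm n (\<lambda>i. P_op n v (X j) i - rhs n f (X j) i))\<^sup>2) +
     measure surface_measure (frontier (cube :: (real ^ 'd) set)) / real N' *
       (\<Sum>j<N'. lam * (vec_norm n (\<lambda>i. S_op \<alpha> v (Y j) i - g (Y j) i))\<^sup>2) +
     (if \<alpha> = Neumann
      then mu * (measure lborel (cube :: (real ^ 'd) set) / real N * (\<Sum>j<N. phi v 0 (X j)))\<^sup>2
      else 0)"

text \<open>Joint independence of all interior and boundary points is expressed by indexing them
  with the disjoint sum \<open>{..<N} <+> {..<N'}\<close>.\<close>

definition training_sample ::
    "'w measure \<Rightarrow> nat \<Rightarrow> nat \<Rightarrow> (nat \<Rightarrow> 'w \<Rightarrow> real ^ 'd) \<Rightarrow> (nat \<Rightarrow> 'w \<Rightarrow> real ^ 'd) \<Rightarrow> bool" where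
  "training_sample M N N' X Y \<longleftrightarrow>
     prob_space M \<and>
     prob_space.indep_vars M (\<lambda>_. borel) (case_sum X Y) ({..<N} <+> {..<N'}) \<and>
     (\<forall>j<N. distr M borel (X j) = uniform_measure lborel cube) \<and>
     (\<forall>j<N'. distr M borel (Y j) = uniform_measure surface_measure (frontier cube))"

text \<open>The expectations are nonnegative integrals, so that finiteness is part of the bound
  and no integrability has to be assumed.\<close>

definition expected_error ::
    "'w measure \<Rightarrow> nat \<Rightarrow> (real ^ 'd \<Rightarrow> real) \<Rightarrow> ('w \<Rightarrow> real ^ 'd \<Rightarrow> 'd state) \<Rightarrow> ennreal" where
  "expected_error M n u v =
     (\<Sum>k<n.
        (\<integral>\<^sup>+\<omega>. ennreal ((H1_norm (\<lambda>x. phi (v \<omega>) k x - (laplacian ^^ k) u x))\<^sup>2) \<partial>M) +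
        (\<integral>\<^sup>+\<omega>. ennreal ((Hdiv_norm (\<lambda>x. psi (v \<omega>) k x - gradient ((laplacian ^^ k) u) x))\<^sup>2) \<partial>M))"

end

theory Submission
  imports Defs "HOL-Probability.Probability"
begin

text \<open>The difference of a network and the field \<open>(u, \<nabla>u, \<Delta>u, \<nabla>\<Delta>u, \<dots>)\<close> of the solution is
  controlled by the loss through a coercivity estimate: testing \<open>\<nabla>\<phi>\<^sub>i \<approx> \<psi>\<^sub>i\<close> and
  \<open>div \<psi>\<^sub>i \<approx> \<phi>\<^sub>i\<^sub>+\<^sub>1\<close> with \<open>\<phi>\<^sub>i\<close> bounds level \<open>i\<close> by the residuals and level \<open>i + 1\<close>. For
  Dirichlet data the flux in the boundary term has no residual of its own and is only bounded,
  which costs a square root of the loss.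

  The cosine series of \<open>u\<close> is a superposition of ridge waves. Each is the limit of quadratic splines in
  one variable, hence of combinations of neurons with controlled \<open>\<ell>\<^sup>1\<close>-norm of the outer weights, and
  random sampling of the neurons (Maurey) gives a competitor of width \<open>m\<close> with loss \<open>O(1/m)\<close>.

  The residuals of all networks in the class are \<open>\<ell>\<^sup>1\<close>-combinations of a dictionary parametrised by
  a cube of dimension \<open>d + 1\<close>. Their squares expand into products of two dictionary elements, so a
  chaining bound for these products makes the empirical and the population loss differ by
  \<open>O(1/sqrt N)\<close> uniformly over the class.\<close>

section \<open>Measures on the cube and its boundary\<close>

text \<open>The minimiser is an arbitrary choice for every outcome and need not depend measurably on
  it. Every random estimate is therefore a pointwise one: a measurable majorant, fixed before any
  network is chosen, dominates the deviations of all features of the class at once, and only this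
  majorant is integrated. Between sampling and integration the argument is deterministic.
  Independence of the constant from \<open>u\<close> is a matter of homogeneity. The coefficients of
  a network in the class are bounded by multiples of the Barron norm \<open>B\<close>, and the two
  ingredients that do depend on \<open>u\<close>, the right-hand side and the boundary data, enter
  the dictionary divided by their bounds in terms of \<open>B\<close>. So the size of the dictionary
  depends only on \<open>n\<close> and the dimension, and \<open>B^2\<close> factors out of every
  estimate. In the Dirichlet case the square root comes from a free parameter: an unknown flux of
  size \<open>T\<close> costs \<open>T^2 / \<tau>\<close> times the loss plus \<open>\<tau>\<close>.
  Taking \<open>\<tau> = B^2 * s\<close> with a deterministic \<open>s\<close> keeps the bound
  affine in the majorant, so that expectations can be taken directly.\<close>

abbreviation unit_lborel :: "real measure" where
  "unit_lborel \<equiv> restrict_space lborel {0..1}"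

text \<open>The law of the interior points in \<open>training_sample\<close>. It is defined on all
  Borel sets, so integrands are functions on the whole space that only need bounds on the
  cube.\<close>

definition cube_measure :: "(real ^ 'd) measure" where
  "cube_measure = uniform_measure lborel cube"

lemma emeasure_lborel_cube: "emeasure lborel (cube :: (real ^ 'd) set) = 1"
  by (subst emeasure_lborel_cbox_eq) (auto simp: Basis_vec_def inner_axis intro!: prod.neutral)

lemma sets_cube_measure [simp, measurable_cong]: "sets cube_measure = sets borel"
  by (simp add: cube_measure_def)

lemma space_cube_measure [simp]: "space cube_measure = UNIV"
  by (simp add: cube_measure_def)

lemma prob_space_cube_measure: "prob_space (cube_measure :: (real ^ 'd) measure)"
  unfolding cube_measure_def
  by (rule prob_space_uniform_measure) (simp_all add: emeasure_lborel_cube)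

lemma AE_cube_measure: "AE x in cube_measure. x \<in> cube"
  unfolding cube_measure_def by (rule AE_uniform_measureI) auto

lemma emeasure_cube_measure:
  "A \<in> sets borel ==> emeasure cube_measure A = emeasure lborel (cube \<inter> A)"
  unfolding cube_measure_def
  by (subst emeasure_uniform_measure) (auto simp: emeasure_lborel_cube divide_ennreal_def)

lemma prob_space_unit_lborel: "prob_space unit_lborel"
  by (rule prob_spaceI) (simp add: emeasure_restrict_space space_restrict_space)

interpretation unit_lborel: prob_space unit_lborel
  by (rule prob_space_unit_lborel)

interpretation unit_product: product_prob_space "\<lambda>_. unit_lborel" I for I
  by unfold_locales

interpretation lborel_product: product_sigma_finite "\<lambda>_. lborel :: real measure"
  by unfold_locales

lemma measurable_unit_lborel_borel [measurable]: "(\<lambda>x. x) \<in> unit_lborel \<rightarrow>\<^sub>M borel"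
  by (rule measurable_restrict_space1) simp

lemma measurable_vec_lambda:
  fixes f :: "'a => 'd::finite => real"
  assumes "\<And>i. (\<lambda>x. f x i) \<in> borel_measurable M"
  shows "(\<lambda>x. \<chi> i. f x i) \<in> borel_measurable M"
  by (subst borel_measurable_euclidean_space) (auto simp: Basis_vec_def inner_axis assms)

lemma measurable_unit_component:
  "i \<in> I ==> (\<lambda>y. y i) \<in> borel_measurable (\<Pi>\<^sub>M j\<in>I. unit_lborel)"
  by (rule measurable_compose[where f = "\<lambda>y. y i" and g = "\<lambda>x. x" and N = unit_lborel])
    (auto intro: measurable_component_singleton measurable_unit_lborel_borel)

text \<open>Fubini in one coordinate is a statement about \<open>PiM\<close>, whereas the theorem
  speaks of \<open>lborel\<close> on vectors. Agreement on boxes, where both give the product of the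
  side lengths, identifies the two.\<close>

lemma lborel_eq_distr_PiM:
  "(lborel :: (real ^ 'd) measure) = distr (\<Pi>\<^sub>M i\<in>UNIV. lborel) borel (\<lambda>f. \<chi> i. f i)"
proof (rule lborel_eqI)
  have m: "(\<lambda>f. \<chi> i. f i) \<in> (\<Pi>\<^sub>M i\<in>UNIV. lborel) \<rightarrow>\<^sub>M (borel :: (real ^ 'd) measure)"
    by (rule measurable_vec_lambda) (use measurable_component_singleton[of _ UNIV "\<lambda>_. lborel"] in simp)
  fix l u :: "real ^ 'd" assume le: "\<And>b. b \<in> Basis ==> l \<bullet> b <= u \<bullet> b"
  have le': "l $ i <= u $ i" for i
    using le[of "axis i 1"] by (auto simp: inner_axis Basis_vec_def)
  have eq: "(\<lambda>f. \<chi> i. f i) -` box l u \<inter> space (\<Pi>\<^sub>M i\<in>UNIV. lborel) = (\<Pi>\<^sub>E i\<in>UNIV. {l $ i <..< u $ i})"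
    by (auto simp: mem_box_cart space_PiM PiE_iff)
  have "emeasure (distr (\<Pi>\<^sub>M i\<in>UNIV. lborel) borel (\<lambda>f. \<chi> i. f i)) (box l u) =
      (\<Prod>i\<in>UNIV. ennreal (u $ i - l $ i))"
    by (subst emeasure_distr[OF m]) (simp_all add: eq lborel_product.emeasure_PiM le')
  also have "... = ennreal (\<Prod>i\<in>UNIV. u $ i - l $ i)"
    using le' by (intro prod_ennreal) auto
  also have "(\<Prod>i\<in>UNIV. u $ i - l $ i) = (\<Prod>b\<in>Basis. (u - l) \<bullet> b)"
  proof -
    have "inj_on (\<lambda>i::'d. axis i (1::real)) UNIV"
      by (auto simp: inj_on_def axis_eq_axis)
    moreover have b: "(Basis :: (real^'d) set) = (\<lambda>i. axis i 1) ` UNIV"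
      by (auto simp: Basis_vec_def)
    ultimately show ?thesis
      unfolding b by (subst prod.reindex) (simp_all add: inner_axis)
  qed
  finally show "emeasure (distr (\<Pi>\<^sub>M i\<in>UNIV. lborel) borel (\<lambda>f. \<chi> i. f i)) (box l u) =
      ennreal (\<Prod>b\<in>Basis. (u - l) \<bullet> b)" .
qed simp

lemma emeasure_lborel_rectangle:
  assumes "\<And>i. A i \<in> sets borel"
  shows "emeasure lborel {x :: real ^ 'd. \<forall>i. x $ i \<in> A i} = (\<Prod>i\<in>UNIV. emeasure lborel (A i))"
proof -
  have m: "(\<lambda>f. \<chi> i. f i) \<in> (\<Pi>\<^sub>M i\<in>UNIV. lborel) \<rightarrow>\<^sub>M (borel :: (real ^ 'd) measure)"
    by (rule measurable_vec_lambda) (use measurable_component_singleton[of _ UNIV "\<lambda>_. lborel"] in simp)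
  have [measurable]: "A i \<in> sets borel" for i by (rule assms)
  have "emeasure lborel {x :: real ^ 'd. \<forall>i. x $ i \<in> A i} =
      emeasure (\<Pi>\<^sub>M i\<in>UNIV. lborel) (\<Pi>\<^sub>E i\<in>UNIV. A i)"
    by (subst lborel_eq_distr_PiM, subst emeasure_distr[OF m])
      (auto intro!: arg_cong2[where f = emeasure] simp: space_PiM)
  also have "... = (\<Prod>i\<in>UNIV. emeasure lborel (A i))"
    by (rule lborel_product.emeasure_PiM) auto
  finally show ?thesis .
qed

lemma cube_measure_eq_distr_PiM:
  "(cube_measure :: (real ^ 'd) measure) = distr (\<Pi>\<^sub>M i\<in>UNIV. unit_lborel) borel (\<lambda>f. \<chi> i. f i)"
proof -
  \<comment> \<open>Truncating the coordinates gives a map into the product space that is defined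
    everywhere and is the identity on the cube, hence almost everywhere inverse to reassembling the
    vector.\<close>
  define clip where "clip x = (\<lambda>i. max 0 (min 1 (x $ i)))" for x :: "real ^ 'd"
  have comp: "(\<lambda>x. clip x i) \<in> borel \<rightarrow>\<^sub>M unit_lborel" for i
    unfolding clip_def by (rule measurable_restrict_space2) auto
  have clip: "clip \<in> cube_measure \<rightarrow>\<^sub>M (\<Pi>\<^sub>M i\<in>UNIV. unit_lborel)"
  proof -
    have "(\<lambda>x. clip x i) \<in> cube_measure \<rightarrow>\<^sub>M unit_lborel" for i
      by (subst measurable_cong_sets[OF sets_cube_measure refl]) (rule comp)
    then show ?thesis
      by (intro measurable_PiM_single'[of UNIV "\<lambda>i x. clip x i" cube_measure "\<lambda>_. unit_lborel"])
        (simp_all add: clip_def space_restrict_space PiE_UNIV_domain)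
  qed
  have vec: "(\<lambda>f. \<chi> i. f i) \<in> (\<Pi>\<^sub>M i\<in>UNIV. unit_lborel) \<rightarrow>\<^sub>M (borel :: (real ^ 'd) measure)"
    by (rule measurable_vec_lambda) (simp add: measurable_unit_component)
  have "distr cube_measure (\<Pi>\<^sub>M i\<in>UNIV. unit_lborel) clip = (\<Pi>\<^sub>M i\<in>UNIV. unit_lborel)"
  proof (rule unit_product.PiM_eqI)
    fix A :: "'d => real set"
    assume A: "\<And>i. i \<in> UNIV ==> A i \<in> sets unit_lborel"
    have A1: "A i \<subseteq> {0..1}" and A2: "A i \<in> sets borel" for i
      using A[of i] by (auto simp: sets_restrict_space)
    have A3: "Pi\<^sub>E UNIV A \<in> sets (\<Pi>\<^sub>M i\<in>UNIV. unit_lborel)"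
      using A by (intro sets_PiM_I_finite) auto
    have "emeasure (distr cube_measure (\<Pi>\<^sub>M i\<in>UNIV. unit_lborel) clip) (Pi\<^sub>E UNIV A) =
        emeasure cube_measure (clip -` Pi\<^sub>E UNIV A)"
      by (subst emeasure_distr[OF clip A3]) simp
    also have "... = emeasure lborel (cube \<inter> clip -` Pi\<^sub>E UNIV A)"
      using measurable_sets[OF clip A3] by (intro emeasure_cube_measure) simp
    also have "cube \<inter> clip -` Pi\<^sub>E UNIV A = {x. \<forall>i. x $ i \<in> A i}"
    proof (intro set_eqI iffI)
      fix x assume "x \<in> cube \<inter> clip -` Pi\<^sub>E UNIV A"
      then show "x \<in> {x. \<forall>i. x $ i \<in> A i}"
        by (auto simp: clip_def mem_box_cart PiE_iff)
    next
      fix x assume "x \<in> {x. \<forall>i. x $ i \<in> A i}"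
      then have "x $ i \<in> A i" "0 <= x $ i" "x $ i <= 1" for i
        using A1[of i] by auto
      then show "x \<in> cube \<inter> clip -` Pi\<^sub>E UNIV A"
        by (auto simp: clip_def mem_box_cart PiE_iff)
    qed
    also have "emeasure lborel {x. \<forall>i. x $ i \<in> A i} = (\<Prod>i\<in>UNIV. emeasure lborel (A i))"
      using A2 by (rule emeasure_lborel_rectangle)
    also have "... = (\<Prod>i\<in>UNIV. emeasure unit_lborel (A i))"
      using A1 by (intro prod.cong refl) (simp add: emeasure_restrict_space)
    finally show "emeasure (distr cube_measure (\<Pi>\<^sub>M i\<in>UNIV. unit_lborel) clip) (Pi\<^sub>E UNIV A) =
        (\<Prod>i\<in>UNIV. emeasure unit_lborel (A i))" .
  qed auto
  then have "distr (\<Pi>\<^sub>M i\<in>UNIV. unit_lborel) borel (\<lambda>f. \<chi> i. f i) =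
      distr cube_measure borel ((\<lambda>f. \<chi> i. f i) \<circ> clip)"
    using distr_distr[OF vec clip] by simp
  also have "... = distr cube_measure borel (\<lambda>x. x)"
  proof (rule distr_cong_AE)
    show "AE x in cube_measure. ((\<lambda>f. \<chi> i. f i) \<circ> clip) x = x"
      using AE_cube_measure
      by (rule AE_mp) (auto intro!: AE_I2 simp: clip_def mem_box_cart vec_eq_iff)
    show "(\<lambda>f. \<chi> i. f i) \<circ> clip \<in> cube_measure \<rightarrow>\<^sub>M borel"
      using measurable_comp[OF clip vec] .
  qed auto
  also have "... = cube_measure"
    by (rule distr_id2) simp
  finally show ?thesis ..
qed

section \<open>Faces of the cube and segments parallel to a coordinate axis\<close>

definition set_coord :: "'d => real => ('d => real) => real ^ 'd" where
  "set_coord i t y = (\<chi> j. if j = i then t else y j)"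

lemma measurable_set_coord [measurable]:
  "set_coord i b \<in> (\<Pi>\<^sub>M j\<in>UNIV - {i}. unit_lborel) \<rightarrow>\<^sub>M (borel :: (real ^ 'd) measure)"
  unfolding set_coord_def
proof (rule measurable_vec_lambda)
  show "(\<lambda>y. if j = i then b else y j) \<in> borel_measurable (\<Pi>\<^sub>M j\<in>UNIV - {i}. unit_lborel)" for j
    by (cases "j = i") (auto intro: measurable_unit_component)
qed

lemma face_measure_eq:
  "face_measure i b = distr (\<Pi>\<^sub>M j\<in>UNIV - {i}. unit_lborel) borel (set_coord i b)"
  unfolding face_measure_def set_coord_def by simp

lemma sets_face_measure [simp, measurable_cong]: "sets (face_measure i b) = sets borel"
  by (simp add: face_measure_def)

lemma space_face_measure [simp]: "space (face_measure i b) = UNIV"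
  by (simp add: face_measure_def)

lemma prob_space_face_measure: "prob_space (face_measure (i :: 'd::finite) b)"
  unfolding face_measure_eq
  by (rule prob_space.prob_space_distr) (auto intro: prob_space_unit_lborel prob_space_PiM)

lemma integral_face_measure:
  fixes f :: "real ^ 'd => real"
  assumes "f \<in> borel_measurable borel"
  shows "(LINT x|face_measure i b. f x) = (LINT y|(\<Pi>\<^sub>M j\<in>UNIV - {i}. unit_lborel). f (set_coord i b y))"
  unfolding face_measure_eq using assms by (intro integral_distr) auto

text \<open>The inner integral runs along the segments joining the two faces orthogonal to axis
  \<open>i\<close>, which is where the fundamental theorem of calculus applies.\<close>

lemma integral_cube_measure_Fubini:
  fixes f :: "real ^ 'd => real"
  assumes [measurable]: "integrable cube_measure f"
  shows "(LINT x|cube_measure. f x) =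
    (LINT y|(\<Pi>\<^sub>M j\<in>UNIV - {i}. unit_lborel). LINT t|unit_lborel. f (set_coord i t y))"
proof -
  have vec: "(\<lambda>f. \<chi> i. f i) \<in> (\<Pi>\<^sub>M i\<in>UNIV. unit_lborel) \<rightarrow>\<^sub>M (borel :: (real ^ 'd) measure)"
    by (rule measurable_vec_lambda) (simp add: measurable_unit_component)
  have fm: "f \<in> borel_measurable borel"
    using borel_measurable_integrable[OF assms] measurable_cong_sets[OF sets_cube_measure refl] by blast
  have "(LINT x|cube_measure. f x) = (LINT y|(\<Pi>\<^sub>M j\<in>UNIV. unit_lborel). f (\<chi> j. y j))"
    by (subst cube_measure_eq_distr_PiM, rule integral_distr[OF vec fm])
  also have "... = (LINT y|(\<Pi>\<^sub>M j\<in>insert i (UNIV - {i}). unit_lborel). f (\<chi> j. y j))"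
    by (simp add: insert_absorb)
  also have "... = (LINT y|(\<Pi>\<^sub>M j\<in>UNIV - {i}. unit_lborel). LINT t|unit_lborel. f (\<chi> j. (y(i := t)) j))"
  proof (rule unit_product.product_integral_insert)
    have "integrable (\<Pi>\<^sub>M j\<in>UNIV. unit_lborel) (\<lambda>y. f (\<chi> j. y j))"
      using assms by (subst (asm) cube_measure_eq_distr_PiM) (simp add: integrable_distr_eq[OF vec fm])
    then show "integrable (\<Pi>\<^sub>M j\<in>insert i (UNIV - {i}). unit_lborel) (\<lambda>y. f (\<chi> j. y j))"
      by (simp add: insert_absorb)
  qed auto
  also have "... = (LINT y|(\<Pi>\<^sub>M j\<in>UNIV - {i}. unit_lborel). LINT t|unit_lborel. f (set_coord i t y))"
    by (simp add: set_coord_def fun_upd_def)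
  finally show ?thesis .
qed

lemma set_coord_in_cube:
  assumes "y \<in> space (\<Pi>\<^sub>M j\<in>UNIV - {i}. unit_lborel)" "t \<in> {0..1}"
  shows "set_coord i t y \<in> cube"
  using assms by (auto simp: set_coord_def mem_box_cart space_PiM space_restrict_space PiE_iff)

lemma AE_face_measure_cube:
  assumes "b \<in> {0,1}"
  shows "AE x in face_measure i b. x \<in> cube"
  unfolding face_measure_eq using assms
  by (subst AE_distr_iff) (auto intro!: AE_I2 set_coord_in_cube)

text \<open>The other coordinates almost surely avoid 0 and 1, so edges are null and the normal is
  constant on a face; \<open>2 * b - 1\<close> turns the face label 0 or 1 into the sign of the
  outer direction.\<close>

lemma AE_face_measure_normal:
  assumes b: "b \<in> {0,1}"
  shows "AE x in face_measure i b. x \<in> smooth_boundary \<and> x $ i = b \<and>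
    outer_normal x = (2 * b - 1) *\<^sub>R axis i 1"
proof -
  let ?P = "\<Pi>\<^sub>M j\<in>UNIV - {i}. unit_lborel"
  have "AE t in unit_lborel. t ~= 0 \<and> t ~= 1"
  proof -
    have "AE t in lborel. t ~= (0::real)" "AE t in lborel. t ~= (1::real)"
      by (rule AE_lborel_singleton)+
    then have "AE t in lborel. t ~= (0::real) \<and> t ~= 1" by auto
    then show ?thesis by (subst AE_restrict_space_iff) auto
  qed
  then have "AE y in ?P. y j ~= 0 \<and> y j ~= 1" if "j \<in> UNIV - {i}" for j
    using that by (intro AE_PiM_component) (auto intro: prob_space_unit_lborel)
  then have ae: "AE y in ?P. \<forall>j\<in>UNIV - {i}. y j ~= 0 \<and> y j ~= 1"
    by (intro AE_finite_allI) auto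
  have ae2: "AE y in ?P. set_coord i b y \<in> smooth_boundary \<and> set_coord i b y $ i = b \<and>
    outer_normal (set_coord i b y) = (2 * b - 1) *\<^sub>R axis i 1"
    using ae AE_space
  proof eventually_elim
    case (elim y)
    have "set_coord i b y \<in> cube"
      using b elim by (intro set_coord_in_cube) auto
    moreover have "\<exists>!j. set_coord i b y $ j = 0 \<or> set_coord i b y $ j = 1"
      using elim b by (intro ex1I[of _ i]) (auto simp: set_coord_def split: if_splits)
    ultimately have "set_coord i b y \<in> smooth_boundary"
      by (simp add: smooth_boundary_def)
    moreover have "outer_normal (set_coord i b y) = (2 * b - 1) *\<^sub>R axis i 1"
      using elim b by (auto simp: outer_normal_def vec_eq_iff set_coord_def axis_def)
    ultimately show ?case by (simp add: set_coord_def)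
  qed
  show ?thesis
    unfolding face_measure_eq
  proof (subst AE_distr_iff)
    show "{x \<in> space borel. x \<in> smooth_boundary \<and> x $ i = b \<and>
        outer_normal x = (2 * b - 1) *\<^sub>R axis i 1} \<in> sets borel"
    proof -
      have e: "smooth_boundary = {x \<in> cube. \<exists>i::'a. (x $ i = 0 \<or> x $ i = 1) \<and> (\<forall>j. x $ j = 0 \<or> x $ j = 1 --> j = i)}"
        unfolding smooth_boundary_def Ex1_def by simp
      have o: "outer_normal x = (2 * b - 1) *\<^sub>R axis i 1 \<longleftrightarrow> (\<forall>j. (if x $ j = 1 then 1 else if x $ j = 0 then - 1 else 0) = (2 * b - 1) * axis i 1 $ j)" for x :: "real^'a"
        by (simp add: outer_normal_def vec_eq_iff)
      show ?thesis unfolding e o by measurable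
    qed
  qed (use ae2 in \<open>simp_all\<close>)
qed

text \<open>Networks and cosine series are both continuously differentiable on the whole space.
  Working with ordinary derivatives there keeps one-sided derivatives out of the analysis;
  \<open>gradient_cube\<close> and \<open>partial_cube\<close> return to the definitions relative to
  the closed cube.\<close>

definition has_grad :: "(real ^ 'd => real) => (real ^ 'd => real ^ 'd) => bool" where
  "has_grad v g \<longleftrightarrow> continuous_on UNIV g \<and> (\<forall>x. (v has_derivative (\<lambda>h. g x \<bullet> h)) (at x))"

lemma has_grad_continuous: "has_grad v g ==> continuous_on UNIV v"
  unfolding has_grad_def by (meson continuous_at_imp_continuous_on has_derivative_continuous)

lemma has_grad_continuous_grad: "has_grad v g ==> continuous_on UNIV g"
  by (simp add: has_grad_def)

lemma continuous_measurable:
  fixes f :: "real ^ 'd => 'b::topological_space"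
  shows "continuous_on UNIV f ==> f \<in> borel_measurable borel"
  by (rule borel_measurable_continuous_onI)

lemma continuous_bounded_on_cube:
  fixes f :: "real ^ 'd => 'b::real_normed_vector"
  assumes "continuous_on UNIV f"
  obtains B where "\<And>x. x \<in> cube ==> norm (f x) <= B"
proof -
  have "compact (f ` cube)"
    using assms by (intro compact_continuous_image) (auto intro: continuous_on_subset)
  then show ?thesis
    using that by (meson bounded_iff compact_imp_bounded image_eqI)
qed

lemma integrable_bounded_on_cube:
  fixes f :: "real ^ 'd => 'b::{banach,second_countable_topology}"
  assumes M: "prob_space M" "sets M = sets borel" "AE x in M. x \<in> cube"
    and f: "f \<in> borel_measurable borel" "\<And>x. x \<in> cube ==> norm (f x) <= B"
  shows "integrable M f"
proof -
  interpret prob_space M by fact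
  show ?thesis
    using M f by (intro integrable_const_bound[of _ B]) (auto simp: measurable_cong_sets[OF M(2) refl])
qed

lemma integrable_continuous_on_cube:
  fixes f :: "real ^ 'd => 'b::{banach,second_countable_topology}"
  assumes M: "prob_space M" "sets M = sets borel" "AE x in M. x \<in> cube"
    and f: "continuous_on UNIV f"
  shows "integrable M f"
  using continuous_bounded_on_cube[OF f] integrable_bounded_on_cube[OF M continuous_measurable[OF f]]
  by metis

lemmas integrable_cube_continuous =
  integrable_continuous_on_cube[OF prob_space_cube_measure sets_cube_measure AE_cube_measure]

lemmas integrable_face_continuous =
  integrable_continuous_on_cube[OF prob_space_face_measure sets_face_measure AE_face_measure_cube]

lemma set_coord_axis: "set_coord i t y = set_coord i 0 y + t *\<^sub>R axis i 1"
  by (auto simp: set_coord_def vec_eq_iff axis_def)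

text \<open>The fundamental theorem of calculus on every line parallel to axis \<open>i\<close>,
  integrated over the remaining coordinates: the divergence theorem for a field with a single
  nonzero component.\<close>

lemma integral_partial:
  assumes v: "has_grad v g"
  shows "(LINT x|cube_measure. g x $ i) = (LINT x|face_measure i 1. v x) - (LINT x|face_measure i 0. v x)"
proof -
  let ?P = "\<Pi>\<^sub>M j\<in>UNIV - {i}. unit_lborel"
  have cg: "continuous_on UNIV g" and cv: "continuous_on UNIV v"
    using v by (auto intro: has_grad_continuous has_grad_continuous_grad)
  have cgi: "continuous_on UNIV (\<lambda>x. g x $ i)"
    using cg by (intro continuous_intros)
  have inner: "(LINT t|unit_lborel. g (set_coord i t y) $ i) = v (set_coord i 1 y) - v (set_coord i 0 y)" for y
  proof -
    have d: "((\<lambda>t. v (set_coord i t y)) has_real_derivative g (set_coord i t y) $ i) (at t)" for t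
    proof -
      have 1: "((\<lambda>t. set_coord i t y) has_derivative (\<lambda>h. h *\<^sub>R axis i 1)) (at t)"
        by (subst set_coord_axis) (auto intro!: derivative_eq_intros)
      have 2: "(v has_derivative (\<lambda>h. g (set_coord i t y) \<bullet> h)) (at (set_coord i t y))"
        using v by (simp add: has_grad_def)
      have "((\<lambda>t. v (set_coord i t y)) has_derivative (\<lambda>h. g (set_coord i t y) \<bullet> (h *\<^sub>R axis i 1))) (at t)"
        using has_derivative_compose[OF 1 2] .
      then show ?thesis
        by (auto simp: has_field_derivative_def inner_axis mult.commute elim!: has_derivative_eq_rhs)
    qed
    have c: "continuous_on UNIV (\<lambda>t. g (set_coord i t y) $ i)"
      by (subst set_coord_axis) (intro continuous_intros continuous_on_compose2[OF cg], auto)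
    have "(LINT t|unit_lborel. g (set_coord i t y) $ i) =
        (LINT t|lborel. g (set_coord i t y) $ i * indicator {0..1} t)"
      by (subst integral_restrict_space) (auto simp: mult.commute)
    also have "... = v (set_coord i 1 y) - v (set_coord i 0 y)"
      by (rule integral_FTC_Icc_real) (use d c in \<open>auto simp: continuous_on_eq_continuous_at\<close>)
    finally show ?thesis .
  qed
  have int: "integrable ?P (\<lambda>y. v (set_coord i b y))" if "b \<in> {0,1}" for b
    using integrable_face_continuous[OF that cv] unfolding face_measure_eq
    by (subst (asm) integrable_distr_eq) (auto intro: continuous_measurable[OF cv])
  have "(LINT x|cube_measure. g x $ i) = (LINT y|?P. LINT t|unit_lborel. g (set_coord i t y) $ i)"
    by (rule integral_cube_measure_Fubini) (rule integrable_cube_continuous[OF cgi])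
  also have "... = (LINT y|?P. v (set_coord i 1 y)) - (LINT y|?P. v (set_coord i 0 y))"
    unfolding inner by (rule Bochner_Integration.integral_diff) (auto intro: int)
  finally show ?thesis
    using continuous_measurable[OF cv] by (simp add: integral_face_measure)
qed

section \<open>The surface measure as a sum over faces\<close>

lemma sets_surface_measure [simp, measurable_cong]: "sets surface_measure = sets borel"
  unfolding surface_measure_def by (subst sets_measure_of) (auto, metis sets.sigma_sets_eq space_borel)

lemma space_surface_measure [simp]: "space surface_measure = UNIV"
  by (simp add: surface_measure_def)

text \<open>\<open>measure_of\<close> falls back to the zero measure unless its argument is
  countably additive, which here follows by exchanging the finite sums over faces with the
  series.\<close>

lemma emeasure_surface_measure:
  fixes A :: "(real ^ 'd) set"
  assumes "A \<in> sets borel"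
  shows "emeasure surface_measure A = (\<Sum>i\<in>UNIV. \<Sum>b\<in>{0,1}. emeasure (face_measure i b) A)"
  unfolding surface_measure_def
proof (rule emeasure_measure_of_sigma)
  show "sigma_algebra UNIV (sets (borel :: (real ^ 'd) measure))"
    using sets.sigma_algebra_axioms[of "borel :: (real ^ 'd) measure"] by simp
  show "positive (sets borel) (\<lambda>A :: (real ^ 'd) set. \<Sum>i\<in>UNIV. \<Sum>b\<in>{0, 1}. emeasure (face_measure i b) A)"
    by (simp add: positive_def)
  show "countably_additive (sets borel) (\<lambda>A :: (real ^ 'd) set. \<Sum>i\<in>UNIV. \<Sum>b\<in>{0, 1}. emeasure (face_measure i b) A)"
  proof (rule countably_additiveI)
    fix A :: "nat => (real ^ 'd) set"
    assume A: "range A \<subseteq> sets borel" "disjoint_family A" "\<Union> (range A) \<in> sets borel"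
    have "(\<Sum>n. \<Sum>i\<in>UNIV. \<Sum>b\<in>{0, 1}. emeasure (face_measure i b) (A n)) =
        (\<Sum>i\<in>UNIV. \<Sum>b\<in>{0, 1}. \<Sum>n. emeasure (face_measure i b) (A n))"
      by (subst suminf_sum) (auto intro!: sum.cong simp: suminf_add)
    also have "... = (\<Sum>i\<in>UNIV. \<Sum>b\<in>{0, 1}. emeasure (face_measure i b) (\<Union> (range A)))"
      using A by (intro sum.cong refl suminf_emeasure) auto
    finally show "(\<Sum>n. \<Sum>i\<in>UNIV. \<Sum>b\<in>{0, 1}. emeasure (face_measure i b) (A n)) =
        (\<Sum>i\<in>UNIV. \<Sum>b\<in>{0, 1}. emeasure (face_measure i b) (\<Union> (range A)))" .
  qed
qed fact

lemma nn_integral_surface_measure: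
  assumes "f \<in> borel_measurable borel"
  shows "(\<integral>\<^sup>+x. f x \<partial>surface_measure) = (\<Sum>i\<in>UNIV. \<Sum>b\<in>{0,1}. \<integral>\<^sup>+x. f x \<partial>face_measure i b)"
  using assms
proof (induction rule: borel_measurable_induct)
  case (cong f g)
  then have "f = g" by auto
  then show ?case using cong by simp
next
  case (set A)
  then show ?case by (simp add: emeasure_surface_measure)
next
  case (mult u c)
  then show ?case by (simp add: nn_integral_cmult sum_distrib_left distrib_left)
next
  case (add u v)
  then show ?case by (simp add: nn_integral_add sum.distrib add_ac)
next
  case (seq U)
  have inc: "incseq (\<lambda>n. \<integral>\<^sup>+x. U n x \<partial>face_measure i b)" for i :: 'a and b
    using seq by (auto intro!: incseq_SucI nn_integral_mono simp: incseq_Suc_iff le_fun_def)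
  have m: "(\<integral>\<^sup>+x. (SUP n. U n x) \<partial>face_measure i b) = (SUP n. \<integral>\<^sup>+x. U n x \<partial>face_measure i b)" for i :: 'a and b
    using seq by (intro nn_integral_monotone_convergence_SUP) auto
  have "(\<integral>\<^sup>+x. (SUP n. U n x) \<partial>surface_measure) = (SUP n. \<integral>\<^sup>+x. U n x \<partial>surface_measure)"
    using seq by (intro nn_integral_monotone_convergence_SUP) auto
  also have "... = (SUP n. \<Sum>i\<in>UNIV. \<Sum>b\<in>{0,1}. \<integral>\<^sup>+x. U n x \<partial>face_measure i b)"
    using seq by simp
  also have "... = (\<Sum>i\<in>UNIV. SUP n. \<Sum>b\<in>{0,1}. \<integral>\<^sup>+x. U n x \<partial>face_measure i b)"
  proof (rule ennreal_SUP_sum)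
    show "incseq (\<lambda>n. \<Sum>b\<in>{0,1}. \<integral>\<^sup>+x. U n x \<partial>face_measure i b)" for i :: 'a
      using inc[of i] by (intro incseq_SucI sum_mono) (auto simp: incseq_Suc_iff)
  qed
  also have "... = (\<Sum>i\<in>UNIV. \<Sum>b\<in>{0,1}. SUP n. \<integral>\<^sup>+x. U n x \<partial>face_measure i b)"
    by (intro sum.cong refl ennreal_SUP_sum inc)
  finally show ?case by (simp add: m SUP_apply image_comp)
qed

definition boundary_measure :: "(real ^ 'd) measure" where
  "boundary_measure = uniform_measure surface_measure (frontier cube)"

lemma smooth_boundary_frontier: "smooth_boundary \<subseteq> (frontier cube :: (real ^ 'd) set)"
proof
  fix x :: "real ^ 'd" assume "x \<in> smooth_boundary"
  then obtain i where "x \<in> cube" "x $ i = 0 \<or> x $ i = 1"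
    by (auto simp: smooth_boundary_def)
  then show "x \<in> frontier cube"
    by (auto simp: frontier_cbox mem_box_cart intro!: exI[of _ i])
qed

lemma emeasure_surface_frontier:
  "emeasure surface_measure (frontier cube :: (real ^ 'd) set) = ennreal (2 * real CARD('d))"
proof -
  have f1: "emeasure (face_measure i b) (frontier cube :: (real ^ 'd) set) = 1" if "b \<in> {0,1}" for i b
  proof -
    have "AE x in face_measure i b. x \<in> frontier cube"
      using AE_face_measure_normal[OF that, of i] smooth_boundary_frontier by auto
    then show ?thesis
      using prob_space.emeasure_eq_1_AE[OF prob_space_face_measure[of i b]] by auto
  qed
  have "emeasure surface_measure (frontier cube :: (real ^ 'd) set) = (\<Sum>i\<in>(UNIV::'d set). 2)"
    by (subst emeasure_surface_measure) (auto simp: f1)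
  also have "... = ennreal (2 * real CARD('d))"
    by (simp add: ennreal_mult ennreal_of_nat_eq_real_of_nat mult.commute)
  finally show ?thesis .
qed

lemma measure_surface_frontier:
  "measure surface_measure (frontier cube :: (real ^ 'd) set) = 2 * real CARD('d)"
  by (simp add: measure_def emeasure_surface_frontier)

lemma sets_boundary_measure [simp, measurable_cong]: "sets boundary_measure = sets borel"
  by (simp add: boundary_measure_def)

lemma prob_space_boundary_measure: "prob_space (boundary_measure :: (real ^ 'd) measure)"
  unfolding boundary_measure_def
  by (rule prob_space_uniform_measure) (simp_all add: emeasure_surface_frontier)

lemma smooth_boundary_borel: "(smooth_boundary :: (real ^ 'd) set) \<in> sets borel"
proof -
  have e: "smooth_boundary = {x \<in> cube. \<exists>i::'d. (x $ i = 0 \<or> x $ i = 1) \<and> (\<forall>j. x $ j = 0 \<or> x $ j = 1 --> j = i)}"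
    unfolding smooth_boundary_def Ex1_def by simp
  show ?thesis unfolding e by measurable
qed

lemma AE_boundary_measure: "AE x in boundary_measure. x \<in> smooth_boundary"
proof -
  have "emeasure (face_measure i b) (- smooth_boundary :: (real ^ 'd) set) = 0" if "b \<in> {0,1}" for i b
    using AE_face_measure_normal[OF that, of i] smooth_boundary_borel
    by (subst AE_iff_measurable[symmetric, where P = "\<lambda>x. x \<in> smooth_boundary"]) (auto intro: borel_comp)
  then have "emeasure surface_measure (- smooth_boundary :: (real ^ 'd) set) = 0"
    using borel_comp[OF smooth_boundary_borel] by (subst emeasure_surface_measure) auto
  then have "AE x in surface_measure. x \<in> (smooth_boundary :: (real ^ 'd) set)"
    using borel_comp[OF smooth_boundary_borel]
    by (subst AE_iff_measurable[where N = "- smooth_boundary"]) auto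
  then show ?thesis
    unfolding boundary_measure_def by (intro AE_uniform_measureI) auto
qed

lemma AE_boundary_measure_cube: "AE x in boundary_measure. x \<in> cube"
  using AE_boundary_measure by (rule AE_mp) (auto intro!: AE_I2 simp: smooth_boundary_def)

text \<open>The factor in front is the surface area, so a mean over random boundary points becomes a
  sum of face integrals. The computation runs through nonnegative integrals, for which
  \<open>surface_measure\<close> has been decomposed.\<close>

lemma integral_boundary_measure:
  fixes f :: "real ^ 'd => real"
  assumes f: "f \<in> borel_measurable borel" "\<And>x. x \<in> cube ==> \<bar>f x\<bar> <= B" "\<And>x. f x >= 0"
  shows "2 * real CARD('d) * (LINT x|boundary_measure. f x) =
    (\<Sum>i\<in>UNIV. \<Sum>b\<in>{0,1}. LINT x|face_measure i b. f x)"
proof -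
  have ib: "integrable boundary_measure f"
    by (rule integrable_bounded_on_cube[OF prob_space_boundary_measure sets_boundary_measure AE_boundary_measure_cube f(1)])
      (use f(2) in simp)
  have if1: "integrable (face_measure i b) f" if "b \<in> {0,1}" for i b
    by (rule integrable_bounded_on_cube[OF prob_space_face_measure sets_face_measure AE_face_measure_cube[OF that] f(1)])
      (use f(2) in simp)
  have AEf: "AE x in face_measure i b. x \<in> frontier cube" if "b \<in> {0,1}" for i :: 'd and b
    using AE_face_measure_normal[OF that, of i] smooth_boundary_frontier by auto
  have "ennreal (2 * real CARD('d)) * (\<integral>\<^sup>+x. ennreal (f x) \<partial>boundary_measure) =
      ennreal (2 * real CARD('d)) * ((\<integral>\<^sup>+x. ennreal (f x) * indicator (frontier cube) x \<partial>surface_measure) / ennreal (2 * real CARD('d)))"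
    unfolding boundary_measure_def using f(1)
    by (subst nn_integral_uniform_measure) (auto simp: emeasure_surface_frontier)
  also have "... = (\<integral>\<^sup>+x. ennreal (f x) * indicator (frontier cube) x \<partial>surface_measure)"
    by (subst ennreal_times_divide, subst mult.commute, rule mult_divide_eq_ennreal) auto
  also have "... = (\<Sum>i\<in>UNIV. \<Sum>b\<in>{0,1}. \<integral>\<^sup>+x. ennreal (f x) * indicator (frontier cube) x \<partial>face_measure i b)"
    using f(1) by (intro nn_integral_surface_measure) simp
  also have "... = (\<Sum>i\<in>UNIV. \<Sum>b\<in>{0,1}. \<integral>\<^sup>+x. ennreal (f x) \<partial>face_measure i b)"
  proof (intro sum.cong refl nn_integral_cong_AE)
    fix i :: 'd and b :: real assume "b \<in> {0,1}"
    from AEf[OF this, of i] show "AE x in face_measure i b. ennreal (f x) * indicator (frontier cube) x = ennreal (f x)"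
      by eventually_elim simp
  qed
  also have "... = (\<Sum>i\<in>UNIV. \<Sum>b\<in>{0,1}. ennreal (LINT x|face_measure i b. f x))"
    by (intro sum.cong refl nn_integral_eq_integral if1) (auto simp: f(3))
  also have "... = ennreal (\<Sum>i\<in>UNIV. \<Sum>b\<in>{0,1}. LINT x|face_measure i b. f x)"
    by (subst sum_ennreal[symmetric], force intro!: sum_nonneg Bochner_Integration.integral_nonneg simp: f(3))
      (auto intro!: sum.cong sum_ennreal Bochner_Integration.integral_nonneg simp: f(3))
  also have "(\<integral>\<^sup>+x. ennreal (f x) \<partial>boundary_measure) = ennreal (LINT x|boundary_measure. f x)"
    by (rule nn_integral_eq_integral[OF ib]) (simp add: f(3))
  also have "ennreal (2 * real CARD('d)) * ennreal (LINT x|boundary_measure. f x) =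
      ennreal (2 * real CARD('d) * (LINT x|boundary_measure. f x))"
    by (rule ennreal_mult[symmetric]) (auto intro: Bochner_Integration.integral_nonneg simp: f(3))
  finally show ?thesis
    by (subst (asm) ennreal_inj)
      (auto intro!: sum_nonneg add_nonneg_nonneg mult_nonneg_nonneg Bochner_Integration.integral_nonneg simp: f(3))
qed

lemma set_integral_cube:
  fixes f :: "real ^ 'd => real"
  assumes "f \<in> borel_measurable borel"
  shows "set_lebesgue_integral lborel cube f = (LINT x|cube_measure. f x)"
proof -
  have "cube_measure = density lborel (\<lambda>x :: real ^ 'd. ennreal (indicator cube x))"
    by (simp add: cube_measure_def uniform_measure_def emeasure_lborel_cube divide_ennreal_def ennreal_indicator)
  moreover have "(LINT x|density lborel (\<lambda>x :: real ^ 'd. ennreal (indicator cube x)). f x) =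
      (LINT x|lborel. indicator cube x *\<^sub>R f x)"
    using assms by (intro integral_density) auto
  ultimately show ?thesis
    by (simp add: set_lebesgue_integral_def)
qed

section \<open>Traces, Poincare inequalities and coercivity\<close>

lemma measure_cube_UNIV [simp]: "measure (cube_measure :: (real ^ 'd) measure) UNIV = 1"
  using prob_space.prob_space[OF prob_space_cube_measure] by simp

lemma measure_face_UNIV [simp]: "measure (face_measure i b) UNIV = 1"
  using prob_space.prob_space[OF prob_space_face_measure] by simp

lemma has_grad_mult:
  assumes "has_grad v g" "has_grad w k"
  shows "has_grad (\<lambda>x. v x * w x) (\<lambda>x. v x *\<^sub>R k x + w x *\<^sub>R g x)"
  unfolding has_grad_def
proof (intro conjI allI)
  show "continuous_on UNIV (\<lambda>x. v x *\<^sub>R k x + w x *\<^sub>R g x)"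
    using assms by (intro continuous_intros has_grad_continuous has_grad_continuous_grad)
  fix x
  have "(v has_derivative (\<lambda>h. g x \<bullet> h)) (at x)" "(w has_derivative (\<lambda>h. k x \<bullet> h)) (at x)"
    using assms by (auto simp: has_grad_def)
  from has_derivative_mult[OF this]
  show "((\<lambda>x. v x * w x) has_derivative (\<lambda>h. (v x *\<^sub>R k x + w x *\<^sub>R g x) \<bullet> h)) (at x)"
    by (rule has_derivative_eq_rhs) (auto simp: inner_add_left algebra_simps)
qed

lemma has_grad_coord: "has_grad (\<lambda>x. x $ i - c) (\<lambda>_. axis i 1)"
  unfolding has_grad_def
proof (intro conjI allI)
  fix x :: "real ^ 'a"
  have "((\<lambda>x. x $ i) has_derivative (\<lambda>h. h $ i)) (at x)"
    by (rule bounded_linear_imp_has_derivative) (rule bounded_linear_vec_nth)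
  then have "((\<lambda>x. x $ i - c) has_derivative (\<lambda>h. h $ i - 0)) (at x)"
    by (rule has_derivative_diff) simp
  then show "((\<lambda>x. x $ i - c) has_derivative (\<lambda>h. axis i 1 \<bullet> h)) (at x)"
    by (rule has_derivative_eq_rhs) (simp add: inner_axis' fun_eq_iff)
qed simp

abbreviation cint :: "(real ^ 'd => real) => real" where
  "cint v \<equiv> LINT x|cube_measure. v x"

abbreviation fint :: "'d => real => (real ^ 'd => real) => real" where
  "fint i b v \<equiv> LINT x|face_measure i b. v x"

text \<open>The integrand may depend on the face, so that normal components stay continuous.\<close>

definition bint :: "('d::finite => real => real ^ 'd => real) => real" where
  "bint u = (\<Sum>i\<in>UNIV. \<Sum>b\<in>{0,1}. fint i b (u i b))"

lemma cint_mono: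
  fixes f g :: "real ^ 'd => real"
  assumes "continuous_on UNIV f" "continuous_on UNIV g" "\<And>x. x \<in> cube ==> f x <= g x"
  shows "cint f <= cint g"
  using AE_cube_measure assms
  by (intro integral_mono_AE integrable_cube_continuous) (auto elim: eventually_mono)

lemma cint_nonneg: "(\<And>x. f x >= 0) ==> cint f >= 0"
  by (rule Bochner_Integration.integral_nonneg) auto

lemma fint_mono:
  fixes f g :: "real ^ 'd => real"
  assumes "b \<in> {0,1}" "continuous_on UNIV f" "continuous_on UNIV g" "\<And>x. x \<in> cube ==> f x <= g x"
  shows "fint i b f <= fint i b g"
  using AE_face_measure_cube[OF assms(1), of i] assms
  by (intro integral_mono_AE integrable_face_continuous) (auto elim: eventually_mono)

lemma fint_nonneg: "(\<And>x. f x >= 0) ==> fint i b f >= 0"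
  by (rule Bochner_Integration.integral_nonneg) auto

lemma bint_mono:
  assumes "\<And>i b. continuous_on UNIV (u i b)" "\<And>i b. continuous_on UNIV (w i b)"
    "\<And>i b x. b \<in> {0,1} ==> x \<in> cube ==> u i b x <= w i b x"
  shows "bint u <= bint w"
  unfolding bint_def using assms by (intro sum_mono fint_mono) auto

lemma bint_nonneg: "(\<And>i b x. u i b x >= 0) ==> bint u >= 0"
  unfolding bint_def by (intro sum_nonneg fint_nonneg) auto

lemma bint_add:
  assumes "\<And>i b. continuous_on UNIV (u i b)" "\<And>i b. continuous_on UNIV (w i b)"
  shows "bint (\<lambda>i b x. u i b x + w i b x) = bint u + bint w"
  unfolding bint_def using assms
  by (simp add: sum.distrib Bochner_Integration.integral_add integrable_face_continuous)

lemma bint_cmult: "bint (\<lambda>i b x. c * u i b x) = c * bint u"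
  unfolding bint_def by (simp add: sum_distrib_left distrib_left)

lemma fint_le_bint:
  assumes "\<And>i b x. u i b x >= 0" "b \<in> {0,1}"
  shows "fint i b (u i b) <= bint u"
proof -
  have "fint i b (u i b) <= (\<Sum>b\<in>{0,1}. fint i b (u i b))"
    using assms by (intro member_le_sum fint_nonneg) auto
  also have "... <= bint u"
    unfolding bint_def using assms
    by (intro member_le_sum[where f = "\<lambda>i. \<Sum>b\<in>{0,1}. fint i b (u i b)"] sum_nonneg fint_nonneg) auto
  finally show ?thesis .
qed

lemma measurable_face_measure:
  "f \<in> borel_measurable borel ==> f \<in> borel_measurable (face_measure i b)"
  by (simp add: measurable_cong_sets[OF sets_face_measure refl])

text \<open>The divergence theorem for the weight \<open>x $ i - (1 - b)\<close>, which vanishes on the face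
  opposite to \<open>(i, b)\<close>; both the trace and the Poincare inequality follow from it.\<close>

lemma face_square:
  assumes v: "has_grad v g" and b: "b \<in> {0,1}"
  shows "fint i b (\<lambda>x. (v x)^2) = cint (\<lambda>x. (v x)^2 + 2 * ((x $ i - (1 - b)) * (v x * g x $ i)))"
proof -
  define p where "p x = (x $ i - (1 - b)) * (v x * v x)" for x
  have "has_grad (\<lambda>x. v x * v x) (\<lambda>x. v x *\<^sub>R g x + v x *\<^sub>R g x)"
    by (rule has_grad_mult[OF v v])
  from has_grad_mult[OF has_grad_coord this]
  have "has_grad p (\<lambda>x. (x $ i - (1 - b)) *\<^sub>R (v x *\<^sub>R g x + v x *\<^sub>R g x) + (v x * v x) *\<^sub>R axis i 1)"
    unfolding p_def .
  note integral_partial[OF this, of i]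
  \<comment> \<open>The weight equals \<open>b\<close> on the upper face and \<open>b - 1\<close> on
    the lower one, so one of the two face integrals vanishes and the other appears with coefficient
    one.\<close>
  moreover have "(LINT x|face_measure i 1. p x) = b * fint i 1 (\<lambda>x. (v x)^2)"
  proof -
    have "(LINT x|face_measure i 1. p x) = (LINT x|face_measure i 1. b * (v x)^2)"
    proof (rule integral_cong_AE)
      have "AE x in face_measure i 1. x $ i = 1"
        using AE_face_measure_normal[of 1 i] by simp
      then show "AE x in face_measure i 1. p x = b * (v x)^2"
        by eventually_elim (simp add: p_def power2_eq_square)
    qed (unfold p_def, (intro measurable_face_measure continuous_measurable continuous_intros has_grad_continuous[OF v])+)
    then show ?thesis by simp
  qed
  moreover have "(LINT x|face_measure i 0. p x) = - (1 - b) * fint i 0 (\<lambda>x. (v x)^2)"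
  proof -
    have "(LINT x|face_measure i 0. p x) = (LINT x|face_measure i 0. - (1 - b) * (v x)^2)"
    proof (rule integral_cong_AE)
      have "AE x in face_measure i 0. x $ i = 0"
        using AE_face_measure_normal[of 0 i] by simp
      then show "AE x in face_measure i 0. p x = - (1 - b) * (v x)^2"
        by eventually_elim (simp add: p_def power2_eq_square)
    qed (unfold p_def, (intro measurable_face_measure continuous_measurable continuous_intros has_grad_continuous[OF v])+)
    then show ?thesis by simp
  qed
  ultimately show ?thesis
    using b by (auto simp: axis_def power2_eq_square algebra_simps)
qed

text \<open>The weight in \<open>face_square\<close> has modulus at most one on the cube, so Young's
  inequality bounds the mixed term by the two squares.\<close>

lemma trace_inequality:
  assumes v: "has_grad v g" and b: "b \<in> {0,1}"
  shows "fint i b (\<lambda>x. (v x)^2) <= 2 * cint (\<lambda>x. (v x)^2) + cint (\<lambda>x. (g x $ i)^2)"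
proof -
  note [continuous_intros] = has_grad_continuous[OF v] has_grad_continuous_grad[OF v]
  have "fint i b (\<lambda>x. (v x)^2) <= cint (\<lambda>x. 2 * (v x)^2 + (g x $ i)^2)"
    unfolding face_square[OF v b]
  proof (rule cint_mono)
    fix x :: "real ^ 'a" assume "x \<in> cube"
    then have "0 <= x $ i" "x $ i <= 1" by (auto simp: mem_box_cart)
    then have p: "\<bar>x $ i - (1 - b)\<bar> <= 1" using b by auto
    have "2 * ((x $ i - (1 - b)) * (v x * g x $ i)) <= 2 * (\<bar>x $ i - (1 - b)\<bar> * \<bar>v x * g x $ i\<bar>)"
      by (simp flip: abs_mult)
    also have "... <= 2 * (1 * \<bar>v x * g x $ i\<bar>)"
      using p by (intro mult_left_mono mult_right_mono) auto
    also have "... <= (v x)^2 + (g x $ i)^2"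
      using sum_squares_bound[of "\<bar>v x\<bar>" "\<bar>g x $ i\<bar>"] by (simp add: abs_mult)
    finally show "(v x)^2 + 2 * ((x $ i - (1 - b)) * (v x * g x $ i)) <= 2 * (v x)^2 + (g x $ i)^2"
      by simp
  qed (intro continuous_intros)+
  also have "... = 2 * cint (\<lambda>x. (v x)^2) + cint (\<lambda>x. (g x $ i)^2)"
    by (subst Bochner_Integration.integral_add) (auto intro!: integrable_cube_continuous continuous_intros)
  finally show ?thesis .
qed

text \<open>\<open>face_square\<close> is read backwards: the mixed term moves to the other side,
  and Young's inequality with unequal weights leaves half of the square of \<open>v\<close>.\<close>

lemma poincare_face:
  assumes v: "has_grad v g" and b: "b \<in> {0,1}"
  shows "cint (\<lambda>x. (v x)^2) <= 2 * fint i b (\<lambda>x. (v x)^2) + 4 * cint (\<lambda>x. (g x $ i)^2)"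
proof -
  note [continuous_intros] = has_grad_continuous[OF v] has_grad_continuous_grad[OF v]
  have "cint (\<lambda>x. (1/2) * (v x)^2) <= cint (\<lambda>x. ((v x)^2 + 2 * ((x $ i - (1 - b)) * (v x * g x $ i))) + 2 * (g x $ i)^2)"
  proof (rule cint_mono)
    fix x :: "real ^ 'a" assume "x \<in> cube"
    then have "0 <= x $ i" "x $ i <= 1" by (auto simp: mem_box_cart)
    then have p: "\<bar>x $ i - (1 - b)\<bar> <= 1" using b by auto
    have "- 2 * ((x $ i - (1 - b)) * (v x * g x $ i)) <= 2 * (\<bar>x $ i - (1 - b)\<bar> * \<bar>v x * g x $ i\<bar>)"
      unfolding abs_mult[symmetric] by linarith
    also have "... <= 2 * (1 * \<bar>v x * g x $ i\<bar>)"
      using p by (intro mult_left_mono mult_right_mono) auto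
    also have "... <= (1/2) * (v x)^2 + 2 * (g x $ i)^2"
      using sum_squares_bound[of "\<bar>v x\<bar> / 2" "\<bar>g x $ i\<bar>"] by (simp add: abs_mult power_divide)
    finally show "(1/2) * (v x)^2 <= ((v x)^2 + 2 * ((x $ i - (1 - b)) * (v x * g x $ i))) + 2 * (g x $ i)^2"
      by simp
  qed (intro continuous_intros)+
  also have "... = fint i b (\<lambda>x. (v x)^2) + 2 * cint (\<lambda>x. (g x $ i)^2)"
    unfolding face_square[OF v b]
    by (subst Bochner_Integration.integral_add) (auto intro!: integrable_cube_continuous continuous_intros)
  finally show ?thesis by simp
qed

section \<open>Green's formula on the cube and boundary norms\<close>

definition has_div :: "(real ^ 'd => real ^ 'd) => (real ^ 'd => real) => bool" where
  "has_div w \<delta> \<longleftrightarrow> (\<exists>D. (\<forall>k. has_grad (\<lambda>x. w x $ k) (D k)) \<and> \<delta> = (\<lambda>x. \<Sum>k\<in>UNIV. D k x $ k))"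

lemma has_div_continuous: "has_div w \<delta> ==> continuous_on UNIV w"
  unfolding has_div_def continuous_on_componentwise[where f = w]
  by (auto simp: Basis_vec_def inner_axis intro: has_grad_continuous)

lemma has_div_continuous_div: "has_div w \<delta> ==> continuous_on UNIV \<delta>"
  unfolding has_div_def by (auto intro!: continuous_intros dest: has_grad_continuous_grad)

text \<open>Componentwise \<open>integral_partial\<close> for the products of \<open>v\<close> with
  the components of \<open>w\<close>. The factor \<open>2 * b - 1\<close> is the sign of the outer
  normal, so the right-hand side is the flux of the product through the boundary.\<close>

lemma Green_formula:
  assumes v: "has_grad v g" and w: "has_div w \<delta>"
  shows "cint (\<lambda>x. g x \<bullet> w x + v x * \<delta> x) = bint (\<lambda>i b x. v x * ((2 * b - 1) * w x $ i))"
proof -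
  obtain D where D: "\<And>k. has_grad (\<lambda>x. w x $ k) (D k)" and \<delta>: "\<delta> = (\<lambda>x. \<Sum>k\<in>UNIV. D k x $ k)"
    using w by (auto simp: has_div_def)
  note [continuous_intros] = has_grad_continuous[OF v] has_grad_continuous_grad[OF v]
    has_grad_continuous_grad[OF D] has_div_continuous[OF w]
  have "cint (\<lambda>x. g x \<bullet> w x + v x * \<delta> x) =
      cint (\<lambda>x. \<Sum>k\<in>UNIV. (v x *\<^sub>R D k x + w x $ k *\<^sub>R g x) $ k)"
    by (rule Bochner_Integration.integral_cong)
      (auto simp: \<delta> inner_vec_def sum.distrib sum_distrib_left mult.commute)
  also have "... = (\<Sum>k\<in>UNIV. cint (\<lambda>x. (v x *\<^sub>R D k x + w x $ k *\<^sub>R g x) $ k))"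
    by (rule Bochner_Integration.integral_sum) (intro integrable_cube_continuous continuous_intros)
  also have "... = (\<Sum>k\<in>UNIV. fint k 1 (\<lambda>x. v x * w x $ k) - fint k 0 (\<lambda>x. v x * w x $ k))"
    by (intro sum.cong refl integral_partial has_grad_mult[OF v D])
  also have "... = bint (\<lambda>i b x. v x * ((2 * b - 1) * w x $ i))"
    by (simp add: bint_def)
  finally show ?thesis .
qed

text \<open>\<open>trace_inequality\<close> summed over all faces, where each component of the
  gradient occurs for two of them. It controls the boundary values of \<open>v\<close> when the
  boundary condition says nothing about them.\<close>

lemma bint_square_bound:
  fixes v :: "real ^ 'd => real"
  assumes v: "has_grad v g"
  shows "bint (\<lambda>i b x. (v x)^2) <= 4 * real CARD('d) * cint (\<lambda>x. (v x)^2) + 2 * cint (\<lambda>x. (norm (g x))^2)"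
proof -
  note [continuous_intros] = has_grad_continuous[OF v] has_grad_continuous_grad[OF v]
  have "bint (\<lambda>i b x. (v x)^2) <= (\<Sum>i\<in>(UNIV :: 'd set). \<Sum>b\<in>{0,1::real}. 2 * cint (\<lambda>x. (v x)^2) + cint (\<lambda>x. (g x $ i)^2))"
    unfolding bint_def by (intro sum_mono trace_inequality[OF v]) auto
  also have "... = 4 * real CARD('d) * cint (\<lambda>x. (v x)^2) + 2 * (\<Sum>i\<in>UNIV. cint (\<lambda>x. (g x $ i)^2))"
    by (simp add: sum.distrib sum_distrib_left algebra_simps)
  also have "(\<Sum>i\<in>UNIV. cint (\<lambda>x. (g x $ i)^2)) = cint (\<lambda>x. (norm (g x))^2)"
    by (subst Bochner_Integration.integral_sum[symmetric], intro integrable_cube_continuous continuous_intros,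
        intro Bochner_Integration.integral_cong refl)
      (simp add: norm_vec_def L2_set_def sum_nonneg)
  finally show ?thesis .
qed

lemma cint_component_le:
  assumes "continuous_on UNIV g"
  shows "cint (\<lambda>x. (g x $ i)^2) <= cint (\<lambda>x. (norm (g x))^2)"
proof (rule cint_mono)
  note [continuous_intros] = assms
  show "continuous_on UNIV (\<lambda>x. (g x $ i)^2)" "continuous_on UNIV (\<lambda>x. (norm (g x))^2)"
    by (intro continuous_intros)+
  show "(g x $ i)^2 <= (norm (g x))^2" for x
    using component_le_norm_cart[of "g x" i] by (metis power2_abs power_mono abs_ge_zero)
qed

text \<open>One face is enough: the lines orthogonal to it sweep out the whole cube, and the axis
  may be arbitrary.\<close>

lemma poincare_boundary:
  assumes v: "has_grad v g"
  shows "cint (\<lambda>x. (v x)^2) <= 2 * bint (\<lambda>i b x. (v x)^2) + 4 * cint (\<lambda>x. (norm (g x))^2)"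
proof -
  fix i
  have "cint (\<lambda>x. (v x)^2) <= 2 * fint i 1 (\<lambda>x. (v x)^2) + 4 * cint (\<lambda>x. (g x $ i)^2)"
    by (rule poincare_face[OF v]) simp
  also have "... <= 2 * bint (\<lambda>i b x. (v x)^2) + 4 * cint (\<lambda>x. (norm (g x))^2)"
    by (intro add_mono mult_left_mono fint_le_bint[where u = "\<lambda>i b x. (v x)^2"]
        cint_component_le has_grad_continuous_grad[OF v]) auto
  finally show ?thesis .
qed

section \<open>Poincare inequality with the mean value\<close>

lemma nn_integral_lborel_affine_le:
  fixes h :: "real ^ 'd => ennreal"
  assumes [measurable]: "h \<in> borel_measurable borel" and c: "c >= 1 / 2"
  shows "(\<integral>\<^sup>+x. h (t + c *\<^sub>R x) \<partial>lborel) <= ennreal (2 ^ CARD('d)) * (\<integral>\<^sup>+x. h x \<partial>lborel)"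
proof -
  have c0: "c ~= 0" "c > 0" using c by auto
  have "(\<integral>\<^sup>+x. h x \<partial>lborel) = (\<integral>\<^sup>+x. h x \<partial>density (distr lborel borel (\<lambda>x. t + c *\<^sub>R x)) (\<lambda>_. \<bar>c\<bar> ^ DIM(real ^ 'd)))"
    using lborel_affine[OF c0(1), of t] by simp
  also have "... = ennreal (c ^ CARD('d)) * (\<integral>\<^sup>+x. h (t + c *\<^sub>R x) \<partial>lborel)"
    using c0 by (simp add: nn_integral_density nn_integral_distr nn_integral_cmult)
  finally have eq: "(\<integral>\<^sup>+x. h x \<partial>lborel) = ennreal (c ^ CARD('d)) * (\<integral>\<^sup>+x. h (t + c *\<^sub>R x) \<partial>lborel)" .
  \<comment> \<open>The Jacobian of the dilation is \<open>c ^ CARD('d)\<close>, and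
    \<open>c >= 1 / 2\<close> bounds its inverse by \<open>2 ^ CARD('d)\<close>.\<close>
  have "1 <= (2 * c) ^ CARD('d)" using c by (intro one_le_power) simp
  then have "1 <= ennreal (2 ^ CARD('d)) * ennreal (c ^ CARD('d))"
    using c0 by (subst ennreal_mult[symmetric]) (auto simp: power_mult_distrib)
  then have "1 * (\<integral>\<^sup>+x. h (t + c *\<^sub>R x) \<partial>lborel) \<le>
      ennreal (2 ^ CARD('d)) * ennreal (c ^ CARD('d)) * (\<integral>\<^sup>+x. h (t + c *\<^sub>R x) \<partial>lborel)"
    by (intro mult_right_mono) auto
  then show ?thesis by (simp add: eq mult.assoc)
qed

lemma nn_integral_cube_le_lborel:
  assumes "h \<in> borel_measurable borel"
  shows "(\<integral>\<^sup>+x. h x \<partial>cube_measure) <= (\<integral>\<^sup>+x. h x \<partial>lborel)"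
  using assms unfolding cube_measure_def
  by (subst nn_integral_uniform_measure)
    (auto simp: emeasure_lborel_cube divide_ennreal_def intro!: nn_integral_mono split: split_indicator)

text \<open>For \<open>s \<ge> 1/2\<close> the substitution is made in \<open>x\<close>, otherwise in \<open>y\<close>.\<close>

lemma segment_average:
  fixes h :: "real ^ 'd => ennreal"
  assumes [measurable]: "h \<in> borel_measurable borel"
  shows "(\<integral>\<^sup>+x. \<integral>\<^sup>+y. h (y + s *\<^sub>R (x - y)) \<partial>cube_measure \<partial>cube_measure) \<le>
    ennreal (2 ^ CARD('d)) * (\<integral>\<^sup>+x. h x \<partial>lborel)"
proof -
  interpret Q: prob_space "cube_measure :: (real ^ 'd) measure" by (rule prob_space_cube_measure)
  interpret QQ: pair_sigma_finite "cube_measure :: (real ^ 'd) measure" "cube_measure :: (real ^ 'd) measure"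
    by unfold_locales
  let ?R = "ennreal (2 ^ CARD('d)) * (\<integral>\<^sup>+x. h x \<partial>lborel)"
  have const: "(\<integral>\<^sup>+(x :: real ^ 'd). ?R \<partial>cube_measure) = ?R"
    using Q.emeasure_space_1 by simp
  have sub: "(\<integral>\<^sup>+x. h (t + c *\<^sub>R x) \<partial>cube_measure) <= ?R" if "c >= 1/2" for c and t :: "real ^ 'd"
    by (rule order_trans[OF nn_integral_cube_le_lborel nn_integral_lborel_affine_le]) (use that in auto)
  show ?thesis
  proof (cases "s >= 1/2")
    case True
    have "(\<integral>\<^sup>+x. \<integral>\<^sup>+y. h (y + s *\<^sub>R (x - y)) \<partial>cube_measure \<partial>cube_measure) =
        (\<integral>\<^sup>+y. \<integral>\<^sup>+x. h (y + s *\<^sub>R (x - y)) \<partial>cube_measure \<partial>cube_measure)"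
      by (rule QQ.Fubini'[symmetric]) measurable
    also have "... = (\<integral>\<^sup>+y. \<integral>\<^sup>+x. h ((1 - s) *\<^sub>R y + s *\<^sub>R x) \<partial>cube_measure \<partial>cube_measure)"
      by (simp add: algebra_simps)
    also have "... <= (\<integral>\<^sup>+(y :: real ^ 'd). ?R \<partial>cube_measure)"
      using True by (intro nn_integral_mono sub)
    finally show ?thesis by (simp only: const)
  next
    case False
    have "(\<integral>\<^sup>+x. \<integral>\<^sup>+y. h (y + s *\<^sub>R (x - y)) \<partial>cube_measure \<partial>cube_measure) =
        (\<integral>\<^sup>+x. \<integral>\<^sup>+y. h (s *\<^sub>R x + (1 - s) *\<^sub>R y) \<partial>cube_measure \<partial>cube_measure)"
      by (simp add: algebra_simps)
    also have "... <= (\<integral>\<^sup>+(x :: real ^ 'd). ?R \<partial>cube_measure)"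
      using False by (intro nn_integral_mono sub) auto
    finally show ?thesis by (simp only: const)
  qed
qed

lemma has_grad_along_segment:
  assumes v: "has_grad v g"
  shows "((\<lambda>s. v (y + s *\<^sub>R d)) has_real_derivative g (y + s *\<^sub>R d) \<bullet> d) (at s)"
proof -
  have 1: "((\<lambda>s. y + s *\<^sub>R d) has_derivative (\<lambda>h. h *\<^sub>R d)) (at s)"
    by (auto intro!: derivative_eq_intros)
  have 2: "(v has_derivative (\<lambda>h. g (y + s *\<^sub>R d) \<bullet> h)) (at (y + s *\<^sub>R d))"
    using v by (simp add: has_grad_def)
  have "((\<lambda>s. v (y + s *\<^sub>R d)) has_derivative (\<lambda>h. g (y + s *\<^sub>R d) \<bullet> (h *\<^sub>R d))) (at s)"
    using has_derivative_compose[OF 1 2] .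
  then show ?thesis
    unfolding has_field_derivative_def by (rule has_derivative_eq_rhs) (auto simp: mult.commute)
qed

lemma norm_diff_cube:
  fixes x y :: "real ^ 'd"
  assumes "x \<in> cube" "y \<in> cube"
  shows "(norm (x - y))^2 <= real CARD('d)"
proof -
  have "(norm (x - y))^2 = (\<Sum>i\<in>UNIV. ((x - y) $ i)^2)"
    by (simp add: norm_vec_def L2_set_def sum_nonneg)
  also have "... <= (\<Sum>i\<in>(UNIV :: 'd set). 1)"
  proof (rule sum_mono)
    fix i
    have "0 <= x $ i" "x $ i <= 1" "0 <= y $ i" "y $ i <= 1"
      using assms by (auto simp: mem_box_cart)
    then show "((x - y) $ i)^2 <= 1" by (simp add: abs_square_le_1)
  qed
  finally show ?thesis by simp
qed

lemma segment_in_cube: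
  fixes x y :: "real ^ 'd"
  assumes "x \<in> cube" "y \<in> cube" "s \<in> {0..1}"
  shows "y + s *\<^sub>R (x - y) \<in> cube"
  using convexD_alt[OF convex_box(1) assms(2,1), of s] assms(3) by (simp add: algebra_simps)

text \<open>The increment is the mean of a directional derivative over the segment from
  \<open>y\<close> to \<open>x\<close>. Nonnegativity of the variance squares it, and the squared
  length is at most the dimension. By convexity the indicator equals one here; it localises the
  integrand for the substitution in \<open>segment_average\<close>.\<close>

lemma square_diff_segment:
  fixes v :: "real ^ 'd => real"
  assumes v: "has_grad v g" and xy: "x \<in> cube" "y \<in> cube"
  shows "ennreal ((v x - v y)^2) \<le>
    (\<integral>\<^sup>+s. ennreal (real CARD('d)) * (ennreal ((norm (g (y + s *\<^sub>R (x - y))))^2) * indicator cube (y + s *\<^sub>R (x - y))) \<partial>unit_lborel)"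
proof -
  define d where "d = x - y"
  define k where "k s = g (y + s *\<^sub>R d) \<bullet> d" for s
  have kc: "continuous_on UNIV k"
    unfolding k_def by (intro continuous_intros continuous_on_compose2[OF has_grad_continuous_grad[OF v]]) auto
  have int: "integrable unit_lborel f" if f: "continuous_on UNIV f" for f :: "real => real"
  proof -
    have "compact (f ` {0..1})"
      using f by (intro compact_continuous_image) (auto intro: continuous_on_subset)
    then obtain B where "\<And>s. s \<in> {0..1} ==> norm (f s) <= B"
      by (meson bounded_iff compact_imp_bounded image_eqI)
    moreover have "f \<in> borel_measurable unit_lborel"
      using borel_measurable_continuous_onI[OF f] by (intro measurable_restrict_space1) simp
    ultimately show ?thesis
      by (intro unit_lborel.integrable_const_bound[of _ B]) (auto simp: space_restrict_space intro!: AE_I2)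
  qed
  have "v x - v y = (LINT s|lborel. k s * indicator {0..1} s)"
  proof (subst integral_FTC_Icc_real[where F = "\<lambda>s. v (y + s *\<^sub>R d)"])
    show "DERIV (\<lambda>s. v (y + s *\<^sub>R d)) s :> k s" for s
      unfolding k_def by (rule has_grad_along_segment[OF v])
    show "isCont k s" for s
      using kc by (simp add: continuous_on_eq_continuous_at)
  qed (auto simp: d_def)
  also have "... = (LINT s|unit_lborel. k s)"
    by (subst integral_restrict_space) (auto simp: mult.commute)
  finally have eq: "v x - v y = (LINT s|unit_lborel. k s)" .
  have k2: "integrable unit_lborel (\<lambda>s. (k s)^2)" and k1: "integrable unit_lborel k"
    using kc by (auto intro!: int continuous_intros)
  have "(v x - v y)^2 <= (LINT s|unit_lborel. (k s)^2)"
    using unit_lborel.variance_positive[of k] unit_lborel.variance_eq[OF k1 k2] by (simp add: eq)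
  then have "ennreal ((v x - v y)^2) <= ennreal (LINT s|unit_lborel. (k s)^2)"
    by (rule ennreal_leI)
  also have "... = (\<integral>\<^sup>+s. ennreal ((k s)^2) \<partial>unit_lborel)"
    by (rule nn_integral_eq_integral[symmetric, OF k2]) simp
  also have "... <= (\<integral>\<^sup>+s. ennreal (real CARD('d)) * (ennreal ((norm (g (y + s *\<^sub>R (x - y))))^2) * indicator cube (y + s *\<^sub>R (x - y))) \<partial>unit_lborel)"
  proof (rule nn_integral_mono)
    fix s assume "s \<in> space unit_lborel"
    then have s: "s \<in> {0..1}" by (simp add: space_restrict_space)
    have "(k s)^2 <= (norm (g (y + s *\<^sub>R d)) * norm d)^2"
      unfolding k_def using Cauchy_Schwarz_ineq2[of "g (y + s *\<^sub>R d)" d] by (metis abs_ge_zero power2_abs power_mono)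
    also have "... <= (norm (g (y + s *\<^sub>R d)))^2 * real CARD('d)"
      unfolding power_mult_distrib d_def using norm_diff_cube[OF xy] by (intro mult_left_mono) auto
    finally have "ennreal ((k s)^2) <= ennreal (real CARD('d) * (norm (g (y + s *\<^sub>R d)))^2)"
      by (intro ennreal_leI) (simp add: mult.commute)
    then show "ennreal ((k s)^2) <= ennreal (real CARD('d)) * (ennreal ((norm (g (y + s *\<^sub>R (x - y))))^2) * indicator cube (y + s *\<^sub>R (x - y)))"
      using segment_in_cube[OF xy s] by (simp add: d_def ennreal_mult)
  qed
  finally show ?thesis .
qed

text \<open>The mean of \<open>(v x - v y)^2\<close> over independent \<open>x\<close> and
  \<open>y\<close> is twice the variance of \<open>v\<close>. It is bounded along segments, and
  exchanging integrals leaves one substitution for each position on the segment, whose Jacobian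
  produces \<open>2 ^ CARD('d)\<close>.\<close>

lemma poincare_mean:
  fixes v :: "real ^ 'd => real"
  assumes v: "has_grad v g"
  shows "cint (\<lambda>x. (v x)^2) <= (cint v)^2 + real CARD('d) * 2 ^ CARD('d) * cint (\<lambda>x. (norm (g x))^2)"
proof -
  note [continuous_intros] = has_grad_continuous[OF v] has_grad_continuous_grad[OF v]
  interpret Q: prob_space "cube_measure :: (real ^ 'd) measure" by (rule prob_space_cube_measure)
  interpret QU: pair_sigma_finite "cube_measure :: (real ^ 'd) measure" unit_lborel by unfold_locales
  have [measurable]: "v \<in> borel_measurable borel" "g \<in> borel_measurable borel"
    by (auto intro!: continuous_measurable continuous_intros)
  define h :: "real ^ 'd => ennreal" where "h z = ennreal ((norm (g z))^2) * indicator cube z" for z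
  have h [measurable]: "h \<in> borel_measurable borel" unfolding h_def by measurable
  have iv: "integrable cube_measure v" "integrable cube_measure (\<lambda>x. (v x)^2)"
    by (auto intro!: integrable_cube_continuous continuous_intros)
  have hint: "(\<integral>\<^sup>+x. h x \<partial>lborel) = ennreal (cint (\<lambda>x. (norm (g x))^2))"
  proof -
    have "(\<integral>\<^sup>+x. h x \<partial>lborel) = (\<integral>\<^sup>+x. ennreal ((norm (g x))^2) \<partial>cube_measure)"
      unfolding cube_measure_def h_def
      by (subst nn_integral_uniform_measure) (auto simp: emeasure_lborel_cube divide_ennreal_def)
    also have "... = ennreal (cint (\<lambda>x. (norm (g x))^2))"
      by (intro nn_integral_eq_integral integrable_cube_continuous continuous_intros) auto
    finally show ?thesis .
  qed
  have inner: "(LINT y|cube_measure. (v x - v y)^2) = (v x)^2 - 2 * v x * cint v + cint (\<lambda>x. (v x)^2)" for x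
  proof -
    have "(LINT y|cube_measure. (v x - v y)^2) = (LINT y|cube_measure. ((v x)^2 - 2 * v x * v y) + (v y)^2)"
      by (simp add: power2_diff algebra_simps)
    also have "... = (LINT y|cube_measure. ((v x)^2 - 2 * v x * v y)) + cint (\<lambda>x. (v x)^2)"
      using iv by (intro Bochner_Integration.integral_add) auto
    also have "(LINT y|cube_measure. ((v x)^2 - 2 * v x * v y)) = (v x)^2 - 2 * v x * cint v"
      using iv by (subst Bochner_Integration.integral_diff) (auto simp: Q.prob_space)
    finally show ?thesis .
  qed
  have outer: "(LINT x|cube_measure. LINT y|cube_measure. (v x - v y)^2) = 2 * cint (\<lambda>x. (v x)^2) - 2 * (cint v)^2"
    unfolding inner using iv
    by (subst Bochner_Integration.integral_add, simp, simp, subst Bochner_Integration.integral_diff)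
      (auto simp: Q.prob_space power2_eq_square)
  have "ennreal (2 * cint (\<lambda>x. (v x)^2) - 2 * (cint v)^2) =
      (\<integral>\<^sup>+x. ennreal (LINT y|cube_measure. (v x - v y)^2) \<partial>cube_measure)"
    unfolding outer[symmetric]
  proof (rule nn_integral_eq_integral[symmetric])
    show "integrable cube_measure (\<lambda>x. LINT y|cube_measure. (v x - v y)^2)"
      unfolding inner by (intro integrable_cube_continuous continuous_intros)
  qed (auto intro!: AE_I2 Bochner_Integration.integral_nonneg)
  also have "... = (\<integral>\<^sup>+x. \<integral>\<^sup>+y. ennreal ((v x - v y)^2) \<partial>cube_measure \<partial>cube_measure)"
    by (intro nn_integral_cong nn_integral_eq_integral[symmetric] integrable_cube_continuous continuous_intros) auto
  also have "... <= (\<integral>\<^sup>+x. \<integral>\<^sup>+y. \<integral>\<^sup>+s. ennreal (real CARD('d)) * h (y + s *\<^sub>R (x - y)) \<partial>unit_lborel \<partial>cube_measure \<partial>cube_measure)"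
  proof (rule nn_integral_mono_AE)
    show "AE x in cube_measure. (\<integral>\<^sup>+y. ennreal ((v x - v y)^2) \<partial>cube_measure) \<le>
        (\<integral>\<^sup>+y. \<integral>\<^sup>+s. ennreal (real CARD('d)) * h (y + s *\<^sub>R (x - y)) \<partial>unit_lborel \<partial>cube_measure)"
      using AE_cube_measure
    proof eventually_elim
      case (elim x)
      show ?case
        using AE_cube_measure
        by (intro nn_integral_mono_AE) (auto elim!: eventually_mono intro!: square_diff_segment[OF v elim, folded h_def])
    qed
  qed
  also have "... = (\<integral>\<^sup>+x. \<integral>\<^sup>+s. \<integral>\<^sup>+y. ennreal (real CARD('d)) * h (y + s *\<^sub>R (x - y)) \<partial>cube_measure \<partial>unit_lborel \<partial>cube_measure)"
    by (intro nn_integral_cong QU.Fubini'[symmetric]) measurable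
  also have "... = (\<integral>\<^sup>+s. \<integral>\<^sup>+x. \<integral>\<^sup>+y. ennreal (real CARD('d)) * h (y + s *\<^sub>R (x - y)) \<partial>cube_measure \<partial>cube_measure \<partial>unit_lborel)"
    by (intro QU.Fubini'[symmetric]) measurable
  also have "... = (\<integral>\<^sup>+s. ennreal (real CARD('d)) * (\<integral>\<^sup>+x. \<integral>\<^sup>+y. h (y + s *\<^sub>R (x - y)) \<partial>cube_measure \<partial>cube_measure) \<partial>unit_lborel)"
    by (intro nn_integral_cong) (simp add: nn_integral_cmult)
  also have "... <= (\<integral>\<^sup>+s. ennreal (real CARD('d)) * (ennreal (2 ^ CARD('d)) * (\<integral>\<^sup>+x. h x \<partial>lborel)) \<partial>unit_lborel)"
    by (intro nn_integral_mono mult_left_mono segment_average) auto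
  also have "... = ennreal (real CARD('d)) * (ennreal (2 ^ CARD('d)) * ennreal (cint (\<lambda>x. (norm (g x))^2)))"
    using unit_lborel.emeasure_space_1 by (simp add: hint)
  also have "... = ennreal (real CARD('d) * (2 ^ CARD('d) * cint (\<lambda>x. (norm (g x))^2)))"
    by (simp add: ennreal_mult cint_nonneg)
  finally have "2 * cint (\<lambda>x. (v x)^2) - 2 * (cint v)^2 <= real CARD('d) * (2 ^ CARD('d) * cint (\<lambda>x. (norm (g x))^2))"
    by (subst (asm) ennreal_le_iff) (auto intro!: mult_nonneg_nonneg cint_nonneg)
  moreover have "0 <= real CARD('d) * (2 ^ CARD('d) * cint (\<lambda>x. (norm (g x))^2))"
    by (intro mult_nonneg_nonneg cint_nonneg) auto
  ultimately show ?thesis unfolding mult.assoc by argo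
qed

text \<open>Testing \<open>g \<approx> w\<close>, \<open>\<delta> \<approx> \<eta>\<close> against \<open>v\<close>; the boundary term is left to the three
  boundary conditions.\<close>

lemma energy_estimate:
  assumes v: "has_grad v g" and w: "has_div w \<delta>" and \<eta>: "continuous_on UNIV \<eta>" and e: "\<epsilon> > 0"
  shows "cint (\<lambda>x. (norm (g x))^2) <= cint (\<lambda>x. (norm (g x - w x))^2)
    + 2 * bint (\<lambda>i b x. v x * ((2 * b - 1) * w x $ i)) + 2 * \<epsilon> * cint (\<lambda>x. (v x)^2)
    + (cint (\<lambda>x. (\<delta> x - \<eta> x)^2) + cint (\<lambda>x. (\<eta> x)^2)) / \<epsilon>"
proof -
  note [continuous_intros] = has_grad_continuous[OF v] has_grad_continuous_grad[OF v]
    has_div_continuous[OF w] has_div_continuous_div[OF w] \<eta>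
  have young: "- (a * b) <= (\<epsilon> / 2) * a^2 + b^2 / (2 * \<epsilon>)" for a b :: real
  proof -
    have "0 <= (\<epsilon> * a + b)^2 / (2 * \<epsilon>)" using e by simp
    also have "... = (\<epsilon> / 2) * a^2 + b^2 / (2 * \<epsilon>) + a * b"
      using e by (simp add: power2_eq_square field_simps)
    finally show ?thesis by simp
  qed
  have "cint (\<lambda>x. (norm (g x))^2) <= cint (\<lambda>x. ((norm (g x - w x))^2 + 2 * (g x \<bullet> w x + v x * \<delta> x))
    + (2 * \<epsilon> * (v x)^2 + ((\<delta> x - \<eta> x)^2 + (\<eta> x)^2) / \<epsilon>))"
  proof (rule cint_mono)
    fix x
    have "(norm (g x))^2 <= (norm (g x - w x))^2 + 2 * (g x \<bullet> w x)"
      by (simp add: power2_norm_eq_inner inner_diff_left inner_diff_right inner_commute)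
    moreover have "0 <= v x * \<delta> x + \<epsilon> * (v x)^2 + ((\<delta> x - \<eta> x)^2 + (\<eta> x)^2) / (2 * \<epsilon>)"
      using young[of "v x" "\<delta> x - \<eta> x"] young[of "v x" "\<eta> x"] by (simp add: algebra_simps add_divide_distrib)
    then have "0 <= 2 * (v x * \<delta> x) + 2 * \<epsilon> * (v x)^2 + ((\<delta> x - \<eta> x)^2 + (\<eta> x)^2) / \<epsilon>"
      by (simp add: add_divide_distrib)
    ultimately show "(norm (g x))^2 <= ((norm (g x - w x))^2 + 2 * (g x \<bullet> w x + v x * \<delta> x))
        + (2 * \<epsilon> * (v x)^2 + ((\<delta> x - \<eta> x)^2 + (\<eta> x)^2) / \<epsilon>)"
      by (simp add: algebra_simps)
  qed (use e in \<open>intro continuous_intros; simp\<close>)+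
  also have "... = (cint (\<lambda>x. (norm (g x - w x))^2) + 2 * cint (\<lambda>x. g x \<bullet> w x + v x * \<delta> x))
    + (2 * \<epsilon> * cint (\<lambda>x. (v x)^2) + (cint (\<lambda>x. (\<delta> x - \<eta> x)^2) + cint (\<lambda>x. (\<eta> x)^2)) / \<epsilon>)"
  proof -
    have i: "integrable cube_measure (\<lambda>x. (norm (g x - w x))^2)" "integrable cube_measure (\<lambda>x. g x \<bullet> w x + v x * \<delta> x)"
      "integrable cube_measure (\<lambda>x. (v x)^2)" "integrable cube_measure (\<lambda>x. (\<delta> x - \<eta> x)^2)" "integrable cube_measure (\<lambda>x. (\<eta> x)^2)"
      by (intro integrable_cube_continuous continuous_intros)+
    show ?thesis
      using i by (subst Bochner_Integration.integral_add; simp del: distrib_left_numeral)+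
  qed
  finally show ?thesis
    unfolding Green_formula[OF v w] by simp
qed

section \<open>One level of the system under each boundary condition\<close>

lemma mult_le_half_squares: "a * b <= (a^2 + b^2) / 2" for a b :: real
  using sum_squares_bound[of a b] by simp

text \<open>With \<open>h\<close> the Robin residual, the flux term is \<open>v * h - v^2\<close>:
  the residual of the boundary condition enters, and a boundary square of \<open>v\<close> with a
  good sign is gained. The latter controls \<open>v\<close> in the interior through
  \<open>poincare_boundary\<close>.\<close>

lemma robin_step:
  assumes v: "has_grad v g" and w: "has_div w \<delta>" and \<eta>: "continuous_on UNIV \<eta>"
  shows "cint (\<lambda>x. (v x)^2) + cint (\<lambda>x. (norm (g x))^2) <= 200 * (cint (\<lambda>x. (norm (g x - w x))^2)
    + cint (\<lambda>x. (\<delta> x - \<eta> x)^2) + cint (\<lambda>x. (\<eta> x)^2) + bint (\<lambda>i b x. (v x + (2 * b - 1) * w x $ i)^2))"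
proof -
  note [continuous_intros] = has_grad_continuous[OF v] has_grad_continuous_grad[OF v]
    has_div_continuous[OF w] has_div_continuous_div[OF w] \<eta>
  let ?h = "\<lambda>i b x. v x + (2 * b - 1) * w x $ i"
  have "bint (\<lambda>i b x. v x * ((2 * b - 1) * w x $ i)) <= bint (\<lambda>i b x. (1/2) * (?h i b x)^2 + (-1/2) * (v x)^2)"
  proof (rule bint_mono)
    fix i b x
    have "v x * ((2 * b - 1) * w x $ i) = v x * ?h i b x - (v x)\<^sup>2"
      by (simp add: power2_eq_square algebra_simps)
    then show "v x * ((2 * b - 1) * w x $ i) <= (1/2) * (?h i b x)^2 + (-1/2) * (v x)^2"
      using mult_le_half_squares[of "v x" "?h i b x"] by simp
  qed (intro continuous_intros)+
  also have "... = (1/2) * bint (\<lambda>i b x. (?h i b x)^2) + (-1/2) * bint (\<lambda>i b x. (v x)^2)"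
    by (subst bint_add) (intro continuous_intros, intro continuous_intros, simp only: bint_cmult)
  finally have 1: "2 * bint (\<lambda>i b x. v x * ((2 * b - 1) * w x $ i)) <= bint (\<lambda>i b x. (?h i b x)^2) - bint (\<lambda>i b x. (v x)^2)"
    by simp
  \<comment> \<open>With \<open>\<epsilon> = 1/16\<close> the interior square of \<open>v\<close>
    appears with factor \<open>1/8\<close>; by Poincare this is at most a quarter of the boundary
    square plus half of the gradient square, and both can be absorbed.\<close>
  note energy_estimate[OF v w \<eta>, of "1/16"]
  moreover note poincare_boundary[OF v]
  moreover have "0 <= cint (\<lambda>x. (\<delta> x - \<eta> x)^2)" "0 <= cint (\<lambda>x. (\<eta> x)^2)" "0 <= cint (\<lambda>x. (norm (g x - w x))^2)"
    "0 <= bint (\<lambda>i b x. (?h i b x)^2)" "0 <= bint (\<lambda>i b x. (v x)^2)" "0 <= cint (\<lambda>x. (norm (g x))^2)"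
    by (auto intro: cint_nonneg bint_nonneg)
  ultimately show ?thesis using 1 by (simp; argo)
qed

text \<open>Dirichlet data give no residual for the flux, which is merely bounded by
  \<open>T\<close>. Young's inequality splits the boundary term into \<open>T^2 / \<tau>\<close>
  times the boundary square of \<open>v\<close> and a remainder of order \<open>\<tau>\<close>;
  \<open>\<tau>\<close> stays free so that it can be balanced against the loss.\<close>

lemma dirichlet_step:
  fixes v \<delta> \<eta> :: "real ^ 'd => real" and g w :: "real ^ 'd => real ^ 'd"
  assumes v: "has_grad v g" and w: "has_div w \<delta>" and \<eta>: "continuous_on UNIV \<eta>"
    and T: "\<And>x i. x \<in> cube ==> \<bar>w x $ i\<bar> <= T" and \<tau>: "\<tau> > 0"
  shows "cint (\<lambda>x. (v x)^2) + cint (\<lambda>x. (norm (g x))^2) <= 200 * (cint (\<lambda>x. (norm (g x - w x))^2)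
    + cint (\<lambda>x. (\<delta> x - \<eta> x)^2) + cint (\<lambda>x. (\<eta> x)^2) + (1 + T^2 / \<tau>) * bint (\<lambda>i b x. (v x)^2) + real CARD('d) * \<tau>)"
proof -
  note [continuous_intros] = has_grad_continuous[OF v] has_grad_continuous_grad[OF v]
    has_div_continuous[OF w] has_div_continuous_div[OF w] \<eta>
  have faces: "bint (\<lambda>(i :: 'd) b x. 1) = 2 * real CARD('d)"
    unfolding bint_def by simp
  have "bint (\<lambda>i b x. v x * ((2 * b - 1) * w x $ i)) <= bint (\<lambda>i b x. (T^2 / \<tau> / 2) * (v x)^2 + \<tau> / 2 * 1)"
  proof (rule bint_mono)
    fix i :: 'd and b and x :: "real ^ 'd" assume "b \<in> {0,1::real}" and x: "x \<in> cube"
    then have b: "\<bar>2 * b - 1\<bar> = 1" by auto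
    have "v x * ((2 * b - 1) * w x $ i) <= \<bar>v x * ((2 * b - 1) * w x $ i)\<bar>" by simp
    also have "... = \<bar>v x\<bar> * \<bar>w x $ i\<bar>" by (simp add: abs_mult b)
    also have "... <= \<bar>v x\<bar> * T" by (intro mult_left_mono T[OF x]) auto
    also have "... <= (T^2 / \<tau> / 2) * (v x)^2 + \<tau> / 2 * 1"
    proof -
      have "0 <= (T * \<bar>v x\<bar> - \<tau>)^2 / (2 * \<tau>)" using \<tau> by simp
      also have "... = (T^2 / \<tau> / 2) * (v x)^2 + \<tau> / 2 - T * \<bar>v x\<bar>"
        using \<tau> by (simp add: power2_diff power_mult_distrib field_simps power2_eq_square)
      finally show ?thesis by (simp add: mult.commute)
    qed
    finally show "v x * ((2 * b - 1) * w x $ i) <= (T^2 / \<tau> / 2) * (v x)^2 + \<tau> / 2 * 1" .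
  qed (intro continuous_intros)+
  also have "... = (T^2 / \<tau> / 2) * bint (\<lambda>i b x. (v x)^2) + \<tau> / 2 * (2 * real CARD('d))"
    by (subst bint_add) (intro continuous_intros, intro continuous_intros, simp only: bint_cmult faces)
  finally have 1: "2 * bint (\<lambda>i b x. v x * ((2 * b - 1) * w x $ i)) <= T^2 / \<tau> * bint (\<lambda>i b x. (v x)^2) + 2 * (real CARD('d) * \<tau>)"
    by (simp add: algebra_simps)
  have "0 <= T^2 / \<tau> * bint (\<lambda>i b x. (v x)^2)" "0 <= real CARD('d) * \<tau>"
    using \<tau> by (auto intro!: mult_nonneg_nonneg divide_nonneg_nonneg bint_nonneg)
  moreover note energy_estimate[OF v w \<eta>, of "1/16"]
  moreover note poincare_boundary[OF v]
  moreover have "0 <= cint (\<lambda>x. (\<delta> x - \<eta> x)^2)" "0 <= cint (\<lambda>x. (\<eta> x)^2)" "0 <= cint (\<lambda>x. (norm (g x - w x))^2)"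
    "0 <= bint (\<lambda>i b x. (v x)^2)" "0 <= cint (\<lambda>x. (norm (g x))^2)"
    by (auto intro: cint_nonneg bint_nonneg)
  ultimately show ?thesis using 1 by (simp add: distrib_right; argo)
qed

text \<open>Here the flux is the residual and the boundary values of \<open>v\<close> are free. They
  are estimated by \<open>bint_square_bound\<close> with a small factor, and the interior square of
  \<open>v\<close> by the Poincare inequality with constant \<open>P\<close>, at the price of the
  mean of \<open>v\<close>.\<close>

lemma neumann_step:
  fixes v \<delta> \<eta> :: "real ^ 'd => real" and g w :: "real ^ 'd => real ^ 'd"
  assumes v: "has_grad v g" and w: "has_div w \<delta>" and \<eta>: "continuous_on UNIV \<eta>"
  defines "P \<equiv> real CARD('d) * 2 ^ CARD('d)"
  defines "K \<equiv> 16 * real CARD('d) * (P + 1)"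
  shows "cint (\<lambda>x. (v x)^2) + cint (\<lambda>x. (norm (g x))^2) <= (1 + 4 * K * (P + 1)) * (cint (\<lambda>x. (norm (g x - w x))^2)
    + cint (\<lambda>x. (\<delta> x - \<eta> x)^2) + cint (\<lambda>x. (\<eta> x)^2) + bint (\<lambda>i b x. ((2 * b - 1) * w x $ i)^2) + (cint v)^2)"
proof -
  note [continuous_intros] = has_grad_continuous[OF v] has_grad_continuous_grad[OF v]
    has_div_continuous[OF w] has_div_continuous_div[OF w] \<eta>
  let ?h = "\<lambda>i b x. (2 * b - 1) * w x $ i"
  define d where "d = real CARD('d)"
  have d1: "d >= 1" by (simp add: d_def Suc_le_eq)
  have P1: "P >= 1"
    unfolding P_def using d1 by (intro mult_ge1_I) (auto simp: d_def)
  have Kd: "K = 16 * d * (P + 1)" by (simp add: K_def d_def)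
  have K1: "K >= 16 * (P + 1)"
    unfolding Kd using d1 P1 by (intro mult_right_mono) auto
  then have K16: "K >= 16" using P1 by argo
  then have K0: "K > 0" by linarith
  define V G A B H S m where "V = cint (\<lambda>x. (v x)^2)" and "G = cint (\<lambda>x. (norm (g x))^2)"
    and "A = cint (\<lambda>x. (norm (g x - w x))^2)" and "B = cint (\<lambda>x. (\<delta> x - \<eta> x)^2)" and "H = cint (\<lambda>x. (\<eta> x)^2)"
    and "S = bint (\<lambda>i b x. (?h i b x)^2)" and "m = (cint v)^2"
  have nn: "V >= 0" "G >= 0" "A >= 0" "B >= 0" "H >= 0" "S >= 0" "m >= 0"
    by (auto simp: V_def G_def A_def B_def H_def S_def m_def intro: cint_nonneg bint_nonneg)
  have "bint (\<lambda>i b x. v x * ?h i b x) <= bint (\<lambda>i b x. (K / 2) * (?h i b x)^2 + (1 / (2 * K)) * (v x)^2)"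
  proof (rule bint_mono)
    fix i b x
    have "0 <= (K * ?h i b x - v x)^2 / (2 * K)" using K0 K16 by simp
    also have "... = (K / 2) * (?h i b x)^2 + (1 / (2 * K)) * (v x)^2 - v x * ?h i b x"
      using K0 K16 by (simp only: power2_diff power_mult_distrib) (simp add: field_simps power2_eq_square)
    finally show "v x * ?h i b x <= (K / 2) * (?h i b x)^2 + (1 / (2 * K)) * (v x)^2" by simp
  qed (intro continuous_intros)+
  also have "... = (K / 2) * S + (1 / (2 * K)) * bint (\<lambda>i b x. (v x)^2)"
    unfolding S_def by (subst bint_add) (intro continuous_intros, intro continuous_intros, simp only: bint_cmult)
  finally have "2 * bint (\<lambda>i b x. v x * ?h i b x) <= K * S + bint (\<lambda>i b x. (v x)^2) / K" by simp
  also have "bint (\<lambda>i b x. (v x)^2) / K <= (4 * d * V + 2 * G) / K"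
    using bint_square_bound[OF v] K0 K16 by (intro divide_right_mono) (auto simp: V_def G_def d_def)
  finally have 1: "2 * bint (\<lambda>i b x. v x * ?h i b x) <= K * S + (4 * d * V + 2 * G) / K" by simp
  have 2: "V <= m + P * G"
    unfolding V_def m_def P_def G_def by (rule poincare_mean[OF v])
  have "G <= A + (K * S + (4 * d * V + 2 * G) / K) + 2 * (1 / K) * V + (B + H) / (1 / K)"
    using energy_estimate[OF v w \<eta>, of "1 / K"] 1 K0 K16 unfolding V_def G_def A_def B_def H_def by simp
  also have "... = A + K * S + K * (B + H) + ((4 * d + 2) * V + 2 * G) / K"
    using K0 K16 by (simp add: field_simps)
  also have "((4 * d + 2) * V + 2 * G) / K <= (8 * d * (m + P * G) + 8 * d * G) / K"
  proof (intro divide_right_mono add_mono)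
    show "(4 * d + 2) * V <= 8 * d * (m + P * G)"
      using d1 nn 2 by (intro mult_mono) auto
    show "2 * G <= 8 * d * G" using d1 nn by (intro mult_right_mono) auto
  qed (use K0 K16 in simp)
  \<comment> \<open>The constant \<open>K\<close> is chosen for this line:
    \<open>8 * d * (P + 1)\<close> is half of \<open>K\<close>, so exactly half of \<open>G\<close>
    remains and can be absorbed.\<close>
  also have "(8 * d * (m + P * G) + 8 * d * G) / K = 8 * d / K * m + 1 / 2 * G"
  proof -
    have "8 * d * (m + P * G) + 8 * d * G = 8 * d * m + K / 2 * G"
      by (simp add: Kd algebra_simps)
    then show ?thesis using K0 K16 by (simp add: add_divide_distrib)
  qed
  also have "8 * d / K * m <= 1 * m"
  proof (intro mult_right_mono nn)
    have "8 * d * 1 <= 8 * d * (2 * (P + 1))" using d1 P1 by (intro mult_left_mono) auto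
    then have "8 * d <= K" by (simp add: Kd algebra_simps)
    then show "8 * d / K <= 1" using K0 K16 by simp
  qed
  finally have "G <= 2 * (A + K * S + K * (B + H) + m)" by simp
  also have "... <= 2 * (K * A + K * S + K * (B + H) + K * m)"
  proof -
    have "1 * A <= K * A" "1 * m <= K * m" using K0 K16 nn by (intro mult_right_mono; simp)+
    then show ?thesis by simp
  qed
  finally have G: "G <= 2 * K * (A + B + H + S + m)" by (simp add: algebra_simps)
  have "V + G <= m + (P + 1) * G" using 2 by (simp add: algebra_simps)
  also have "... <= (A + B + H + S + m) + (P + 1) * (2 * K * (A + B + H + S + m))"
    using nn P1 G by (intro add_mono mult_left_mono) auto
  also have "... = (1 + 2 * K * (P + 1)) * (A + B + H + S + m)"
    by (simp add: algebra_simps)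
  also have "... <= (1 + 4 * K * (P + 1)) * (A + B + H + S + m)"
    using nn P1 K0 K16 by (intro mult_right_mono add_left_mono) auto
  finally show ?thesis
    unfolding V_def G_def A_def B_def H_def S_def m_def .
qed

section \<open>From single levels to the whole system\<close>

lemma downward_recursion:
  fixes e r :: "nat => real"
  assumes C: "C >= 1" and e: "\<And>i. i < n ==> e i <= C * (r i + e (Suc i))" and en: "e n = 0"
    and r: "\<And>i. r i >= 0" and i: "i <= n"
  shows "e i <= C ^ n * (\<Sum>j<n. r j)"
proof -
  \<comment> \<open>Unrolling starts at level \<open>n\<close>, where nothing is left, and each
    level passed on the way down multiplies the accumulated residuals by \<open>C\<close>.\<close>
  have *: "e i <= C ^ (n - i) * (\<Sum>j=i..<n. r j)" if "i <= n" for i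
    using that
  proof (induction i rule: inc_induct)
    case (step i)
    let ?R = "\<Sum>j=Suc i..<n. r j"
    have R: "?R >= 0" using r by (intro sum_nonneg)
    have p: "C ^ (n - Suc i) >= 1" using C by (rule one_le_power)
    have "e i <= C * (r i + C ^ (n - Suc i) * ?R)"
      using C step.IH by (intro order_trans[OF e[OF step.hyps(2)]] mult_left_mono add_left_mono) simp_all
    also have "... <= C * (C ^ (n - Suc i) * r i + C ^ (n - Suc i) * ?R)"
      using mult_right_mono[OF p r[of i]] C by (intro mult_left_mono) auto
    also have "... = C ^ Suc (n - Suc i) * (r i + ?R)" by (simp add: algebra_simps)
    also have "Suc (n - Suc i) = n - i" using step.hyps by simp
    also have "r i + ?R = (\<Sum>j=i..<n. r j)"
      using step.hyps by (simp add: sum.atLeast_Suc_lessThan)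
    finally show ?case .
  qed (simp add: en)
  have "e i <= C ^ (n - i) * (\<Sum>j=i..<n. r j)" by (rule *[OF i])
  also have "... <= C ^ n * (\<Sum>j<n. r j)"
    using C r by (intro mult_mono power_increasing sum_mono2 sum_nonneg) auto
  finally show ?thesis .
qed

text \<open>The first two summands form the squared \<open>H1_norm\<close> of the scalar error, the
  last two the squared \<open>Hdiv_norm\<close> of the vector error.\<close>

definition pair_error :: "(real ^ 'd => real) => (real ^ 'd => real ^ 'd) => (real ^ 'd => real ^ 'd) => (real ^ 'd => real) => real" where
  "pair_error v g w \<delta> = cint (\<lambda>x. (v x)^2) + cint (\<lambda>x. (norm (g x))^2) +
     cint (\<lambda>x. (norm (w x))^2) + cint (\<lambda>x. (\<delta> x)^2)"

text \<open>The fields are the errors of the scalar and vector components together with their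
  gradients and divergences. By linearity \<open>A\<close> and \<open>B\<close> below are the mean
  square residuals of the two kinds of equations.\<close>

locale error_fields =
  fixes n :: nat and v \<delta> :: "nat => real ^ 'd => real" and g w :: "nat => real ^ 'd => real ^ 'd"
  assumes grad: "\<And>i. i < n ==> has_grad (v i) (g i)" and dive: "\<And>i. i < n ==> has_div (w i) (\<delta> i)"
begin

definition next_v :: "nat => real ^ 'd => real" where
  "next_v i x = (if Suc i < n then v (Suc i) x else 0)"

definition A :: "nat => real" where "A i = cint (\<lambda>x. (norm (g i x - w i x))^2)"
definition B :: "nat => real" where "B i = cint (\<lambda>x. (\<delta> i x - next_v i x)^2)"

lemma A_nonneg: "A i >= 0" and B_nonneg: "B i >= 0"
  by (auto simp: A_def B_def intro: cint_nonneg)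

lemma continuous_next: "continuous_on UNIV (next_v i)"
  unfolding next_v_def using has_grad_continuous[OF grad] by (cases "Suc i < n") auto

text \<open>The one-level estimates are combined by \<open>downward_recursion\<close>. They concern
  only the scalar errors; the vector error and its divergence differ from the gradient and from the
  next scalar error by residuals. The multiples add up to \<open>3 + 2 + 2 = 7\<close>.\<close>

lemma chain:
  assumes C: "C >= 1" and \<beta>: "\<And>i. \<beta> i >= 0"
    and step: "\<And>i. i < n ==> cint (\<lambda>x. (v i x)^2) + cint (\<lambda>x. (norm (g i x))^2) \<le>
      C * (A i + B i + cint (\<lambda>x. (next_v i x)^2) + \<beta> i)"
    and k: "k < n"
  shows "pair_error (v k) (g k) (w k) (\<delta> k) <= 7 * C ^ n * (\<Sum>i<n. A i + B i + \<beta> i)"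
proof -
  define e where "e i = (if i < n then cint (\<lambda>x. (v i x)^2) + cint (\<lambda>x. (norm (g i x))^2) else 0)" for i
  define r where "r i = A i + B i + \<beta> i" for i
  have r: "r i >= 0" for i using A_nonneg B_nonneg \<beta> by (simp add: r_def)
  have next_le: "cint (\<lambda>x. (next_v i x)^2) <= e (Suc i)" for i
    by (auto simp: next_v_def e_def intro!: cint_nonneg)
  have rec: "e i <= C * (r i + e (Suc i))" if "i < n" for i
  proof -
    have "e i <= C * (A i + B i + cint (\<lambda>x. (next_v i x)^2) + \<beta> i)"
      using step[OF that] that by (simp add: e_def)
    also have "... <= C * (r i + e (Suc i))"
      using next_le[of i] C by (intro mult_left_mono) (auto simp: r_def)
    finally show ?thesis .
  qed
  define R where "R = (\<Sum>j<n. r j)"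
  have e_le: "e i <= C ^ n * R" if "i <= n" for i
    unfolding R_def by (rule downward_recursion[where e = e and r = r, OF C rec _ r that]) (simp_all add: e_def)
  have C1: "1 <= C ^ n" using C by (rule one_le_power)
  have R0: "R >= 0" unfolding R_def by (intro sum_nonneg r)
  have rR: "r k <= C ^ n * R"
  proof -
    have "r k <= R" unfolding R_def using k r by (intro member_le_sum) auto
    also have "... <= C ^ n * R" using mult_right_mono[OF C1 R0] by simp
    finally show ?thesis .
  qed
  note [continuous_intros] = has_grad_continuous_grad[OF grad[OF k]] has_div_continuous[OF dive[OF k]]
    has_div_continuous_div[OF dive[OF k]] continuous_next
  have "cint (\<lambda>x. (norm (w k x))^2) <= cint (\<lambda>x. 2 * (norm (g k x))^2 + 2 * (norm (g k x - w k x))^2)"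
  proof (rule cint_mono)
    fix x
    have "(norm (w k x))^2 <= (norm (g k x) + norm (g k x - w k x))^2"
      using norm_triangle_ineq4[of "g k x" "g k x - w k x"] by (intro power_mono) auto
    also have "... <= 2 * (norm (g k x))^2 + 2 * (norm (g k x - w k x))^2"
      using sum_squares_bound[of "norm (g k x)" "norm (g k x - w k x)"] by (simp add: power2_sum)
    finally show "(norm (w k x))^2 <= 2 * (norm (g k x))^2 + 2 * (norm (g k x - w k x))^2" .
  qed (intro continuous_intros)+
  also have "... = 2 * cint (\<lambda>x. (norm (g k x))^2) + 2 * A k"
    unfolding A_def by (subst Bochner_Integration.integral_add) (auto intro!: integrable_cube_continuous continuous_intros)
  finally have 1: "cint (\<lambda>x. (norm (w k x))^2) <= 2 * cint (\<lambda>x. (norm (g k x))^2) + 2 * A k" .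
  have "cint (\<lambda>x. (\<delta> k x)^2) <= cint (\<lambda>x. 2 * (\<delta> k x - next_v k x)^2 + 2 * (next_v k x)^2)"
  proof (rule cint_mono)
    fix x
    show "(\<delta> k x)^2 <= 2 * (\<delta> k x - next_v k x)^2 + 2 * (next_v k x)^2"
      using sum_squares_bound[of "\<delta> k x - next_v k x" "next_v k x"] power2_sum[of "\<delta> k x - next_v k x" "next_v k x"] by simp
  qed (intro continuous_intros)+
  also have "... = 2 * B k + 2 * cint (\<lambda>x. (next_v k x)^2)"
    unfolding B_def by (subst Bochner_Integration.integral_add) (auto intro!: integrable_cube_continuous continuous_intros)
  finally have 2: "cint (\<lambda>x. (\<delta> k x)^2) <= 2 * B k + 2 * e (Suc k)" using next_le[of k] by simp
  have "pair_error (v k) (g k) (w k) (\<delta> k) <= 3 * e k + 2 * r k + 2 * e (Suc k)"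
  proof -
    have ek: "e k = cint (\<lambda>x. (v k x)^2) + cint (\<lambda>x. (norm (g k x))^2)" using k by (simp add: e_def)
    show ?thesis
      using 1 2 \<beta>[of k] cint_nonneg[of "\<lambda>x. (v k x)^2", OF zero_le_power2] unfolding pair_error_def ek r_def by argo
  qed
  also have "... <= 7 * (C ^ n * R)" using e_le[of k] e_le[of "Suc k"] rR k by simp
  finally show ?thesis by (simp add: R_def r_def)
qed

text \<open>In the Neumann case the mean of \<open>v (Suc i)\<close> is the flux of \<open>w i\<close> up to a residual.\<close>

lemma mean_next:
  assumes i: "Suc i < n"
  shows "(cint (v (Suc i)))^2 <= 4 * real CARD('d) * bint (\<lambda>k b x. ((2 * b - 1) * w i x $ k)^2) + 2 * B i"
proof -
  have i': "i < n" using i by simp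
  note [continuous_intros] = has_div_continuous[OF dive[OF i']] has_div_continuous_div[OF dive[OF i']]
    has_grad_continuous[OF grad[OF i]]
  have one: "has_grad (\<lambda>_. 1) (\<lambda>_. 0 :: real ^ 'd)" by (simp add: has_grad_def)
  let ?h = "\<lambda>k b x. (2 * b - 1) * w i x $ k"
  \<comment> \<open>Green's formula with the constant test function 1: the mean of a divergence is
    the total flux.\<close>
  have flux: "cint (\<delta> i) = bint ?h"
    using Green_formula[OF one dive[OF i']] by simp
  have jensen: "(LINT x|M. f x)^2 <= (LINT x|M. (f x)^2)"
    if "prob_space M" "integrable M f" "integrable M (\<lambda>x. (f x)^2)" for M and f :: "real ^ 'd => real"
    using prob_space.variance_positive[OF that(1), of f] prob_space.variance_eq[OF that] by simp
  \<comment> \<open>Cauchy-Schwarz over the faces, then Jensen on each face, which carries a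
    probability measure.\<close>
  have "(bint ?h)^2 <= 2 * real CARD('d) * bint (\<lambda>k b x. (?h k b x)^2)"
  proof -
    have "bint ?h = (\<Sum>p\<in>UNIV \<times> {0,1}. fint (fst p) (snd p) (?h (fst p) (snd p)))"
      unfolding bint_def by (subst sum.cartesian_product) (simp add: case_prod_beta')
    then have "(bint ?h)^2 <= (\<Sum>p\<in>(UNIV :: 'd set) \<times> {0,1::real}. 1^2) * (\<Sum>p\<in>UNIV \<times> {0,1}. (fint (fst p) (snd p) (?h (fst p) (snd p)))^2)"
      using Cauchy_Schwarz_ineq_sum[of "\<lambda>_. 1" "\<lambda>p. fint (fst p) (snd p) (?h (fst p) (snd p))" "(UNIV :: 'd set) \<times> {0,1::real}"] by simp
    also have "(\<Sum>p\<in>(UNIV :: 'd set) \<times> {0,1::real}. 1^2) = 2 * real CARD('d)" by simp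
    also have "2 * real CARD('d) * (\<Sum>p\<in>UNIV \<times> {0,1}. (fint (fst p) (snd p) (?h (fst p) (snd p)))^2) \<le>
        2 * real CARD('d) * (\<Sum>p\<in>UNIV \<times> {0,1}. fint (fst p) (snd p) (\<lambda>x. (?h (fst p) (snd p) x)^2))"
      by (intro mult_left_mono sum_mono jensen prob_space_face_measure integrable_face_continuous continuous_intros) auto
    also have "(\<Sum>p\<in>UNIV \<times> {0,1}. fint (fst p) (snd p) (\<lambda>x. (?h (fst p) (snd p) x)^2)) = bint (\<lambda>k b x. (?h k b x)^2)"
      unfolding bint_def by (subst sum.cartesian_product) (simp add: case_prod_beta')
    finally show ?thesis .
  qed
  moreover have "(cint (\<lambda>x. \<delta> i x - next_v i x))^2 <= B i"
    unfolding B_def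
    by (intro jensen prob_space_cube_measure integrable_cube_continuous continuous_intros continuous_next)
  moreover have "cint (v (Suc i)) = bint ?h - cint (\<lambda>x. \<delta> i x - next_v i x)"
  proof -
    have "next_v i = v (Suc i)" using i by (auto simp: next_v_def fun_eq_iff)
    then show ?thesis
      unfolding flux[symmetric]
      by (subst Bochner_Integration.integral_diff) (auto intro!: integrable_cube_continuous continuous_intros)
  qed
  moreover have "(a - b)^2 <= 2 * (2 * c * S) + 2 * D" if "a^2 <= 2 * c * S" "b^2 <= D" for a b c S D :: real
  proof -
    have "0 <= (a + b)^2" by simp
    then have "(a - b)^2 <= 2 * a^2 + 2 * b^2" unfolding power2_diff power2_sum by argo
    also have "... <= 2 * (2 * c * S) + 2 * D" using that by (intro add_mono mult_left_mono) simp_all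
    finally show ?thesis .
  qed
  ultimately have "(cint (v (Suc i)))^2 <= 2 * (2 * real CARD('d) * bint (\<lambda>k b x. (?h k b x)^2)) + 2 * B i"
    by (simp only:)
  then show ?thesis by simp
qed

lemma coercivity_robin:
  assumes k: "k < n"
  shows "pair_error (v k) (g k) (w k) (\<delta> k) <= 7 * 200 ^ n *
    (\<Sum>i<n. A i + B i + bint (\<lambda>l b x. (v i x + (2 * b - 1) * w i x $ l)^2))"
  using robin_step[OF grad dive continuous_next]
  by (intro chain[OF _ _ _ k]) (auto simp: A_def B_def intro: bint_nonneg)

lemma coercivity_dirichlet:
  assumes k: "k < n" and T: "\<And>i x l. i < n ==> x \<in> cube ==> \<bar>w i x $ l\<bar> <= T" and \<tau>: "\<tau> > 0"
  shows "pair_error (v k) (g k) (w k) (\<delta> k) <= 7 * 200 ^ n *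
    (\<Sum>i<n. A i + B i + ((1 + T^2 / \<tau>) * bint (\<lambda>l b x. (v i x)^2) + real CARD('d) * \<tau>))"
proof (rule chain[OF _ _ _ k])
  show "0 <= (1 + T^2 / \<tau>) * bint (\<lambda>l b x. (v i x)^2) + real CARD('d) * \<tau>" for i
    using \<tau> by (intro add_nonneg_nonneg mult_nonneg_nonneg bint_nonneg) auto
qed (use dirichlet_step[OF grad dive continuous_next T \<tau>] in \<open>auto simp: A_def B_def add.assoc\<close>)

text \<open>The loss penalises only the mean of \<open>v 0\<close>. By \<open>mean_next\<close>
  every other mean is already paid for by the flux and divergence residuals of the preceding level,
  which adds \<open>2 + 4 * real CARD('d)\<close> copies of the residuals.\<close>

lemma coercivity_neumann:
  assumes k: "k < n"
  defines "P \<equiv> real CARD('d) * 2 ^ CARD('d)"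
  defines "K \<equiv> 16 * real CARD('d) * (P + 1)"
  shows "pair_error (v k) (g k) (w k) (\<delta> k) <= 7 * (1 + 4 * K * (P + 1)) ^ n * (3 + 4 * real CARD('d)) *
    ((\<Sum>i<n. A i + B i + bint (\<lambda>l b x. ((2 * b - 1) * w i x $ l)^2)) + (cint (v 0))^2)"
proof -
  define S where "S i = bint (\<lambda>l b x. ((2 * b - 1) * w i x $ l)^2)" for i
  have S0: "S i >= 0" for i by (auto simp: S_def intro: bint_nonneg)
  have C: "1 + 4 * K * (P + 1) >= 1" by (simp add: K_def P_def)
  have 1: "pair_error (v k) (g k) (w k) (\<delta> k) <= 7 * (1 + 4 * K * (P + 1)) ^ n * (\<Sum>i<n. A i + B i + (S i + (cint (v i))^2))"
  proof (rule chain[OF C _ _ k])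
    show "0 <= S i + (cint (v i))^2" for i using S0 by simp
    show "cint (\<lambda>x. (v i x)^2) + cint (\<lambda>x. (norm (g i x))^2) \<le>
      (1 + 4 * K * (P + 1)) * (A i + B i + cint (\<lambda>x. (next_v i x)^2) + (S i + (cint (v i))^2))" if "i < n" for i
      using neumann_step[OF grad[OF that] dive[OF that] continuous_next]
      by (simp add: A_def B_def S_def K_def P_def add.assoc)
  qed
  have 2: "(\<Sum>i<n. A i + B i + (S i + (cint (v i))^2)) <= (3 + 4 * real CARD('d)) * ((\<Sum>i<n. A i + B i + S i) + (cint (v 0))^2)"
  proof -
    obtain n' where n': "n = Suc n'" using k by (cases n) auto
    have "(\<Sum>i<n. (cint (v i))^2) = (cint (v 0))^2 + (\<Sum>i<n'. (cint (v (Suc i)))^2)"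
      unfolding n' by (rule sum.lessThan_Suc_shift)
    also have "(\<Sum>i<n'. (cint (v (Suc i)))^2) <= (\<Sum>i<n'. 4 * real CARD('d) * S i + 2 * B i)"
      unfolding S_def by (intro sum_mono mean_next) (simp add: n')
    also have "... <= (\<Sum>i<n. (2 + 4 * real CARD('d)) * (A i + B i + S i))"
    proof (rule order_trans[OF sum_mono sum_mono2])
      show "4 * real CARD('d) * S i + 2 * B i <= (2 + 4 * real CARD('d)) * (A i + B i + S i)" for i
        using A_nonneg[of i] B_nonneg[of i] S0[of i] by (simp add: algebra_simps)
      show "0 <= (2 + 4 * real CARD('d)) * (A i + B i + S i)" for i
        using A_nonneg[of i] B_nonneg[of i] S0[of i] by (intro mult_nonneg_nonneg) auto
    qed (auto simp: n')
    finally have "(\<Sum>i<n. (cint (v i))^2) <= (cint (v 0))^2 + (2 + 4 * real CARD('d)) * (\<Sum>i<n. A i + B i + S i)"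
      by (simp add: sum_distrib_left)
    moreover have "0 <= (2 + 4 * real CARD('d)) * (cint (v 0))^2" by (intro mult_nonneg_nonneg) auto
    moreover have "a <= m + c * X ==> 0 <= c * m ==> X + a <= (1 + c) * (X + m)" for a m c X :: real
      by (simp add: algebra_simps)
    ultimately have "(\<Sum>i<n. A i + B i + S i) + (\<Sum>i<n. (cint (v i))^2) \<le>
        (1 + (2 + 4 * real CARD('d))) * ((\<Sum>i<n. A i + B i + S i) + (cint (v 0))^2)" by blast
    moreover have "(\<Sum>i<n. A i + B i + (S i + (cint (v i))^2)) = (\<Sum>i<n. A i + B i + S i) + (\<Sum>i<n. (cint (v i))^2)"
      by (simp add: sum.distrib)
    ultimately show ?thesis by (simp add: add.assoc[symmetric])
  qed
  have "0 <= 7 * (1 + 4 * K * (P + 1)) ^ n"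
    by (intro mult_nonneg_nonneg zero_le_power order_trans[OF zero_le_one C]) simp
  from order_trans[OF 1 mult_left_mono[OF 2 this]] show ?thesis
    by (simp only: S_def mult.assoc)
qed

end

section \<open>Cosine series\<close>

text \<open>A superposition of plane waves with a common phase. Differentiation multiplies the
  weights by a component of the frequency and advances the phase by \<open>pi / 2\<close>, so every
  derivative stays in this form.\<close>

definition wave :: "('j => real) => ('j => real ^ 'd) => real => real ^ 'd => real" where
  "wave w \<kappa> p x = (\<Sum>\<^sub>\<infinity>j. w j * cos (\<kappa> j \<bullet> x + p))"

text \<open>All lower powers are included as well, since for a small frequency a lower power exceeds
  a higher one.\<close>

definition moments :: "nat => ('j => real) => ('j => real ^ 'd) => bool" where
  "moments s w \<kappa> \<longleftrightarrow> (\<forall>q\<le>s. (\<lambda>j. \<bar>w j\<bar> * norm (\<kappa> j) ^ q) summable_on UNIV)"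

lemma moments_mono: "moments s w \<kappa> ==> r <= s ==> moments r w \<kappa>"
  unfolding moments_def by (meson order_trans)

lemma momentsD: "moments s w \<kappa> ==> q <= s ==> (\<lambda>j. \<bar>w j\<bar> * norm (\<kappa> j) ^ q) summable_on UNIV"
  unfolding moments_def by blast

lemma moments_abs_summable: "moments s w \<kappa> ==> (\<lambda>j. \<bar>w j\<bar>) summable_on UNIV"
  using momentsD[of s w \<kappa> 0] by (simp only: power_0 mult_1_right le0)

lemma summable_on_real_abs:
  fixes f :: "'j => real"
  assumes "g summable_on A" "\<And>x. x \<in> A ==> \<bar>f x\<bar> <= g x"
  shows "f summable_on A"
  by (rule abs_summable_summable, rule Infinite_Sum.abs_summable_on_comparison_test'[OF assms(1)]) (simp add: assms(2))

lemma moments_mult: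
  assumes m: "moments (s + r) w \<kappa>" and le: "\<And>j. \<bar>c j\<bar> <= norm (\<kappa> j) ^ r"
  shows "moments s (\<lambda>j. w j * c j) \<kappa>"
  unfolding moments_def
proof (intro allI impI)
  fix q assume "q <= s"
  then have "(\<lambda>j. \<bar>w j\<bar> * norm (\<kappa> j) ^ (q + r)) summable_on UNIV"
    by (intro momentsD[OF m]) simp
  then show "(\<lambda>j. \<bar>w j * c j\<bar> * norm (\<kappa> j) ^ q) summable_on UNIV"
  proof (rule summable_on_comparison_test)
    fix j
    have "\<bar>w j\<bar> * norm (\<kappa> j) ^ q * \<bar>c j\<bar> <= \<bar>w j\<bar> * norm (\<kappa> j) ^ q * norm (\<kappa> j) ^ r"
      by (intro mult_left_mono le) auto
    then show "\<bar>w j * c j\<bar> * norm (\<kappa> j) ^ q <= \<bar>w j\<bar> * norm (\<kappa> j) ^ (q + r)"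
      by (simp add: abs_mult power_add mult_ac)
  qed auto
qed

lemma moments_component:
  assumes "moments (Suc s) w \<kappa>"
  shows "moments s (\<lambda>j. w j * \<kappa> j $ l) \<kappa>"
  using moments_mult[of s 1 w \<kappa> "\<lambda>j. \<kappa> j $ l"] assms component_le_norm_cart by auto

lemma moments_laplace:
  assumes "moments (s + 2 * k) w \<kappa>"
  shows "moments s (\<lambda>j. w j * (- (norm (\<kappa> j))\<^sup>2) ^ k) \<kappa>"
  by (rule moments_mult[OF assms]) (simp add: power_abs power_mult)

lemma wave_term_summable:
  assumes "moments s w \<kappa>"
  shows "(\<lambda>j. w j * cos (\<kappa> j \<bullet> x + p)) summable_on UNIV"
proof (rule summable_on_real_abs)
  show "(\<lambda>j. \<bar>w j\<bar>) summable_on UNIV" by (rule moments_abs_summable[OF assms])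
  show "\<bar>w j * cos (\<kappa> j \<bullet> x + p)\<bar> <= \<bar>w j\<bar>" for j
    using mult_left_mono[OF abs_cos_le_one, of "\<bar>w j\<bar>"] by (simp add: abs_mult)
qed

lemma wave_has_sum:
  "moments s w \<kappa> ==> ((\<lambda>j. w j * cos (\<kappa> j \<bullet> x + p)) has_sum wave w \<kappa> p x) UNIV"
  unfolding wave_def by (rule has_sum_infsum) (rule wave_term_summable)

lemma abs_wave_le:
  assumes "moments s w \<kappa>"
  shows "\<bar>wave w \<kappa> p x\<bar> <= (\<Sum>\<^sub>\<infinity>j. \<bar>w j\<bar>)"
proof -
  have s: "(\<lambda>j. \<bar>w j\<bar>) summable_on UNIV" by (rule moments_abs_summable[OF assms])
  have "norm (wave w \<kappa> p x) <= (\<Sum>\<^sub>\<infinity>j. \<bar>w j\<bar>)"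
    by (rule norm_infsum_le[OF wave_has_sum[OF assms] has_sum_infsum[OF s]])
      (use mult_left_mono[OF abs_cos_le_one] in \<open>force simp: abs_mult\<close>)
  then show ?thesis by simp
qed

lemma has_sum_finite_sum:
  fixes f :: "'l => 'j => real"
  assumes "finite L" "\<And>l. l \<in> L ==> (f l has_sum s l) A"
  shows "((\<lambda>j. \<Sum>l\<in>L. f l j) has_sum (\<Sum>l\<in>L. s l)) A"
  using assms by (induction L rule: finite_induct) (auto intro!: has_sum_add)

lemma has_sum_diff_real:
  fixes f g :: "'j => real"
  assumes "(f has_sum a) A" "(g has_sum b) A"
  shows "((\<lambda>j. f j - g j) has_sum (a - b)) A"
  using has_sum_add[OF assms(1) has_sum_cmult_right[OF assms(2), of "-1"]] by simp

lemma cos_taylor: "\<bar>cos (a + t) - cos a + t * sin a\<bar> <= t^2" for a t :: real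
proof -
  have s: "\<bar>sin (a + u) - sin a\<bar> <= \<bar>u\<bar>" for u
    using field_differentiable_bound[of UNIV sin cos 1 "a + u" a]
    by (auto intro: has_field_derivative_at_within)
  define f where "f u = cos (a + u) - cos a + u * sin a" for u
  have "norm (f t - f 0) <= \<bar>t\<bar> * norm (t - 0)"
  proof (rule field_differentiable_bound[of "closed_segment 0 t"])
    show "(f has_field_derivative (- sin (a + u) + sin a)) (at u within closed_segment 0 t)" for u
      unfolding f_def by (auto intro!: derivative_eq_intros)
    show "norm (- sin (a + u) + sin a) <= \<bar>t\<bar>" if "u \<in> closed_segment 0 t" for u
      using s[of u] that by (auto simp: closed_segment_eq_real_ivl split: if_splits)
  qed auto
  then show ?thesis by (simp add: f_def power2_eq_square flip: abs_mult)
qed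

lemma has_derivative_quadratic_error:
  fixes f :: "'a::real_normed_vector => real"
  assumes D: "bounded_linear D" and q: "\<And>h. \<bar>f (x + h) - f x - D h\<bar> <= C * (norm h)^2"
  shows "(f has_derivative D) (at x)"
  unfolding has_derivative_at
proof (intro conjI D)
  show "(\<lambda>h. norm (f (x + h) - f x - D h) / norm h) \<midarrow>0\<rightarrow> 0"
  proof (rule Lim_null_comparison)
    show "\<forall>\<^sub>F h in at 0. norm (norm (f (x + h) - f x - D h) / norm h) <= C * norm h"
      using q by (auto simp: eventually_at_filter divide_le_eq power2_eq_square mult.assoc)
    show "((\<lambda>h. C * norm h) \<longlongrightarrow> 0) (at 0)"
      by (auto intro!: tendsto_eq_intros)
  qed
qed

text \<open>Every summand deviates from its linearisation by at most
  \<open>\<bar>w j\<bar> * (norm (\<kappa> j))^2 * (norm h)^2\<close>. The second moments sum these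
  remainders to one quadratic bound, which proves differentiability directly.\<close>

lemma wave_has_derivative:
  assumes m: "moments 2 w \<kappa>"
  shows "(wave w \<kappa> p has_derivative (\<lambda>h. (\<chi> l. wave (\<lambda>j. w j * \<kappa> j $ l) \<kappa> (p + pi / 2) x) \<bullet> h)) (at x)"
proof (rule has_derivative_quadratic_error)
  let ?W = "\<lambda>l. wave (\<lambda>j. w j * \<kappa> j $ l) \<kappa> (p + pi / 2) x"
  show "bounded_linear (\<lambda>h. (\<chi> l. ?W l) \<bullet> h)" by (rule bounded_linear_inner_right)
  fix h :: "real ^ 'b"
  have s2: "(\<lambda>j. \<bar>w j\<bar> * (norm (\<kappa> j))^2) summable_on UNIV" by (rule momentsD[OF m]) simp
  have 1: "((\<lambda>j. \<Sum>l\<in>UNIV. h $ l * ((w j * \<kappa> j $ l) * cos (\<kappa> j \<bullet> x + (p + pi / 2)))) has_sum (\<Sum>l\<in>UNIV. h $ l * ?W l)) UNIV"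
    using m by (intro has_sum_finite_sum has_sum_cmult_right wave_has_sum[of 1] moments_component) (auto simp: numeral_2_eq_2)
  have 2: "(\<Sum>l\<in>UNIV. h $ l * ((w j * \<kappa> j $ l) * cos (\<kappa> j \<bullet> x + (p + pi / 2)))) = - (w j * (\<kappa> j \<bullet> h) * sin (\<kappa> j \<bullet> x + p))" for j
  proof -
    have c: "cos (\<kappa> j \<bullet> x + (p + pi / 2)) = - sin (\<kappa> j \<bullet> x + p)"
      using minus_sin_cos_eq[of "\<kappa> j \<bullet> x + p"] by (simp add: add.assoc)
    have i: "\<kappa> j \<bullet> h = (\<Sum>l\<in>UNIV. \<kappa> j $ l * h $ l)" by (simp add: inner_vec_def)
    show ?thesis unfolding c i by (simp add: sum_distrib_left sum_distrib_right sum_negf mult_ac)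
  qed
  have 3: "((\<lambda>j. (w j * cos (\<kappa> j \<bullet> (x + h) + p) - w j * cos (\<kappa> j \<bullet> x + p)) - - (w j * (\<kappa> j \<bullet> h) * sin (\<kappa> j \<bullet> x + p)))
      has_sum ((wave w \<kappa> p (x + h) - wave w \<kappa> p x) - (\<chi> l. ?W l) \<bullet> h)) UNIV"
  proof -
    have ip: "(\<chi> l. ?W l) \<bullet> h = (\<Sum>l\<in>UNIV. h $ l * ?W l)"
      by (simp add: inner_vec_def mult.commute)
    show ?thesis
      unfolding ip by (intro has_sum_diff_real wave_has_sum[OF m] 1[unfolded 2])
  qed
  have "norm ((wave w \<kappa> p (x + h) - wave w \<kappa> p x) - (\<chi> l. ?W l) \<bullet> h) <= (\<Sum>\<^sub>\<infinity>j. \<bar>w j\<bar> * (norm (\<kappa> j))^2) * (norm h)^2"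
  proof (rule norm_infsum_le[OF 3])
    show "((\<lambda>j. \<bar>w j\<bar> * (norm (\<kappa> j))^2 * (norm h)^2) has_sum (\<Sum>\<^sub>\<infinity>j. \<bar>w j\<bar> * (norm (\<kappa> j))^2) * (norm h)^2) UNIV"
      by (rule has_sum_cmult_left[OF has_sum_infsum[OF s2]])
    fix j
    have "(w j * cos (\<kappa> j \<bullet> (x + h) + p) - w j * cos (\<kappa> j \<bullet> x + p)) - - (w j * (\<kappa> j \<bullet> h) * sin (\<kappa> j \<bullet> x + p)) =
        w j * (cos ((\<kappa> j \<bullet> x + p) + \<kappa> j \<bullet> h) - cos (\<kappa> j \<bullet> x + p) + (\<kappa> j \<bullet> h) * sin (\<kappa> j \<bullet> x + p))"
      by (simp add: inner_add_right algebra_simps)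
    also have "norm ... = \<bar>w j\<bar> * \<bar>cos ((\<kappa> j \<bullet> x + p) + \<kappa> j \<bullet> h) - cos (\<kappa> j \<bullet> x + p) + (\<kappa> j \<bullet> h) * sin (\<kappa> j \<bullet> x + p)\<bar>"
      by (simp add: abs_mult)
    also have "... <= \<bar>w j\<bar> * (\<kappa> j \<bullet> h)^2"
      by (intro mult_left_mono cos_taylor) auto
    also have "... <= \<bar>w j\<bar> * ((norm (\<kappa> j))^2 * (norm h)^2)"
      using Cauchy_Schwarz_ineq2[of "\<kappa> j" h]
      by (intro mult_left_mono) (auto simp: power_mult_distrib[symmetric] abs_le_square_iff[symmetric])
    finally show "norm ((w j * cos (\<kappa> j \<bullet> (x + h) + p) - w j * cos (\<kappa> j \<bullet> x + p)) - - (w j * (\<kappa> j \<bullet> h) * sin (\<kappa> j \<bullet> x + p)))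
        <= \<bar>w j\<bar> * (norm (\<kappa> j))^2 * (norm h)^2" by (simp add: mult.assoc)
  qed
  then show "\<bar>wave w \<kappa> p (x + h) - wave w \<kappa> p x - (\<chi> l. ?W l) \<bullet> h\<bar> <= (\<Sum>\<^sub>\<infinity>j. \<bar>w j\<bar> * (norm (\<kappa> j))^2) * (norm h)^2"
    by simp
qed

lemma continuous_wave:
  assumes "moments 2 w \<kappa>"
  shows "continuous_on UNIV (wave w \<kappa> p)"
  using wave_has_derivative[OF assms]
  by (meson continuous_at_imp_continuous_on has_derivative_continuous)

lemma has_grad_wave:
  assumes m: "moments 3 w \<kappa>"
  shows "has_grad (wave w \<kappa> p) (\<lambda>x. \<chi> l. wave (\<lambda>j. w j * \<kappa> j $ l) \<kappa> (p + pi / 2) x)"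
  unfolding has_grad_def
proof (intro conjI allI wave_has_derivative)
  show "moments 2 w \<kappa>" using m by (rule moments_mono) simp
  show "continuous_on UNIV (\<lambda>x. \<chi> l. wave (\<lambda>j. w j * \<kappa> j $ l) \<kappa> (p + pi / 2) x)"
    using m by (intro continuous_on_vec_lambda continuous_wave moments_component) (simp add: eval_nat_numeral)
qed

text \<open>Two differentiations advance the phase by \<open>pi\<close>, which changes the sign of
  the cosine, and the squared components of the frequency add up to its squared norm.\<close>

lemma wave_divergence:
  assumes m: "moments 4 w \<kappa>"
  shows "(\<Sum>l\<in>UNIV. wave (\<lambda>j. w j * \<kappa> j $ l * \<kappa> j $ l) \<kappa> (p + pi / 2 + pi / 2) x) =
    wave (\<lambda>j. w j * (- (norm (\<kappa> j))\<^sup>2)) \<kappa> p x"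
proof -
  have "((\<lambda>j. \<Sum>l\<in>UNIV. w j * \<kappa> j $ l * \<kappa> j $ l * cos (\<kappa> j \<bullet> x + (p + pi / 2 + pi / 2))) has_sum
      (\<Sum>l\<in>UNIV. wave (\<lambda>j. w j * \<kappa> j $ l * \<kappa> j $ l) \<kappa> (p + pi / 2 + pi / 2) x)) UNIV"
    using m by (intro has_sum_finite_sum wave_has_sum[of 2] moments_component) (auto simp: eval_nat_numeral)
  moreover have "(\<Sum>l\<in>UNIV. w j * \<kappa> j $ l * \<kappa> j $ l * cos (\<kappa> j \<bullet> x + (p + pi / 2 + pi / 2))) =
      w j * (- (norm (\<kappa> j))\<^sup>2) * cos (\<kappa> j \<bullet> x + p)" for j
  proof -
    have c: "cos (\<kappa> j \<bullet> x + (p + pi / 2 + pi / 2)) = - cos (\<kappa> j \<bullet> x + p)"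
      using cos_periodic_pi[of "\<kappa> j \<bullet> x + p"] by (simp add: add.assoc)
    have n: "(norm (\<kappa> j))^2 = (\<Sum>l\<in>UNIV. \<kappa> j $ l * \<kappa> j $ l)"
      by (simp add: power2_norm_eq_inner inner_vec_def)
    show ?thesis unfolding c n by (simp add: sum_distrib_left sum_distrib_right sum_negf mult_ac)
  qed
  ultimately show ?thesis
    unfolding wave_def by (simp add: infsumI)
qed

text \<open>\<open>frechet_derivative\<close> is a choice among all derivatives within the cube. It
  is determined even at boundary points because the cube has positive extent in every coordinate
  direction.\<close>

lemma frechet_derivative_cube:
  fixes u :: "real ^ 'd => real"
  assumes v: "has_grad v g" and eq: "\<And>y. y \<in> cube ==> u y = v y" and x: "x \<in> cube"
  shows "frechet_derivative u (at x within cube) = (\<lambda>h. g x \<bullet> h)"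
proof -
  have "(v has_derivative (\<lambda>h. g x \<bullet> h)) (at x within cube)"
    using v by (auto simp: has_grad_def intro: has_derivative_at_withinI)
  then have u: "(u has_derivative (\<lambda>h. g x \<bullet> h)) (at x within cube)"
    by (rule has_derivative_transform[OF x, rotated]) (simp add: eq)
  then have "(u has_derivative frechet_derivative u (at x within cube)) (at x within cube)"
    using frechet_derivative_works differentiableI by blast
  then show ?thesis
    by (intro frechet_derivative_unique_within_closed_interval[OF _ x _ u])
      (auto simp: Basis_vec_def inner_axis)
qed

lemma partial_cube:
  assumes "has_grad v g" "\<And>y. y \<in> cube ==> u y = v y" "x \<in> cube"
  shows "partial i u x = g x $ i"
  using fun_cong[OF frechet_derivative_cube[of v g u x, OF assms], of "axis i 1"]
  by (simp add: partial_def inner_axis)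

lemma gradient_cube:
  assumes "has_grad v g" "\<And>y. y \<in> cube ==> u y = v y" "x \<in> cube"
  shows "gradient u x = g x"
  unfolding gradient_def by (simp add: partial_cube[of v g u x, OF assms] vec_eq_iff)

lemma laplacian_power_wave:
  assumes u: "\<And>x. x \<in> cube ==> u x = wave w \<kappa> 0 x" and m: "moments (2 * n + 2) w \<kappa>"
  shows "k <= n ==> x \<in> cube ==> (laplacian ^^ k) u x = wave (\<lambda>j. w j * (- (norm (\<kappa> j))\<^sup>2) ^ k) \<kappa> 0 x"
proof (induction k arbitrary: x)
  case (Suc k)
  let ?w = "\<lambda>j. w j * (- (norm (\<kappa> j))\<^sup>2) ^ k"
  \<comment> \<open>Level \<open>k < n\<close> has used \<open>2 * k\<close> of the
    \<open>2 * n + 2\<close> moments. At least four remain, enough to apply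
    \<open>has_grad_wave\<close> to the wave and to its partial derivatives.\<close>
  have m4: "moments 4 ?w \<kappa>"
    using m Suc.prems by (intro moments_laplace) (auto elim: moments_mono)
  then have m3: "moments 3 ?w \<kappa>" by (rule moments_mono) simp
  have g: "gradient ((laplacian ^^ k) u) y = (\<chi> l. wave (\<lambda>j. ?w j * \<kappa> j $ l) \<kappa> (0 + pi / 2) y)" if "y \<in> cube" for y
    using Suc that by (intro gradient_cube[OF has_grad_wave[OF m3]]) auto
  have "partial l (\<lambda>y. gradient ((laplacian ^^ k) u) y $ l) x =
      (\<chi> k. wave (\<lambda>j. ?w j * \<kappa> j $ l * \<kappa> j $ k) \<kappa> (0 + pi / 2 + pi / 2) x) $ l" for l
    using m4 Suc.prems g by (intro partial_cube[OF has_grad_wave]) (auto intro!: moments_component simp: eval_nat_numeral)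
  then have "laplacian ((laplacian ^^ k) u) x = (\<Sum>l\<in>UNIV. wave (\<lambda>j. ?w j * \<kappa> j $ l * \<kappa> j $ l) \<kappa> (0 + pi / 2 + pi / 2) x)"
    by (simp add: laplacian_def divergence_def)
  also have "... = wave (\<lambda>j. ?w j * (- (norm (\<kappa> j))\<^sup>2)) \<kappa> 0 x"
    by (rule wave_divergence[OF m4])
  finally show ?case by (simp add: mult_ac)
qed (simp add: u)

section \<open>Orthogonality and completeness of the cosine system\<close>

lemma integral_unit_FTC:
  assumes "\<And>t. (F has_real_derivative f t) (at t)" "continuous_on UNIV f"
  shows "(LINT t|unit_lborel. f t) = F 1 - F 0"
proof -
  have "(LINT t|unit_lborel. f t) = (LINT t|lborel. f t * indicator {0..1} t)"
    by (subst integral_restrict_space) (auto simp: mult.commute)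
  also have "... = F 1 - F 0"
    by (rule integral_FTC_Icc_real) (use assms in \<open>auto simp: continuous_on_eq_continuous_at\<close>)
  finally show ?thesis .
qed

lemma integrable_unit_continuous:
  fixes f :: "real => real"
  assumes f: "continuous_on UNIV f"
  shows "integrable unit_lborel f"
proof -
  have "compact (f ` {0..1})"
    using f by (intro compact_continuous_image) (auto intro: continuous_on_subset)
  then obtain B where "\<And>s. s \<in> {0..1} ==> norm (f s) <= B"
    by (meson bounded_iff compact_imp_bounded image_eqI)
  moreover have "f \<in> borel_measurable unit_lborel"
    using borel_measurable_continuous_onI[OF f] by (intro measurable_restrict_space1) simp
  ultimately show ?thesis
    by (intro unit_lborel.integrable_const_bound[of _ B]) (auto simp: space_restrict_space intro!: AE_I2)
qed

lemma integral_cos_unit: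
  "(LINT t|unit_lborel. cos (pi * of_int k * t)) = (if k = 0 then 1 else 0)"
proof (cases "k = 0")
  case True
  have "measure unit_lborel (space unit_lborel) = 1" by (rule unit_lborel.prob_space)
  then show ?thesis using True by simp
next
  case False
  have "(LINT t|unit_lborel. cos (pi * of_int k * t)) = sin (pi * of_int k * 1) / (pi * of_int k) - sin (pi * of_int k * 0) / (pi * of_int k)"
    by (rule integral_unit_FTC[where F = "\<lambda>t. sin (pi * of_int k * t) / (pi * of_int k)"])
      (use False in \<open>auto intro!: derivative_eq_intros continuous_intros\<close>)
  then show ?thesis using False sin_int_times_real[of k pi] by (simp add: mult.commute)
qed

lemma integral_cos_cos_unit:
  fixes a b :: nat
  shows "(LINT t|unit_lborel. cos (pi * real a * t) * cos (pi * real b * t)) =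
    (if a = b then if a = 0 then 1 else 1 / 2 else 0)"
proof -
  have "(LINT t|unit_lborel. cos (pi * real a * t) * cos (pi * real b * t)) =
      (LINT t|unit_lborel. (cos (pi * of_int (int a - int b) * t) + cos (pi * of_int (int a + int b) * t)) / 2)"
    by (simp add: cos_times_cos algebra_simps)
  also have "... = ((LINT t|unit_lborel. cos (pi * of_int (int a - int b) * t)) + (LINT t|unit_lborel. cos (pi * of_int (int a + int b) * t))) / 2"
    by (simp only: Bochner_Integration.integral_divide_zero, subst Bochner_Integration.integral_add)
      (auto intro!: integrable_unit_continuous continuous_intros)
  finally show ?thesis unfolding integral_cos_unit by auto
qed

lemma integral_cube_prod:
  fixes f :: "'d::finite => real => real"
  assumes f: "\<And>i. continuous_on UNIV (f i)"
  shows "(LINT x|cube_measure. (\<Prod>i\<in>UNIV. f i (x $ i))) = (\<Prod>i\<in>UNIV. (LINT t|unit_lborel. f i t))"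
proof -
  have vec: "(\<lambda>f. \<chi> i. f i) \<in> (\<Pi>\<^sub>M i\<in>UNIV. unit_lborel) \<rightarrow>\<^sub>M (borel :: (real ^ 'd) measure)"
    by (rule measurable_vec_lambda) (simp add: measurable_unit_component)
  have m: "(\<lambda>x :: real ^ 'd. \<Prod>i\<in>UNIV. f i (x $ i)) \<in> borel_measurable borel"
    by (intro borel_measurable_continuous_onI continuous_intros continuous_on_compose2[OF f]) auto
  have "(LINT x|cube_measure. (\<Prod>i\<in>UNIV. f i (x $ i))) = (LINT y|(\<Pi>\<^sub>M i\<in>UNIV. unit_lborel). (\<Prod>i\<in>UNIV. f i (y i)))"
    by (subst cube_measure_eq_distr_PiM, subst integral_distr[OF vec m]) simp
  also have "... = (\<Prod>i\<in>UNIV. (LINT t|unit_lborel. f i t))"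
    by (rule unit_product.product_integral_prod) (auto intro!: integrable_unit_continuous f)
  finally show ?thesis .
qed


lemma continuous_cos_basis [continuous_intros]: "continuous_on S (cos_basis k)"
  unfolding cos_basis_def by (intro continuous_intros)

lemma abs_cos_basis_le: "\<bar>cos_basis k x\<bar> <= 1"
  unfolding cos_basis_def abs_prod by (intro prod_le_1) auto

lemma cos_basis_inner:
  "cint (\<lambda>x. cos_basis k x * cos_basis l x) =
    (\<Prod>i\<in>UNIV. if k $ i = l $ i then if k $ i = 0 then 1 else 1 / 2 else 0)"
proof -
  have "cint (\<lambda>x. cos_basis k x * cos_basis l x) =
      cint (\<lambda>x. (\<Prod>i\<in>UNIV. cos (pi * real (k $ i) * x $ i) * cos (pi * real (l $ i) * x $ i)))"
    by (simp add: cos_basis_def prod.distrib)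
  also have "... = (\<Prod>i\<in>UNIV. (LINT t|unit_lborel. cos (pi * real (k $ i) * t) * cos (pi * real (l $ i) * t)))"
    by (rule integral_cube_prod[of "\<lambda>i t. cos (pi * real (k $ i) * t) * cos (pi * real (l $ i) * t)"]) (intro continuous_intros)
  finally show ?thesis by (simp only: integral_cos_cos_unit)
qed

lemma cos_basis_orthogonal: "k ~= l ==> cint (\<lambda>x. cos_basis k x * cos_basis l x) = 0"
proof -
  assume "k ~= l"
  then obtain i where "k $ i ~= l $ i" by (auto simp: vec_eq_iff)
  then show ?thesis
    unfolding cos_basis_inner by (intro prod_zero bexI[of _ i]) simp_all
qed

lemma cos_basis_square_pos: "cint (\<lambda>x. cos_basis k x * cos_basis k x) > 0"
  unfolding cos_basis_inner by (auto intro!: prod_pos)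

lemma cos_coeff_eq:
  assumes u: "\<And>x. x \<in> cube ==> u x = v x" and v: "v \<in> borel_measurable borel"
  shows "cos_coeff u k * cint (\<lambda>x. cos_basis k x * cos_basis k x) = cint (\<lambda>x. v x * cos_basis k x)"
proof -
  have m: "cos_basis k \<in> borel_measurable borel"
    by (intro borel_measurable_continuous_onI continuous_intros)
  have "set_lebesgue_integral lborel cube (\<lambda>x. u x * cos_basis k x) = set_lebesgue_integral lborel cube (\<lambda>x. v x * cos_basis k x)"
    by (rule set_lebesgue_integral_cong) (auto simp: u)
  also have "... = cint (\<lambda>x. v x * cos_basis k x)"
    using m v by (intro set_integral_cube) simp
  finally have 1: "set_lebesgue_integral lborel cube (\<lambda>x. u x * cos_basis k x) = cint (\<lambda>x. v x * cos_basis k x)" .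
  have 2: "set_lebesgue_integral lborel cube (\<lambda>x. (cos_basis k x)^2) = cint (\<lambda>x. cos_basis k x * cos_basis k x)"
    using m unfolding power2_eq_square by (intro set_integral_cube) simp
  show ?thesis
    unfolding cos_coeff_def 1 2 using cos_basis_square_pos[of k] by simp
qed

text \<open>Orthogonality to the cosine system is preserved under multiplication by polynomials in
  the functions \<open>cos (pi * x $ i)\<close>; these are dense by the Weierstrass theorem after the
  substitution \<open>y $ i = cos (pi * x $ i)\<close>.\<close>

definition cos_orthogonal :: "(real ^ 'd => real) => bool" where
  "cos_orthogonal v \<longleftrightarrow> v \<in> borel_measurable borel \<and> (\<exists>B. \<forall>x\<in>cube. \<bar>v x\<bar> <= B) \<and>
     (\<forall>k. cint (\<lambda>x. v x * cos_basis k x) = 0)"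

lemma integrable_bounded_cube:
  fixes v :: "real ^ 'd => real"
  assumes "v \<in> borel_measurable borel" "\<And>x. x \<in> cube ==> \<bar>v x\<bar> <= B"
  shows "integrable cube_measure v"
  by (rule integrable_bounded_on_cube[OF prob_space_cube_measure sets_cube_measure AE_cube_measure assms(1)])
    (use assms(2) in simp)

lemma cos_orthogonal_integrable:
  assumes "cos_orthogonal v"
  shows "integrable cube_measure (\<lambda>x. v x * cos_basis k x)"
proof -
  obtain B where B: "\<And>x. x \<in> cube ==> \<bar>v x\<bar> <= B" using assms by (auto simp: cos_orthogonal_def)
  have m: "cos_basis k \<in> borel_measurable borel"
    by (intro borel_measurable_continuous_onI continuous_intros)
  have "\<bar>v x * cos_basis k x\<bar> <= B * 1" if "x \<in> cube" for x
    unfolding abs_mult using B[OF that] abs_cos_basis_le[of k x] by (intro mult_mono) auto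
  then show ?thesis
    using assms m by (intro integrable_bounded_cube[where B = "B * 1"]) (auto simp: cos_orthogonal_def)
qed

lemma cos_orthogonal_add:
  assumes "cos_orthogonal v" "cos_orthogonal w"
  shows "cos_orthogonal (\<lambda>x. v x + w x)"
  unfolding cos_orthogonal_def
proof (intro conjI allI)
  show "(\<lambda>x. v x + w x) \<in> borel_measurable borel"
    using assms unfolding cos_orthogonal_def by (intro borel_measurable_add) auto
  obtain B C where "\<And>x. x \<in> cube ==> \<bar>v x\<bar> <= B" "\<And>x. x \<in> cube ==> \<bar>w x\<bar> <= C"
    using assms unfolding cos_orthogonal_def by blast
  then show "\<exists>B. \<forall>x\<in>cube. \<bar>v x + w x\<bar> <= B"
    by (intro exI[of _ "B + C"] ballI order_trans[OF abs_triangle_ineq] add_mono)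
  show "cint (\<lambda>x. (v x + w x) * cos_basis k x) = 0" for k
    unfolding distrib_right
    by (subst Bochner_Integration.integral_add) (use assms cos_orthogonal_integrable in \<open>auto simp: cos_orthogonal_def\<close>)
qed

lemma cos_orthogonal_cmult:
  assumes "cos_orthogonal v"
  shows "cos_orthogonal (\<lambda>x. c * v x)"
  unfolding cos_orthogonal_def
proof (intro conjI allI)
  show "(\<lambda>x. c * v x) \<in> borel_measurable borel"
    using assms unfolding cos_orthogonal_def by (intro borel_measurable_times) auto
  obtain B where "\<And>x. x \<in> cube ==> \<bar>v x\<bar> <= B" using assms by (auto simp: cos_orthogonal_def)
  then show "\<exists>B. \<forall>x\<in>cube. \<bar>c * v x\<bar> <= B"
    by (intro exI[of _ "\<bar>c\<bar> * B"] ballI) (auto simp: abs_mult intro!: mult_left_mono)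
  show "cint (\<lambda>x. (c * v x) * cos_basis k x) = 0" for k
    unfolding mult.assoc using assms by (simp add: cos_orthogonal_def)
qed

lemma cos_orthogonal_sum:
  assumes "finite L" "\<And>l. l \<in> L ==> cos_orthogonal (v l)"
  shows "cos_orthogonal (\<lambda>x. \<Sum>l\<in>L. v l x)"
  using assms
proof (induction L rule: finite_induct)
  case empty
  show ?case by (auto simp: cos_orthogonal_def)
next
  case (insert l L)
  then show ?case using cos_orthogonal_add[of "v l" "\<lambda>x. \<Sum>l\<in>L. v l x"] by simp
qed

text \<open>The product formula for cosines in coordinate \<open>i\<close> raises and lowers the
  index by one. At index 0 the lowered index -1 is replaced by 1, since the cosine is even.\<close>

lemma cos_basis_times_cos:
  "cos_basis k x * cos (pi * x $ i) =
    (cos_basis (\<chi> j. if j = i then Suc (k $ j) else k $ j) x +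
     cos_basis (\<chi> j. if j = i then if k $ j = 0 then 1 else k $ j - 1 else k $ j) x) / 2"
proof -
  let ?R = "\<Prod>j\<in>UNIV - {i}. cos (pi * real (k $ j) * x $ j)"
  have split: "cos_basis l x = cos (pi * real (l $ i) * x $ i) * ?R" if "\<And>j. j ~= i ==> l $ j = k $ j" for l
  proof -
    have "cos_basis l x = cos (pi * real (l $ i) * x $ i) * (\<Prod>j\<in>UNIV - {i}. cos (pi * real (l $ j) * x $ j))"
      unfolding cos_basis_def by (rule prod.remove) auto
    also have "(\<Prod>j\<in>UNIV - {i}. cos (pi * real (l $ j) * x $ j)) = ?R"
      by (intro prod.cong) (auto simp: that)
    finally show ?thesis .
  qed
  have c: "cos (pi * real m * t) * cos (pi * t) =
      (cos (pi * real (Suc m) * t) + cos (pi * real (if m = 0 then 1 else m - 1) * t)) / 2" for m and t :: real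
  proof (cases m)
    case (Suc m')
    then show ?thesis
      by (simp add: cos_times_cos algebra_simps)
  qed simp
  let ?k1 = "\<chi> j. if j = i then Suc (k $ j) else k $ j"
  let ?k2 = "\<chi> j. if j = i then if k $ j = 0 then 1 else k $ j - 1 else k $ j"
  have 0: "cos_basis k x = cos (pi * real (k $ i) * x $ i) * ?R" by (rule split) simp
  have 1: "cos_basis ?k1 x = cos (pi * real (Suc (k $ i)) * x $ i) * ?R"
    by (subst split) simp_all
  have 2: "cos_basis ?k2 x = cos (pi * real (if k $ i = 0 then 1 else k $ i - 1) * x $ i) * ?R"
    by (subst split) simp_all
  have "cos_basis k x * cos (pi * x $ i) = (cos (pi * real (k $ i) * x $ i) * cos (pi * x $ i)) * ?R"
    unfolding 0 by (simp only: mult_ac)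
  also have "... = (cos_basis ?k1 x + cos_basis ?k2 x) / 2"
    unfolding 1 2 c by (simp only: distrib_right times_divide_eq_left)
  finally show ?thesis .
qed

lemma cos_orthogonal_times_cos:
  assumes v: "cos_orthogonal v"
  shows "cos_orthogonal (\<lambda>x. cos (pi * x $ i) * v x)"
  unfolding cos_orthogonal_def
proof (intro conjI allI)
  show "(\<lambda>x. cos (pi * x $ i) * v x) \<in> borel_measurable borel"
  proof (rule borel_measurable_times)
    show "(\<lambda>x. cos (pi * x $ i)) \<in> borel_measurable borel"
      by (intro borel_measurable_continuous_onI continuous_intros)
  qed (use v in \<open>simp add: cos_orthogonal_def\<close>)
  obtain B where B: "\<And>x. x \<in> cube ==> \<bar>v x\<bar> <= B" using v by (auto simp: cos_orthogonal_def)
  have "\<bar>cos (pi * x $ i) * v x\<bar> <= 1 * B" if "x \<in> cube" for x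
    unfolding abs_mult using B[OF that] by (intro mult_mono) auto
  then show "\<exists>B. \<forall>x\<in>cube. \<bar>cos (pi * x $ i) * v x\<bar> <= B" by blast
  fix k
  let ?k1 = "\<chi> j. if j = i then Suc (k $ j) else k $ j"
  let ?k2 = "\<chi> j. if j = i then if k $ j = 0 then 1 else k $ j - 1 else k $ j"
  have eq: "(cos (pi * x $ i) * v x) * cos_basis k x = (v x * cos_basis ?k1 x + v x * cos_basis ?k2 x) / 2" for x
    using cos_basis_times_cos[of k x i] by (simp add: algebra_simps)
  have "cint (\<lambda>x. (v x * cos_basis ?k1 x + v x * cos_basis ?k2 x) / 2) = 0"
    using v by (simp add: Bochner_Integration.integral_add cos_orthogonal_integrable cos_orthogonal_def)
  then show "cint (\<lambda>x. (cos (pi * x $ i) * v x) * cos_basis k x) = 0"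
    unfolding eq .
qed

lemma cos_orthogonal_times_polynomial:
  fixes p :: "real ^ 'd => real"
  assumes "real_polynomial_function p"
  shows "cos_orthogonal v ==> cos_orthogonal (\<lambda>x. p (\<chi> i. cos (pi * x $ i)) * v x)"
  using assms
proof (induction p arbitrary: v rule: real_polynomial_function.induct)
  case (linear f)
  have "f (\<chi> i. cos (pi * x $ i)) = (\<Sum>i\<in>UNIV. f (axis i 1) * cos (pi * x $ i))" for x
  proof -
    have "f (\<chi> i. cos (pi * x $ i)) = f (\<Sum>i\<in>UNIV. cos (pi * x $ i) *\<^sub>R axis i 1)"
      by (rule arg_cong[where f = f]) (simp add: vec_eq_iff axis_def if_distrib[of "(*) _"] cong: if_cong)
    also have "... = (\<Sum>i\<in>UNIV. f (axis i 1) * cos (pi * x $ i))"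
      using linear(1) by (simp add: linear_sum linear_scale bounded_linear.linear mult.commute)
    finally show ?thesis .
  qed
  then have "(\<lambda>x. f (\<chi> i. cos (pi * x $ i)) * v x) = (\<lambda>x. \<Sum>i\<in>UNIV. f (axis i 1) * (cos (pi * x $ i) * v x))"
    by (simp add: sum_distrib_right mult.assoc)
  then show ?case
    using linear(2) by (simp add: cos_orthogonal_sum cos_orthogonal_cmult cos_orthogonal_times_cos)
next
  case (const c)
  then show ?case by (rule cos_orthogonal_cmult)
next
  case (add f g)
  show ?case unfolding distrib_right by (intro cos_orthogonal_add add)
next
  case (mult f g)
  show ?case unfolding mult.assoc by (intro mult)
qed

text \<open>With \<open>p\<close> a polynomial approximation of \<open>v\<close> in the variables
  \<open>cos (pi * x $ i)\<close>, the integral of \<open>p * v\<close> vanishes, so the integral of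
  \<open>v^2\<close> equals that of \<open>(v - p) * v\<close> and is arbitrarily small.\<close>

lemma cos_orthogonal_zero:
  fixes v :: "real ^ 'd => real"
  assumes v: "cos_orthogonal v" and c: "continuous_on cube v" and x: "x \<in> cube"
  shows "v x = 0"
proof -
  obtain B where B: "\<And>x. x \<in> cube ==> \<bar>v x\<bar> <= B" using v by (auto simp: cos_orthogonal_def)
  have vm: "v \<in> borel_measurable borel" using v by (simp add: cos_orthogonal_def)
  have B0: "B >= 0" using B[OF x] by linarith
  define c' where "c' x = (\<chi> i. cos (pi * x $ i))" for x :: "real ^ 'd"
  \<comment> \<open>The inverse of the substitution, continuous on the cube of side from -1 to 1;
    the Weierstrass theorem is applied to \<open>v (a y)\<close>.\<close>
  define a where "a y = (\<chi> i. arccos (y $ i) / pi)" for y :: "real ^ 'd"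
  have ac: "a (c' x) = x" if "x \<in> cube" for x
    using that by (auto simp: a_def c'_def vec_eq_iff mem_box_cart arccos_cos)
  have a_cube: "a y \<in> cube" if "y \<in> cbox (- 1) 1" for y
    using that by (auto simp: a_def mem_box_cart arccos_lbound arccos_ubound)
  have a_cont: "continuous_on (cbox (- 1) 1) a"
    unfolding a_def by (intro continuous_intros) (auto simp: mem_box_cart)
  have va: "continuous_on (cbox (- 1) 1) (\<lambda>y. v (a y))"
    using a_cube by (intro continuous_on_compose2[OF c a_cont]) auto
  have sq: "cint (\<lambda>x. (v x)^2) <= e * B" if e: "e > 0" for e
  proof -
    obtain p where p: "real_polynomial_function p" "\<And>y. y \<in> cbox (- 1) 1 ==> \<bar>v (a y) - p y\<bar> < e"
      using Stone_Weierstrass_real_polynomial_function[OF compact_cbox va e] by blast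
    have pv: "cos_orthogonal (\<lambda>x. p (c' x) * v x)"
      using cos_orthogonal_times_polynomial[OF p(1) v] by (simp add: c'_def)
    have c0: "cos_basis 0 x = 1" for x :: "real ^ 'd" by (simp add: cos_basis_def)
    have 0: "cint (\<lambda>x. p (c' x) * v x) = 0"
      using pv c0 by (auto simp: cos_orthogonal_def dest!: spec[of _ 0])
    have ip: "integrable cube_measure (\<lambda>x. p (c' x) * v x)"
      using cos_orthogonal_integrable[OF pv, of 0] c0 by simp
    have iv: "integrable cube_measure (\<lambda>x. (v x)^2)"
      using vm B power_mono[OF B abs_ge_zero, of _ 2] by (intro integrable_bounded_cube[of _ "B^2"]) auto
    have "cint (\<lambda>x. (v x)^2) = cint (\<lambda>x. (v x)^2 - p (c' x) * v x)"
      using iv ip 0 by simp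
    also have "... <= cint (\<lambda>x :: real ^ 'd. e * B)"
    proof (rule integral_mono_AE)
      show "AE x in cube_measure. (v x)^2 - p (c' x) * v x <= e * B"
        using AE_cube_measure
      proof eventually_elim
        case (elim x)
        have "c' x \<in> cbox (- 1) 1" by (simp add: c'_def mem_box_cart)
        then have "\<bar>v x - p (c' x)\<bar> < e" using p(2)[of "c' x"] ac[OF elim] by simp
        then have "\<bar>v x - p (c' x)\<bar> * \<bar>v x\<bar> <= e * B"
          using B[OF elim] e by (intro mult_mono) auto
        then have "\<bar>(v x - p (c' x)) * v x\<bar> <= e * B" by (simp add: abs_mult)
        then show ?case by (simp add: power2_eq_square algebra_simps)
      qed
    qed (intro Bochner_Integration.integrable_diff iv ip, intro integrable_cube_continuous continuous_intros)
    also have "... = e * B"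
      using prob_space.prob_space[OF prob_space_cube_measure[where 'd = 'd]] by simp
    finally show ?thesis .
  qed
  have "cint (\<lambda>x. (v x)^2) <= 0"
  proof (rule field_le_epsilon)
    fix e :: real assume "e > 0"
    then have "e / (B + 1) > 0" using B0 by simp
    from sq[OF this] have "cint (\<lambda>x. (v x)^2) <= e / (B + 1) * B" .
    also have "... <= e" using B0 \<open>e > 0\<close> by (simp add: divide_simps)
    finally show "cint (\<lambda>x. (v x)^2) <= 0 + e" by simp
  qed
  moreover have "cint (\<lambda>x. (v x)^2) >= 0" by (rule Bochner_Integration.integral_nonneg) simp
  ultimately have z: "set_lebesgue_integral lborel cube (\<lambda>x. (v x)^2) = 0"
    using vm by (subst set_integral_cube) auto
  have si: "set_integrable lborel cube (\<lambda>x. (v x)^2)"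
    unfolding set_integrable_def
    by (rule borel_integrable_compact) (auto intro!: continuous_intros c)
  have "((\<lambda>x. (v x)^2) has_integral 0) cube"
    using set_borel_integral_eq_integral[OF si] z by (simp add: has_integral_iff)
  \<comment> \<open>Continuity on the closed cube turns a vanishing integral into a vanishing value
    at every point, boundary points included.\<close>
  then have "(v x)^2 = 0"
    by (rule has_integral_0_cbox_imp_0[rotated 2])
      (use x c in \<open>auto intro!: continuous_intros simp: box_ne_empty Basis_vec_def inner_axis\<close>)
  then show ?thesis by simp
qed

section \<open>Cosine series as superpositions of plane waves\<close>

lemma prod_cis: "(\<Prod>i\<in>A. cis (f i)) = cis (\<Sum>i\<in>A. f i)"
  by (induction A rule: infinite_finite_induct) (auto simp: cis_mult)

text \<open>Each factor \<open>2 * cos (\<theta> i)\<close> is the sum of two complex exponentials;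
  expanding the product gives one exponential for every choice of signs, recorded by the set
  \<open>X\<close> of plus signs.\<close>

lemma prod_cos:
  fixes \<theta> :: "'d::finite => real"
  shows "(\<Prod>i\<in>UNIV. cos (\<theta> i)) = (\<Sum>X\<in>UNIV. cos (\<Sum>i\<in>UNIV. if i \<in> X then \<theta> i else - \<theta> i)) / 2 ^ CARD('d)"
proof -
  have "complex_of_real (\<Prod>i\<in>(UNIV :: 'd set). 2 * cos (\<theta> i)) = (\<Prod>i\<in>(UNIV :: 'd set). cis (\<theta> i) + cis (- \<theta> i))"
    unfolding of_real_prod by (intro prod.cong refl) (simp add: complex_eq_iff)
  also have "... = (\<Sum>X\<in>Pow UNIV. (\<Prod>i\<in>X. cis (\<theta> i)) * (\<Prod>i\<in>UNIV - X. cis (- \<theta> i)))"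
    by (rule prod_add) simp
  also have "... = (\<Sum>X\<in>Pow UNIV. cis (\<Sum>i\<in>UNIV. if i \<in> X then \<theta> i else - \<theta> i))"
  proof (rule sum.cong[OF refl])
    fix X :: "'d set"
    have "(\<Sum>i\<in>UNIV. if i \<in> X then \<theta> i else - \<theta> i) = (\<Sum>i\<in>X. \<theta> i) + (\<Sum>i\<in>UNIV - X. - \<theta> i)"
      by (subst sum.If_cases) (auto simp: Compl_eq_Diff_UNIV)
    then show "(\<Prod>i\<in>X. cis (\<theta> i)) * (\<Prod>i\<in>UNIV - X. cis (- \<theta> i)) = cis (\<Sum>i\<in>UNIV. if i \<in> X then \<theta> i else - \<theta> i)"
      by (simp only: prod_cis cis_mult)
  qed
  finally have "Re (complex_of_real (\<Prod>i\<in>(UNIV :: 'd set). 2 * cos (\<theta> i))) =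
      Re (\<Sum>X\<in>Pow UNIV. cis (\<Sum>i\<in>UNIV. if i \<in> X then \<theta> i else - \<theta> i))" by simp
  then have "(\<Prod>i\<in>(UNIV :: 'd set). 2 * cos (\<theta> i)) = (\<Sum>X\<in>UNIV. cos (\<Sum>i\<in>UNIV. if i \<in> X then \<theta> i else - \<theta> i))"
    by (simp only: Re_complex_of_real Re_sum cis.sel Pow_UNIV)
  then show ?thesis
    by (simp add: prod.distrib eq_divide_eq mult.commute)
qed

text \<open>Waves are indexed by a multi-index and a sign pattern, and a coefficient of the cosine
  series is shared equally by all patterns.\<close>

definition barron_weight :: "(real ^ 'd => real) => (nat ^ 'd) \<times> 'd set => real" where
  "barron_weight u j = cos_coeff u (fst j) / 2 ^ CARD('d)"

definition barron_freq :: "(nat ^ 'd) \<times> 'd set => real ^ 'd" where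
  "barron_freq j = (\<chi> i. (if i \<in> snd j then pi else - pi) * real (fst j $ i))"

lemma cos_basis_waves:
  fixes x :: "real ^ 'd"
  shows "cos_coeff u k * cos_basis k x = (\<Sum>X\<in>UNIV. barron_weight u (k, X) * cos (barron_freq (k, X) \<bullet> x + 0))"
proof -
  have e: "(\<Sum>i\<in>UNIV. if i \<in> X then pi * real (k $ i) * x $ i else - (pi * real (k $ i) * x $ i)) = barron_freq (k, X) \<bullet> x" for X
    by (auto simp: barron_freq_def inner_vec_def intro!: sum.cong)
  have "cos_basis k x = (\<Sum>X\<in>UNIV. cos (barron_freq (k, X) \<bullet> x)) / 2 ^ CARD('d)"
    unfolding cos_basis_def prod_cos e ..
  then show ?thesis
    by (simp add: barron_weight_def sum_distrib_left sum_divide_distrib)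
qed

lemma barron_freq_l1:
  "(\<Sum>l\<in>UNIV. \<bar>barron_freq (k, X) $ l\<bar>) = pi * real (\<Sum>i\<in>UNIV. k $ i)"
proof -
  have "\<bar>barron_freq (k, X) $ l\<bar> = pi * real (k $ l)" for l
    by (auto simp: barron_freq_def abs_mult)
  then show ?thesis by (simp add: sum_distrib_left)
qed

text \<open>The frequencies of all sign patterns of one multi-index have the same 1-norm, so summing
  over the patterns restores the term of the Barron norm. The total mass of the waves is thus
  exactly the Barron norm, free of a dimensional factor.\<close>

lemma barron_weights_has_sum:
  fixes u :: "real ^ 'd => real"
  assumes u: "u \<in> barron_space s"
  shows "((\<lambda>j. \<bar>barron_weight u j\<bar> * (1 + (\<Sum>l\<in>UNIV. \<bar>barron_freq j $ l\<bar>) ^ s)) has_sum barron_norm s u) UNIV"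
proof -
  let ?f = "\<lambda>j. \<bar>barron_weight u j\<bar> * (1 + (\<Sum>l\<in>UNIV. \<bar>barron_freq j $ l\<bar>) ^ s)"
  have bs: "(barron_term s u has_sum barron_norm s u) UNIV"
    using u unfolding barron_norm_def barron_space_def by (simp add: has_sum_infsum)
  have inner: "((\<lambda>X. ?f (k, X)) has_sum barron_term s u k) UNIV" for k
  proof -
    have "(\<Sum>X\<in>UNIV. ?f (k, X)) = (\<Sum>X\<in>(UNIV :: 'd set set). barron_term s u k / 2 ^ CARD('d))"
      by (intro sum.cong refl) (simp add: barron_freq_l1 barron_weight_def barron_term_def abs_divide power_mult_distrib)
    also have "... = barron_term s u k"
      by (simp add: card_Pow[of "UNIV :: 'd set", simplified])
    finally show ?thesis using has_sum_finite[of UNIV "\<lambda>X. ?f (k, X)"] by simp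
  qed
  have sm: "?f summable_on (UNIV \<times> UNIV)"
    by (rule summable_on_SigmaI[where f = ?f and g = "barron_term s u", OF inner])
      (use bs in \<open>auto simp: has_sum_imp_summable intro!: mult_nonneg_nonneg add_nonneg_nonneg zero_le_power sum_nonneg\<close>)
  have "(?f has_sum barron_norm s u) (UNIV \<times> UNIV)"
    by (rule has_sum_SigmaI[OF inner bs sm])
  then show ?thesis by simp
qed

lemma moments_barron:
  fixes \<kappa> :: "'j => real ^ 'd"
  assumes "(\<lambda>j. \<bar>w j\<bar> * (1 + (\<Sum>l\<in>UNIV. \<bar>\<kappa> j $ l\<bar>) ^ s)) summable_on UNIV"
  shows "moments s w \<kappa>"
  unfolding moments_def
proof (intro allI impI summable_on_comparison_test[OF assms] mult_left_mono)
  fix q j assume q: "q <= s"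
  let ?r = "\<Sum>l\<in>UNIV. \<bar>\<kappa> j $ l\<bar>"
  have r0: "?r >= 0" by (intro sum_nonneg) auto
  have "norm (\<kappa> j) ^ q <= ?r ^ q"
    by (intro power_mono norm_le_l1_cart) auto
  also have "... <= 1 + ?r ^ s"
  proof (cases "?r <= 1")
    case True
    then have "?r ^ q <= 1" using r0 by (intro power_le_one)
    then show ?thesis using zero_le_power[OF r0, of s] by linarith
  next
    case False
    then have "?r ^ q <= ?r ^ s" using q by (intro power_increasing) auto
    then show ?thesis by linarith
  qed
  finally show "norm (\<kappa> j) ^ q <= 1 + ?r ^ s" .
qed auto

text \<open>The series and \<open>u\<close> have the same cosine coefficients, and their difference
  is continuous on the cube, so it vanishes by \<open>cos_orthogonal_zero\<close>. From here on
  \<open>u\<close> is accessible as a wave, with all its derivatives.\<close>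

lemma barron_representation:
  fixes u :: "real ^ 'd => real"
  assumes u: "u \<in> barron_space s" and s: "s >= 2" and c: "continuous_on cube u" and x: "x \<in> cube"
  shows "u x = wave (barron_weight u) barron_freq 0 x"
proof -
  let ?F = "wave (barron_weight u) barron_freq 0"
  have m: "moments s (barron_weight u) barron_freq"
    by (rule moments_barron) (rule has_sum_imp_summable[OF barron_weights_has_sum[OF u]])
  have m2: "moments 2 (barron_weight u) barron_freq" using m s by (rule moments_mono)
  have Fc: "continuous_on UNIV ?F" by (rule continuous_wave[OF m2])
  have abs_sum: "(\<lambda>k. \<bar>cos_coeff u k\<bar>) summable_on UNIV"
  proof (rule summable_on_comparison_test)
    show "barron_term s u summable_on UNIV" using u by (simp add: barron_space_def)
    have "1 * \<bar>cos_coeff u k\<bar> <= (1 + pi ^ s * real (\<Sum>i\<in>UNIV. k $ i) ^ s) * \<bar>cos_coeff u k\<bar>" for k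
      by (intro mult_right_mono) (auto intro!: mult_nonneg_nonneg zero_le_power sum_nonneg)
    then show "\<bar>cos_coeff u k\<bar> <= barron_term s u k" for k by (simp add: barron_term_def)
  qed auto
  have F: "((\<lambda>k. cos_coeff u k * cos_basis k y) has_sum ?F y) UNIV" for y
  proof (rule has_sum_SigmaD)
    show "((\<lambda>j. barron_weight u j * cos (barron_freq j \<bullet> y + 0)) has_sum ?F y) (UNIV \<times> UNIV)"
      using wave_has_sum[OF m, of y 0] by simp
    show "((\<lambda>X. barron_weight u (k, X) * cos (barron_freq (k, X) \<bullet> y + 0)) has_sum cos_coeff u k * cos_basis k y) UNIV" for k
      unfolding cos_basis_waves by (rule has_sum_finite) simp
  qed
  define S where "S = (\<Sum>\<^sub>\<infinity>k. \<bar>cos_coeff u k\<bar>)"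
  have tail: "\<bar>?F y - (\<Sum>k\<in>A. cos_coeff u k * cos_basis k y)\<bar> <= S - (\<Sum>k\<in>A. \<bar>cos_coeff u k\<bar>)" if A: "finite A" for A y
  proof -
    have s1: "((\<lambda>k. cos_coeff u k * cos_basis k y) has_sum (?F y - (\<Sum>k\<in>A. cos_coeff u k * cos_basis k y))) (UNIV - A)"
      by (rule has_sum_Diff[OF F has_sum_finite[OF A]]) simp
    have s2: "((\<lambda>k. \<bar>cos_coeff u k\<bar>) has_sum (S - (\<Sum>k\<in>A. \<bar>cos_coeff u k\<bar>))) (UNIV - A)"
      unfolding S_def by (rule has_sum_Diff[OF has_sum_infsum[OF abs_sum] has_sum_finite[OF A]]) simp
    have "norm (?F y - (\<Sum>k\<in>A. cos_coeff u k * cos_basis k y)) <= S - (\<Sum>k\<in>A. \<bar>cos_coeff u k\<bar>)"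
    proof (rule norm_infsum_le[OF s1 s2])
      show "norm (cos_coeff u k * cos_basis k y) <= \<bar>cos_coeff u k\<bar>" for k
        using mult_left_mono[OF abs_cos_basis_le[of k y], of "\<bar>cos_coeff u k\<bar>"] by (simp add: abs_mult)
    qed
    then show ?thesis by simp
  qed
  define D where "D l = cint (\<lambda>x. cos_basis l x * cos_basis l x)" for l :: "nat ^ 'd"
  \<comment> \<open>Integration and summation are exchanged through partial sums: one that contains
    \<open>l\<close> has the coefficient exactly, and its distance to the series is at most a tail
    of the absolute sum.\<close>
  have Fcoeff: "cint (\<lambda>x. ?F x * cos_basis l x) = cos_coeff u l * D l" for l
  proof -
    have "\<bar>cint (\<lambda>x. ?F x * cos_basis l x) - cos_coeff u l * D l\<bar> <= 0 + e" if e: "e > 0" for e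
    proof -
      obtain A0 where A0: "finite A0" "dist (\<Sum>k\<in>A0. \<bar>cos_coeff u k\<bar>) S <= e"
        using infsum_finite_approximation[OF abs_sum e] unfolding S_def by blast
      define A where "A = insert l A0"
      have A: "finite A" "l \<in> A" using A0 by (auto simp: A_def)
      have "(\<Sum>k\<in>A0. \<bar>cos_coeff u k\<bar>) <= (\<Sum>k\<in>A. \<bar>cos_coeff u k\<bar>)"
        using A by (intro sum_mono2) (auto simp: A_def)
      then have Se: "S - (\<Sum>k\<in>A. \<bar>cos_coeff u k\<bar>) <= e" using A0(2) by (simp add: dist_real_def)
      define FA where "FA y = (\<Sum>k\<in>A. cos_coeff u k * cos_basis k y)" for y
      have FAc: "continuous_on UNIV FA" unfolding FA_def by (intro continuous_intros)
      have "cint (\<lambda>x. FA x * cos_basis l x) = (\<Sum>k\<in>A. cos_coeff u k * cint (\<lambda>x. cos_basis k x * cos_basis l x))"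
        unfolding FA_def sum_distrib_right mult.assoc
        by (subst Bochner_Integration.integral_sum) (auto intro!: integrable_cube_continuous continuous_intros)
      also have "... = (\<Sum>k\<in>A. if k = l then cos_coeff u k * D l else 0)"
        by (intro sum.cong refl) (auto simp: D_def cos_basis_orthogonal)
      also have "... = cos_coeff u l * D l" using A by simp
      finally have 1: "cint (\<lambda>x. FA x * cos_basis l x) = cos_coeff u l * D l" .
      have "cint (\<lambda>x. ?F x * cos_basis l x) - cint (\<lambda>x. FA x * cos_basis l x) =
          cint (\<lambda>x. (?F x - FA x) * cos_basis l x)"
        unfolding left_diff_distrib
        by (subst Bochner_Integration.integral_diff) (auto intro!: integrable_cube_continuous continuous_intros Fc FAc)
      also have "\<bar>...\<bar> <= cint (\<lambda>x. \<bar>(?F x - FA x) * cos_basis l x\<bar>)"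
        by (rule integral_abs_bound)
      also have "... <= cint (\<lambda>x :: real ^ 'd. e)"
      proof (rule integral_mono)
        show "\<bar>(?F y - FA y) * cos_basis l y\<bar> <= e" for y
        proof -
          have "\<bar>?F y - FA y\<bar> * \<bar>cos_basis l y\<bar> <= e * 1"
            using tail[OF A(1), of y] Se abs_cos_basis_le[of l y] e unfolding FA_def by (intro mult_mono) auto
          then show ?thesis by (simp add: abs_mult)
        qed
      qed (auto intro!: integrable_cube_continuous continuous_intros Fc FAc)
      also have "... = e" using prob_space.prob_space[OF prob_space_cube_measure[where 'd = 'd]] by simp
      finally show ?thesis using 1 by simp
    qed
    then have "\<bar>cint (\<lambda>x. ?F x * cos_basis l x) - cos_coeff u l * D l\<bar> <= 0"
      by (rule field_le_epsilon)
    then show ?thesis by simp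
  qed
  \<comment> \<open>The values of \<open>u\<close> outside the cube are arbitrary; cutting off there
    makes the difference Borel measurable on the whole space.\<close>
  define v where "v x = indicator cube x * (u x - ?F x)" for x
  define u' where "u' x = indicator cube x *\<^sub>R u x" for x
  have u'm: "u' \<in> borel_measurable borel"
    unfolding u'_def by (rule borel_measurable_continuous_on_indicator[OF _ c]) simp
  have v_eq: "v x = u' x - indicator cube x * ?F x" for x
    by (simp add: v_def u'_def algebra_simps)
  have vm: "v \<in> borel_measurable borel"
    unfolding v_eq[abs_def] using u'm continuous_measurable[OF Fc] by (intro borel_measurable_diff borel_measurable_times borel_measurable_indicator) auto
  have ucF: "continuous_on cube (\<lambda>x. u x - ?F x)"
    by (intro continuous_intros c continuous_on_subset[OF Fc]) simp
  have vc: "continuous_on cube v"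
    using ucF by (rule continuous_on_eq) (simp add: v_def)
  have "compact (v ` cube)" by (rule compact_continuous_image[OF vc compact_cbox])
  then obtain B where B: "\<And>x. x \<in> cube ==> \<bar>v x\<bar> <= B"
    by (metis bounded_iff compact_imp_bounded image_eqI real_norm_def)
  have "compact (u ` cube)" by (rule compact_continuous_image[OF c compact_cbox])
  then obtain B' where B': "\<And>x. x \<in> cube ==> \<bar>u x\<bar> <= B'"
    by (metis bounded_iff compact_imp_bounded image_eqI real_norm_def)
  have bm: "cos_basis k \<in> borel_measurable borel" for k :: "nat ^ 'd"
    by (intro borel_measurable_continuous_onI continuous_intros)
  have "cos_orthogonal v"
    unfolding cos_orthogonal_def
  proof (intro conjI allI vm)
    show "\<exists>B. \<forall>x\<in>cube. \<bar>v x\<bar> <= B" using B by blast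
    fix k :: "nat ^ 'd"
    have iu: "integrable cube_measure (\<lambda>x. u' x * cos_basis k x)"
    proof (rule integrable_bounded_cube)
      show "(\<lambda>x. u' x * cos_basis k x) \<in> borel_measurable borel" using u'm bm by simp
      show "\<bar>u' x * cos_basis k x\<bar> <= B' * 1" if "x \<in> cube" for x
        unfolding abs_mult using B'[OF that] that abs_cos_basis_le[of k x] order_trans[OF abs_ge_zero B'[OF that]]
        by (intro mult_mono) (auto simp: u'_def)
    qed
    have "cint (\<lambda>x. v x * cos_basis k x) = cint (\<lambda>x. u' x * cos_basis k x - ?F x * cos_basis k x)"
    proof (rule integral_cong_AE)
      show "AE x in cube_measure. v x * cos_basis k x = u' x * cos_basis k x - ?F x * cos_basis k x"
        using AE_cube_measure by eventually_elim (simp add: v_eq algebra_simps)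
    qed (use vm bm u'm continuous_measurable[OF Fc] in simp_all)
    also have "... = cint (\<lambda>x. u' x * cos_basis k x) - cint (\<lambda>x. ?F x * cos_basis k x)"
      by (intro Bochner_Integration.integral_diff iu integrable_cube_continuous continuous_intros Fc)
    also have "cint (\<lambda>x. u' x * cos_basis k x) = cos_coeff u k * D k"
      unfolding D_def by (rule cos_coeff_eq[symmetric, OF _ u'm]) (simp add: u'_def)
    finally show "cint (\<lambda>x. v x * cos_basis k x) = 0" by (simp add: Fcoeff)
  qed
  from cos_orthogonal_zero[OF this vc x] show ?thesis using x by (simp add: v_def)
qed

text \<open>Every nonzero frequency has a component of modulus at least \<open>pi\<close>. This gap
  lets the highest power of a frequency dominate the lower ones in \<open>power_budget\<close>,
  which is what makes the explicit constants of the network class sufficient.\<close>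

lemma barron_freq_norm:
  fixes j :: "(nat ^ 'd) \<times> 'd set"
  shows "barron_freq j = 0 \<or> norm (barron_freq j) >= 3"
proof (cases "fst j = 0")
  case True
  then show ?thesis by (simp add: barron_freq_def vec_eq_iff)
next
  case False
  then obtain i where "fst j $ i ~= 0" by (auto simp: vec_eq_iff)
  then have "real (fst j $ i) >= 1" by simp
  then have "pi * 1 <= pi * real (fst j $ i)" by (intro mult_left_mono) auto
  also have "... = \<bar>barron_freq j $ i\<bar>" by (auto simp: barron_freq_def abs_mult)
  also have "... <= norm (barron_freq j)" by (rule component_le_norm_cart)
  finally show ?thesis using pi_gt3 by simp
qed

section \<open>Approximation by networks\<close>

definition relu :: "real => real" where "relu t = max 0 t"

lemma ReQU_eq: "ReQU t = (relu t)^2"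
  by (auto simp: ReQU_def relu_def max_def)

lemma ReQU_has_real_derivative: "(ReQU has_real_derivative 2 * relu t) (at t)"
proof -
  consider "t > 0" | "t < 0" | "t = 0" by linarith
  then show ?thesis
  proof cases
    case 1
    have "((\<lambda>t. t^2) has_real_derivative 2 * relu t) (at t)"
      using 1 by (auto intro!: derivative_eq_intros simp: relu_def)
    then show ?thesis
      by (rule has_field_derivative_transform_within_open[where S = "{0<..}"]) (use 1 in \<open>auto simp: ReQU_def\<close>)
  next
    case 2
    have "((\<lambda>t. 0) has_real_derivative 2 * relu t) (at t)"
      using 2 by (auto simp: relu_def)
    then show ?thesis
      by (rule has_field_derivative_transform_within_open[where S = "{..<0}"]) (use 2 in \<open>auto simp: ReQU_def\<close>)
  next
    case 3
    have "((\<lambda>h. ReQU h / h) \<longlongrightarrow> 0) (at 0)"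
    proof (rule Lim_null_comparison)
      show "\<forall>\<^sub>F h in at 0. norm (ReQU h / h) <= \<bar>h\<bar>"
        by (auto simp: ReQU_def power2_eq_square eventually_at_filter)
      show "((\<lambda>h. \<bar>h\<bar>) \<longlongrightarrow> 0) (at (0::real))"
        by (auto intro!: tendsto_eq_intros)
    qed
    then show ?thesis
      using 3 by (simp add: DERIV_def relu_def ReQU_def)
  qed
qed

lemma relu_has_real_derivative:
  "t ~= 0 ==> (relu has_real_derivative (if t > 0 then 1 else 0)) (at t)"
proof (cases "t > 0")
  case True
  have "((\<lambda>t. t) has_real_derivative (if t > 0 then 1 else 0)) (at t)" using True by simp
  then show ?thesis
    by (rule has_field_derivative_transform_within_open[where S = "{0<..}"]) (use True in \<open>auto simp: relu_def\<close>)
next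
  case False
  assume "t ~= 0"
  have "((\<lambda>t. 0) has_real_derivative (if t > 0 then 1 else 0)) (at t)" using False by simp
  then show ?thesis
    by (rule has_field_derivative_transform_within_open[where S = "{..<0}"])
      (use False \<open>t ~= 0\<close> in \<open>auto simp: relu_def\<close>)
qed

lemma continuous_on_relu [continuous_intros]:
  "continuous_on S f ==> continuous_on S (\<lambda>x. relu (f x))"
  unfolding relu_def by (intro continuous_intros)

lemma continuous_on_ReQU [continuous_intros]:
  "continuous_on S f ==> continuous_on S (\<lambda>x. ReQU (f x))"
  unfolding ReQU_eq by (intro continuous_intros)

text \<open>Replacing \<open>g2\<close> by a step function with nodes \<open>i / M\<close> and integrating twice gives a
  quadratic spline whose jumps in the second derivative cost at most the variation of \<open>g2\<close>.\<close>

lemma spline_one_sided: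
  fixes g g1 g2 :: "real => real"
  assumes d0: "\<And>z. (g has_real_derivative g1 z) (at z)"
    and d1: "\<And>z. (g1 has_real_derivative g2 z) (at z)"
    and lip: "\<And>y z. \<bar>g2 y - g2 z\<bar> <= D * \<bar>y - z\<bar>"
    and M: "M > 0"
  obtains \<beta> :: "nat => real" where "(\<Sum>i<M. \<bar>\<beta> i\<bar>) <= D / 2"
    "\<And>z. z \<in> {0..1} ==>
      \<bar>g z - g 0 - g1 0 * z - g2 0 * z^2 / 2 - (\<Sum>i<M. \<beta> i * ReQU (z - real i / real M))\<bar> <= D / real M"
    "\<And>z. z \<in> {0..1} ==>
      \<bar>g1 z - g1 0 - g2 0 * z - (\<Sum>i<M. \<beta> i * (2 * relu (z - real i / real M)))\<bar> <= D / real M"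
proof
  define \<Delta> where "\<Delta> i = g2 (real (Suc i) / real M) - g2 (real i / real M)" for i
  \<comment> \<open>The second derivative of \<open>ReQU\<close> jumps by 2 at its knot, so half the
    increment of \<open>g2\<close> is the right weight.\<close>
  define \<beta> where "\<beta> i = \<Delta> i / 2" for i
  have D: "D >= 0" using lip[of 1 0] by simp
  have "\<bar>\<Delta> i\<bar> <= D / real M" for i
  proof -
    have "real (Suc i) / real M - real i / real M = 1 / real M"
      by (simp add: add_divide_distrib)
    then show ?thesis
      using lip[of "real (Suc i) / real M" "real i / real M"] M by (simp add: \<Delta>_def)
  qed
  then have "(\<Sum>i<M. \<bar>\<beta> i\<bar>) <= (\<Sum>i<M. D / real M / 2)"
    by (intro sum_mono) (auto simp: \<beta>_def)
  also have "... = D / 2" using M by simp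
  finally show "(\<Sum>i<M. \<bar>\<beta> i\<bar>) <= D / 2" .
  define e1 where "e1 z = g1 z - g1 0 - g2 0 * z - (\<Sum>i<M. \<beta> i * (2 * relu (z - real i / real M)))" for z
  define e0 where "e0 z = g z - g 0 - g1 0 * z - g2 0 * z^2 / 2 - (\<Sum>i<M. \<beta> i * ReQU (z - real i / real M))" for z
  define e2 where "e2 z = g2 z - g2 0 - (\<Sum>i<M. \<Delta> i * (if z - real i / real M > 0 then 1 else 0))" for z
  \<comment> \<open>Outside the knots and the right end point the spline is twice differentiable and
    the index \<open>k\<close> below stays under \<open>M\<close>.\<close>
  let ?S = "insert 1 ((\<lambda>i. real i / real M) ` {..<M})"
  have e2b: "\<bar>e2 z\<bar> <= D / real M" if z: "z \<in> {0..1} - ?S" for z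
  proof -
    define k where "k = nat \<lfloor>z * real M\<rfloor>"
    have z01: "0 <= z" "z < 1" using z by auto
    have k1: "real k <= z * real M" and k2: "z * real M < real k + 1"
      using z01 M by (auto simp: k_def)
    have "z * real M < real M" using z01 M by simp
    then have kM: "k < M" using k1 by linarith
    have "z ~= real k / real M" using z kM by auto
    then have k3: "real k < z * real M" using k1 M by (auto simp: field_simps)
    have iff: "z - real i / real M > 0 \<longleftrightarrow> i < Suc k" for i
    proof -
      have "z - real i / real M > 0 \<longleftrightarrow> real i < z * real M"
        using M by (simp add: field_simps)
      also have "... \<longleftrightarrow> i < Suc k"
      proof
        assume "real i < z * real M"
        then have "real i < real k + 1" using k2 by linarith
        then show "i < Suc k" by linarith
      next
        assume "i < Suc k"
        then have "real i <= real k" by simp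
        then show "real i < z * real M" using k3 by linarith
      qed
      finally show ?thesis .
    qed
    have "(\<Sum>i<M. \<Delta> i * (if z - real i / real M > 0 then 1 else 0)) = (\<Sum>i<M. if i < Suc k then \<Delta> i else 0)"
      by (intro sum.cong refl) (subst iff, simp)
    also have "... = (\<Sum>i<Suc k. \<Delta> i)"
    proof -
      have "{i \<in> {..<M}. i < Suc k} = {..<Suc k}" using kM by auto
      then show ?thesis by (simp only: sum.inter_filter[symmetric] finite_lessThan)
    qed
    \<comment> \<open>Each increment is placed at the left end of its cell, so the telescoped sum is
      the value of \<open>g2\<close> at the node to the right of \<open>z\<close>, at distance at
      most \<open>1 / real M\<close>.\<close>
    also have "... = g2 (real (Suc k) / real M) - g2 0"
      unfolding \<Delta>_def by (subst sum_lessThan_telescope) simp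
    finally have "e2 z = g2 z - g2 (real (Suc k) / real M)"
      by (simp add: e2_def)
    also have "\<bar>...\<bar> <= D * \<bar>z - real (Suc k) / real M\<bar>" by (rule lip)
    also have "... <= D * (1 / real M)"
    proof (rule mult_left_mono[OF _ D])
      have "z <= real (Suc k) / real M" "real (Suc k) / real M - 1 / real M <= z"
        using k1 k2 M by (simp_all add: field_simps)
      then show "\<bar>z - real (Suc k) / real M\<bar> <= 1 / real M" by linarith
    qed
    finally show ?thesis by simp
  qed
  have cg1: "continuous_on A g1" for A
    using d1 by (intro continuous_at_imp_continuous_on ballI DERIV_isCont) auto
  have e1c: "continuous_on A e1" for A
    unfolding e1_def by (intro continuous_intros cg1)
  have e1d: "(e1 has_real_derivative e2 z) (at z)" if z: "z \<notin> ?S" for z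
  proof -
    have "((\<lambda>z. relu (z - real i / real M)) has_real_derivative (if z - real i / real M > 0 then 1 else 0)) (at z)"
      if "i < M" for i
    proof -
      have "z - real i / real M ~= 0" using z that by auto
      have "((\<lambda>z. relu (z - real i / real M)) has_real_derivative (if z - real i / real M > 0 then 1 else 0) * 1) (at z)"
        by (rule DERIV_chain2[where f = relu and g = "\<lambda>z. z - real i / real M"])
          (rule relu_has_real_derivative[OF \<open>z - real i / real M ~= 0\<close>], auto intro!: derivative_eq_intros)
      then show ?thesis by simp
    qed
    then show ?thesis
      unfolding e1_def e2_def \<beta>_def
      by (auto intro!: derivative_eq_intros d1 simp del: of_nat_Suc) (auto intro!: sum.cong)
  qed
  have e1b: "\<bar>e1 z\<bar> <= D / real M * z" if z: "z \<in> {0..1}" for z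
  proof -
    let ?f = "\<lambda>t. if t \<in> ?S then 0 else e2 t"
    have "(?f has_integral (e1 z - e1 0)) {0..z}"
    \<comment> \<open>This version of the fundamental theorem tolerates the finitely many knots,
      where \<open>relu\<close> has no derivative.\<close>
    proof (rule fundamental_theorem_of_calculus_strong[of ?S])
      show "(e1 has_vector_derivative ?f x) (at x)" if "x \<in> {0..z} - ?S" for x
        using e1d[of x] that by (auto simp: has_real_derivative_iff_has_vector_derivative)
    qed (use z e1c in auto)
    moreover have "e1 0 = 0"
      by (auto simp: e1_def relu_def intro!: sum.neutral)
    ultimately have I: "(?f has_integral e1 z) (cbox 0 z)" by simp
    have "norm (e1 z) <= D / real M * measure lborel (cbox 0 z)"
    proof (rule has_integral_bound[OF _ I])
      show "norm (?f x) <= D / real M" if "x \<in> cbox 0 z" for x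
        using e2b[of x] that z D M by auto
    qed (use D M in auto)
    then show ?thesis using z by simp
  qed
  show "\<bar>g1 z - g1 0 - g2 0 * z - (\<Sum>i<M. \<beta> i * (2 * relu (z - real i / real M)))\<bar> <= D / real M"
    if "z \<in> {0..1}" for z
  proof -
    have "D / real M * z <= D / real M * 1" using that D M by (intro mult_left_mono) auto
    then show ?thesis using e1b[OF that] by (simp add: e1_def)
  qed
  have e0d: "(e0 has_real_derivative e1 z) (at z)" for z
    unfolding e0_def e1_def
    by (auto intro!: derivative_eq_intros d0 DERIV_chain2[OF ReQU_has_real_derivative] sum.cong)
  show "\<bar>g z - g 0 - g1 0 * z - g2 0 * z^2 / 2 - (\<Sum>i<M. \<beta> i * ReQU (z - real i / real M))\<bar> <= D / real M"
    if z: "z \<in> {0..1}" for z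
  proof -
    have "(e1 has_integral (e0 z - e0 0)) {0..z}"
      using z e0d by (intro fundamental_theorem_of_calculus)
        (auto simp: has_real_derivative_iff_has_vector_derivative[symmetric] intro: has_field_derivative_at_within)
    moreover have "e0 0 = 0"
      by (auto simp: e0_def ReQU_eq relu_def intro!: sum.neutral)
    ultimately have I: "(e1 has_integral e0 z) (cbox 0 z)" by simp
    have "norm (e0 z) <= D / real M * measure lborel (cbox 0 z)"
    proof (rule has_integral_bound[OF _ I])
      show "norm (e1 x) <= D / real M" if "x \<in> cbox 0 z" for x
      proof -
        have "D / real M * x <= D / real M * 1"
          using that z D M by (intro mult_left_mono) auto
        then show ?thesis using e1b[of x] that z by auto
      qed
    qed (use D M in auto)
    moreover have "D / real M * z <= D / real M * 1" using z D M by (intro mult_left_mono) auto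
    ultimately show ?thesis using z by (simp add: e0_def)
  qed
qed

text \<open>\<open>G\<close> plays the role of the Gram matrix of centred vectors. The cross terms
  between the chosen indices and a new one have weighted mean zero, so some new index makes them
  nonpositive and the double sum grows by at most \<open>R\<close>. This greedy argument
  derandomises Maurey's sampling.\<close>

lemma maurey:
  fixes p :: "'j => real" and G :: "'j => 'j => real"
  assumes J: "finite J" "\<And>j. j \<in> J ==> p j >= 0" "(\<Sum>j\<in>J. p j) = 1"
    and sym: "\<And>a b. G a b = G b a"
    and mean: "\<And>a. a \<in> J ==> (\<Sum>b\<in>J. p b * G a b) = 0"
    and diag: "\<And>a. a \<in> J ==> G a a <= R"
  shows "\<exists>idx. (\<forall>k<m. idx k \<in> J) \<and> (\<Sum>k<m. \<Sum>l<m. G (idx k) (idx l)) <= real m * R"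
proof (induction m)
  case (Suc m)
  then obtain idx where idx: "\<And>k. k < m ==> idx k \<in> J"
    "(\<Sum>k<m. \<Sum>l<m. G (idx k) (idx l)) <= real m * R" by blast
  have "\<exists>b\<in>J. (\<Sum>k<m. G (idx k) b) <= 0"
  proof (rule ccontr)
    assume "\<not> ?thesis"
    then have pos: "\<And>b. b \<in> J ==> (\<Sum>k<m. G (idx k) b) > 0" by force
    have "(\<Sum>b\<in>J. p b * (\<Sum>k<m. G (idx k) b)) = (\<Sum>k<m. \<Sum>b\<in>J. p b * G (idx k) b)"
      by (simp add: sum_distrib_left) (rule sum.swap)
    also have "... = 0" using mean idx by simp
    finally have "(\<Sum>b\<in>J. p b * (\<Sum>k<m. G (idx k) b)) = 0" .
    then have "\<forall>b\<in>J. p b * (\<Sum>k<m. G (idx k) b) = 0"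
      using J pos by (subst (asm) sum_nonneg_eq_0_iff) (auto intro!: mult_nonneg_nonneg intro: less_imp_le)
    then have "\<forall>b\<in>J. p b = 0" using pos by force
    then show False using J by simp
  qed
  then obtain b where b: "b \<in> J" "(\<Sum>k<m. G (idx k) b) <= 0" by blast
  define idx' where "idx' = idx(m := b)"
  have eq: "(\<Sum>k<Suc m. h (idx' k)) = (\<Sum>k<m. h (idx k)) + h b" for h :: "'j => real"
  proof -
    have "(\<Sum>k<m. h (idx' k)) = (\<Sum>k<m. h (idx k))"
      by (intro sum.cong) (auto simp: idx'_def)
    then show ?thesis by (simp add: idx'_def)
  qed
  have "(\<Sum>k<Suc m. \<Sum>l<Suc m. G (idx' k) (idx' l)) =
      (\<Sum>k<m. \<Sum>l<m. G (idx k) (idx l)) + 2 * (\<Sum>k<m. G (idx k) b) + G b b"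
  proof -
    have inner: "(\<Sum>l<Suc m. G a (idx' l)) = (\<Sum>l<m. G a (idx l)) + G a b" for a
      by (rule eq[of "G a"])
    have "(\<Sum>k<Suc m. \<Sum>l<Suc m. G (idx' k) (idx' l)) =
        (\<Sum>k<m. (\<Sum>l<m. G (idx k) (idx l)) + G (idx k) b) + ((\<Sum>l<m. G b (idx l)) + G b b)"
      unfolding inner by (rule eq[of "\<lambda>a. (\<Sum>l<m. G a (idx l)) + G a b"])
    moreover have "(\<Sum>l<m. G b (idx l)) = (\<Sum>l<m. G (idx l) b)"
      by (rule sum.cong) (simp_all add: sym[of b])
    ultimately show ?thesis by (simp add: sum.distrib)
  qed
  also have "... <= real m * R + 2 * 0 + R"
    using idx b diag by (intro add_mono) auto
  finally have "(\<Sum>k<Suc m. \<Sum>l<Suc m. G (idx' k) (idx' l)) <= real (Suc m) * R"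
    by (simp add: algebra_simps)
  moreover have "\<forall>k<Suc m. idx' k \<in> J"
    using idx b by (auto simp: idx'_def less_Suc_eq)
  ultimately show ?case by blast
qed simp

section \<open>Functions approximable by finite sums of neurons\<close>

definition net_sum :: "nat => (nat => 'd::finite state) => (nat => real ^ 'd) => (nat => real) => real ^ 'd => 'd state" where
  "net_sum m a W b x = (\<lambda>i. \<Sum>j<m. ReQU (W j \<bullet> x + b j) *\<^sub>R a j i)"

definition net_deriv :: "nat => (nat => 'd::finite state) => (nat => real ^ 'd) => (nat => real) => 'd => real ^ 'd => 'd state" where
  "net_deriv m a W b l x = (\<lambda>i. \<Sum>j<m. (2 * relu (W j \<bullet> x + b j) * W j $ l) *\<^sub>R a j i)"

text \<open>The width is left open and only the sum \<open>T\<close> of the norms of the outer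
  weights is recorded, as \<open>network_reduce\<close> will restore the width. Derivatives are
  approximated along with values because the loss contains them.\<close>

definition net_within :: "nat => real => (real ^ 'd => 'd::finite state) => ('d => real ^ 'd => 'd state) => real => bool" where
  "net_within n \<epsilon> V D T \<longleftrightarrow> (\<exists>m a W b. (\<forall>j<m. a j \<in> states n \<and> norm (W j) <= 1 \<and> \<bar>b j\<bar> <= 1) \<and>
     (\<Sum>j<m. vec_norm n (a j)) <= T \<and>
     (\<forall>x\<in>cube. \<forall>i<n. norm (V x i - net_sum m a W b x i) <= \<epsilon> \<and>
        (\<forall>l. norm (D l x i - net_deriv m a W b l x i) <= \<epsilon>)))"

lemma sum_concat:
  fixes f g :: "nat => 'a::comm_monoid_add"
  shows "(\<Sum>j<m + k. if j < m then f j else g (j - m)) = (\<Sum>j<m. f j) + (\<Sum>j<k. g j)"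
  by (induction k) (simp_all add: add.assoc)

lemma net_within_add:
  assumes "net_within n \<epsilon>1 V1 D1 T1" "net_within n \<epsilon>2 V2 D2 T2"
  shows "net_within n (\<epsilon>1 + \<epsilon>2) (\<lambda>x i. V1 x i + V2 x i) (\<lambda>l x i. D1 l x i + D2 l x i) (T1 + T2)"
proof -
  obtain m a W b where 1: "\<And>j. j < m ==> a j \<in> states n \<and> norm (W j) <= 1 \<and> \<bar>b j\<bar> <= 1"
    "(\<Sum>j<m. vec_norm n (a j)) <= T1"
    "\<And>x i. x \<in> cube ==> i < n ==> norm (V1 x i - net_sum m a W b x i) <= \<epsilon>1"
    "\<And>x i l. x \<in> cube ==> i < n ==> norm (D1 l x i - net_deriv m a W b l x i) <= \<epsilon>1"
    using assms(1) unfolding net_within_def by blast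
  obtain m' a' W' b' where 2: "\<And>j. j < m' ==> a' j \<in> states n \<and> norm (W' j) <= 1 \<and> \<bar>b' j\<bar> <= 1"
    "(\<Sum>j<m'. vec_norm n (a' j)) <= T2"
    "\<And>x i. x \<in> cube ==> i < n ==> norm (V2 x i - net_sum m' a' W' b' x i) <= \<epsilon>2"
    "\<And>x i l. x \<in> cube ==> i < n ==> norm (D2 l x i - net_deriv m' a' W' b' l x i) <= \<epsilon>2"
    using assms(2) unfolding net_within_def by blast
  define A where "A j = (if j < m then a j else a' (j - m))" for j
  define W2 where "W2 j = (if j < m then W j else W' (j - m))" for j
  define b2 where "b2 j = (if j < m then b j else b' (j - m))" for j
  have cc: "(\<Sum>j<m + m'. h (A j) (W2 j) (b2 j)) = (\<Sum>j<m. h (a j) (W j) (b j)) + (\<Sum>j<m'. h (a' j) (W' j) (b' j))"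
    for h :: "'a state => real ^ 'a => real => 'z::comm_monoid_add"
    unfolding sum_concat[symmetric] by (intro sum.cong) (auto simp: A_def W2_def b2_def)
  have s: "net_sum (m + m') A W2 b2 x i = net_sum m a W b x i + net_sum m' a' W' b' x i" for x i
    unfolding net_sum_def by (rule cc[of "\<lambda>a W b. ReQU (W \<bullet> x + b) *\<^sub>R a i"])
  have d: "net_deriv (m + m') A W2 b2 l x i = net_deriv m a W b l x i + net_deriv m' a' W' b' l x i" for l x i
    unfolding net_deriv_def by (rule cc[of "\<lambda>a W b. (2 * relu (W \<bullet> x + b) * W $ l) *\<^sub>R a i"])
  have tri: "norm (p + q - (r + s)) <= norm (p - r) + norm (q - s)" for p q r s :: "real \<times> (real ^ 'a)"
    using norm_triangle_ineq[of "p - r" "q - s"] by (simp add: algebra_simps)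
  show ?thesis
    unfolding net_within_def
  proof (intro exI conjI allI ballI impI)
    show "A j \<in> states n" "norm (W2 j) <= 1" "\<bar>b2 j\<bar> <= 1" if "j < m + m'" for j
      using 1(1)[of j] 2(1)[of "j - m"] that by (auto simp: A_def W2_def b2_def)
    show "(\<Sum>j<m + m'. vec_norm n (A j)) <= T1 + T2"
      using 1(2) 2(2) cc[of "\<lambda>a W b. vec_norm n a"] by simp
    show "norm (V1 x i + V2 x i - net_sum (m + m') A W2 b2 x i) <= \<epsilon>1 + \<epsilon>2" if "x \<in> cube" "i < n" for x i
      unfolding s by (rule order_trans[OF tri add_mono[OF 1(3)[OF that] 2(3)[OF that]]])
    show "norm (D1 l x i + D2 l x i - net_deriv (m + m') A W2 b2 l x i) <= \<epsilon>1 + \<epsilon>2" if "x \<in> cube" "i < n" for x i l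
      unfolding d by (rule order_trans[OF tri add_mono[OF 1(4)[OF that] 2(4)[OF that]]])
  qed
qed

lemma net_within_zero: "net_within n 0 (\<lambda>x i. 0) (\<lambda>l x i. 0) 0"
  unfolding net_within_def by (rule exI[of _ 0]) (simp add: net_sum_def net_deriv_def)

lemma net_within_sum:
  assumes "finite F" "\<And>j. j \<in> F ==> net_within n (\<epsilon> j) (V j) (D j) (T j)"
  shows "net_within n (\<Sum>j\<in>F. \<epsilon> j) (\<lambda>x i. \<Sum>j\<in>F. V j x i) (\<lambda>l x i. \<Sum>j\<in>F. D j l x i) (\<Sum>j\<in>F. T j)"
  using assms
proof (induction F rule: finite_induct)
  case (insert j F)
  then show ?case
    using net_within_add[of n "\<epsilon> j" "V j" "D j" "T j"] by simp
qed (simp add: net_within_zero)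

lemma net_within_perturb:
  assumes "net_within n \<epsilon> V D T" "T <= T'"
    and "\<And>x i. x \<in> cube ==> i < n ==> norm (V' x i - V x i) <= \<delta>"
    and "\<And>x i l. x \<in> cube ==> i < n ==> norm (D' l x i - D l x i) <= \<delta>"
  shows "net_within n (\<delta> + \<epsilon>) V' D' T'"
proof -
  obtain m a W b where 1: "\<forall>j<m. a j \<in> states n \<and> norm (W j) <= 1 \<and> \<bar>b j\<bar> <= 1"
    "(\<Sum>j<m. vec_norm n (a j)) <= T"
    "\<And>x i. x \<in> cube ==> i < n ==> norm (V x i - net_sum m a W b x i) <= \<epsilon>"
    "\<And>x i l. x \<in> cube ==> i < n ==> norm (D l x i - net_deriv m a W b l x i) <= \<epsilon>"
    using assms(1) unfolding net_within_def by blast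
  have tri: "norm (p - r) <= norm (p - q) + norm (q - r)" for p q r :: "real \<times> (real ^ 'a)"
    using norm_triangle_ineq[of "p - q" "q - r"] by simp
  show ?thesis
    unfolding net_within_def
  proof (rule exI[of _ m], rule exI[of _ a], rule exI[of _ W], rule exI[of _ b], intro conjI ballI)
    show "\<forall>j<m. a j \<in> states n \<and> norm (W j) <= 1 \<and> \<bar>b j\<bar> <= 1" by (rule 1(1))
    show "(\<Sum>j<m. vec_norm n (a j)) <= T'" using 1(2) assms(2) by simp
    fix x :: "real ^ 'a" assume x: "x \<in> cube"
    show "\<forall>i<n. norm (V' x i - net_sum m a W b x i) <= \<delta> + \<epsilon> \<and> (\<forall>l. norm (D' l x i - net_deriv m a W b l x i) <= \<delta> + \<epsilon>)"
      using order_trans[OF tri add_mono[OF assms(3)[OF x] 1(3)[OF x]]]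
        order_trans[OF tri add_mono[OF assms(4)[OF x] 1(4)[OF x]]] by blast
  qed
qed

lemma net_within_mono:
  assumes "net_within n \<epsilon> V D T" "\<epsilon> <= \<epsilon>'" "T <= T'"
  shows "net_within n \<epsilon>' V D T'"
  using net_within_perturb[OF assms(1,3), of V "\<epsilon>' - \<epsilon>" D] assms(2) by simp

lemma vec_norm_scale: "vec_norm n (\<lambda>i. c *\<^sub>R P i) = \<bar>c\<bar> * vec_norm n P"
  unfolding vec_norm_def by (simp add: L2_set_right_distrib)

lemma vec_norm_nonneg: "vec_norm n P >= 0"
  unfolding vec_norm_def by (rule L2_set_nonneg)

lemma states_scale: "P \<in> states n ==> (\<lambda>i. c *\<^sub>R P i) \<in> states n"
  by (simp add: states_def)

lemma net_within_atom:
  assumes P: "P \<in> states n" and \<eta>: "norm \<eta> <= 1" and s: "\<bar>s\<bar> = 1" and b: "\<bar>b\<bar> <= 1"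
  shows "net_within n 0 (\<lambda>x i. (\<beta> * ReQU (s * (\<eta> \<bullet> x) + b)) *\<^sub>R P i)
    (\<lambda>l x i. (\<beta> * (s * (2 * relu (s * (\<eta> \<bullet> x) + b))) * \<eta> $ l) *\<^sub>R P i) (\<bar>\<beta>\<bar> * vec_norm n P)"
  unfolding net_within_def
  by (intro exI[of _ 1] exI[of _ "\<lambda>_ i. \<beta> *\<^sub>R P i"] exI[of _ "\<lambda>_. s *\<^sub>R \<eta>"] exI[of _ "\<lambda>_. b"])
    (use assms in \<open>auto simp: net_sum_def net_deriv_def vec_norm_scale states_scale mult_ac\<close>)

text \<open>The one-sided spline is used for \<open>z\<close> and for \<open>- z\<close>; the
  neurons of each half vanish on the other half-line. On \<open>[-1,1]\<close> the Taylor part is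
  exact: \<open>z^2 = ReQU z + ReQU (- z)\<close> and
  \<open>4 * z = ReQU (1 + z) - ReQU (1 - z)\<close>. The normalisation of \<open>\<eta>\<close>
  keeps \<open>z\<close> in this range. The mass is \<open>K / 2\<close> for each spline, and
  \<open>\<bar>g2 0\<bar>\<close> and \<open>\<bar>g1 0\<bar> / 2\<close> for the Taylor
  part.\<close>

lemma spline_two_sided:
  fixes g g1 g2 :: "real => real"
  assumes d0: "\<And>z. (g has_real_derivative g1 z) (at z)"
    and d1: "\<And>z. (g1 has_real_derivative g2 z) (at z)"
    and lip: "\<And>y z. \<bar>g2 y - g2 z\<bar> <= K * \<bar>y - z\<bar>"
    and P: "P \<in> states n" and \<eta>: "(\<Sum>l\<in>UNIV. \<bar>\<eta> $ l\<bar>) <= 1" and e: "\<epsilon> > 0"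
  shows "net_within n \<epsilon> (\<lambda>x i. (g (\<eta> \<bullet> x) - g 0) *\<^sub>R P i) (\<lambda>l x i. (g1 (\<eta> \<bullet> x) * \<eta> $ l) *\<^sub>R P i)
    ((K + \<bar>g2 0\<bar> + \<bar>g1 0\<bar> / 2) * vec_norm n P)"
proof -
  have K: "K >= 0" using lip[of 1 0] by simp
  have n\<eta>: "norm \<eta> <= 1" using norm_le_l1_cart[of \<eta>] \<eta> by simp
  have z1: "\<eta> \<bullet> x \<in> {-1..1}" if "x \<in> cube" for x
  proof -
    have "\<bar>\<eta> \<bullet> x\<bar> <= (\<Sum>l\<in>UNIV. \<bar>\<eta> $ l * x $ l\<bar>)" unfolding inner_vec_def inner_real_def by (rule sum_abs)
    also have "... <= (\<Sum>l\<in>UNIV. \<bar>\<eta> $ l\<bar> * 1)"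
      unfolding abs_mult using that by (intro sum_mono mult_left_mono) (auto simp: mem_box_cart)
    finally show ?thesis using \<eta> by auto
  qed
  define v where "v = vec_norm n P"
  have v0: "v >= 0" by (simp add: v_def vec_norm_nonneg)
  define S where "S = (\<Sum>i<n. norm (P i)) + 1"
  have S0: "S > 0" unfolding S_def by (simp add: add_nonneg_pos sum_nonneg)
  have PS: "norm (P i) <= S" if "i < n" for i
    using member_le_sum[of i "{..<n}" "\<lambda>i. norm (P i)"] that by (simp add: S_def)
  obtain M :: nat where M: "K * S / \<epsilon> < real M" using reals_Archimedean2 by blast
  have M0: "M > 0" using M K S0 e by (cases M) (auto simp: divide_less_0_iff mult_less_0_iff)
  have KM: "K / real M * S <= \<epsilon>" using M M0 e by (simp add: field_simps)
  obtain \<beta> where \<beta>: "(\<Sum>i<M. \<bar>\<beta> i\<bar>) <= K / 2"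
    "\<And>z. z \<in> {0..1} ==>
      \<bar>g z - g 0 - g1 0 * z - g2 0 * z^2 / 2 - (\<Sum>i<M. \<beta> i * ReQU (z - real i / real M))\<bar> <= K / real M"
    "\<And>z. z \<in> {0..1} ==>
      \<bar>g1 z - g1 0 - g2 0 * z - (\<Sum>i<M. \<beta> i * (2 * relu (z - real i / real M)))\<bar> <= K / real M"
    by (rule spline_one_sided[OF d0 d1 lip M0], rule that)
  have um: "(uminus has_real_derivative - 1) (at z)" for z :: real
    by (auto intro!: derivative_eq_intros)
  have d0': "((\<lambda>z. g (- z)) has_real_derivative - g1 (- z)) (at z)" for z
    using DERIV_chain2[of g "g1 (- z)" uminus z "-1" UNIV, OF d0 um] by simp
  have d1': "((\<lambda>z. - g1 (- z)) has_real_derivative g2 (- z)) (at z)" for z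
    using DERIV_minus[OF DERIV_chain2[of g1 "g2 (- z)" uminus z "-1" UNIV, OF d1 um]] by simp
  have lip': "\<bar>g2 (- y) - g2 (- z)\<bar> <= K * \<bar>y - z\<bar>" for y z
    using lip[of "- y" "- z"] by (simp add: abs_minus_commute)
  obtain \<gamma> where \<gamma>: "(\<Sum>i<M. \<bar>\<gamma> i\<bar>) <= K / 2"
    "\<And>z. z \<in> {0..1} ==>
      \<bar>g (- z) - g (- 0) - - g1 (- 0) * z - g2 (- 0) * z^2 / 2 - (\<Sum>i<M. \<gamma> i * ReQU (z - real i / real M))\<bar> <= K / real M"
    "\<And>z. z \<in> {0..1} ==>
      \<bar>- g1 (- z) - - g1 (- 0) - g2 (- 0) * z - (\<Sum>i<M. \<gamma> i * (2 * relu (z - real i / real M)))\<bar> <= K / real M"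
    by (rule spline_one_sided[OF d0' d1' lip' M0], rule that)
  define H where "H z = (\<Sum>i<M. \<beta> i * ReQU (1 * z + (- (real i / real M)))) + (\<Sum>i<M. \<gamma> i * ReQU (-1 * z + (- (real i / real M))))
    + (g2 0 / 2 * ReQU (1 * z + 0) + g2 0 / 2 * ReQU (-1 * z + 0)) + (g1 0 / 4 * ReQU (1 * z + 1) + (- g1 0 / 4) * ReQU (-1 * z + 1))" for z
  define H1 where "H1 z = (\<Sum>i<M. \<beta> i * (1 * (2 * relu (1 * z + (- (real i / real M)))))) + (\<Sum>i<M. \<gamma> i * (-1 * (2 * relu (-1 * z + (- (real i / real M))))))
    + (g2 0 / 2 * (1 * (2 * relu (1 * z + 0))) + g2 0 / 2 * (-1 * (2 * relu (-1 * z + 0)))) + (g1 0 / 4 * (1 * (2 * relu (1 * z + 1))) + (- g1 0 / 4) * (-1 * (2 * relu (-1 * z + 1))))" for z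
  have quad: "g2 0 / 2 * ReQU (1 * z + 0) + g2 0 / 2 * ReQU (-1 * z + 0) = g2 0 * z^2 / 2" for z
    by (auto simp: ReQU_def)
  have quad1: "g2 0 / 2 * (1 * (2 * relu (1 * z + 0))) + g2 0 / 2 * (-1 * (2 * relu (-1 * z + 0))) = g2 0 * z" for z
    by (auto simp: relu_def max_def)
  have lin: "g1 0 / 4 * ReQU (1 * z + 1) + (- g1 0 / 4) * ReQU (-1 * z + 1) = g1 0 * z" if "z \<in> {-1..1}" for z
    using that by (auto simp: ReQU_def power2_eq_square algebra_simps)
  have lin1: "g1 0 / 4 * (1 * (2 * relu (1 * z + 1))) + (- g1 0 / 4) * (-1 * (2 * relu (-1 * z + 1))) = g1 0" if "z \<in> {-1..1}" for z
    using that by (auto simp: relu_def algebra_simps)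
  have zero: "ReQU (z - real i / real M) = 0" "relu (z - real i / real M) = 0" if "z <= 0" for z i
  proof -
    have "z - real i / real M <= 0" using that M0 by (simp add: order_trans[OF that])
    then show "ReQU (z - real i / real M) = 0" "relu (z - real i / real M) = 0"
      by (auto simp: ReQU_def relu_def)
  qed
  have err: "\<bar>(g z - g 0) - H z\<bar> <= K / real M" "\<bar>g1 z - H1 z\<bar> <= K / real M" if z: "z \<in> {-1..1}" for z
  proof -
    have e: "1 * z + - (real i / real M) = z - real i / real M" "-1 * z + - (real i / real M) = - z - real i / real M" for i
      by simp_all
    show "\<bar>(g z - g 0) - H z\<bar> <= K / real M"
    proof (cases "z >= 0")
      case True
      then have "(\<Sum>i<M. \<gamma> i * ReQU (- z - real i / real M)) = 0" by (simp add: zero)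
      then show ?thesis
        using \<beta>(2)[of z] True z unfolding H_def quad lin[OF z] e by (simp add: algebra_simps)
    next
      case False
      then have "(\<Sum>i<M. \<beta> i * ReQU (z - real i / real M)) = 0" by (simp add: zero)
      then show ?thesis
        using \<gamma>(2)[of "- z"] False z unfolding H_def quad lin[OF z] e by (simp add: algebra_simps)
    qed
    show "\<bar>g1 z - H1 z\<bar> <= K / real M"
    proof (cases "z >= 0")
      case True
      then have "(\<Sum>i<M. \<gamma> i * (-1 * (2 * relu (- z - real i / real M)))) = 0" by (simp add: zero)
      then show ?thesis
        using \<beta>(3)[of z] True z unfolding H1_def quad1 lin1[OF z] e by (simp add: algebra_simps)
    next
      case False
      then have 0: "(\<Sum>i<M. \<beta> i * (1 * (2 * relu (z - real i / real M)))) = 0" by (simp add: zero)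
      have "g1 z - H1 z = - (- g1 (- (- z)) - - g1 (- 0) - g2 (- 0) * (- z) - (\<Sum>i<M. \<gamma> i * (2 * relu (- z - real i / real M))))"
        unfolding H1_def quad1 lin1[OF z] e 0 by (simp add: sum_negf)
      then show ?thesis
        using \<gamma>(3)[of "- z"] False z by (simp only: abs_minus_cancel) simp
    qed
  qed
  let ?at = "\<lambda>\<beta> s b x i. (\<beta> * ReQU (s * (\<eta> \<bullet> x) + b)) *\<^sub>R P i"
  let ?dt = "\<lambda>\<beta> s b l x i. (\<beta> * (s * (2 * relu (s * (\<eta> \<bullet> x) + b))) * \<eta> $ l) *\<^sub>R P i"
  have iM: "\<bar>- (real i / real M)\<bar> <= 1" if "i < M" for i using that by simp
  have atom: "net_within n 0 (?at \<beta> s b) (?dt \<beta> s b) (\<bar>\<beta>\<bar> * v)" if "\<bar>s\<bar> = 1" "\<bar>b\<bar> <= 1" for \<beta> s b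
    unfolding v_def by (rule net_within_atom[OF P n\<eta> that])
  have atoms: "net_within n (\<Sum>i<M. 0) (\<lambda>x j. \<Sum>i<M. ?at (\<beta> i) s (- (real i / real M)) x j)
      (\<lambda>l x j. \<Sum>i<M. ?dt (\<beta> i) s (- (real i / real M)) l x j) (\<Sum>i<M. \<bar>\<beta> i\<bar> * v)" if "\<bar>s\<bar> = 1" for \<beta> s
    using iM by (intro net_within_sum atom that) auto
  have eqV: "H (\<eta> \<bullet> x) *\<^sub>R P j = (\<Sum>i<M. ?at (\<beta> i) 1 (- (real i / real M)) x j) + (\<Sum>i<M. ?at (\<gamma> i) (-1) (- (real i / real M)) x j)
      + (?at (g2 0 / 2) 1 0 x j + ?at (g2 0 / 2) (-1) 0 x j) + (?at (g1 0 / 4) 1 1 x j + ?at (- g1 0 / 4) (-1) 1 x j)" for x j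
    by (simp only: H_def scaleR_add_left scaleR_left.sum)
  have eqD: "(H1 (\<eta> \<bullet> x) * \<eta> $ l) *\<^sub>R P j = (\<Sum>i<M. ?dt (\<beta> i) 1 (- (real i / real M)) l x j) + (\<Sum>i<M. ?dt (\<gamma> i) (-1) (- (real i / real M)) l x j)
      + (?dt (g2 0 / 2) 1 0 l x j + ?dt (g2 0 / 2) (-1) 0 l x j) + (?dt (g1 0 / 4) 1 1 l x j + ?dt (- g1 0 / 4) (-1) 1 l x j)" for x l j
    by (simp only: H1_def distrib_right sum_distrib_right scaleR_add_left scaleR_left.sum)
  have "net_within n (0 + 0 + (0 + 0) + (0 + 0)) (\<lambda>x j. H (\<eta> \<bullet> x) *\<^sub>R P j) (\<lambda>l x j. (H1 (\<eta> \<bullet> x) * \<eta> $ l) *\<^sub>R P j)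
    ((\<Sum>i<M. \<bar>\<beta> i\<bar> * v) + (\<Sum>i<M. \<bar>\<gamma> i\<bar> * v) + (\<bar>g2 0 / 2\<bar> * v + \<bar>g2 0 / 2\<bar> * v) + (\<bar>g1 0 / 4\<bar> * v + \<bar>- g1 0 / 4\<bar> * v))"
    unfolding eqV eqD
    by (rule net_within_add[OF net_within_add[OF net_within_add[OF atoms[of 1 \<beta>] atoms[of "-1" \<gamma>]]
        net_within_add[OF atom[of 1 0 "g2 0 / 2"] atom[of "-1" 0 "g2 0 / 2"]]]
        net_within_add[OF atom[of 1 1 "g1 0 / 4"] atom[of "-1" 1 "- g1 0 / 4"]], unfolded sum.neutral_const]) simp_all
  then have "net_within n (K / real M * S + (0 + 0 + (0 + 0) + (0 + 0))) (\<lambda>x i. (g (\<eta> \<bullet> x) - g 0) *\<^sub>R P i) (\<lambda>l x i. (g1 (\<eta> \<bullet> x) * \<eta> $ l) *\<^sub>R P i)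
    ((K + \<bar>g2 0\<bar> + \<bar>g1 0\<bar> / 2) * v)"
  proof (rule net_within_perturb)
    have "(\<Sum>i<M. \<bar>\<beta> i\<bar> * v) <= K / 2 * v" "(\<Sum>i<M. \<bar>\<gamma> i\<bar> * v) <= K / 2 * v"
      unfolding sum_distrib_right[symmetric] by (rule mult_right_mono[OF \<beta>(1) v0], rule mult_right_mono[OF \<gamma>(1) v0])
    then show "(\<Sum>i<M. \<bar>\<beta> i\<bar> * v) + (\<Sum>i<M. \<bar>\<gamma> i\<bar> * v) + (\<bar>g2 0 / 2\<bar> * v + \<bar>g2 0 / 2\<bar> * v) + (\<bar>g1 0 / 4\<bar> * v + \<bar>- g1 0 / 4\<bar> * v)
        <= (K + \<bar>g2 0\<bar> + \<bar>g1 0\<bar> / 2) * v" by (simp add: algebra_simps)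
  next
    fix x :: "real ^ 'a" and i assume x: "x \<in> cube" and i: "i < n"
    have "\<bar>(g (\<eta> \<bullet> x) - g 0) - H (\<eta> \<bullet> x)\<bar> * norm (P i) <= K / real M * S"
      using err(1)[OF z1[OF x]] PS[OF i] K by (intro mult_mono) auto
    then show "norm ((g (\<eta> \<bullet> x) - g 0) *\<^sub>R P i - H (\<eta> \<bullet> x) *\<^sub>R P i) <= K / real M * S"
      by (simp add: scaleR_diff_left[symmetric])
    fix l
    have "\<bar>\<eta> $ l\<bar> <= 1" using component_le_norm_cart[of \<eta> l] n\<eta> by linarith
    then have "\<bar>g1 (\<eta> \<bullet> x) - H1 (\<eta> \<bullet> x)\<bar> * \<bar>\<eta> $ l\<bar> * norm (P i) <= K / real M * 1 * S"
      using err(2)[OF z1[OF x]] PS[OF i] K by (intro mult_mono) auto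
    then show "norm ((g1 (\<eta> \<bullet> x) * \<eta> $ l) *\<^sub>R P i - (H1 (\<eta> \<bullet> x) * \<eta> $ l) *\<^sub>R P i) <= K / real M * S"
      by (simp add: scaleR_diff_left[symmetric] left_diff_distrib[symmetric] abs_mult)
  qed
  then show ?thesis
    unfolding v_def[symmetric]
    by (rule net_within_mono) (use KM in simp_all)
qed

text \<open>The exact solution of the first-order system: the pair at level \<open>i\<close>
  consists of the \<open>i\<close>-fold Laplacian of the series and the gradient of that
  Laplacian.\<close>

definition U_field :: "('j => real) => ('j => real ^ 'd) => real ^ 'd => nat => real \<times> (real ^ 'd)" where
  "U_field w \<kappa> x i = (wave (\<lambda>j. w j * (- (norm (\<kappa> j))\<^sup>2) ^ i) \<kappa> 0 x,
     \<chi> k. wave (\<lambda>j. w j * (- (norm (\<kappa> j))\<^sup>2) ^ i * \<kappa> j $ k) \<kappa> (0 + pi / 2) x)"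

definition U_deriv :: "('j => real) => ('j => real ^ 'd) => 'd => real ^ 'd => nat => real \<times> (real ^ 'd)" where
  "U_deriv w \<kappa> l x i = (wave (\<lambda>j. w j * (- (norm (\<kappa> j))\<^sup>2) ^ i * \<kappa> j $ l) \<kappa> (0 + pi / 2) x,
     \<chi> k. wave (\<lambda>j. w j * (- (norm (\<kappa> j))\<^sup>2) ^ i * \<kappa> j $ k * \<kappa> j $ l) \<kappa> (0 + pi / 2 + pi / 2) x)"

text \<open>A summable bound on the weights controls the truncation error uniformly in the point and
  the phase; one finite set \<open>F\<close> then serves the field and all its derivatives.\<close>

lemma wave_tail:
  fixes h :: "'j => real"
  assumes h: "(h has_sum B) UNIV" and v: "\<And>j. \<bar>v j\<bar> <= h j" and F: "finite F"
  shows "\<bar>wave v \<kappa> p x - (\<Sum>j\<in>F. v j * cos (\<kappa> j \<bullet> x + p))\<bar> <= B - (\<Sum>j\<in>F. h j)"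
proof -
  have le: "\<bar>v j * cos (\<kappa> j \<bullet> x + p)\<bar> <= h j" for j
    using mult_left_mono[OF abs_cos_le_one[of "\<kappa> j \<bullet> x + p"], of "\<bar>v j\<bar>"] v[of j] by (simp add: abs_mult)
  have sv: "(\<lambda>j. v j * cos (\<kappa> j \<bullet> x + p)) summable_on UNIV"
    by (rule summable_on_real_abs[OF has_sum_imp_summable[OF h]]) (rule le)
  have "norm (wave v \<kappa> p x - (\<Sum>j\<in>F. v j * cos (\<kappa> j \<bullet> x + p))) <= B - (\<Sum>j\<in>F. h j)"
  proof (rule norm_infsum_le)
    show "((\<lambda>j. v j * cos (\<kappa> j \<bullet> x + p)) has_sum (wave v \<kappa> p x - (\<Sum>j\<in>F. v j * cos (\<kappa> j \<bullet> x + p)))) (UNIV - F)"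
      unfolding wave_def by (rule has_sum_Diff[OF has_sum_infsum[OF sv] has_sum_finite[OF F]]) simp
    show "(h has_sum (B - (\<Sum>j\<in>F. h j))) (UNIV - F)"
      by (rule has_sum_Diff[OF h has_sum_finite[OF F]]) simp
  qed (use le in simp)
  then show ?thesis by simp
qed

lemma L2_set_le_sum_abs:
  "vec_norm n P <= (\<Sum>i<n. norm (P i))"
  unfolding vec_norm_def by (rule L2_set_le_sum) simp

text \<open>The ratio of successive terms is at least 9, and
  \<open>9 / 8 = 1 / (1 - 1 / 9)\<close>.\<close>

lemma geometric_bound:
  fixes \<rho> :: real
  assumes "\<rho> >= 3" "n >= 1"
  shows "(\<Sum>i<n. \<rho> ^ (2 * i)) <= 9 / 8 * \<rho> ^ (2 * n - 2)"
  using assms(2)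
proof (induction n rule: nat_induct_at_least)
  case (Suc n)
  have "9 * \<rho> ^ (2 * n - 2) <= \<rho>\<^sup>2 * \<rho> ^ (2 * n - 2)"
    using assms(1) power_mono[of 3 \<rho> 2] by (intro mult_right_mono) auto
  also have "... = \<rho> ^ (2 * n)"
  proof -
    have "\<rho>\<^sup>2 * \<rho> ^ (2 * n - 2) = \<rho> ^ (2 + (2 * n - 2))" by (simp only: power_add)
    moreover have "2 + (2 * n - 2) = 2 * n" using Suc.hyps by simp
    ultimately show ?thesis by (simp only:)
  qed
  finally show ?case using Suc.IH by simp
qed simp

text \<open>The exponents fit: a derivative of order up to \<open>2 n - 1\<close> times the factor \<open>r\<^sup>3\<close> lost in the
  spline gives the weight \<open>r\<^sup>2\<^sup>n\<^sup>+\<^sup>2\<close> of the Barron norm.\<close>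

lemma power_budget:
  fixes r \<rho> :: real
  assumes n: "n >= 1" and \<rho>: "\<rho> = 0 \<and> r = 0 \<or> 3 <= \<rho> \<and> \<rho> <= r"
  defines "A \<equiv> (\<Sum>i<n. \<rho> ^ (2 * i))"
  shows "A * (r ^ 3 + r^2) + \<rho> * A * (r ^ 3 + r / 2) <= 4 * (1 + r ^ (2 * n + 2))" "A <= 2 * (1 + r ^ (2 * n + 2))"
proof -
  have "A * (r ^ 3 + r^2) + \<rho> * A * (r ^ 3 + r / 2) <= 4 * (1 + r ^ (2 * n + 2)) \<and> A <= 2 * (1 + r ^ (2 * n + 2))"
    using \<rho>
  proof
    assume z: "\<rho> = 0 \<and> r = 0"
    have "A <= 1"
    proof -
      obtain n' where "n = Suc n'" using n by (cases n) auto
      then have "A = \<rho> ^ 0 + (\<Sum>i<n'. \<rho> ^ (2 * Suc i))" unfolding A_def by (simp add: sum.lessThan_Suc_shift del: sum.lessThan_Suc)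
      then show ?thesis using z by simp
    qed
    then show ?thesis using z by simp
  next
    assume b: "3 <= \<rho> \<and> \<rho> <= r"
    obtain n' where n': "n = Suc n'" using n by (cases n) auto
    have r3: "r >= 3" using b by simp
    define R where "R = r ^ (2 * n')"
    have R0: "R >= 1" unfolding R_def using r3 by (intro one_le_power) simp
    have "A <= 9 / 8 * \<rho> ^ (2 * n - 2)" unfolding A_def using b n by (intro geometric_bound) auto
    also have "\<rho> ^ (2 * n - 2) <= r ^ (2 * n - 2)" using b by (intro power_mono) auto
    finally have A: "A <= 9 / 8 * R" by (simp add: n' R_def)
    have A0: "A >= 0" unfolding A_def by (intro sum_nonneg) (simp add: power_mult)
    have r4: "r ^ (2 * n + 2) = R * r ^ 4" by (simp add: n' R_def power_add power4_eq_xxxx power2_eq_square)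
    have p: "1 <= r" "3 * r ^ 3 <= r ^ 4" "9 * r^2 <= r ^ 4" "81 <= r ^ 4"
    proof -
      show "3 * r ^ 3 <= r ^ 4" using mult_right_mono[OF r3, of "r ^ 3"] r3 by (simp add: power4_eq_xxxx power3_eq_cube)
      show "9 * r^2 <= r ^ 4" using mult_right_mono[OF power_mono[OF r3, of 2], of "r^2"] r3 by (simp add: power4_eq_xxxx power2_eq_square)
      show "81 <= r ^ 4" using power_mono[OF r3, of 4] by simp
    qed (use r3 in simp)
    have "A * (r ^ 3 + r^2) + \<rho> * A * (r ^ 3 + r / 2) <= 9 / 8 * R * (r ^ 3 + r^2) + r * (9 / 8 * R) * (r ^ 3 + r / 2)"
      using A A0 b r3 R0 by (intro add_mono mult_mono mult_right_mono) auto
    also have "... = R * (9 / 8 * (r ^ 3 + r^2) + 9 / 8 * (r ^ 4 + r^2 / 2))"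
      by (simp add: algebra_simps power2_eq_square power3_eq_cube power4_eq_xxxx)
    also have "... <= R * (4 * r ^ 4)"
    proof (rule mult_left_mono)
      show "9 / 8 * (r ^ 3 + r^2) + 9 / 8 * (r ^ 4 + r^2 / 2) <= 4 * r ^ 4" using p by argo
    qed (use R0 in simp)
    also have "... <= 4 * (1 + r ^ (2 * n + 2))" unfolding r4 by simp
    finally have 1: "A * (r ^ 3 + r^2) + \<rho> * A * (r ^ 3 + r / 2) <= 4 * (1 + r ^ (2 * n + 2))" .
    have "A <= R * (9 / 8)" using A by simp
    also have "... <= R * r ^ 4" using p R0 by (intro mult_left_mono) auto
    also have "... <= 2 * (1 + r ^ (2 * n + 2))" unfolding r4 using R0 p by simp
    finally show ?thesis using 1 by simp
  qed
  then show "A * (r ^ 3 + r^2) + \<rho> * A * (r ^ 3 + r / 2) <= 4 * (1 + r ^ (2 * n + 2))" "A <= 2 * (1 + r ^ (2 * n + 2))"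
    by auto
qed

lemma power_le_one_plus:
  fixes a r :: real
  assumes "0 <= a" "a <= r" "q <= s"
  shows "a ^ q <= 1 + r ^ s"
proof (cases "a <= 1")
  case True
  then have "a ^ q <= 1" using assms by (intro power_le_one)
  moreover have "0 <= r ^ s" using assms by simp
  ultimately show ?thesis by linarith
next
  case False
  then have "a ^ q <= a ^ s" using assms by (intro power_increasing) auto
  also have "... <= r ^ s" using assms by (intro power_mono) auto
  finally show ?thesis by linarith
qed

lemma sin_cos_lipschitz: "\<bar>cos a - cos b\<bar> <= \<bar>a - b\<bar>" "\<bar>sin a - sin b\<bar> <= \<bar>a - b\<bar>" for a b :: real
  using field_differentiable_bound[of UNIV cos "\<lambda>x. - sin x" 1 a b] field_differentiable_bound[of UNIV sin cos 1 a b]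
  by (auto intro: has_field_derivative_at_within)

text \<open>Each frequency contributes a cosine profile in the scalar components and a sine profile
  in the vector components, both functions of \<open>\<kappa> j \<bullet> x\<close>. Two
  applications of \<open>spline_two_sided\<close> per frequency therefore cover all \<open>n\<close>
  levels; the values at 0 that the splines leave out form the constant \<open>c\<close>.\<close>

lemma network_approximation:
  fixes w :: "'j => real" and \<kappa> :: "'j => real ^ 'd"
  assumes n: "n >= 1" and B: "((\<lambda>j. \<bar>w j\<bar> * (1 + (\<Sum>l\<in>UNIV. \<bar>\<kappa> j $ l\<bar>) ^ (2 * n + 2))) has_sum B) UNIV"
    and \<kappa>: "\<And>j. \<kappa> j = 0 \<or> norm (\<kappa> j) >= 3" and e: "\<epsilon> > 0"
  obtains c where "c \<in> states n" "vec_norm n c <= 2 * B"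
    "net_within n \<epsilon> (\<lambda>x i. U_field w \<kappa> x i - c i) (U_deriv w \<kappa>) (4 * B)"
proof -
  define r where "r j = (\<Sum>l\<in>UNIV. \<bar>\<kappa> j $ l\<bar>)" for j
  define \<rho> where "\<rho> j = norm (\<kappa> j)" for j
  define h where "h j = \<bar>w j\<bar> * (1 + r j ^ (2 * n + 2))" for j
  have hB: "(h has_sum B) UNIV" using B unfolding h_def[abs_def] r_def .
  have r0: "r j >= 0" for j unfolding r_def by (intro sum_nonneg) auto
  have \<rho>r: "\<rho> j <= r j" for j unfolding r_def \<rho>_def by (rule norm_le_l1_cart)
  have \<rho>0: "\<rho> j >= 0" for j by (simp add: \<rho>_def)
  have rz: "\<rho> j = 0 \<and> r j = 0 \<or> 3 <= \<rho> j \<and> \<rho> j <= r j" for j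
    using \<kappa>[of j] \<rho>r[of j] by (auto simp: \<rho>_def r_def)
  have h0: "h j >= 0" for j unfolding h_def using r0 by (intro mult_nonneg_nonneg add_nonneg_nonneg zero_le_power) auto
  define q where "q j i = (- (\<rho> j)\<^sup>2) ^ i" for j and i :: nat
  have absq: "\<bar>q j i\<bar> = \<rho> j ^ (2 * i)" for j i
    unfolding q_def by (simp add: power_abs power_mult)
  \<comment> \<open>\<open>P j\<close> and \<open>Q j\<close> collect the amplitudes of all levels
    for the cosine and for the sine; the sign in \<open>Q j\<close> comes from differentiating the
    cosine.\<close>
  define P where "P j = (\<lambda>i. if i < n then (q j i, 0 :: real ^ 'd) else 0)" for j
  define Q where "Q j = (\<lambda>i. if i < n then (0 :: real, - q j i *\<^sub>R \<kappa> j) else 0)" for j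
  have PS: "P j \<in> states n" and QS: "Q j \<in> states n" for j
    by (auto simp: states_def P_def Q_def zero_prod_def)
  have PN: "vec_norm n (P j) <= (\<Sum>i<n. \<rho> j ^ (2 * i))" for j
    by (rule order_trans[OF L2_set_le_sum_abs]) (auto intro!: sum_mono simp: P_def norm_Pair absq)
  have QN: "vec_norm n (Q j) <= \<rho> j * (\<Sum>i<n. \<rho> j ^ (2 * i))" for j
    by (rule order_trans[OF L2_set_le_sum_abs]) (auto intro!: sum_mono simp: Q_def norm_Pair absq sum_distrib_left \<rho>_def mult.commute)
  note budget = power_budget[OF n rz]
  \<comment> \<open>The length \<open>r j\<close>, measured in the 1-norm, moves into the profile,
    whose third derivative is then bounded by \<open>r j ^ 3\<close>. For a zero frequency the
    direction is zero by the convention for division.\<close>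
  define \<eta> where "\<eta> j = \<kappa> j /\<^sub>R r j" for j
  have r\<eta>: "r j *\<^sub>R \<eta> j = \<kappa> j" for j
    using rz[of j] by (auto simp: \<eta>_def \<rho>_def)
  have r\<eta>l: "r j * \<eta> j $ l = \<kappa> j $ l" for j l
    using arg_cong[OF r\<eta>[of j], of "\<lambda>v. v $ l"] by simp
  have z: "r j * (\<eta> j \<bullet> x) = \<kappa> j \<bullet> x" for j x
    using r\<eta>[of j] by (metis inner_scaleR_left)
  have \<eta>1: "(\<Sum>l\<in>UNIV. \<bar>\<eta> j $ l\<bar>) <= 1" for j
  proof -
    have "\<bar>\<eta> j $ l\<bar> = \<bar>\<kappa> j $ l\<bar> / r j" for l
      using r0[of j] by (simp add: \<eta>_def abs_mult divide_inverse mult.commute)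
    then have "(\<Sum>l\<in>UNIV. \<bar>\<eta> j $ l\<bar>) = r j / r j"
      by (simp only: sum_divide_distrib[symmetric] r_def)
    then show ?thesis by simp
  qed
  \<comment> \<open>Half of \<open>\<epsilon>\<close> is reserved for truncation: a state has one
    scalar and \<open>CARD('d)\<close> vector entries per level, each of which may lose
    \<open>\<epsilon>'\<close>. The other half is spent on the splines, two for each frequency in
    \<open>F\<close>.\<close>
  define \<epsilon>' where "\<epsilon>' = \<epsilon> / (2 * (1 + real CARD('d)))"
  have e': "\<epsilon>' > 0" using e by (simp add: \<epsilon>'_def)
  obtain F where F: "finite F" "dist (sum h F) B <= \<epsilon>'"
    using has_sum_finite_approximation[OF hB e'] by blast
  have FB: "B - sum h F <= \<epsilon>'" using F(2) by (simp add: dist_real_def)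
  have FleB: "sum h F <= B"
  proof -
    have "sum h F <= infsum h UNIV"
      by (rule finite_sum_le_infsum[OF has_sum_imp_summable[OF hB] F(1)]) (auto simp: h0)
    then show ?thesis using infsumI[OF hB] by simp
  qed
  define \<delta> where "\<delta> = \<epsilon> / (4 * (real (card F) + 1))"
  have d: "\<delta> > 0" using e by (simp add: \<delta>_def)
  have abs_gen: "\<bar>- a * p - - a * q\<bar> = a * \<bar>p - q\<bar>" if "a >= 0" for a p q :: real
  proof -
    have "- a * p - - a * q = - (a * (p - q))" by (simp add: algebra_simps)
    then show ?thesis using that by (simp only: abs_minus_cancel abs_mult abs_of_nonneg)
  qed
  have cosN: "net_within n \<delta> (\<lambda>x i. (cos (r j * (\<eta> j \<bullet> x)) - cos (r j * 0)) *\<^sub>R (w j *\<^sub>R P j i))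
      (\<lambda>l x i. (- r j * sin (r j * (\<eta> j \<bullet> x)) * \<eta> j $ l) *\<^sub>R (w j *\<^sub>R P j i))
      ((r j ^ 3 + \<bar>- (r j)\<^sup>2 * cos (r j * 0)\<bar> + \<bar>- r j * sin (r j * 0)\<bar> / 2) * vec_norm n (\<lambda>i. w j *\<^sub>R P j i))" for j
  proof (rule spline_two_sided[where g = "\<lambda>z. cos (r j * z)" and ?g1.0 = "\<lambda>z. - r j * sin (r j * z)" and ?g2.0 = "\<lambda>z. - (r j)\<^sup>2 * cos (r j * z)"])
    show "\<bar>- (r j)\<^sup>2 * cos (r j * y) - - (r j)\<^sup>2 * cos (r j * z)\<bar> <= r j ^ 3 * \<bar>y - z\<bar>" for y z
    proof -
      have "\<bar>- (r j)\<^sup>2 * cos (r j * y) - - (r j)\<^sup>2 * cos (r j * z)\<bar> = (r j)^2 * \<bar>cos (r j * y) - cos (r j * z)\<bar>"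
        by (rule abs_gen) simp
      also have "... <= (r j)^2 * \<bar>r j * y - r j * z\<bar>" by (intro mult_left_mono sin_cos_lipschitz) auto
      also have "... = r j ^ 3 * \<bar>y - z\<bar>"
        using r0[of j] by (simp add: right_diff_distrib[symmetric] abs_mult power3_eq_cube power2_eq_square)
      finally show ?thesis .
    qed
  qed (use states_scale[OF PS] \<eta>1 d in \<open>auto intro!: derivative_eq_intros simp: power2_eq_square\<close>)
  have sinN: "net_within n \<delta> (\<lambda>x i. (sin (r j * (\<eta> j \<bullet> x)) - sin (r j * 0)) *\<^sub>R (w j *\<^sub>R Q j i))
      (\<lambda>l x i. (r j * cos (r j * (\<eta> j \<bullet> x)) * \<eta> j $ l) *\<^sub>R (w j *\<^sub>R Q j i))
      ((r j ^ 3 + \<bar>- (r j)\<^sup>2 * sin (r j * 0)\<bar> + \<bar>r j * cos (r j * 0)\<bar> / 2) * vec_norm n (\<lambda>i. w j *\<^sub>R Q j i))" for j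
  proof (rule spline_two_sided[where g = "\<lambda>z. sin (r j * z)" and ?g1.0 = "\<lambda>z. r j * cos (r j * z)" and ?g2.0 = "\<lambda>z. - (r j)\<^sup>2 * sin (r j * z)"])
    show "\<bar>- (r j)\<^sup>2 * sin (r j * y) - - (r j)\<^sup>2 * sin (r j * z)\<bar> <= r j ^ 3 * \<bar>y - z\<bar>" for y z
    proof -
      have "\<bar>- (r j)\<^sup>2 * sin (r j * y) - - (r j)\<^sup>2 * sin (r j * z)\<bar> = (r j)^2 * \<bar>sin (r j * y) - sin (r j * z)\<bar>"
        by (rule abs_gen) simp
      also have "... <= (r j)^2 * \<bar>r j * y - r j * z\<bar>" by (intro mult_left_mono sin_cos_lipschitz) auto
      also have "... = r j ^ 3 * \<bar>y - z\<bar>"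
        using r0[of j] by (simp add: right_diff_distrib[symmetric] abs_mult power3_eq_cube power2_eq_square)
      finally show ?thesis .
    qed
  qed (use states_scale[OF QS] \<eta>1 d in \<open>auto intro!: derivative_eq_intros simp: power2_eq_square\<close>)
  define c where "c i = (\<Sum>j\<in>F. w j *\<^sub>R P j i)" for i
  have cS: "c \<in> states n"
    by (simp add: states_def c_def P_def)
  have cN: "vec_norm n c <= 2 * B"
  proof -
    have "vec_norm n c <= (\<Sum>j\<in>F. vec_norm n (\<lambda>i. w j *\<^sub>R P j i))"
      unfolding c_def vec_norm_def using F(1)
    proof (induction F rule: finite_induct)
      case (insert j F)
      have "L2_set (\<lambda>i. norm (\<Sum>j\<in>insert j F. w j *\<^sub>R P j i)) {..<n} \<le>
          L2_set (\<lambda>i. norm (w j *\<^sub>R P j i) + norm (\<Sum>j\<in>F. w j *\<^sub>R P j i)) {..<n}"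
      proof (rule L2_set_mono)
        show "norm (\<Sum>j\<in>insert j F. w j *\<^sub>R P j i) <= norm (w j *\<^sub>R P j i) + norm (\<Sum>j\<in>F. w j *\<^sub>R P j i)" for i
          unfolding sum.insert[OF insert.hyps] by (rule norm_triangle_ineq)
      qed simp
      also have "... <= L2_set (\<lambda>i. norm (w j *\<^sub>R P j i)) {..<n} + L2_set (\<lambda>i. norm (\<Sum>j\<in>F. w j *\<^sub>R P j i)) {..<n}"
        by (rule L2_set_triangle_ineq)
      finally show ?case using insert by simp
    qed (simp add: L2_set_def)
    also have "... <= (\<Sum>j\<in>F. 2 * h j)"
    proof (rule sum_mono)
      fix j
      have "vec_norm n (\<lambda>i. w j *\<^sub>R P j i) <= \<bar>w j\<bar> * (2 * (1 + r j ^ (2 * n + 2)))"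
        unfolding vec_norm_scale by (intro mult_left_mono order_trans[OF PN budget(2)]) auto
      then show "vec_norm n (\<lambda>i. w j *\<^sub>R P j i) <= 2 * h j" by (simp add: h_def algebra_simps)
    qed
    also have "... <= 2 * B" using FleB by (simp add: sum_distrib_left[symmetric])
    finally show ?thesis .
  qed
  let ?V = "\<lambda>j x i. (cos (r j * (\<eta> j \<bullet> x)) - cos (r j * 0)) *\<^sub>R (w j *\<^sub>R P j i) + (sin (r j * (\<eta> j \<bullet> x)) - sin (r j * 0)) *\<^sub>R (w j *\<^sub>R Q j i)"
  let ?D = "\<lambda>j l x i. (- r j * sin (r j * (\<eta> j \<bullet> x)) * \<eta> j $ l) *\<^sub>R (w j *\<^sub>R P j i) + (r j * cos (r j * (\<eta> j \<bullet> x)) * \<eta> j $ l) *\<^sub>R (w j *\<^sub>R Q j i)"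
  have "net_within n (\<Sum>j\<in>F. \<delta> + \<delta>) (\<lambda>x i. \<Sum>j\<in>F. ?V j x i) (\<lambda>l x i. \<Sum>j\<in>F. ?D j l x i) (\<Sum>j\<in>F. 4 * h j)"
  proof (rule net_within_sum[OF F(1)])
    fix j
    show "net_within n (\<delta> + \<delta>) (?V j) (?D j) (4 * h j)"
    proof (rule net_within_mono[OF net_within_add[OF cosN[of j] sinN[of j]] order_refl])
      let ?c = "(r j ^ 3 + \<bar>- (r j)\<^sup>2 * cos (r j * 0)\<bar> + \<bar>- r j * sin (r j * 0)\<bar> / 2) * vec_norm n (\<lambda>i. w j *\<^sub>R P j i) +
          (r j ^ 3 + \<bar>- (r j)\<^sup>2 * sin (r j * 0)\<bar> + \<bar>r j * cos (r j * 0)\<bar> / 2) * vec_norm n (\<lambda>i. w j *\<^sub>R Q j i)"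
      have "?c =
          \<bar>w j\<bar> * (vec_norm n (P j) * (r j ^ 3 + (r j)^2) + vec_norm n (Q j) * (r j ^ 3 + r j / 2))"
        using r0[of j] unfolding vec_norm_scale by (simp add: algebra_simps)
      also have "... <= \<bar>w j\<bar> * ((\<Sum>i<n. \<rho> j ^ (2 * i)) * (r j ^ 3 + (r j)^2) + (\<rho> j * (\<Sum>i<n. \<rho> j ^ (2 * i))) * (r j ^ 3 + r j / 2))"
        using r0[of j] PN[of j] QN[of j] by (intro mult_left_mono add_mono mult_right_mono) auto
      also have "... <= \<bar>w j\<bar> * (4 * (1 + r j ^ (2 * n + 2)))"
        using budget(1)[of j] by (intro mult_left_mono) auto
      finally show "?c <= 4 * h j"
        by (simp add: h_def algebra_simps)
    qed
  qed
  moreover have "(\<Sum>j\<in>F. 4 * h j) <= 4 * B" using FleB by (simp add: sum_distrib_left[symmetric])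
  ultimately have "net_within n ((1 + real CARD('d)) * \<epsilon>' + (\<Sum>j\<in>F. \<delta> + \<delta>)) (\<lambda>x i. U_field w \<kappa> x i - c i) (U_deriv w \<kappa>) (4 * B)"
  proof (rule net_within_perturb)
    have pair: "norm (p - s) <= (1 + real CARD('d)) * \<epsilon>'"
      if "\<bar>fst p - fst s\<bar> <= \<epsilon>'" "\<And>k. \<bar>snd p $ k - snd s $ k\<bar> <= \<epsilon>'" for p s :: "real \<times> (real ^ 'd)"
    proof -
      have "norm (p - s) <= norm (fst (p - s)) + norm (snd (p - s))"
        using norm_Pair_le[of "fst (p - s)" "snd (p - s)"] by (simp only: prod.collapse)
      also have "norm (snd (p - s)) <= (\<Sum>k\<in>UNIV. \<bar>snd (p - s) $ k\<bar>)" by (rule norm_le_l1_cart)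
      also have "... <= (\<Sum>k\<in>(UNIV :: 'd set). \<epsilon>')" using that(2) by (intro sum_mono) simp
      finally show ?thesis using that(1) by (simp add: distrib_right)
    qed
    have dom: "\<bar>w j * q j i * t\<bar> <= h j" if "\<bar>t\<bar> <= \<rho> j ^ m" "2 * i + m <= 2 * n + 2" for j i m t
    proof -
      have "\<rho> j ^ (2 * i) * \<bar>t\<bar> <= \<rho> j ^ (2 * i) * \<rho> j ^ m" using that(1) \<rho>0[of j] by (intro mult_left_mono) auto
      also have "... = \<rho> j ^ (2 * i + m)" by (simp add: power_add)
      also have "... <= 1 + r j ^ (2 * n + 2)" by (rule power_le_one_plus[OF \<rho>0 \<rho>r that(2)])
      finally have "\<bar>w j\<bar> * (\<rho> j ^ (2 * i) * \<bar>t\<bar>) <= \<bar>w j\<bar> * (1 + r j ^ (2 * n + 2))" by (intro mult_left_mono) auto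
      then show ?thesis by (simp add: abs_mult absq h_def mult.assoc)
    qed
    have \<kappa>\<rho>: "\<bar>\<kappa> j $ l\<bar> <= \<rho> j" for j l unfolding \<rho>_def by (rule component_le_norm_cart)
    have \<kappa>\<rho>2: "\<bar>\<kappa> j $ k * \<kappa> j $ l\<bar> <= (\<rho> j)^2" for j k l
      unfolding abs_mult power2_eq_square using \<kappa>\<rho> \<rho>0 by (intro mult_mono) auto
    have tail: "\<bar>wave v \<kappa> p x - (\<Sum>j\<in>F. v j * cos (\<kappa> j \<bullet> x + p))\<bar> <= \<epsilon>'" if "\<And>j. \<bar>v j\<bar> <= h j" for v p x
      by (rule order_trans[OF wave_tail[OF hB that F(1)] FB])
    have c1: "cos (t + (0 + pi / 2)) = - sin t" for t :: real using minus_sin_cos_eq[of t] by simp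
    have c2: "cos (t + (0 + pi / 2 + pi / 2)) = - cos t" for t :: real by simp
    have wq: "w j * (- (norm (\<kappa> j))\<^sup>2) ^ i = w j * q j i" for j i by (simp add: q_def \<rho>_def)
    fix x :: "real ^ 'd" and i assume i: "i < n"
    let ?S = "(\<Sum>j\<in>F. (w j * q j i * cos (\<kappa> j \<bullet> x), - (w j * q j i * sin (\<kappa> j \<bullet> x)) *\<^sub>R \<kappa> j))"
    show "norm (U_field w \<kappa> x i - c i - (\<Sum>j\<in>F. ?V j x i)) <= (1 + real CARD('d)) * \<epsilon>'"
    proof -
      have "c i + (\<Sum>j\<in>F. ?V j x i) = (\<Sum>j\<in>F. cos (\<kappa> j \<bullet> x) *\<^sub>R (w j *\<^sub>R P j i) + sin (\<kappa> j \<bullet> x) *\<^sub>R (w j *\<^sub>R Q j i))"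
        unfolding c_def z sum.distrib[symmetric] by (intro sum.cong refl) (simp add: scaleR_diff_left algebra_simps)
      also have "... = ?S"
        using i by (intro sum.cong refl) (simp add: P_def Q_def)
      finally have eq: "U_field w \<kappa> x i - c i - (\<Sum>j\<in>F. ?V j x i) =
          U_field w \<kappa> x i - ?S"
        by (simp add: algebra_simps)
      show ?thesis
        unfolding eq
      proof (rule pair)
        show "\<bar>fst (U_field w \<kappa> x i) - fst ?S\<bar> <= \<epsilon>'"
          using tail[of "\<lambda>j. w j * q j i" 0 x] dom[of 1 _ 0 i] i by (simp add: U_field_def wq fst_sum)
        fix k
        have "\<bar>wave (\<lambda>j. w j * q j i * \<kappa> j $ k) \<kappa> (0 + pi / 2) x - (\<Sum>j\<in>F. w j * q j i * \<kappa> j $ k * cos (\<kappa> j \<bullet> x + (0 + pi / 2)))\<bar> <= \<epsilon>'"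
          by (rule tail, rule dom[of _ _ 1]) (use i \<kappa>\<rho> in simp_all)
        then show "\<bar>snd (U_field w \<kappa> x i) $ k - snd ?S $ k\<bar> <= \<epsilon>'"
          unfolding c1 by (simp add: U_field_def wq snd_sum mult_ac)
      qed
    qed
    fix l
    let ?T = "(\<Sum>j\<in>F. (- (w j * q j i * \<kappa> j $ l * sin (\<kappa> j \<bullet> x)), - (w j * q j i * \<kappa> j $ l * cos (\<kappa> j \<bullet> x)) *\<^sub>R \<kappa> j))"
    show "norm (U_deriv w \<kappa> l x i - (\<Sum>j\<in>F. ?D j l x i)) <= (1 + real CARD('d)) * \<epsilon>'"
    proof -
      have "(\<Sum>j\<in>F. ?D j l x i) = ?T"
      proof (intro sum.cong refl)
        fix j
        have "- r j * sin (r j * (\<eta> j \<bullet> x)) * \<eta> j $ l = - sin (\<kappa> j \<bullet> x) * \<kappa> j $ l"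
          "r j * cos (r j * (\<eta> j \<bullet> x)) * \<eta> j $ l = cos (\<kappa> j \<bullet> x) * \<kappa> j $ l"
          unfolding z r\<eta>l[symmetric] by (simp_all add: mult_ac)
        then show "?D j l x i = (- (w j * q j i * \<kappa> j $ l * sin (\<kappa> j \<bullet> x)), - (w j * q j i * \<kappa> j $ l * cos (\<kappa> j \<bullet> x)) *\<^sub>R \<kappa> j)"
          using i by (simp only:) (simp add: P_def Q_def mult_ac)
      qed
      then show ?thesis
      proof (simp only:, intro pair)
        have "\<bar>wave (\<lambda>j. w j * q j i * \<kappa> j $ l) \<kappa> (0 + pi / 2) x - (\<Sum>j\<in>F. w j * q j i * \<kappa> j $ l * cos (\<kappa> j \<bullet> x + (0 + pi / 2)))\<bar> <= \<epsilon>'"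
          by (rule tail, rule dom[of _ _ 1]) (use i \<kappa>\<rho> in simp_all)
        then show "\<bar>fst (U_deriv w \<kappa> l x i) - fst ?T\<bar> <= \<epsilon>'"
          unfolding c1 by (simp add: U_deriv_def wq fst_sum)
        fix k
        have "\<bar>wave (\<lambda>j. w j * q j i * (\<kappa> j $ k * \<kappa> j $ l)) \<kappa> (0 + pi / 2 + pi / 2) x - (\<Sum>j\<in>F. w j * q j i * (\<kappa> j $ k * \<kappa> j $ l) * cos (\<kappa> j \<bullet> x + (0 + pi / 2 + pi / 2)))\<bar> <= \<epsilon>'"
          by (rule tail, rule dom[of _ _ 2]) (use i \<kappa>\<rho>2 in simp_all)
        then show "\<bar>snd (U_deriv w \<kappa> l x i) $ k - snd ?T $ k\<bar> <= \<epsilon>'"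
          unfolding c2 by (simp add: U_deriv_def wq snd_sum mult_ac)
      qed
    qed
  qed
  then have "net_within n \<epsilon> (\<lambda>x i. U_field w \<kappa> x i - c i) (U_deriv w \<kappa>) (4 * B)"
  proof (rule net_within_mono[OF _ _ order_refl])
    have "(1 + real CARD('d)) * \<epsilon>' = \<epsilon> / 2" by (simp add: \<epsilon>'_def field_simps)
    moreover have "(\<Sum>j\<in>F. \<delta> + \<delta>) <= \<epsilon> / 2"
      using e by (simp add: \<delta>_def divide_simps)
    ultimately show "(1 + real CARD('d)) * \<epsilon>' + (\<Sum>j\<in>F. \<delta> + \<delta>) <= \<epsilon>" by simp
  qed
  then show thesis using that cS cN by blast
qed

section \<open>Uniform deviations\<close>

definition deviation :: "'i set => ('i => 'w => 'x) => 'x measure => ('x => real) => 'w => real" where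
  "deviation I X \<rho> h \<omega> = (\<Sum>i\<in>I. h (X i \<omega>)) / real (card I) - (LINT x|\<rho>. h x)"

text \<open>Level \<open>J\<close> is meant to resolve the class up to \<open>K / 2 ^ J\<close>, and
  its size grows exponentially in \<open>J\<close>, as for a Lipschitz image of a cube of fixed
  dimension. \<open>net_limit\<close> singles out the functions approximated at every level.\<close>

definition nets :: "(nat => ('x::topological_space => real) set) => nat => real => bool" where
  "nets G A K \<longleftrightarrow> (\<forall>J. finite (G J) \<and> card (G J) <= A ^ Suc J \<and>
     (\<forall>g\<in>G J. g \<in> borel_measurable borel \<and> (\<forall>x. \<bar>g x\<bar> <= K)))"

definition net_limit :: "(nat => ('x::topological_space => real) set) => real => ('x => real) => bool" where
  "net_limit G K h \<longleftrightarrow> h \<in> borel_measurable borel \<and> (\<forall>x. \<bar>h x\<bar> <= K) \<and>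
     (\<forall>J. \<exists>g\<in>G J. \<forall>x. \<bar>h x - g x\<bar> <= K / 2 ^ J)"

locale iid_sample = prob_space M for M :: "'w measure" +
  fixes I :: "'i set" and X :: "'i => 'w => 'x::topological_space" and \<rho> :: "'x measure"
  assumes finite_I: "finite I" and nonempty_I: "I ~= {}"
    and indep: "indep_vars (\<lambda>_. borel) X I"
    and distr_X: "\<And>i. i \<in> I ==> distr M borel (X i) = \<rho>"
begin

lemma measurable_X: "i \<in> I ==> X i \<in> borel_measurable M"
  using indep unfolding indep_vars_def by auto

lemma card_pos: "real (card I) > 0"
  using finite_I nonempty_I by (simp add: card_gt_0_iff)

lemma sets_rho: "sets \<rho> = sets borel"
  using distr_X nonempty_I by (metis ex_in_conv sets_distr)

lemma prob_space_rho: "prob_space \<rho>"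
  using distr_X nonempty_I measurable_X prob_space_distr by (metis ex_in_conv)

lemma integrable_rho:
  fixes h :: "'x => real"
  assumes "h \<in> borel_measurable borel" "\<And>x. \<bar>h x\<bar> <= K"
  shows "integrable \<rho> h"
proof -
  interpret R: prob_space \<rho> by (rule prob_space_rho)
  show ?thesis
    using assms by (intro R.integrable_const_bound[of _ K]) (auto simp: measurable_cong_sets[OF sets_rho refl])
qed

lemma integral_X:
  fixes h :: "'x => real"
  assumes "i \<in> I" "h \<in> borel_measurable borel"
  shows "(LINT \<omega>|M. h (X i \<omega>)) = (LINT x|\<rho>. h x)"
  using integral_distr[OF measurable_X[OF assms(1)] assms(2)] distr_X[OF assms(1)] by simp

lemma measurable_deviation [measurable]:
  assumes "h \<in> borel_measurable borel"
  shows "deviation I X \<rho> h \<in> borel_measurable M"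
  unfolding deviation_def using measurable_X assms by measurable

lemma deviation_uminus: "deviation I X \<rho> (\<lambda>x. - h x) \<omega> = - deviation I X \<rho> h \<omega>"
  by (simp add: deviation_def sum_negf)

lemma deviation_cmult: "deviation I X \<rho> (\<lambda>x. c * h x) \<omega> = c * deviation I X \<rho> h \<omega>"
  by (simp add: deviation_def sum_distrib_left right_diff_distrib)

lemma deviation_add:
  assumes "integrable \<rho> h" "integrable \<rho> k"
  shows "deviation I X \<rho> (\<lambda>x. h x + k x) \<omega> = deviation I X \<rho> h \<omega> + deviation I X \<rho> k \<omega>"
  using assms by (simp add: deviation_def sum.distrib add_divide_distrib)

lemma deviation_sum:
  assumes "finite T" "\<And>t. t \<in> T ==> integrable \<rho> (h t)"
  shows "deviation I X \<rho> (\<lambda>x. \<Sum>t\<in>T. h t x) \<omega> = (\<Sum>t\<in>T. deviation I X \<rho> (h t) \<omega>)"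
  using assms
proof (induction T rule: finite_induct)
  case (insert t T)
  then show ?case using deviation_add[of "h t" "\<lambda>x. \<Sum>t\<in>T. h t x"] by simp
qed (simp add: deviation_def)

lemma deviation_bound:
  assumes "h \<in> borel_measurable borel" "\<And>x. \<bar>h x\<bar> <= s"
  shows "\<bar>deviation I X \<rho> h \<omega>\<bar> <= 2 * s"
proof -
  interpret R: prob_space \<rho> by (rule prob_space_rho)
  have "\<bar>\<Sum>i\<in>I. h (X i \<omega>)\<bar> <= real (card I) * s"
    using sum_norm_bound[of I "\<lambda>i. h (X i \<omega>)" s] assms by simp
  then have "\<bar>(\<Sum>i\<in>I. h (X i \<omega>)) / real (card I)\<bar> <= s"
    using card_pos by (simp add: abs_divide divide_le_eq mult.commute)
  moreover have "\<bar>LINT x|\<rho>. h x\<bar> <= s"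
  proof -
    have "s >= 0" using assms(2)[of undefined] by linarith
    have "\<bar>LINT x|\<rho>. h x\<bar> <= (LINT x|\<rho>. \<bar>h x\<bar>)"
      by simp
    also have "... <= (LINT x|\<rho>. s)"
      using assms \<open>s >= 0\<close> by (intro integral_mono integrable_rho[of _ s]) auto
    finally show ?thesis by (simp add: R.prob_space)
  qed
  ultimately show ?thesis unfolding deviation_def by linarith
qed

text \<open>Independence factorises the exponential, Hoeffding's lemma treats each factor, and the
  scale \<open>sqrt (card I) / s\<close> is chosen so that the product stays bounded independently
  of the sample size.\<close>

lemma exp_deviation_one_sided:
  assumes h: "h \<in> borel_measurable borel" "\<And>x. \<bar>h x\<bar> <= s" and s: "s > 0"
  shows "(\<integral>\<^sup>+\<omega>. ennreal (exp (sqrt (card I) / s * deviation I X \<rho> h \<omega>)) \<partial>M) <= ennreal 2"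
proof -
  define l where "l = 1 / (s * sqrt (card I))"
  define \<mu> where "\<mu> = (LINT x|\<rho>. h x)"
  note N = card_pos
  have l: "l > 0" using s N by (simp add: l_def)
  have sq: "sqrt (card I) * sqrt (card I) = real (card I)" by simp
  have eq: "sqrt (card I) / s * deviation I X \<rho> h \<omega> = (\<Sum>i\<in>I. l * (h (X i \<omega>) - \<mu>))" for \<omega>
  proof -
    have alg: "1 / (s * r) * (a - r * r * \<mu>) = r / s * (a / (r * r) - \<mu>)" if "r > 0" for a r
      using s that by (simp add: field_simps)
    have "(\<Sum>i\<in>I. l * (h (X i \<omega>) - \<mu>)) = l * ((\<Sum>i\<in>I. h (X i \<omega>)) - real (card I) * \<mu>)"
      by (simp add: sum_distrib_left[symmetric] sum_subtractf)
    also have "... = sqrt (card I) / s * ((\<Sum>i\<in>I. h (X i \<omega>)) / real (card I) - \<mu>)"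
      using alg[of "sqrt (card I)" "\<Sum>i\<in>I. h (X i \<omega>)"] N by (simp add: l_def)
    finally show ?thesis by (simp add: deviation_def \<mu>_def)
  qed
  have "(\<integral>\<^sup>+\<omega>. ennreal (exp (sqrt (card I) / s * deviation I X \<rho> h \<omega>)) \<partial>M) =
      (\<integral>\<^sup>+\<omega>. (\<Prod>i\<in>I. ennreal (exp (l * (h (X i \<omega>) - \<mu>)))) \<partial>M)"
    unfolding eq by (simp add: exp_sum finite_I prod_ennreal)
  also have "... = (\<Prod>i\<in>I. \<integral>\<^sup>+\<omega>. ennreal (exp (l * (h (X i \<omega>) - \<mu>))) \<partial>M)"
  proof (rule indep_vars_nn_integral[OF finite_I])
    show "indep_vars (\<lambda>_. borel) (\<lambda>i \<omega>. ennreal (exp (l * (h (X i \<omega>) - \<mu>)))) I"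
      by (rule indep_vars_compose2[OF indep, of "\<lambda>_ x. ennreal (exp (l * (h x - \<mu>)))"]) (use h in measurable)
  qed simp
  also have "... <= (\<Prod>i\<in>I. ennreal (exp (l^2 * (s - (-s))^2 / 8)))"
  proof (rule prod_mono_ennreal)
    fix i assume i: "i \<in> I"
    have "(\<lambda>\<omega>. h (X i \<omega>)) \<in> borel_measurable M"
      using measurable_compose[OF measurable_X[OF i] h(1)] .
    moreover have "AE \<omega> in M. h (X i \<omega>) \<in> {-s..s}"
      using h(2) by (auto simp: abs_le_iff minus_le_iff)
    ultimately interpret interval_bounded_random_variable M "\<lambda>\<omega>. h (X i \<omega>)" "-s" s
      by unfold_locales
    show "(\<integral>\<^sup>+\<omega>. ennreal (exp (l * (h (X i \<omega>) - \<mu>))) \<partial>M) <= ennreal (exp (l^2 * (s - (-s))^2 / 8))"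
      using Hoeffdings_lemma_nn_integral[OF l] by (simp add: integral_X[OF i h(1)] \<mu>_def)
  qed
  also have "... = ennreal (exp (1 / 2))"
  proof -
    have "l^2 * (s - (-s))^2 / 8 = 1 / (2 * real (card I))"
      using s N by (simp add: l_def power_divide power_mult_distrib)
    then show ?thesis
      using N by (simp add: prod_ennreal exp_of_nat_mult[symmetric] ennreal_power)
  qed
  also have "... <= ennreal 2"
  proof (rule ennreal_leI)
    have "exp (1/2::real) <= 1 + 1/2 + (1/2)^2"
      by (rule exp_bound) auto
    then show "exp (1/2::real) <= 2" by (simp add: power2_eq_square)
  qed
  finally show ?thesis .
qed

lemma exp_deviation:
  assumes h: "h \<in> borel_measurable borel" "\<And>x. \<bar>h x\<bar> <= s" and s: "s > 0"
  shows "(\<integral>\<^sup>+\<omega>. ennreal (exp (sqrt (card I) / s * \<bar>deviation I X \<rho> h \<omega>\<bar>)) \<partial>M) <= ennreal 4"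
proof -
  let ?c = "sqrt (card I) / s" and ?D = "deviation I X \<rho> h"
  have D [measurable]: "?D \<in> borel_measurable M" using h by measurable
  have "(\<integral>\<^sup>+\<omega>. ennreal (exp (?c * \<bar>?D \<omega>\<bar>)) \<partial>M) \<le>
      (\<integral>\<^sup>+\<omega>. ennreal (exp (?c * ?D \<omega>)) + ennreal (exp (?c * - ?D \<omega>)) \<partial>M)"
  proof (rule nn_integral_mono)
    fix \<omega>
    have "exp (?c * \<bar>?D \<omega>\<bar>) <= exp (?c * ?D \<omega>) + exp (?c * - ?D \<omega>)"
      by (cases "?D \<omega> >= 0") auto
    then have "ennreal (exp (?c * \<bar>?D \<omega>\<bar>)) <= ennreal (exp (?c * ?D \<omega>) + exp (?c * - ?D \<omega>))"
      by (rule ennreal_leI)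
    then show "ennreal (exp (?c * \<bar>?D \<omega>\<bar>)) <= ennreal (exp (?c * ?D \<omega>)) + ennreal (exp (?c * - ?D \<omega>))"
      by (subst (asm) ennreal_plus) (rule exp_ge_zero exp_ge_zero)+
  qed
  also have "... = (\<integral>\<^sup>+\<omega>. ennreal (exp (?c * ?D \<omega>)) \<partial>M) + (\<integral>\<^sup>+\<omega>. ennreal (exp (?c * - ?D \<omega>)) \<partial>M)"
    by (rule nn_integral_add) auto
  also have "... <= ennreal 2 + ennreal 2"
    using exp_deviation_one_sided[OF h s] exp_deviation_one_sided[of "\<lambda>x. - h x" s] h s
    by (intro add_mono) (auto simp: deviation_uminus)
  also have "... = ennreal 4" by (subst ennreal_plus[symmetric]) auto
  finally show ?thesis .
qed

text \<open>The inequality \<open>x <= exp x / a + ln a\<close> turns the maximum over the class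
  into a sum of exponentials plus a logarithm. \<open>Y\<close> dominates at every outcome, so no
  maximiser has to be selected measurably.\<close>

lemma finite_class_deviation:
  assumes S: "finite S" "real (card S) <= a" "a >= 1" and s: "s > 0"
    and h: "\<And>h. h \<in> S ==> h \<in> borel_measurable borel" "\<And>h x. h \<in> S ==> \<bar>h x\<bar> <= s"
  shows "\<exists>Y\<in>borel_measurable M. (\<integral>\<^sup>+\<omega>. Y \<omega> \<partial>M) <= ennreal (s / sqrt (card I) * (4 + ln a)) \<and>
    (\<forall>h\<in>S. \<forall>\<omega>. ennreal \<bar>deviation I X \<rho> h \<omega>\<bar> <= Y \<omega>)"
proof -
  let ?c = "s / sqrt (card I)"
  let ?e = "\<lambda>h \<omega>. exp (sqrt (card I) / s * \<bar>deviation I X \<rho> h \<omega>\<bar>)"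
  define Y where "Y \<omega> = ennreal (?c / a) * (\<Sum>h\<in>S. ennreal (?e h \<omega>)) + ennreal (?c * ln a)" for \<omega>
  have c: "?c > 0" using s card_pos by simp
  have Ym: "Y \<in> borel_measurable M"
    unfolding Y_def using h by measurable
  have "(\<integral>\<^sup>+\<omega>. Y \<omega> \<partial>M) = ennreal (?c / a) * (\<Sum>h\<in>S. \<integral>\<^sup>+\<omega>. ennreal (?e h \<omega>) \<partial>M) + ennreal (?c * ln a)"
    unfolding Y_def using h
    by (subst nn_integral_add) (auto simp: nn_integral_cmult nn_integral_sum emeasure_space_1 simp del: sum_ennreal)
  also have "... <= ennreal (?c / a) * (\<Sum>h\<in>S. ennreal 4) + ennreal (?c * ln a)"
    using h s by (intro add_mono mult_left_mono sum_mono exp_deviation) auto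
  also have "... = ennreal (?c / a * (4 * card S)) + ennreal (?c * ln a)"
  proof -
    have "(\<Sum>h\<in>S. ennreal 4) = ennreal (4 * card S)"
      by (subst sum_ennreal) (auto simp: mult.commute)
    moreover have "ennreal (?c / a) * ennreal (4 * card S) = ennreal (?c / a * (4 * card S))"
      using s S by (intro ennreal_mult[symmetric] divide_nonneg_nonneg) auto
    ultimately show ?thesis by (simp only:)
  qed
  also have "... = ennreal (?c / a * (4 * card S) + ?c * ln a)"
    using s S by (intro ennreal_plus[symmetric] mult_nonneg_nonneg divide_nonneg_nonneg) auto
  also have "... <= ennreal (?c * (4 + ln a))"
  proof (rule ennreal_leI)
    have "?c / a * (4 * card S) <= ?c / a * (4 * a)"
      using s S by (intro mult_left_mono divide_nonneg_nonneg) auto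
    also have "... = ?c * 4" using S by simp
    finally show "?c / a * (4 * card S) + ?c * ln a <= ?c * (4 + ln a)"
      by (simp add: distrib_left)
  qed
  finally have 1: "(\<integral>\<^sup>+\<omega>. Y \<omega> \<partial>M) <= ennreal (?c * (4 + ln a))" .
  have 2: "ennreal \<bar>deviation I X \<rho> h \<omega>\<bar> <= Y \<omega>" if "h \<in> S" for h \<omega>
  proof -
    let ?r = "sqrt (card I) / s * \<bar>deviation I X \<rho> h \<omega>\<bar>"
    have "?r - ln a <= exp (?r - ln a)"
      using exp_ge_add_one_self[of "?r - ln a"] by linarith
    then have "?r <= exp ?r / a + ln a"
      using S by (simp add: exp_diff)
    then have "?c * ?r <= ?c * (exp ?r / a + ln a)"
      using c by (intro mult_left_mono) auto
    moreover have "?c * ?r = \<bar>deviation I X \<rho> h \<omega>\<bar>"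
      using s card_pos by simp
    ultimately have "\<bar>deviation I X \<rho> h \<omega>\<bar> <= ?c / a * ?e h \<omega> + ?c * ln a"
      by (simp add: algebra_simps)
    then have "ennreal \<bar>deviation I X \<rho> h \<omega>\<bar> <= ennreal (?c / a * ?e h \<omega> + ?c * ln a)"
      by (rule ennreal_leI)
    also have "... = ennreal (?c / a * ?e h \<omega>) + ennreal (?c * ln a)"
      using s S by (intro ennreal_plus mult_nonneg_nonneg divide_nonneg_nonneg) auto
    also have "ennreal (?c / a * ?e h \<omega>) = ennreal (?c / a) * ennreal (?e h \<omega>)"
      using s S by (intro ennreal_mult divide_nonneg_nonneg) auto
    also have "ennreal (?c / a) * ennreal (?e h \<omega>) + ennreal (?c * ln a) <= Y \<omega>"
      unfolding Y_def using S that
      by (intro add_mono mult_left_mono member_le_sum[where f = "\<lambda>h. ennreal (?e h \<omega>)"] order_refl) simp_all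
    finally show ?thesis .
  qed
  show ?thesis using Ym 1 2 by blast
qed

end

context iid_sample
begin

lemma deviation_lincomb:
  assumes "finite T" "\<And>t. t \<in> T ==> integrable \<rho> (h t)"
  shows "deviation I X \<rho> (\<lambda>x. \<Sum>t\<in>T. c t * h t x) \<omega> = (\<Sum>t\<in>T. c t * deviation I X \<rho> (h t) \<omega>)"
  using assms by (subst deviation_sum) (auto simp: deviation_cmult)

text \<open>Every \<open>h\<close> is its level 0 approximation plus the increments between
  successive levels. Increments at level \<open>J\<close> have size at most
  \<open>2 * K / 2 ^ J\<close> and there are at most \<open>A ^ (2 * J + 3)\<close> of them, so the
  contributions given by \<open>finite_class_deviation\<close> are summable over \<open>J\<close>,
  and each carries the factor \<open>K / sqrt (card I)\<close>.\<close>

lemma chaining: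
  assumes G: "nets G A K" and A: "A >= 1" and K: "K > 0"
  shows "\<exists>Z\<in>borel_measurable M.
    (\<integral>\<^sup>+\<omega>. Z \<omega> \<partial>M) <= ennreal (K / sqrt (card I) * (40 + 40 * ln A)) \<and>
    (\<forall>h. net_limit G K h --> (\<forall>\<omega>. ennreal \<bar>deviation I X \<rho> h \<omega>\<bar> <= Z \<omega>))"
proof -
  have finG: "finite (G J)" and cardG: "card (G J) <= A ^ Suc J"
    and measG: "g \<in> G J ==> g \<in> borel_measurable borel" and boundG: "g \<in> G J ==> \<bar>g x\<bar> <= K" for J g x
    using G by (auto simp: nets_def)
  define s where "s J = 2 * K / 2 ^ J" for J :: nat
  define D where "D J = (\<lambda>(g, g') x. g' x - g x) ` {(g, g') \<in> G J \<times> G (Suc J). \<forall>x. \<bar>g' x - g x\<bar> <= s J}" for J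
  define a where "a J = real A ^ (2 * J + 3)" for J
  have sqN: "sqrt (card I) > 0" using card_pos by simp
  have spos: "s J > 0" for J using K by (simp add: s_def)
  have lnA: "ln A >= 0" using A by simp
  have "\<exists>Y\<in>borel_measurable M. (\<integral>\<^sup>+\<omega>. Y \<omega> \<partial>M) <= ennreal (s J / sqrt (card I) * (4 + ln (a J))) \<and>
    (\<forall>h\<in>D J. \<forall>\<omega>. ennreal \<bar>deviation I X \<rho> h \<omega>\<bar> <= Y \<omega>)" for J
  proof (rule finite_class_deviation)
    let ?S = "{(g, g') \<in> G J \<times> G (Suc J). \<forall>x. \<bar>g' x - g x\<bar> <= s J}"
    have fin: "finite (G J \<times> G (Suc J))" using finG by simp
    then show "finite (D J)"
      unfolding D_def by (intro finite_imageI) (auto intro: finite_subset[of _ "G J \<times> G (Suc J)"])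
    have "card (D J) <= card ?S"
      unfolding D_def by (intro card_image_le finite_subset[OF _ fin]) auto
    also have "... <= card (G J \<times> G (Suc J))"
      by (intro card_mono fin) auto
    also have "... <= A ^ Suc J * A ^ Suc (Suc J)"
      unfolding card_cartesian_product by (intro mult_le_mono cardG)
    also have "... = A ^ (2 * J + 3)"
      by (subst power_add[symmetric]) (rule arg_cong[where f = "\<lambda>n. A ^ n"], simp)
    finally have "card (D J) <= A ^ (2 * J + 3)" .
    then show "real (card (D J)) <= a J"
      unfolding a_def by (metis of_nat_le_iff of_nat_power)
    show "1 <= a J" unfolding a_def using A by (intro one_le_power) simp
    show "h \<in> borel_measurable borel" if "h \<in> D J" for h
      using that measG by (auto simp: D_def)
    show "\<bar>h x\<bar> <= s J" if "h \<in> D J" for h x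
      using that by (auto simp: D_def)
  qed (rule spos)
  then obtain Y where Ym: "\<And>J. Y J \<in> borel_measurable M"
    and YE: "\<And>J. (\<integral>\<^sup>+\<omega>. Y J \<omega> \<partial>M) <= ennreal (s J / sqrt (card I) * (4 + ln (a J)))"
    and Yd: "\<And>J h \<omega>. h \<in> D J ==> ennreal \<bar>deviation I X \<rho> h \<omega>\<bar> <= Y J \<omega>"
    by metis
  have "\<exists>Y\<in>borel_measurable M. (\<integral>\<^sup>+\<omega>. Y \<omega> \<partial>M) <= ennreal (K / sqrt (card I) * (4 + ln A)) \<and>
    (\<forall>h\<in>G 0. \<forall>\<omega>. ennreal \<bar>deviation I X \<rho> h \<omega>\<bar> <= Y \<omega>)"
    using finG[of 0] cardG[of 0] A K measG boundG by (intro finite_class_deviation) auto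
  then obtain Y0 where Y0m: "Y0 \<in> borel_measurable M"
    and Y0E: "(\<integral>\<^sup>+\<omega>. Y0 \<omega> \<partial>M) <= ennreal (K / sqrt (card I) * (4 + ln A))"
    and Y0d: "\<And>h \<omega>. h \<in> G 0 ==> ennreal \<bar>deviation I X \<rho> h \<omega>\<bar> <= Y0 \<omega>"
    by metis
  define Z where "Z \<omega> = Y0 \<omega> + (\<Sum>J. Y J \<omega>)" for \<omega>
  have Zm: "Z \<in> borel_measurable M"
    unfolding Z_def using Ym Y0m by measurable
  \<comment> \<open>The logarithm of the number of increments grows linearly in \<open>J\<close>;
    bounding it by a power of \<open>3 / 2\<close> makes the series geometric with ratio
    \<open>3 / 4\<close>.\<close>
  have lin: "2 * real J + 3 <= 4 * (3 / 2) ^ J" for J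
  proof (induction J)
    case (Suc J)
    have "(1::real) <= (3/2) ^ J" by simp
    moreover have "2 * (1 + r) + 3 <= 4 * (3 / 2 * x)" if "1 <= x" "2 * r + 3 <= 4 * x" for r x :: real
      using that by argo
    ultimately show ?case using Suc unfolding power_Suc of_nat_Suc by blast
  qed simp
  define B where "B J = 2 * K / sqrt (card I) * (4 * (1/2) ^ J + 4 * ln A * (3/4) ^ J)" for J
  have Bs: "B sums (2 * K / sqrt (card I) * (4 * 2 + 4 * ln A * 4))"
    unfolding B_def
    using geometric_sums[of "1/2 :: real"] geometric_sums[of "3/4 :: real"]
    by (intro sums_mult sums_add) (auto simp: field_simps)
  have Bb: "s J / sqrt (card I) * (4 + ln (a J)) <= B J" for J
  proof -
    have e: "(1/2::real) ^ J * (3/2) ^ J = (3/4) ^ J"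
      by (simp flip: power_mult_distrib)
    have "ln (a J) = (2 * real J + 3) * ln A"
      using A by (simp add: a_def ln_realpow add.commute)
    also have "... <= 4 * (3/2) ^ J * ln A"
      using lin lnA by (intro mult_right_mono)
    finally have "s J / sqrt (card I) * (4 + ln (a J)) <= s J / sqrt (card I) * (4 + 4 * (3/2) ^ J * ln A)"
      using spos[of J] sqN by (intro mult_left_mono) auto
    also have "... = B J"
      unfolding B_def e[symmetric] by (simp add: s_def power_one_over field_simps)
    finally show ?thesis .
  qed
  have B0: "B J >= 0" for J
    using K lnA by (simp add: B_def)
  have "(\<integral>\<^sup>+\<omega>. Z \<omega> \<partial>M) = (\<integral>\<^sup>+\<omega>. Y0 \<omega> \<partial>M) + (\<Sum>J. \<integral>\<^sup>+\<omega>. Y J \<omega> \<partial>M)"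
    unfolding Z_def using Ym Y0m by (simp add: nn_integral_add nn_integral_suminf)
  also have "... <= ennreal (K / sqrt (card I) * (4 + ln A)) + (\<Sum>J. ennreal (B J))"
    by (intro add_mono Y0E suminf_le order_trans[OF YE ennreal_leI[OF Bb]]) auto
  also have "(\<Sum>J. ennreal (B J)) = ennreal (2 * K / sqrt (card I) * (4 * 2 + 4 * ln A * 4))"
    using Bs B0 by (simp add: suminf_ennreal2 sums_iff)
  also have "ennreal (K / sqrt (card I) * (4 + ln A)) + ... =
      ennreal (K / sqrt (card I) * (4 + ln A) + 2 * K / sqrt (card I) * (4 * 2 + 4 * ln A * 4))"
    using K lnA by (intro ennreal_plus[symmetric]) auto
  also have "... <= ennreal (K / sqrt (card I) * (40 + 40 * ln A))"
  proof (rule ennreal_leI)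
    have "K / sqrt (card I) * (4 + ln A) + 2 * K / sqrt (card I) * (4 * 2 + 4 * ln A * 4) =
        K / sqrt (card I) * (20 + 33 * ln A)"
      by (simp add: algebra_simps add_divide_distrib)
    also have "... <= K / sqrt (card I) * (40 + 40 * ln A)"
      using K lnA by (intro mult_left_mono) auto
    finally show "K / sqrt (card I) * (4 + ln A) + 2 * K / sqrt (card I) * (4 * 2 + 4 * ln A * 4) \<le>
        K / sqrt (card I) * (40 + 40 * ln A)" .
  qed
  finally have ZE: "(\<integral>\<^sup>+\<omega>. Z \<omega> \<partial>M) <= ennreal (K / sqrt (card I) * (40 + 40 * ln A))" .
  have Zd: "ennreal \<bar>deviation I X \<rho> h \<omega>\<bar> <= Z \<omega>" if h: "net_limit G K h" for h \<omega>
  proof -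
    have hm: "h \<in> borel_measurable borel" and hb: "\<And>x. \<bar>h x\<bar> <= K"
      using h by (auto simp: net_limit_def)
    obtain g where gG: "\<And>J. g J \<in> G J" and gh: "\<And>J x. \<bar>h x - g J x\<bar> <= K / 2 ^ J"
      using h unfolding net_limit_def by metis
    have int: "integrable \<rho> (g J)" "integrable \<rho> h" for J
      using integrable_rho measG[OF gG] boundG[OF gG] hm hb by blast+
    let ?d = "\<lambda>h. deviation I X \<rho> h \<omega>"
    have step: "ennreal \<bar>?d (g J)\<bar> <= Y0 \<omega> + (\<Sum>j<J. Y j \<omega>)" for J
    proof (induction J)
      case 0
      then show ?case using Y0d[OF gG] by simp
    next
      case (Suc J)
      let ?k = "\<lambda>x. g (Suc J) x - g J x"
      have "\<bar>g (Suc J) x - g J x\<bar> <= s J" for x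
      proof -
        have "\<bar>g (Suc J) x - g J x\<bar> <= K / 2 ^ Suc J + K / 2 ^ J"
          using gh[of x "Suc J"] gh[of x J] by linarith
        also have "... <= K / 2 ^ J + K / 2 ^ J"
          using K by (intro add_mono divide_left_mono) auto
        finally show ?thesis by (simp add: s_def)
      qed
      then have "?k \<in> D J"
        unfolding D_def using gG by (intro image_eqI[of _ _ "(g J, g (Suc J))"]) auto
      then have k: "ennreal \<bar>?d ?k\<bar> <= Y J \<omega>" by (rule Yd)
      have "?d (\<lambda>x. g J x + ?k x) = ?d (g J) + ?d ?k"
        using int by (intro deviation_add) auto
      then have "\<bar>?d (g (Suc J))\<bar> <= \<bar>?d (g J)\<bar> + \<bar>?d ?k\<bar>" by simp
      then have "ennreal \<bar>?d (g (Suc J))\<bar> <= ennreal \<bar>?d (g J)\<bar> + ennreal \<bar>?d ?k\<bar>"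
        by (simp add: ennreal_leI ennreal_plus[symmetric] del: ennreal_plus)
      also have "... <= (Y0 \<omega> + (\<Sum>j<J. Y j \<omega>)) + Y J \<omega>"
        by (intro add_mono Suc.IH k)
      finally show ?case by (simp add: add.assoc)
    qed
    have le: "ennreal \<bar>?d (g J)\<bar> <= Z \<omega>" for J
      using step[of J] sum_le_suminf[of "\<lambda>J. Y J \<omega>" "{..<J}"] unfolding Z_def
      by (auto intro: order_trans add_left_mono)
    \<comment> \<open>Deviations are continuous in the supremum norm, so the bound for the
      approximations passes to \<open>h\<close> at the same outcome.\<close>
    have "(\<lambda>J. ?d (g J)) \<longlonglongrightarrow> ?d h"
    proof (rule LIMSEQ_I)
      have lim: "(\<lambda>J. 2 * (K / 2 ^ J)) \<longlonglongrightarrow> 0"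
        by (rule tendsto_mult_right_zero, rule LIMSEQ_divide_realpow_zero) simp
      fix e :: real assume "e > 0"
      then obtain J0 where J0: "\<And>J. J >= J0 ==> 2 * (K / 2 ^ J) < e"
        using LIMSEQ_D[OF lim \<open>e > 0\<close>] K by auto
      show "\<exists>no. \<forall>n\<ge>no. norm (?d (g n) - ?d h) < e"
      proof (intro exI allI impI)
        fix n assume "J0 <= n"
        have "?d (\<lambda>x. h x + (g n x - h x)) = ?d h + ?d (\<lambda>x. g n x - h x)"
          using int by (intro deviation_add) auto
        moreover have "\<bar>?d (\<lambda>x. g n x - h x)\<bar> <= 2 * (K / 2 ^ n)"
          using gh measG[OF gG] hm by (intro deviation_bound) (auto simp: abs_minus_commute)
        ultimately show "norm (?d (g n) - ?d h) < e"
          using J0[OF \<open>J0 <= n\<close>] by simp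
      qed
    qed
    then have "(\<lambda>J. ennreal \<bar>?d (g J)\<bar>) \<longlonglongrightarrow> ennreal \<bar>?d h\<bar>"
      by (intro tendsto_ennrealI tendsto_rabs)
    then show ?thesis
      by (rule LIMSEQ_le_const2) (use le in auto)
  qed
  show ?thesis using Zm ZE Zd by blast
qed

lemma nets_products:
  assumes G: "nets G A K" and K: "K >= 0"
  shows "nets (\<lambda>J. (\<lambda>(g, g') x. g x * g' x) ` (G J \<times> G J)) (A^2) (2 * K^2)"
  unfolding nets_def
proof (intro allI conjI ballI)
  fix J
  have fin: "finite (G J)" and c: "card (G J) <= A ^ Suc J" using G by (auto simp: nets_def)
  show "finite ((\<lambda>(g, g') x. g x * g' x) ` (G J \<times> G J))" using fin by simp
  have "card ((\<lambda>(g, g') x. g x * g' x) ` (G J \<times> G J)) <= card (G J \<times> G J)"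
    using fin by (intro card_image_le) auto
  also have "... <= A ^ Suc J * A ^ Suc J"
    unfolding card_cartesian_product using c by (intro mult_le_mono)
  also have "... = (A^2) ^ Suc J" by (simp add: power2_eq_square power_mult_distrib)
  finally show "card ((\<lambda>(g, g') x. g x * g' x) ` (G J \<times> G J)) <= (A^2) ^ Suc J" .
next
  fix J p assume "p \<in> (\<lambda>(g, g') x. g x * g' x) ` (G J \<times> G J)"
  then obtain g g' where p: "p = (\<lambda>x. g x * g' x)" "g \<in> G J" "g' \<in> G J" by auto
  then have m: "g \<in> borel_measurable borel" "g' \<in> borel_measurable borel"
    and b: "\<And>x. \<bar>g x\<bar> <= K" "\<And>x. \<bar>g' x\<bar> <= K"
    using G by (auto simp: nets_def)
  show "p \<in> borel_measurable borel" unfolding p using m by simp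
  fix x
  have "\<bar>p x\<bar> <= K * K" unfolding p abs_mult using b K by (intro mult_mono) auto
  then show "\<bar>p x\<bar> <= 2 * K^2" using K by (simp add: power2_eq_square)
qed

text \<open>In the difference of products each factor changes by at most \<open>K / 2 ^ J\<close>
  while the other is bounded by \<open>K\<close>, which explains \<open>2 * K^2\<close>.\<close>

lemma net_limit_product:
  assumes G: "nets G A K" and K: "K >= 0" and h: "net_limit G K h" "net_limit G K h'"
  shows "net_limit (\<lambda>J. (\<lambda>(g, g') x. g x * g' x) ` (G J \<times> G J)) (2 * K^2) (\<lambda>x. h x * h' x)"
  unfolding net_limit_def
proof (intro conjI allI)
  have hb: "\<And>x. \<bar>h x\<bar> <= K" "\<And>x. \<bar>h' x\<bar> <= K" using h by (auto simp: net_limit_def)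
  show "(\<lambda>x. h x * h' x) \<in> borel_measurable borel"
    using h unfolding net_limit_def by (intro borel_measurable_times) auto
  show "\<bar>h x * h' x\<bar> <= 2 * K^2" for x
  proof -
    have "\<bar>h x * h' x\<bar> <= K * K" unfolding abs_mult using hb K by (intro mult_mono) auto
    then show ?thesis using K by (simp add: power2_eq_square)
  qed
  fix J
  obtain g g' where g: "g \<in> G J" "g' \<in> G J" "\<And>x. \<bar>h x - g x\<bar> <= K / 2 ^ J" "\<And>x. \<bar>h' x - g' x\<bar> <= K / 2 ^ J"
    using h unfolding net_limit_def by metis
  have gb: "\<bar>g' x\<bar> <= K" for x using G g by (auto simp: nets_def)
  have "\<bar>h x * h' x - g x * g' x\<bar> <= 2 * K^2 / 2 ^ J" for x
  proof -
    have "h x * h' x - g x * g' x = h x * (h' x - g' x) + (h x - g x) * g' x"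
      by (simp add: algebra_simps)
    then have "\<bar>h x * h' x - g x * g' x\<bar> <= \<bar>h x\<bar> * \<bar>h' x - g' x\<bar> + \<bar>h x - g x\<bar> * \<bar>g' x\<bar>"
      by (metis abs_mult abs_triangle_ineq)
    also have "... <= K * (K / 2 ^ J) + (K / 2 ^ J) * K"
      using hb gb g K by (intro add_mono mult_mono) auto
    finally show ?thesis by (simp add: power2_eq_square)
  qed
  with g show "\<exists>p\<in>(\<lambda>(g, g') x. g x * g' x) ` (G J \<times> G J). \<forall>x. \<bar>h x * h' x - p x\<bar> <= 2 * K^2 / 2 ^ J"
    by (intro bexI[of _ "\<lambda>x. g x * g' x"]) auto
qed

text \<open>Squared combinations expand into products of two elements of the class, so a single
  majorant for the products controls all of them at the cost of the squared sum of the
  coefficients.\<close>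

lemma quadratic_deviation:
  assumes G: "nets G A K" and A: "A >= 1" and K: "K > 0" and one: "net_limit G K (\<lambda>_. 1)"
  shows "\<exists>Z\<in>borel_measurable M.
    (\<integral>\<^sup>+\<omega>. Z \<omega> \<partial>M) <= ennreal (2 * K^2 / sqrt (card I) * (40 + 80 * ln A)) \<and>
    (\<forall>(T :: 't set) q (v :: 't => 'v::real_inner). finite T --> (\<forall>t\<in>T. net_limit G K (q t)) -->
      (\<forall>\<omega>. ennreal \<bar>deviation I X \<rho> (\<lambda>x. (norm (\<Sum>t\<in>T. q t x *\<^sub>R v t))^2) \<omega>\<bar>
        <= ennreal ((\<Sum>t\<in>T. norm (v t))^2) * Z \<omega>)) \<and>
    (\<forall>(T :: 't set) q (c :: 't => real). finite T --> (\<forall>t\<in>T. net_limit G K (q t)) -->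
      (\<forall>\<omega>. ennreal \<bar>deviation I X \<rho> (\<lambda>x. \<Sum>t\<in>T. q t x * c t) \<omega>\<bar>
        <= ennreal (\<Sum>t\<in>T. \<bar>c t\<bar>) * Z \<omega>))"
proof -
  let ?G = "\<lambda>J. (\<lambda>(g, g') x. g x * g' x) ` (G J \<times> G J)"
  obtain Z where Z: "Z \<in> borel_measurable M"
    "(\<integral>\<^sup>+\<omega>. Z \<omega> \<partial>M) <= ennreal (2 * K^2 / sqrt (card I) * (40 + 40 * ln (real (A^2))))"
    "\<And>h \<omega>. net_limit ?G (2 * K^2) h ==> ennreal \<bar>deviation I X \<rho> h \<omega>\<bar> <= Z \<omega>"
  proof -
    have "A^2 >= 1" using A by (rule one_le_power)
    moreover have "2 * K^2 > 0" using K by simp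
    ultimately show ?thesis
      using chaining[OF nets_products[OF G less_imp_le[OF K]]] that by blast
  qed
  have lnA: "40 * ln (real (A^2)) = 80 * ln A"
  proof -
    have "real A > 0" using A by simp
    then have "ln (real A ^ 2) = 2 * ln (real A)" by (subst ln_realpow) simp_all
    then show ?thesis by (simp only: of_nat_power)
  qed
  have int: "integrable \<rho> h" if "net_limit G' K' h" for G' K' h
    using that integrable_rho unfolding net_limit_def by blast
  have quad: "ennreal \<bar>deviation I X \<rho> (\<lambda>x. (norm (\<Sum>t\<in>T. q t x *\<^sub>R v t))^2) \<omega>\<bar>
        <= ennreal ((\<Sum>t\<in>T. norm (v t))^2) * Z \<omega>"
    if T: "finite T" and q: "\<forall>t\<in>T. net_limit G K (q t)" for T :: "'t set" and q and v :: "'t => 'v" and \<omega>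
  proof -
    let ?h = "\<lambda>p x. q (fst p) x * q (snd p) x" and ?c = "\<lambda>p. v (fst p) \<bullet> v (snd p)"
    have lim: "net_limit ?G (2 * K^2) (?h p)" if "p \<in> T \<times> T" for p
      using net_limit_product[OF G] K q that by auto
    have "(norm (\<Sum>t\<in>T. q t x *\<^sub>R v t))^2 = (\<Sum>p\<in>T \<times> T. ?c p * ?h p x)" for x
    proof -
      have "(norm (\<Sum>t\<in>T. q t x *\<^sub>R v t))^2 = (\<Sum>t\<in>T. \<Sum>t'\<in>T. ?c (t, t') * ?h (t, t') x)"
        unfolding power2_norm_eq_inner inner_sum_left inner_sum_right by (simp add: mult_ac inner_commute)
      also have "... = (\<Sum>p\<in>T \<times> T. ?c p * ?h p x)"
        by (subst sum.cartesian_product) (simp add: case_prod_beta')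
      finally show ?thesis .
    qed
    then have "deviation I X \<rho> (\<lambda>x. (norm (\<Sum>t\<in>T. q t x *\<^sub>R v t))^2) \<omega> =
        (\<Sum>p\<in>T \<times> T. ?c p * deviation I X \<rho> (?h p) \<omega>)"
      using deviation_lincomb[of "T \<times> T" ?h ?c] T int[OF lim] by simp
    also have "\<bar>...\<bar> <= (\<Sum>p\<in>T \<times> T. norm (v (fst p)) * norm (v (snd p)) * \<bar>deviation I X \<rho> (?h p) \<omega>\<bar>)"
      by (rule order_trans[OF sum_abs]) (auto intro!: sum_mono mult_right_mono Cauchy_Schwarz_ineq2 simp: abs_mult)
    finally have "ennreal \<bar>deviation I X \<rho> (\<lambda>x. (norm (\<Sum>t\<in>T. q t x *\<^sub>R v t))^2) \<omega>\<bar> \<le>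
        ennreal (\<Sum>p\<in>T \<times> T. norm (v (fst p)) * norm (v (snd p)) * \<bar>deviation I X \<rho> (?h p) \<omega>\<bar>)"
      by (rule ennreal_leI)
    also have "... = (\<Sum>p\<in>T \<times> T. ennreal (norm (v (fst p)) * norm (v (snd p))) * ennreal \<bar>deviation I X \<rho> (?h p) \<omega>\<bar>)"
      by (subst sum_ennreal[symmetric]) (auto simp: ennreal_mult)
    also have "... <= (\<Sum>p\<in>T \<times> T. ennreal (norm (v (fst p)) * norm (v (snd p))) * Z \<omega>)"
      using lim Z by (intro sum_mono mult_left_mono) auto
    also have "... = ennreal (\<Sum>p\<in>T \<times> T. norm (v (fst p)) * norm (v (snd p))) * Z \<omega>"
      by (subst sum_distrib_right[symmetric], subst sum_ennreal) auto
    also have "(\<Sum>p\<in>T \<times> T. norm (v (fst p)) * norm (v (snd p))) = (\<Sum>t\<in>T. norm (v t))^2"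
      by (simp add: power2_eq_square sum_product sum.cartesian_product case_prod_beta')
    finally show ?thesis .
  qed
  have lin: "ennreal \<bar>deviation I X \<rho> (\<lambda>x. \<Sum>t\<in>T. q t x * c t) \<omega>\<bar> <= ennreal (\<Sum>t\<in>T. \<bar>c t\<bar>) * Z \<omega>"
    if T: "finite T" and q: "\<forall>t\<in>T. net_limit G K (q t)" for T :: "'t set" and q and c :: "'t => real" and \<omega>
  proof -
    \<comment> \<open>A single feature is its product with the constant 1, so the majorant for
      products also serves linear expressions.\<close>
    have lim: "net_limit ?G (2 * K^2) (q t)" if "t \<in> T" for t
      using net_limit_product[OF G _ _ one, of "q t"] K q that by auto
    have "deviation I X \<rho> (\<lambda>x. \<Sum>t\<in>T. c t * q t x) \<omega> = (\<Sum>t\<in>T. c t * deviation I X \<rho> (q t) \<omega>)"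
      using T int[OF lim] by (intro deviation_lincomb)
    then have "\<bar>deviation I X \<rho> (\<lambda>x. \<Sum>t\<in>T. q t x * c t) \<omega>\<bar> = \<bar>\<Sum>t\<in>T. c t * deviation I X \<rho> (q t) \<omega>\<bar>"
      by (simp add: mult.commute)
    also have "... <= (\<Sum>t\<in>T. \<bar>c t\<bar> * \<bar>deviation I X \<rho> (q t) \<omega>\<bar>)"
      by (rule order_trans[OF sum_abs]) (simp add: abs_mult)
    finally have "ennreal \<bar>deviation I X \<rho> (\<lambda>x. \<Sum>t\<in>T. q t x * c t) \<omega>\<bar> \<le>
        ennreal (\<Sum>t\<in>T. \<bar>c t\<bar> * \<bar>deviation I X \<rho> (q t) \<omega>\<bar>)"
      by (rule ennreal_leI)
    also have "... = (\<Sum>t\<in>T. ennreal \<bar>c t\<bar> * ennreal \<bar>deviation I X \<rho> (q t) \<omega>\<bar>)"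
      by (subst sum_ennreal[symmetric]) (auto simp: ennreal_mult)
    also have "... <= (\<Sum>t\<in>T. ennreal \<bar>c t\<bar> * Z \<omega>)"
      using lim Z by (intro sum_mono mult_left_mono) auto
    also have "... = ennreal (\<Sum>t\<in>T. \<bar>c t\<bar>) * Z \<omega>"
      by (subst sum_distrib_right[symmetric], subst sum_ennreal) auto
    finally show ?thesis .
  qed
  show ?thesis
    by (intro bexI[OF _ Z(1)] conjI allI impI, rule Z(2)[unfolded lnA])
      (rule quad, assumption, assumption, rule lin, assumption, assumption)
qed

end

section \<open>Features of the loss\<close>

lemma has_grad_const: "has_grad (\<lambda>_. c) (\<lambda>_. 0)"
  by (simp add: has_grad_def)

lemma has_grad_add:
  assumes "has_grad v g" "has_grad w k"
  shows "has_grad (\<lambda>x. v x + w x) (\<lambda>x. g x + k x)"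
  using assms unfolding has_grad_def
  by (auto intro!: continuous_intros has_derivative_eq_rhs[OF has_derivative_add] simp: inner_add_left)

lemma has_grad_diff:
  assumes "has_grad v g" "has_grad w k"
  shows "has_grad (\<lambda>x. v x - w x) (\<lambda>x. g x - k x)"
  using assms unfolding has_grad_def
  by (auto intro!: continuous_intros has_derivative_eq_rhs[OF has_derivative_diff] simp: inner_diff_left)

lemma has_grad_sum:
  assumes "\<And>j. j \<in> J ==> has_grad (v j) (g j)"
  shows "has_grad (\<lambda>x. \<Sum>j\<in>J. v j x) (\<lambda>x. \<Sum>j\<in>J. g j x)"
  using assms by (induction J rule: infinite_finite_induct) (auto simp: has_grad_const intro!: has_grad_add)

lemma has_grad_ReQU:
  "has_grad (\<lambda>x. ReQU (W \<bullet> x + b) * s) (\<lambda>x. (2 * relu (W \<bullet> x + b) * s) *\<^sub>R W)"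
  unfolding has_grad_def
proof (intro conjI allI)
  show "continuous_on UNIV (\<lambda>x. (2 * relu (W \<bullet> x + b) * s) *\<^sub>R W)"
    by (intro continuous_intros)
  fix x
  have 1: "((\<lambda>x. W \<bullet> x + b) has_derivative (\<lambda>h. W \<bullet> h)) (at x)"
    by (auto intro!: derivative_eq_intros)
  have 2: "(ReQU has_derivative (\<lambda>h. 2 * relu (W \<bullet> x + b) * h)) (at (W \<bullet> x + b))"
    using ReQU_has_real_derivative by (simp add: has_field_derivative_def)
  have "((\<lambda>x. ReQU (W \<bullet> x + b) * s) has_derivative (\<lambda>h. (2 * relu (W \<bullet> x + b) * (W \<bullet> h)) * s)) (at x)"
    by (rule has_derivative_mult_left[OF has_derivative_compose[OF 1 2]])
  then show "((\<lambda>x. ReQU (W \<bullet> x + b) * s) has_derivative (\<lambda>h. ((2 * relu (W \<bullet> x + b) * s) *\<^sub>R W) \<bullet> h)) (at x)"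
    by (rule has_derivative_eq_rhs) (simp add: fun_eq_iff)
qed

text \<open>The arguments of \<open>D\<close> are the direction of differentiation, the point and the component.\<close>

definition C1_field :: "nat => (real ^ 'd => 'd::finite state) => ('d => real ^ 'd => 'd state) => bool" where
  "C1_field n E D \<longleftrightarrow> (\<forall>i<n. has_grad (\<lambda>x. fst (E x i)) (\<lambda>x. \<chi> l. fst (D l x i)) \<and>
     (\<forall>k. has_grad (\<lambda>x. snd (E x i) $ k) (\<lambda>x. \<chi> l. snd (D l x i) $ k)))"

lemma C1_field_fst: "C1_field n E D ==> i < n ==> has_grad (\<lambda>x. fst (E x i)) (\<lambda>x. \<chi> l. fst (D l x i))"
  and C1_field_snd: "C1_field n E D ==> i < n ==> has_grad (\<lambda>x. snd (E x i) $ k) (\<lambda>x. \<chi> l. snd (D l x i) $ k)"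
  by (simp_all add: C1_field_def)

lemma C1_field_diff:
  assumes "C1_field n E D" "C1_field n E' D'"
  shows "C1_field n (\<lambda>x i. E x i - E' x i) (\<lambda>l x i. D l x i - D' l x i)"
  unfolding C1_field_def
proof (intro allI impI conjI)
  fix i k assume i: "i < n"
  show "has_grad (\<lambda>x. fst (E x i - E' x i)) (\<lambda>x. \<chi> l. fst (D l x i - D' l x i))"
    using has_grad_diff[OF C1_field_fst[OF assms(1) i] C1_field_fst[OF assms(2) i]]
    by (simp add: minus_vec_def)
  show "has_grad (\<lambda>x. snd (E x i - E' x i) $ k) (\<lambda>x. \<chi> l. snd (D l x i - D' l x i) $ k)"
    using has_grad_diff[OF C1_field_snd[OF assms(1) i] C1_field_snd[OF assms(2) i], of k k]
    by (simp add: minus_vec_def)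
qed

lemma C1_field_network: "C1_field n (network m c a W b) (net_deriv m a W b)"
  unfolding C1_field_def
proof (intro allI impI conjI)
  fix i k assume i: "i < n"
  have "has_grad (\<lambda>x. fst (c i) + (\<Sum>j<m. ReQU (W j \<bullet> x + b j) * fst (a j i)))
      (\<lambda>x. 0 + (\<Sum>j<m. (2 * relu (W j \<bullet> x + b j) * fst (a j i)) *\<^sub>R W j))"
    by (intro has_grad_add has_grad_const has_grad_sum has_grad_ReQU)
  moreover have "(\<lambda>x. 0 + (\<Sum>j<m. (2 * relu (W j \<bullet> x + b j) * fst (a j i)) *\<^sub>R W j)) = (\<lambda>x. \<chi> l. fst (net_deriv m a W b l x i))"
    by (simp add: net_deriv_def fst_sum vec_eq_iff fun_eq_iff mult_ac)
  ultimately show "has_grad (\<lambda>x. fst (network m c a W b x i)) (\<lambda>x. \<chi> l. fst (net_deriv m a W b l x i))"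
    by (simp add: network_def fst_sum)
  have "has_grad (\<lambda>x. snd (c i) $ k + (\<Sum>j<m. ReQU (W j \<bullet> x + b j) * (snd (a j i) $ k)))
      (\<lambda>x. 0 + (\<Sum>j<m. (2 * relu (W j \<bullet> x + b j) * (snd (a j i) $ k)) *\<^sub>R W j))"
    by (intro has_grad_add has_grad_const has_grad_sum has_grad_ReQU)
  moreover have "(\<lambda>x. 0 + (\<Sum>j<m. (2 * relu (W j \<bullet> x + b j) * (snd (a j i) $ k)) *\<^sub>R W j)) = (\<lambda>x. \<chi> l. snd (net_deriv m a W b l x i) $ k)"
    by (simp add: net_deriv_def snd_sum vec_eq_iff fun_eq_iff mult_ac)
  ultimately show "has_grad (\<lambda>x. snd (network m c a W b x i) $ k) (\<lambda>x. \<chi> l. snd (net_deriv m a W b l x i) $ k)"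
    by (simp add: network_def snd_sum)
qed

lemma C1_field_U:
  assumes m: "moments (2 * n + 2) w \<kappa>"
  shows "C1_field n (U_field w \<kappa>) (U_deriv w \<kappa>)"
  unfolding C1_field_def
proof (intro allI impI conjI)
  fix i k assume i: "i < n"
  have m4: "moments 4 (\<lambda>j. w j * (- (norm (\<kappa> j))\<^sup>2) ^ i) \<kappa>"
    by (rule moments_laplace, rule moments_mono[OF m]) (use i in simp)
  have m3: "moments 3 (\<lambda>j. w j * (- (norm (\<kappa> j))\<^sup>2) ^ i) \<kappa>" by (rule moments_mono[OF m4]) simp
  show "has_grad (\<lambda>x. fst (U_field w \<kappa> x i)) (\<lambda>x. \<chi> l. fst (U_deriv w \<kappa> l x i))"
    using has_grad_wave[OF m3, of 0] by (simp add: U_field_def U_deriv_def)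
  have "moments 3 (\<lambda>j. w j * (- (norm (\<kappa> j))\<^sup>2) ^ i * \<kappa> j $ k) \<kappa>"
    by (rule moments_component) (use m4 in \<open>simp add: eval_nat_numeral\<close>)
  from has_grad_wave[OF this, of "0 + pi / 2"]
  show "has_grad (\<lambda>x. snd (U_field w \<kappa> x i) $ k) (\<lambda>x. \<chi> l. snd (U_deriv w \<kappa> l x i) $ k)"
    by (simp add: U_field_def U_deriv_def)
qed

text \<open>The residual operator with the derivative passed as a separate argument. In this form it
  is linear in the pair of field and derivative, which the sampling and covering arguments rely
  on.\<close>

definition P_feat :: "nat => (real ^ 'd => 'd::finite state) => ('d => real ^ 'd => 'd state) => real ^ 'd => nat => (real ^ 'd) \<times> real" where
  "P_feat n E D x i = ((\<chi> l. fst (D l x i)) - snd (E x i),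
     (\<Sum>l\<in>UNIV. snd (D l x i) $ l) - (if Suc i < n then fst (E x (Suc i)) else 0))"

text \<open>The coefficients of trace and flux; they merge the three boundary operators into one
  formula, so that most estimates treat the boundary conditions together.\<close>

fun bc0 :: "bc => real" where "bc0 Dirichlet = 1" | "bc0 Neumann = 0" | "bc0 Robin = 1"
fun bc1 :: "bc => real" where "bc1 Dirichlet = 0" | "bc1 Neumann = 1" | "bc1 Robin = 1"

lemma bc_bounds: "\<bar>bc0 \<alpha>\<bar> <= 1" "\<bar>bc1 \<alpha>\<bar> <= 1"
  by (cases \<alpha>; simp)+

definition S_feat :: "bc => (real ^ 'd => 'd::finite state) => real ^ 'd => real ^ 'd => nat => real" where
  "S_feat \<alpha> E \<nu> x i = bc0 \<alpha> * fst (E x i) + bc1 \<alpha> * (\<nu> \<bullet> snd (E x i))"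

lemma S_op_feat: "S_op \<alpha> v x i = S_feat \<alpha> v (outer_normal x) x i"
  by (cases \<alpha>) (simp_all add: S_feat_def)

lemma P_op_feat:
  assumes v: "C1_field n v D" and i: "i < n" and x: "x \<in> cube"
  shows "P_op n v x i = P_feat n v D x i"
proof -
  have "gradient (phi v i) x = (\<chi> l. fst (D l x i))"
    by (rule gradient_cube[OF C1_field_fst[OF v i] _ x]) simp
  moreover have "divergence (psi v i) x = (\<Sum>l\<in>UNIV. snd (D l x i) $ l)"
    unfolding divergence_def
  proof (rule sum.cong[OF refl])
    fix l
    show "partial l (\<lambda>y. snd (v y i) $ l) x = snd (D l x i) $ l"
      by (subst partial_cube[OF C1_field_snd[OF v i] _ x]) simp_all
  qed
  ultimately show ?thesis by (simp add: P_op_def P_feat_def)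
qed

lemma P_feat_lincomb:
  assumes "finite J"
  shows "P_feat n (\<lambda>x i. \<Sum>j\<in>J. c j *\<^sub>R E j x i) (\<lambda>l x i. \<Sum>j\<in>J. c j *\<^sub>R D j l x i) x i =
    (\<Sum>j\<in>J. c j *\<^sub>R P_feat n (E j) (D j) x i)"
proof (rule prod_eqI)
  show "fst (P_feat n (\<lambda>x i. \<Sum>j\<in>J. c j *\<^sub>R E j x i) (\<lambda>l x i. \<Sum>j\<in>J. c j *\<^sub>R D j l x i) x i) =
      fst (\<Sum>j\<in>J. c j *\<^sub>R P_feat n (E j) (D j) x i)"
    by (simp add: P_feat_def fst_sum snd_sum vec_eq_iff sum_subtractf algebra_simps)
  have "(\<Sum>l\<in>UNIV. \<Sum>j\<in>J. c j * snd (D j l x i) $ l) = (\<Sum>j\<in>J. \<Sum>l\<in>UNIV. c j * snd (D j l x i) $ l)"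
    by (rule sum.swap)
  then show "snd (P_feat n (\<lambda>x i. \<Sum>j\<in>J. c j *\<^sub>R E j x i) (\<lambda>l x i. \<Sum>j\<in>J. c j *\<^sub>R D j l x i) x i) =
      snd (\<Sum>j\<in>J. c j *\<^sub>R P_feat n (E j) (D j) x i)"
    by (simp add: P_feat_def fst_sum snd_sum sum_subtractf right_diff_distrib sum_distrib_left)
qed

lemma S_feat_lincomb:
  "S_feat \<alpha> (\<lambda>x i. \<Sum>j\<in>J. c j *\<^sub>R E j x i) \<nu> x i = (\<Sum>j\<in>J. c j * S_feat \<alpha> (E j) \<nu> x i)"
  by (simp add: S_feat_def fst_sum snd_sum inner_sum_right sum_distrib_left sum.distrib algebra_simps)

text \<open>All terms of the loss are squared norms of linear features, integrated against a
  probability measure: \<open>r < n\<close> for the equations, \<open>n \<le> r < 2 n\<close> for the boundary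
  conditions and \<open>r = 2 n\<close> for the mean.\<close>

definition feat :: "bc => nat => (real ^ 'd => 'd::finite state) => ('d => real ^ 'd => 'd state) => nat => real ^ 'd => (real ^ 'd) \<times> real" where
  "feat \<alpha> n E D r x = (if r < n then P_feat n E D x r
     else if r < 2 * n then (0, S_feat \<alpha> E (outer_normal x) x (r - n))
     else (0, cint (\<lambda>y. fst (E y 0))))"

definition feat_measure :: "nat => nat => (real ^ 'd) measure" where
  "feat_measure n r = (if n <= r \<and> r < 2 * n then boundary_measure else cube_measure)"

definition feat_weight :: "bc => nat => real => real => real => nat => real" where
  "feat_weight \<alpha> n d lam mu r = (if r < n then 1 else if r < 2 * n then 2 * d * lam
     else if \<alpha> = Neumann then mu else 0)"

text \<open>\<open>E\<close> stands for an error field, network minus exact solution. The exact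
  solution satisfies the equations and boundary conditions, so the data do not appear and the zero
  field has loss zero.\<close>

definition population_loss :: "bc => nat => real => real => (real ^ 'd => 'd::finite state) => ('d => real ^ 'd => 'd state) => real" where
  "population_loss \<alpha> n lam mu E D = (\<Sum>r<2 * n + 1. feat_weight \<alpha> n (real CARD('d)) lam mu r *
     (LINT x|feat_measure n r. (norm (feat \<alpha> n E D r x))^2))"

lemma sum_split_features:
  fixes h :: "nat => real"
  shows "(\<Sum>r<2 * n + 1. h r) = (\<Sum>i<n. h i) + (\<Sum>i<n. h (n + i)) + h (2 * n)"
proof -
  have "(\<Sum>r<n + n. h r) = (\<Sum>i<n. h i) + (\<Sum>i<n. h (n + i))"
    using sum_concat[where f = h and g = "\<lambda>i. h (n + i)" and m = n and k = n]
    by (simp add: sum.cong[of "{..<n + n}" _ "\<lambda>j. if j < n then h j else h (n + (j - n))" h])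
  then show ?thesis by (simp add: mult_2)
qed

lemma population_loss_split:
  fixes E :: "real ^ 'd => 'd::finite state"
  shows "population_loss \<alpha> n lam mu E D = (\<Sum>i<n. cint (\<lambda>x. (norm (P_feat n E D x i))^2)) +
    (\<Sum>i<n. lam * (2 * real CARD('d) * (LINT x|boundary_measure. (S_feat \<alpha> E (outer_normal x) x i)^2))) +
    (if \<alpha> = Neumann then mu * (cint (\<lambda>x. fst (E x 0)))^2 else 0)"
  unfolding population_loss_def sum_split_features
  by (simp add: feat_weight_def feat_measure_def feat_def norm_Pair mult_ac)

lemma measurable_outer_normal: "(\<lambda>x :: real ^ 'd. outer_normal x $ l) \<in> borel_measurable borel"
  unfolding outer_normal_def by simp

lemma abs_outer_normal_le: "\<bar>outer_normal x $ l\<bar> <= 1"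
  by (simp add: outer_normal_def)

lemma C1_field_continuous:
  assumes "C1_field n E D" "i < n"
  shows "continuous_on UNIV (\<lambda>x. fst (E x i))" "continuous_on UNIV (\<lambda>x. snd (E x i))"
    "continuous_on UNIV (\<lambda>x. fst (D l x i))" "continuous_on UNIV (\<lambda>x. snd (D l x i))"
proof -
  show "continuous_on UNIV (\<lambda>x. fst (E x i))"
    using C1_field_fst[OF assms] by (rule has_grad_continuous)
  show "continuous_on UNIV (\<lambda>x. snd (E x i))"
    using has_grad_continuous[OF C1_field_snd[OF assms]]
    by (subst continuous_on_componentwise) (auto simp: Basis_vec_def inner_axis)
  show "continuous_on UNIV (\<lambda>x. fst (D l x i))"
    using continuous_on_component[OF has_grad_continuous_grad[OF C1_field_fst[OF assms]], of l] by simp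
  show "continuous_on UNIV (\<lambda>x. snd (D l x i))"
    using continuous_on_component[OF has_grad_continuous_grad[OF C1_field_snd[OF assms]], of _ l]
    by (subst continuous_on_componentwise) (auto simp: Basis_vec_def inner_axis)
qed

text \<open>\<open>outer_normal\<close> jumps between faces. On a single face it is almost
  everywhere a constant unit vector, and replacing it by that vector gives the continuous integrands
  for which the coercivity estimates are stated.\<close>

lemma boundary_term:
  fixes E :: "real ^ 'd => 'd::finite state"
  assumes E: "C1_field n E D" and i: "i < n"
  shows "2 * real CARD('d) * (LINT x|boundary_measure. (S_feat \<alpha> E (outer_normal x) x i)^2) =
    bint (\<lambda>l b x. (bc0 \<alpha> * fst (E x i) + bc1 \<alpha> * ((2 * b - 1) * snd (E x i) $ l))^2)"
proof -
  note c = C1_field_continuous[OF E i]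
  obtain B where B: "\<And>x. x \<in> cube ==> norm (fst (E x i)) <= B" using continuous_bounded_on_cube[OF c(1)] by blast
  obtain C where C: "\<And>x. x \<in> cube ==> norm (snd (E x i)) <= C" using continuous_bounded_on_cube[OF c(2)] by blast
  have inner: "outer_normal x \<bullet> snd (E x i) = (\<Sum>l\<in>UNIV. outer_normal x $ l * snd (E x i) $ l)" for x
    by (simp add: inner_vec_def)
  have m: "(\<lambda>x. S_feat \<alpha> E (outer_normal x) x i) \<in> borel_measurable borel"
    unfolding S_feat_def inner
    by (intro borel_measurable_add borel_measurable_times borel_measurable_sum borel_measurable_const measurable_outer_normal
        continuous_measurable[OF c(1)] continuous_measurable[OF continuous_on_component[OF c(2)]])
  have bound: "\<bar>S_feat \<alpha> E (outer_normal x) x i\<bar> <= B + real CARD('d) * C" if x: "x \<in> cube" for x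
  proof -
    have "\<bar>outer_normal x \<bullet> snd (E x i)\<bar> <= (\<Sum>l\<in>UNIV. \<bar>outer_normal x $ l * snd (E x i) $ l\<bar>)"
      unfolding inner by (rule sum_abs)
    also have "... <= (\<Sum>l\<in>(UNIV :: 'd set). 1 * C)"
      unfolding abs_mult using order_trans[OF component_le_norm_cart C[OF x]]
      by (intro sum_mono mult_mono abs_outer_normal_le) auto
    finally have 1: "\<bar>outer_normal x \<bullet> snd (E x i)\<bar> <= real CARD('d) * C" by simp
    have "\<bar>S_feat \<alpha> E (outer_normal x) x i\<bar> <= \<bar>bc0 \<alpha>\<bar> * \<bar>fst (E x i)\<bar> + \<bar>bc1 \<alpha>\<bar> * \<bar>outer_normal x \<bullet> snd (E x i)\<bar>"
      unfolding S_feat_def abs_mult[symmetric] by (rule abs_triangle_ineq)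
    also have "... <= 1 * B + 1 * (real CARD('d) * C)"
      using B[OF x] 1 by (intro add_mono mult_mono bc_bounds) auto
    finally show ?thesis by simp
  qed
  have "2 * real CARD('d) * (LINT x|boundary_measure. (S_feat \<alpha> E (outer_normal x) x i)^2) =
      (\<Sum>l\<in>UNIV. \<Sum>b\<in>{0,1}. fint l b (\<lambda>x. (S_feat \<alpha> E (outer_normal x) x i)^2))"
  proof (rule integral_boundary_measure)
    show "\<bar>(S_feat \<alpha> E (outer_normal x) x i)\<^sup>2\<bar> <= (B + real CARD('d) * C)^2" if "x \<in> cube" for x
      using power_mono[OF bound[OF that] abs_ge_zero, of 2] by simp
  qed (use m in simp_all)
  also have "... = bint (\<lambda>l b x. (bc0 \<alpha> * fst (E x i) + bc1 \<alpha> * ((2 * b - 1) * snd (E x i) $ l))^2)"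
    unfolding bint_def
  proof (intro sum.cong refl integral_cong_AE)
    fix l :: 'd and b :: real assume b: "b \<in> {0,1}"
    show "AE x in face_measure l b. (S_feat \<alpha> E (outer_normal x) x i)^2 = (bc0 \<alpha> * fst (E x i) + bc1 \<alpha> * ((2 * b - 1) * snd (E x i) $ l))^2"
      using AE_face_measure_normal[OF b, of l] by eventually_elim (simp add: S_feat_def inner_axis' )
    show "(\<lambda>x. (S_feat \<alpha> E (outer_normal x) x i)^2) \<in> borel_measurable (face_measure l b)"
      by (rule measurable_face_measure) (use m in simp)
    show "(\<lambda>x. (bc0 \<alpha> * fst (E x i) + bc1 \<alpha> * ((2 * b - 1) * snd (E x i) $ l))^2) \<in> borel_measurable (face_measure l b)"
      by (intro measurable_face_measure continuous_measurable continuous_intros c)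
  qed
  finally show ?thesis .
qed

lemma has_div_field:
  assumes E: "C1_field n E D" and i: "i < n"
  shows "has_div (\<lambda>x. snd (E x i)) (\<lambda>x. \<Sum>l\<in>UNIV. snd (D l x i) $ l)"
  unfolding has_div_def
  by (rule exI[of _ "\<lambda>k x. \<chi> l. snd (D l x i) $ k"]) (simp add: C1_field_snd[OF assms])

lemma error_fields_C1: "C1_field n E D ==> error_fields n (\<lambda>i x. fst (E x i)) (\<lambda>i x. \<Sum>l\<in>UNIV. snd (D l x i) $ l)
    (\<lambda>i x. \<chi> l. fst (D l x i)) (\<lambda>i x. snd (E x i))"
  by unfold_locales (auto intro: C1_field_fst has_div_field)

lemma continuous_P_feat:
  assumes E: "C1_field n E D" and i: "i < n"
  shows "continuous_on UNIV (\<lambda>x. P_feat n E D x i)"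
proof -
  note c = C1_field_continuous[OF E i]
  have "continuous_on UNIV (\<lambda>x. if Suc i < n then fst (E x (Suc i)) else 0)"
    by (cases "Suc i < n") (simp_all add: C1_field_continuous[OF E])
  then show ?thesis
    unfolding P_feat_def by (intro continuous_intros c)
qed

definition field_error :: "(real ^ 'd => 'd::finite state) => ('d => real ^ 'd => 'd state) => nat => real" where
  "field_error E D k = pair_error (\<lambda>x. fst (E x k)) (\<lambda>x. \<chi> l. fst (D l x k)) (\<lambda>x. snd (E x k)) (\<lambda>x. \<Sum>l\<in>UNIV. snd (D l x k) $ l)"

lemma P_feat_square:
  fixes E :: "real ^ 'd => 'd::finite state"
  assumes E: "C1_field n E D" and i: "i < n"
  shows "cint (\<lambda>x. (norm (P_feat n E D x i))^2) =
    error_fields.A (\<lambda>i x. \<chi> l. fst (D l x i)) (\<lambda>i x. snd (E x i)) i +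
    error_fields.B n (\<lambda>i x. fst (E x i)) (\<lambda>i x. \<Sum>l\<in>UNIV. snd (D l x i) $ l) i"
proof -
  interpret error_fields n "\<lambda>i x. fst (E x i)" "\<lambda>i x. \<Sum>l\<in>UNIV. snd (D l x i) $ l"
    "\<lambda>i x. \<chi> l. fst (D l x i)" "\<lambda>i x. snd (E x i)"
    by (rule error_fields_C1[OF E])
  note [continuous_intros] = has_grad_continuous_grad[OF grad[OF i]] has_div_continuous[OF dive[OF i]]
    has_div_continuous_div[OF dive[OF i]] continuous_next
  have "(norm (P_feat n E D x i))^2 = (norm ((\<chi> l. fst (D l x i)) - snd (E x i)))^2 +
      ((\<Sum>l\<in>UNIV. snd (D l x i) $ l) - next_v i x)\<^sup>2" for x
    by (simp add: P_feat_def next_v_def norm_Pair)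
  then show ?thesis
    unfolding A_def B_def
    by (simp only:, intro Bochner_Integration.integral_add integrable_cube_continuous continuous_intros)
qed

lemma weighted_sum_le:
  fixes P Q lam :: real
  assumes "lam > 0" "P >= 0" "Q >= 0"
  shows "P + Q <= (1 + 1 / lam) * (P + lam * Q)"
proof -
  have "(1 + 1 / lam) * (P + lam * Q) = P + Q + (lam * Q + P / lam)"
    using assms(1) by (simp add: field_simps)
  moreover have "0 <= lam * Q + P / lam" using assms by (intro add_nonneg_nonneg mult_nonneg_nonneg divide_nonneg_nonneg) auto
  ultimately show ?thesis by linarith
qed

lemma constant_chain:
  fixes x y z a b c :: real
  assumes "x <= a * y" "y <= b * z" "a >= 0" "a * b <= c" "z >= 0"
  shows "x <= c * z"
proof -
  have "a * y <= a * (b * z)" using assms(2,3) by (rule mult_left_mono)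
  also have "... <= c * z" using mult_right_mono[OF assms(4,5)] by (simp add: mult.assoc)
  finally show ?thesis using assms(1) by linarith
qed

lemma coercivity:
  fixes n :: nat and lam mu :: real
  assumes lam: "lam > 0" and mu: "mu > 0"
  shows "\<exists>C>0. \<forall>(E :: real ^ 'd => 'd::finite state) D k. C1_field n E D --> k < n -->
    (\<forall>\<alpha>\<in>{Neumann, Robin}. field_error E D k <= C * population_loss \<alpha> n lam mu E D) \<and>
    (\<forall>T \<tau>. (\<forall>i<n. \<forall>x\<in>cube. \<forall>l. \<bar>snd (E x i) $ l\<bar> <= T) --> \<tau> > 0 -->
      field_error E D k <= C * ((1 + T^2 / \<tau>) * population_loss Dirichlet n lam mu E D + \<tau>))"
proof -
  define P where "P = real CARD('d) * 2 ^ CARD('d)"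
  define K where "K = 16 * real CARD('d) * (P + 1)"
  define CR where "CR = 7 * (200 :: real) ^ n"
  define CN where "CN = 7 * (1 + 4 * K * (P + 1)) ^ n * (3 + 4 * real CARD('d))"
  \<comment> \<open>\<open>L\<close> converts unweighted residuals to the loss with penalties
    \<open>lam\<close> and \<open>mu\<close>; \<open>N\<close> absorbs the factor that the sum over
    levels puts before \<open>\<tau>\<close>.\<close>
  define L where "L = (1 + 1 / lam) + 1 / mu"
  define N where "N = real n * real CARD('d) + 1"
  define C where "C = (CR + CN) * L * N"
  have P0: "P >= 0" by (simp add: P_def)
  have K0: "K >= 0" using P0 by (simp add: K_def)
  have CR1: "CR >= 0" by (simp add: CR_def)
  have CR2: "CR > 0" by (simp add: CR_def)
  have CN1: "CN >= 0" unfolding CN_def using K0 P0 by (intro mult_nonneg_nonneg zero_le_power add_nonneg_nonneg) auto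
  have L1: "L >= 1 + 1 / lam" "L >= 1" "L >= 1 / mu" using lam mu by (auto simp: L_def)
  have N1: "N >= 1" by (simp add: N_def)
  have C1: "CR * L * N <= C" "CN * L * N <= C" using CR1 CN1 L1 N1 by (auto simp: C_def algebra_simps)
  have CR_C: "CR * L <= C" "CN * L <= C"
  proof -
    have "CR * L * 1 <= CR * L * N" "CN * L * 1 <= CN * L * N"
      using CR1 CN1 L1 N1 by (intro mult_left_mono mult_nonneg_nonneg; simp)+
    then show "CR * L <= C" "CN * L <= C" using C1 by auto
  qed
  have C0: "C > 0" using CR2 CN1 L1 N1 by (simp add: C_def add_pos_nonneg)
  show ?thesis
  proof (intro exI[of _ C] conjI C0 allI impI)
    fix E :: "real ^ 'd => 'd state" and D k
    assume E: "C1_field n E D" and k: "k < n"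
    interpret error_fields n "\<lambda>i x. fst (E x i)" "\<lambda>i x. \<Sum>l\<in>UNIV. snd (D l x i) $ l"
      "\<lambda>i x. \<chi> l. fst (D l x i)" "\<lambda>i x. snd (E x i)"
      by (rule error_fields_C1[OF E])
    define R where "R = (\<Sum>i<n. A i + B i)"
    define Q where "Q \<alpha> = (\<Sum>i<n. bint (\<lambda>l b x. (bc0 \<alpha> * fst (E x i) + bc1 \<alpha> * ((2 * b - 1) * snd (E x i) $ l))^2))" for \<alpha>
    have R0: "R >= 0" unfolding R_def using A_nonneg B_nonneg by (intro sum_nonneg add_nonneg_nonneg) auto
    have Q0: "Q \<alpha> >= 0" for \<alpha> unfolding Q_def by (intro sum_nonneg bint_nonneg) simp
    have loss: "population_loss \<alpha> n lam mu E D = R + lam * Q \<alpha> + (if \<alpha> = Neumann then mu * (cint (\<lambda>x. fst (E x 0)))^2 else 0)" for \<alpha>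
      unfolding population_loss_split R_def Q_def sum_distrib_left
      using P_feat_square[OF E] boundary_term[OF E] by simp
    have RQ: "R + Q \<alpha> <= (1 + 1 / lam) * (R + lam * Q \<alpha>)" for \<alpha>
      by (rule weighted_sum_le[OF lam R0 Q0])
    have RQL: "R + Q \<alpha> <= L * (R + lam * Q \<alpha>)" for \<alpha>
      using RQ[of \<alpha>] mult_right_mono[OF L1(1), of "R + lam * Q \<alpha>"] R0 Q0[of \<alpha>] lam by simp
    show "\<forall>\<alpha>\<in>{Neumann, Robin}. field_error E D k <= C * population_loss \<alpha> n lam mu E D"
    proof (intro ballI)
      fix \<alpha> assume "\<alpha> \<in> {Neumann, Robin}"
      then consider "\<alpha> = Robin" | "\<alpha> = Neumann" by blast
      then show "field_error E D k <= C * population_loss \<alpha> n lam mu E D"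
      proof cases
        case 1
        have "field_error E D k <= CR * (R + Q Robin)"
          using coercivity_robin[OF k] unfolding field_error_def R_def Q_def CR_def by (simp add: sum.distrib)
        from constant_chain[OF this RQL CR1 CR_C(1)] show ?thesis using R0 Q0 lam by (simp add: loss 1)
      next
        case 2
        let ?m = "(cint (\<lambda>x. fst (E x 0)))^2"
        have "field_error E D k <= CN * ((R + Q Neumann) + ?m)"
          using coercivity_neumann[OF k] unfolding field_error_def R_def Q_def CN_def K_def P_def by (simp add: sum.distrib)
        moreover have "(R + Q Neumann) + ?m <= L * population_loss Neumann n lam mu E D"
        proof -
          have "1 / mu * (mu * ?m) <= L * (mu * ?m)" using L1(3) mu by (intro mult_right_mono) auto
          then show ?thesis using RQL[of Neumann] mu by (simp add: loss distrib_left)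
        qed
        ultimately show ?thesis
          using constant_chain[OF _ _ CN1 CR_C(2)] R0 Q0 lam mu by (simp add: loss 2)
      qed
    qed
    fix T \<tau> :: real
    assume T: "\<forall>i<n. \<forall>x\<in>cube. \<forall>l. \<bar>snd (E x i) $ l\<bar> <= T" and \<tau>: "\<tau> > 0"
    have t1: "1 + T^2 / \<tau> >= 1" using \<tau> by simp
    have "field_error E D k <= CR * (R + ((1 + T^2 / \<tau>) * Q Dirichlet + real n * real CARD('d) * \<tau>))"
      using coercivity_dirichlet[OF k _ \<tau>, of T] T unfolding field_error_def R_def Q_def CR_def
      by (simp add: sum.distrib sum_distrib_left algebra_simps)
    also have "... <= CR * ((1 + T^2 / \<tau>) * R + ((1 + T^2 / \<tau>) * Q Dirichlet + N * \<tau>))"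
      using CR1 mult_right_mono[OF t1 R0] \<tau> by (intro mult_left_mono add_mono mult_right_mono) (auto simp: N_def)
    also have "... = CR * ((1 + T^2 / \<tau>) * (R + Q Dirichlet) + N * \<tau>)" by (simp only: distrib_left add.assoc)
    also have "... <= CR * ((1 + T^2 / \<tau>) * (L * (R + lam * Q Dirichlet)) + N * \<tau>)"
      using t1 CR1 by (intro mult_left_mono add_right_mono RQL) auto
    also have "... = CR * L * ((1 + T^2 / \<tau>) * population_loss Dirichlet n lam mu E D) + CR * N * \<tau>"
    proof -
      have "CR * (c * (L * z) + N * \<tau>) = CR * L * (c * z) + CR * N * \<tau>" for c z by (simp add: algebra_simps)
      moreover have "population_loss Dirichlet n lam mu E D = R + lam * Q Dirichlet" by (simp add: loss)
      ultimately show ?thesis by simp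
    qed
    also have "... <= C * ((1 + T^2 / \<tau>) * population_loss Dirichlet n lam mu E D) + C * \<tau>"
    proof (intro add_mono mult_right_mono CR_C)
      show "0 <= (1 + T^2 / \<tau>) * population_loss Dirichlet n lam mu E D"
        using t1 R0 Q0 lam by (simp add: loss)
      have "CR * N * 1 <= CR * N * L" using CR1 N1 L1 by (intro mult_left_mono mult_nonneg_nonneg) auto
      then show "CR * N <= C" using C1(1) by (simp add: mult_ac)
    qed (use \<tau> in simp)
    finally show "field_error E D k <= C * ((1 + T^2 / \<tau>) * population_loss Dirichlet n lam mu E D + \<tau>)"
      by (simp add: distrib_left)
  qed
qed

text \<open>The Gram matrix adds up the weighted inner products of all features, so one choice of
  indices works for all residuals simultaneously. Centring doubles the bound \<open>K\<close>, hence
  \<open>4 * K^2\<close>.\<close>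

lemma maurey_features:
  fixes f :: "nat => 'j => real ^ 'd => 'v::euclidean_space"
  assumes J: "finite J" "\<And>j. j \<in> J ==> p j >= 0" "(\<Sum>j\<in>J. p j) = 1"
    and R: "finite R"
    and \<rho>: "\<And>r. r \<in> R ==> prob_space (\<rho> r)" "\<And>r. r \<in> R ==> sets (\<rho> r) = sets borel" "\<And>r. r \<in> R ==> AE x in \<rho> r. x \<in> cube"
    and wt: "\<And>r. r \<in> R ==> wt r >= 0"
    and f: "\<And>r j. r \<in> R ==> j \<in> J ==> f r j \<in> borel_measurable borel"
      "\<And>r j x. r \<in> R ==> j \<in> J ==> x \<in> cube ==> norm (f r j x) <= K"
    and m: "m >= 1"
  shows "\<exists>idx. (\<forall>k<m. idx k \<in> J) \<and> (\<Sum>r\<in>R. wt r *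
    (LINT x|\<rho> r. (norm ((\<Sum>k<m. (1 / real m) *\<^sub>R f r (idx k) x) - (\<Sum>j\<in>J. p j *\<^sub>R f r j x)))^2)) <= (\<Sum>r\<in>R. wt r) * (4 * K^2) / real m"
proof -
  define y where "y r x = (\<Sum>j\<in>J. p j *\<^sub>R f r j x)" for r x
  define e where "e r j x = f r j x - y r x" for r j x
  have ym: "y r \<in> borel_measurable borel" if "r \<in> R" for r
    unfolding y_def using f(1)[OF that] by (intro borel_measurable_sum borel_measurable_scaleR) auto
  have em: "e r j \<in> borel_measurable borel" if "r \<in> R" "j \<in> J" for r j
    unfolding e_def using f(1)[OF that] ym[OF that(1)] by (intro borel_measurable_diff) auto
  have yb: "norm (y r x) <= K" if "r \<in> R" "x \<in> cube" for r x
  proof -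
    have "norm (y r x) <= (\<Sum>j\<in>J. norm (p j *\<^sub>R f r j x))" unfolding y_def by (rule norm_sum)
    also have "... <= (\<Sum>j\<in>J. p j * K)"
      using J(2) f(2)[OF that(1) _ that(2)] by (intro sum_mono) (auto intro!: mult_mono)
    also have "... = K" by (simp add: sum_distrib_right[symmetric] J(3))
    finally show ?thesis .
  qed
  have eb: "norm (e r j x) <= 2 * K" if "r \<in> R" "j \<in> J" "x \<in> cube" for r j x
    unfolding e_def using norm_triangle_ineq4[of "f r j x" "y r x"] f(2)[OF that] yb[OF that(1,3)] by linarith
  have int: "integrable (\<rho> r) (\<lambda>x. e r a x \<bullet> e r b x)" if r: "r \<in> R" and ab: "a \<in> J" "b \<in> J" for r a b
  proof (rule integrable_bounded_on_cube[OF \<rho>(1-3)[OF r]])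
    show "(\<lambda>x. e r a x \<bullet> e r b x) \<in> borel_measurable borel"
      by (intro borel_measurable_inner em r ab)
    show "norm (e r a x \<bullet> e r b x) <= 2 * K * (2 * K)" if "x \<in> cube" for x
    proof -
      have "norm (e r a x \<bullet> e r b x) <= norm (e r a x) * norm (e r b x)" using Cauchy_Schwarz_ineq2 by simp
      also have "... <= 2 * K * (2 * K)"
        using eb[OF r ab(1) that] eb[OF r ab(2) that] order_trans[OF norm_ge_zero eb[OF r ab(1) that]] by (intro mult_mono) auto
      finally show ?thesis .
    qed
  qed
  define G where "G a b = (\<Sum>r\<in>R. wt r * (LINT x|\<rho> r. e r a x \<bullet> e r b x))" for a b
  have "\<exists>idx. (\<forall>k<m. idx k \<in> J) \<and> (\<Sum>k<m. \<Sum>l<m. G (idx k) (idx l)) <= real m * ((\<Sum>r\<in>R. wt r) * (4 * K^2))"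
  proof (rule maurey[OF J])
    show "G a b = G b a" for a b unfolding G_def by (simp add: inner_commute)
    show "(\<Sum>b\<in>J. p b * G a b) = 0" if a: "a \<in> J" for a
    proof -
      have z: "(\<Sum>b\<in>J. p b * (e r a x \<bullet> e r b x)) = 0" for r x
      proof -
        have "(\<Sum>b\<in>J. p b *\<^sub>R e r b x) = y r x - (\<Sum>b\<in>J. p b) *\<^sub>R y r x"
          unfolding e_def scaleR_diff_right sum_subtractf scaleR_left.sum[symmetric] by (simp add: y_def)
        also have "... = 0" by (simp add: J(3))
        finally have "e r a x \<bullet> (\<Sum>b\<in>J. p b *\<^sub>R e r b x) = 0" by simp
        then show ?thesis by (simp add: inner_sum_right)
      qed
      have "(\<Sum>b\<in>J. p b * G a b) = (\<Sum>r\<in>R. wt r * (\<Sum>b\<in>J. p b * (LINT x|\<rho> r. e r a x \<bullet> e r b x)))"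
        unfolding G_def sum_distrib_left by (subst sum.swap) (simp add: mult_ac)
      also have "... = (\<Sum>r\<in>R. wt r * (LINT x|\<rho> r. (\<Sum>b\<in>J. p b * (e r a x \<bullet> e r b x))))"
        using int a by (intro sum.cong refl arg_cong2[where f = "(*)"]) (subst Bochner_Integration.integral_sum, auto)
      finally show ?thesis by (simp add: z)
    qed
    show "G a a <= (\<Sum>r\<in>R. wt r) * (4 * K^2)" if a: "a \<in> J" for a
      unfolding G_def sum_distrib_right
    proof (intro sum_mono mult_left_mono wt)
      fix r assume r: "r \<in> R"
      interpret prob_space "\<rho> r" by (rule \<rho>(1)[OF r])
      have "(LINT x|\<rho> r. e r a x \<bullet> e r a x) <= (LINT x|\<rho> r. 4 * K^2)"
      proof (rule integral_mono_AE)
        show "AE x in \<rho> r. e r a x \<bullet> e r a x <= 4 * K^2"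
          using \<rho>(3)[OF r]
        proof eventually_elim
          case (elim x)
          show ?case using power_mono[OF eb[OF r a elim] norm_ge_zero, of 2] by (simp add: power2_norm_eq_inner power_mult_distrib)
        qed
      qed (use int[OF r a a] in simp_all)
      then show "(LINT x|\<rho> r. e r a x \<bullet> e r a x) <= 4 * K^2" by (simp add: prob_space)
    qed
  qed
  then obtain idx where idx: "\<And>k. k < m ==> idx k \<in> J"
    "(\<Sum>k<m. \<Sum>l<m. G (idx k) (idx l)) <= real m * ((\<Sum>r\<in>R. wt r) * (4 * K^2))" by blast
  have sq: "(norm ((\<Sum>k<m. (1 / real m) *\<^sub>R f r (idx k) x) - y r x))^2 =
      (1 / (real m)^2) * (\<Sum>k<m. \<Sum>l<m. e r (idx k) x \<bullet> e r (idx l) x)" for r x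
  proof -
    have "(\<Sum>k<m. (1 / real m) *\<^sub>R f r (idx k) x) - y r x = (1 / real m) *\<^sub>R (\<Sum>k<m. e r (idx k) x)"
      using m unfolding e_def sum_subtractf by (simp add: scaleR_diff_right scaleR_sum_right sum_constant_scaleR)
    then show ?thesis
      unfolding power2_norm_eq_inner by (simp add: inner_sum_left inner_sum_right power2_eq_square sum_divide_distrib)
        (subst sum.swap, simp)
  qed
  have "(\<Sum>r\<in>R. wt r * (LINT x|\<rho> r. (norm ((\<Sum>k<m. (1 / real m) *\<^sub>R f r (idx k) x) - y r x))^2)) =
      (\<Sum>r\<in>R. wt r * ((1 / (real m)^2) * (\<Sum>k<m. \<Sum>l<m. LINT x|\<rho> r. e r (idx k) x \<bullet> e r (idx l) x)))"
  proof (intro sum.cong refl arg_cong2[where f = "(*)"])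
    fix r assume r: "r \<in> R"
    have "(LINT x|\<rho> r. (\<Sum>k<m. \<Sum>l<m. e r (idx k) x \<bullet> e r (idx l) x)) = (\<Sum>k<m. \<Sum>l<m. LINT x|\<rho> r. e r (idx k) x \<bullet> e r (idx l) x)"
    proof -
      have "(LINT x|\<rho> r. (\<Sum>k<m. \<Sum>l<m. e r (idx k) x \<bullet> e r (idx l) x)) = (\<Sum>k<m. LINT x|\<rho> r. (\<Sum>l<m. e r (idx k) x \<bullet> e r (idx l) x))"
        by (rule Bochner_Integration.integral_sum) (auto intro!: Bochner_Integration.integrable_sum int[OF r] idx)
      also have "... = (\<Sum>k<m. \<Sum>l<m. LINT x|\<rho> r. e r (idx k) x \<bullet> e r (idx l) x)"
        by (intro sum.cong refl Bochner_Integration.integral_sum int[OF r] idx) auto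
      finally show ?thesis .
    qed
    then show "(LINT x|\<rho> r. (norm ((\<Sum>k<m. (1 / real m) *\<^sub>R f r (idx k) x) - y r x))^2) =
        (1 / (real m)^2) * (\<Sum>k<m. \<Sum>l<m. LINT x|\<rho> r. e r (idx k) x \<bullet> e r (idx l) x)"
      unfolding sq by simp
  qed
  also have "... = (1 / (real m)^2) * (\<Sum>k<m. \<Sum>l<m. G (idx k) (idx l))"
  proof -
    have "(\<Sum>k<m. \<Sum>l<m. G (idx k) (idx l)) = (\<Sum>r\<in>R. \<Sum>k<m. \<Sum>l<m. wt r * (LINT x|\<rho> r. e r (idx k) x \<bullet> e r (idx l) x))"
      unfolding G_def by (subst sum.swap[of _ _ R], subst sum.swap[of _ _ R], simp)
    then show ?thesis by (simp add: sum_distrib_left mult_ac)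
  qed
  also have "... <= (1 / (real m)^2) * (real m * ((\<Sum>r\<in>R. wt r) * (4 * K^2)))"
    by (intro mult_left_mono idx(2)) simp
  also have "... = (\<Sum>r\<in>R. wt r) * (4 * K^2) / real m"
    using m by (simp add: power2_eq_square)
  finally show ?thesis using idx(1) unfolding y_def by blast
qed

lemma C1_field_bounded:
  assumes E: "C1_field n E D"
  obtains K where "K >= 0" "\<And>x i. x \<in> cube ==> i < n ==> norm (E x i) <= K" "\<And>x i l. x \<in> cube ==> i < n ==> norm (D l x i) <= K"
proof -
  have "\<exists>b. \<forall>x\<in>cube. norm (E x i) <= b" if "i < n" for i
  proof -
    have "continuous_on UNIV (\<lambda>x. E x i)"
      using continuous_on_Pair[OF C1_field_continuous(1,2)[OF E that]] by simp
    then show ?thesis using continuous_bounded_on_cube by metis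
  qed
  then obtain b where b: "\<And>i x. i < n ==> x \<in> cube ==> norm (E x i) <= b i" by metis
  have "\<exists>b. \<forall>x\<in>cube. norm (D l x i) <= b" if "i < n" for i l
  proof -
    have "continuous_on UNIV (\<lambda>x. D l x i)"
      using continuous_on_Pair[OF C1_field_continuous(3)[OF E that, of l] C1_field_continuous(4)[OF E that, of l]] by simp
    then show ?thesis using continuous_bounded_on_cube by metis
  qed
  then obtain c where c: "\<And>i l x. i < n ==> x \<in> cube ==> norm (D l x i) <= c i l" by metis
  define K where "K = (\<Sum>i<n. \<bar>b i\<bar> + (\<Sum>l\<in>UNIV. \<bar>c i l\<bar>))"
  have le: "\<bar>b i\<bar> + (\<Sum>l\<in>UNIV. \<bar>c i l\<bar>) <= K" if "i < n" for i
    unfolding K_def by (rule member_le_sum) (use that in \<open>auto intro!: add_nonneg_nonneg sum_nonneg\<close>)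
  have le2: "\<bar>c i l\<bar> <= (\<Sum>l\<in>UNIV. \<bar>c i l\<bar>)" for i l
    by (rule member_le_sum) auto
  show ?thesis
  proof (rule that)
    show "K >= 0" unfolding K_def by (intro sum_nonneg add_nonneg_nonneg) auto
    show "norm (E x i) <= K" if "x \<in> cube" "i < n" for x i
    proof -
      have "0 <= (\<Sum>l\<in>UNIV. \<bar>c i l\<bar>)" by (intro sum_nonneg) auto
      then show ?thesis using b[OF that(2,1)] le[OF that(2)] by argo
    qed
    show "norm (D l x i) <= K" if "x \<in> cube" "i < n" for x i l
      using c[OF that(2,1), of l] le[OF that(2)] le2[of i l] by argo
  qed
qed

lemma feat_bound:
  fixes E :: "real ^ 'd => 'd::finite state"
  assumes n: "n >= 1" and K: "K >= 0"
    and E: "\<And>x i. x \<in> cube ==> i < n ==> norm (E x i) <= K" "\<And>x i l. x \<in> cube ==> i < n ==> norm (D l x i) <= K"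
    and x: "x \<in> cube"
  shows "norm (feat \<alpha> n E D r x) <= (2 * real CARD('d) + 2) * K"
proof -
  have fE: "\<bar>fst (E y i)\<bar> <= K" "norm (snd (E y i)) <= K" "\<bar>snd (E y i) $ l\<bar> <= K" if "y \<in> cube" "i < n" for y i l
    using E(1)[OF that] norm_fst_le[of "fst (E y i)" "snd (E y i)"] norm_snd_le[of "snd (E y i)" "fst (E y i)"] component_le_norm_cart[of "snd (E y i)" l] by auto
  have fD: "\<bar>fst (D l y i)\<bar> <= K" "\<bar>snd (D l y i) $ k\<bar> <= K" if "y \<in> cube" "i < n" for y i l k
    using E(2)[OF that, of l] norm_fst_le[of "fst (D l y i)" "snd (D l y i)"] norm_snd_le[of "snd (D l y i)" "fst (D l y i)"] component_le_norm_cart[of "snd (D l y i)" k] by auto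
  let ?d = "real CARD('d)"
  have dK: "?d * K >= 0" using K by simp
  have eq: "(2 * ?d + 2) * K = (K + ?d * K) + (K + ?d * K)" by (simp add: algebra_simps)
  show ?thesis
  proof (cases "r < n")
    case True
    have 1: "norm (\<chi> l. fst (D l x r)) <= ?d * K"
    proof -
      have "norm (\<chi> l. fst (D l x r)) <= (\<Sum>l\<in>UNIV. \<bar>(\<chi> l. fst (D l x r)) $ l\<bar>)" by (rule norm_le_l1_cart)
      also have "... <= (\<Sum>l\<in>(UNIV :: 'd set). K)" by (intro sum_mono) (simp add: fD[OF x True])
      finally show ?thesis by simp
    qed
    have 2: "\<bar>\<Sum>l\<in>UNIV. snd (D l x r) $ l\<bar> <= ?d * K"
      using sum_norm_bound[of "UNIV :: 'd set" "\<lambda>l. snd (D l x r) $ l" K] fD(2)[OF x True] by simp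
    have 3: "\<bar>if Suc r < n then fst (E x (Suc r)) else 0\<bar> <= K" using fE(1)[OF x] K by simp
    have "norm (feat \<alpha> n E D r x) <= norm ((\<chi> l. fst (D l x r)) - snd (E x r)) +
        norm ((\<Sum>l\<in>UNIV. snd (D l x r) $ l) - (if Suc r < n then fst (E x (Suc r)) else 0))"
      unfolding feat_def P_feat_def if_P[OF True] by (rule norm_Pair_le)
    also have "... <= (?d * K + K) + (?d * K + K)"
    proof (rule add_mono)
      show "norm ((\<chi> l. fst (D l x r)) - snd (E x r)) <= ?d * K + K"
        using norm_triangle_ineq4[of "\<chi> l. fst (D l x r)" "snd (E x r)"] 1 fE(2)[OF x True] by argo
      show "norm ((\<Sum>l\<in>UNIV. snd (D l x r) $ l) - (if Suc r < n then fst (E x (Suc r)) else 0)) <= ?d * K + K"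
        using 2 3 unfolding real_norm_def by linarith
    qed
    finally show ?thesis by (simp add: algebra_simps)
  next
    case False
    show ?thesis
    proof (cases "r < 2 * n")
      case True
      then have i: "r - n < n" using False by simp
      have 1: "\<bar>outer_normal x \<bullet> snd (E x (r - n))\<bar> <= ?d * K"
      proof -
        have "\<bar>outer_normal x \<bullet> snd (E x (r - n))\<bar> <= (\<Sum>l\<in>UNIV. \<bar>outer_normal x $ l * snd (E x (r - n)) $ l\<bar>)"
          unfolding inner_vec_def by (simp add: sum_abs)
        also have "... <= (\<Sum>l\<in>(UNIV :: 'd set). 1 * K)"
          unfolding abs_mult using fE(3)[OF x i] by (intro sum_mono mult_mono abs_outer_normal_le) auto
        finally show ?thesis by simp
      qed
      have "\<bar>S_feat \<alpha> E (outer_normal x) x (r - n)\<bar> <= \<bar>bc0 \<alpha>\<bar> * \<bar>fst (E x (r - n))\<bar> + \<bar>bc1 \<alpha>\<bar> * \<bar>outer_normal x \<bullet> snd (E x (r - n))\<bar>"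
        unfolding S_feat_def abs_mult[symmetric] by (rule abs_triangle_ineq)
      also have "... <= 1 * K + 1 * (?d * K)"
        using fE(1)[OF x i] 1 by (intro add_mono mult_mono bc_bounds) auto
      finally have "norm (feat \<alpha> n E D r x) <= K + ?d * K" using True False by (simp add: feat_def norm_Pair)
      then show ?thesis unfolding eq using add_nonneg_nonneg[OF K dK] dK by linarith
    next
      case False2: False
      interpret prob_space "cube_measure :: (real ^ 'd) measure" by (rule prob_space_cube_measure)
      have "\<bar>cint (\<lambda>y. fst (E y 0))\<bar> <= cint (\<lambda>y. \<bar>fst (E y 0)\<bar>)" by simp
      also have "... <= K"
      proof (cases "integrable cube_measure (\<lambda>y. \<bar>fst (E y 0)\<bar>)")
        case True
        have "cint (\<lambda>y. \<bar>fst (E y 0)\<bar>) <= cint (\<lambda>y :: real ^ 'd. K)"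
          using AE_cube_measure n fE(1) by (intro integral_mono_AE True) auto
        then show ?thesis by (simp add: prob_space)
      next
        case False
        \<comment> \<open>A non-integrable integrand has integral 0 by convention, which lies within
          the bound.\<close>
        then show ?thesis using K by (simp add: not_integrable_integral_eq)
      qed
      finally have "norm (feat \<alpha> n E D r x) <= K" using False False2 by (simp add: feat_def norm_Pair)
      then show ?thesis unfolding eq using add_nonneg_nonneg[OF K dK] dK by linarith
    qed
  qed
qed

lemma measurable_feat:
  fixes E :: "real ^ 'd => 'd::finite state"
  assumes E: "C1_field n E D" and n: "n >= 1"
  shows "feat \<alpha> n E D r \<in> borel_measurable borel"
proof -
  consider "r < n" | "n <= r" "r < 2 * n" | "2 * n <= r" by linarith
  then show ?thesis
  proof cases
    case 1
    then have "feat \<alpha> n E D r = (\<lambda>x. P_feat n E D x r)" by (simp add: feat_def fun_eq_iff)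
    then show ?thesis using continuous_measurable[OF continuous_P_feat[OF E 1]] by simp
  next
    case 2
    then have i: "r - n < n" by simp
    note c = C1_field_continuous[OF E i]
    have "(\<lambda>x. bc0 \<alpha> * fst (E x (r - n)) + bc1 \<alpha> * (\<Sum>l\<in>UNIV. outer_normal x $ l * snd (E x (r - n)) $ l)) \<in> borel_measurable borel"
      by (intro borel_measurable_add borel_measurable_times borel_measurable_sum borel_measurable_const measurable_outer_normal
        continuous_measurable[OF c(1)] continuous_measurable[OF continuous_on_component[OF c(2)]])
    then have "(\<lambda>x. (0 :: real ^ 'd, S_feat \<alpha> E (outer_normal x) x (r - n))) \<in> borel_measurable borel"
      unfolding S_feat_def inner_vec_def inner_real_def by (intro borel_measurable_Pair borel_measurable_const)
    moreover have "feat \<alpha> n E D r = (\<lambda>x. (0 :: real ^ 'd, S_feat \<alpha> E (outer_normal x) x (r - n)))" using 2 by (simp add: feat_def fun_eq_iff)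
    ultimately show ?thesis by simp
  next
    case 3
    then have "feat \<alpha> n E D r = (\<lambda>x. (0, cint (\<lambda>y. fst (E y 0))))" by (simp add: feat_def fun_eq_iff)
    then show ?thesis by simp
  qed
qed

lemma feat_lincomb:
  fixes E :: "'j => real ^ 'd => 'd::finite state"
  assumes J: "finite J" and E: "\<And>j. j \<in> J ==> C1_field n (E j) (D j)" and n: "n >= 1"
  shows "feat \<alpha> n (\<lambda>x i. \<Sum>j\<in>J. c j *\<^sub>R E j x i) (\<lambda>l x i. \<Sum>j\<in>J. c j *\<^sub>R D j l x i) r x =
    (\<Sum>j\<in>J. c j *\<^sub>R feat \<alpha> n (E j) (D j) r x)"
proof -
  have "cint (\<lambda>y. \<Sum>j\<in>J. c j * fst (E j y 0)) = (\<Sum>j\<in>J. c j * cint (\<lambda>y. fst (E j y 0)))"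
  proof (subst Bochner_Integration.integral_sum)
    show "integrable cube_measure (\<lambda>y. c j * fst (E j y 0))" if "j \<in> J" for j
      by (intro integrable_cube_continuous continuous_on_mult_left C1_field_continuous(1)[OF E[OF that]]) (use n in simp)
  qed simp
  then have 1: "feat \<alpha> n (\<lambda>x i. \<Sum>j\<in>J. c j *\<^sub>R E j x i) (\<lambda>l x i. \<Sum>j\<in>J. c j *\<^sub>R D j l x i) r x =
    (\<Sum>j\<in>J. c j *\<^sub>R feat \<alpha> n (E j) (D j) r x)" if "\<not> r < n" "\<not> r < 2 * n"
    using that by (intro prod_eqI) (simp_all add: feat_def fst_sum snd_sum)
  have 2: "feat \<alpha> n (\<lambda>x i. \<Sum>j\<in>J. c j *\<^sub>R E j x i) (\<lambda>l x i. \<Sum>j\<in>J. c j *\<^sub>R D j l x i) r x =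
    (\<Sum>j\<in>J. c j *\<^sub>R feat \<alpha> n (E j) (D j) r x)" if "\<not> r < n" "r < 2 * n"
    using that by (intro prod_eqI) (simp_all add: feat_def fst_sum snd_sum S_feat_lincomb)
  show ?thesis
    using 1 2 P_feat_lincomb[OF J] by (cases "r < n"; cases "r < 2 * n") (simp_all add: feat_def)
qed

lemma feat_add:
  fixes E :: "real ^ 'd => 'd::finite state"
  assumes E: "C1_field n E D" "C1_field n E' D'" and n: "n >= 1"
  shows "feat \<alpha> n (\<lambda>x i. E x i + E' x i) (\<lambda>l x i. D l x i + D' l x i) r x = feat \<alpha> n E D r x + feat \<alpha> n E' D' r x"
  using feat_lincomb[of "UNIV :: bool set" n "\<lambda>b. if b then E else E'" "\<lambda>b. if b then D else D'" \<alpha> "\<lambda>_. 1" r x] E n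
  by (simp add: UNIV_bool add.commute)

lemma feat_measure_props:
  shows "prob_space (feat_measure n r :: (real ^ 'd) measure)" "sets (feat_measure n r :: (real ^ 'd) measure) = sets borel"
    "AE x in feat_measure n r. x \<in> (cube :: (real ^ 'd) set)"
proof -
  show "prob_space (feat_measure n r :: (real ^ 'd) measure)" "sets (feat_measure n r :: (real ^ 'd) measure) = sets borel"
    by (simp_all add: feat_measure_def prob_space_boundary_measure prob_space_cube_measure)
  show "AE x in feat_measure n r. x \<in> (cube :: (real ^ 'd) set)"
  proof (cases "n <= r \<and> r < 2 * n")
    case True
    show ?thesis unfolding feat_measure_def if_P[OF True] by (rule AE_boundary_measure_cube)
  next
    case False
    show ?thesis unfolding feat_measure_def if_not_P[OF False] by (rule AE_cube_measure)
  qed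
qed

lemma integrable_feat_square:
  fixes E :: "real ^ 'd => 'd::finite state"
  assumes E: "C1_field n E D" and n: "n >= 1"
  shows "integrable (feat_measure n r) (\<lambda>x. (norm (feat \<alpha> n E D r x))^2)"
proof -
  obtain K where K: "K >= 0" "\<And>x i. x \<in> cube ==> i < n ==> norm (E x i) <= K" "\<And>x i l. x \<in> cube ==> i < n ==> norm (D l x i) <= K"
    using C1_field_bounded[OF E] by blast
  show ?thesis
  proof (rule integrable_bounded_on_cube[OF feat_measure_props])
    show "(\<lambda>x. (norm (feat \<alpha> n E D r x))^2) \<in> borel_measurable borel"
      using measurable_feat[OF E n] by measurable
    show "norm ((norm (feat \<alpha> n E D r x))^2) <= ((2 * real CARD('d) + 2) * K)^2" if "x \<in> cube" for x
    proof -
      have "norm (feat \<alpha> n E D r x) <= (2 * real CARD('d) + 2) * K" by (rule feat_bound[OF n K that])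
      from power_mono[OF this norm_ge_zero, of 2] show ?thesis by simp
    qed
  qed
qed

definition total_weight :: "nat => real => real => real => real" where
  "total_weight n d lam mu = real n * (1 + 2 * d * lam) + mu"

lemma feat_weight_nonneg: "lam > 0 ==> mu > 0 ==> d >= 0 ==> feat_weight \<alpha> n d lam mu r >= 0"
  by (simp add: feat_weight_def)

lemma sum_feat_weight: "mu > 0 ==> (\<Sum>r<2 * n + 1. feat_weight \<alpha> n d lam mu r) <= total_weight n d lam mu"
  unfolding sum_split_features by (simp add: feat_weight_def total_weight_def algebra_simps)

lemma population_loss_bound:
  fixes E :: "real ^ 'd => 'd::finite state"
  assumes E: "C1_field n E D" and n: "n >= 1" and lam: "lam > 0" "mu > 0" and K: "K >= 0"
    "\<And>x i. x \<in> cube ==> i < n ==> norm (E x i) <= K" "\<And>x i l. x \<in> cube ==> i < n ==> norm (D l x i) <= K"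
  shows "population_loss \<alpha> n lam mu E D <= total_weight n (real CARD('d)) lam mu * ((2 * real CARD('d) + 2) * K)^2"
proof -
  have "population_loss \<alpha> n lam mu E D <= (\<Sum>r<2 * n + 1. feat_weight \<alpha> n (real CARD('d)) lam mu r * ((2 * real CARD('d) + 2) * K)^2)"
    unfolding population_loss_def
  proof (intro sum_mono mult_left_mono feat_weight_nonneg lam)
    fix r
    interpret prob_space "feat_measure n r :: (real ^ 'd) measure" by (rule feat_measure_props)
    have "(LINT x|feat_measure n r. (norm (feat \<alpha> n E D r x))^2) <= (LINT x|(feat_measure n r :: (real ^ 'd) measure). ((2 * real CARD('d) + 2) * K)^2)"
    proof (rule integral_mono_AE[OF integrable_feat_square[OF E n]])
      show "AE x in feat_measure n r. (norm (feat \<alpha> n E D r x))^2 <= ((2 * real CARD('d) + 2) * K)^2"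
        using feat_measure_props(3)
      proof eventually_elim
        case (elim x)
        show ?case by (rule power_mono[OF feat_bound[OF n K elim] norm_ge_zero])
      qed
    qed simp
    then show "(LINT x|feat_measure n r. (norm (feat \<alpha> n E D r x))^2) <= ((2 * real CARD('d) + 2) * K)^2" by (simp add: prob_space)
  qed simp
  also have "... <= total_weight n (real CARD('d)) lam mu * ((2 * real CARD('d) + 2) * K)^2"
    unfolding sum_distrib_right[symmetric] by (intro mult_right_mono sum_feat_weight lam) simp
  finally show ?thesis .
qed

lemma norm_add_square_le:
  fixes a b :: "'a::real_inner"
  shows "(norm (a + b))^2 <= 2 * (norm a)^2 + 2 * (norm b)^2"
proof -
  have "(norm (a + b))^2 + (norm (a - b))^2 = 2 * (norm a)^2 + 2 * (norm b)^2"
    by (simp add: power2_norm_eq_inner algebra_simps inner_commute)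
  then show ?thesis using zero_le_power2[of "norm (a - b)"] by argo
qed

lemma population_loss_add:
  fixes E :: "real ^ 'd => 'd::finite state"
  assumes E: "C1_field n E D" "C1_field n E' D'" and n: "n >= 1" and lam: "lam > 0" "mu > 0"
  shows "population_loss \<alpha> n lam mu (\<lambda>x i. E x i + E' x i) (\<lambda>l x i. D l x i + D' l x i) \<le>
    2 * population_loss \<alpha> n lam mu E D + 2 * population_loss \<alpha> n lam mu E' D'"
  unfolding population_loss_def sum_distrib_left sum.distrib[symmetric]
proof (rule sum_mono)
  fix r
  note i = integrable_feat_square[OF E(1) n, of r \<alpha>] integrable_feat_square[OF E(2) n, of r \<alpha>]
  have meas: "(\<lambda>x. (norm (feat \<alpha> n E D r x + feat \<alpha> n E' D' r x))^2) \<in> borel_measurable (feat_measure n r)"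
    using measurable_feat[OF E(1) n, of \<alpha> r] measurable_feat[OF E(2) n, of \<alpha> r]
    by (simp add: measurable_cong_sets[OF feat_measure_props(2) refl])
  have "(LINT x|feat_measure n r. (norm (feat \<alpha> n (\<lambda>x i. E x i + E' x i) (\<lambda>l x i. D l x i + D' l x i) r x))^2) \<le>
      (LINT x|feat_measure n r. 2 * (norm (feat \<alpha> n E D r x))^2 + 2 * (norm (feat \<alpha> n E' D' r x))^2)"
    unfolding feat_add[OF E n]
  proof (rule integral_mono)
    show "integrable (feat_measure n r) (\<lambda>x. (norm (feat \<alpha> n E D r x + feat \<alpha> n E' D' r x))^2)"
      by (rule Bochner_Integration.integrable_bound[of _ "\<lambda>x. 2 * (norm (feat \<alpha> n E D r x))^2 + 2 * (norm (feat \<alpha> n E' D' r x))^2"])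
        (use i meas norm_add_square_le in auto)
  qed (use i norm_add_square_le in auto)
  also have "... = 2 * (LINT x|feat_measure n r. (norm (feat \<alpha> n E D r x))^2) + 2 * (LINT x|feat_measure n r. (norm (feat \<alpha> n E' D' r x))^2)"
    using i by simp
  finally have le: "(LINT x|feat_measure n r. (norm (feat \<alpha> n (\<lambda>x i. E x i + E' x i) (\<lambda>l x i. D l x i + D' l x i) r x))^2) <= ..." .
  show "feat_weight \<alpha> n (real CARD('d)) lam mu r * (LINT x|feat_measure n r. (norm (feat \<alpha> n (\<lambda>x i. E x i + E' x i) (\<lambda>l x i. D l x i + D' l x i) r x))^2) \<le>
      2 * (feat_weight \<alpha> n (real CARD('d)) lam mu r * (LINT x|feat_measure n r. (norm (feat \<alpha> n E D r x))^2)) +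
      2 * (feat_weight \<alpha> n (real CARD('d)) lam mu r * (LINT x|feat_measure n r. (norm (feat \<alpha> n E' D' r x))^2))"
    using mult_left_mono[OF le feat_weight_nonneg[OF lam, of "real CARD('d)" \<alpha> n r]] by (simp add: distrib_left mult.left_commute)
qed

section \<open>Networks of prescribed width\<close>

lemma abs_neuron_le:
  fixes x :: "real ^ 'd"
  assumes "x \<in> cube" "norm W <= 1" "\<bar>b\<bar> <= 1"
  shows "\<bar>W \<bullet> x + b\<bar> <= real CARD('d) + 1"
proof -
  have "norm x <= (\<Sum>i\<in>UNIV. \<bar>x $ i\<bar>)" by (rule norm_le_l1_cart)
  also have "... <= (\<Sum>i\<in>(UNIV :: 'd set). 1)"
    using assms(1) by (intro sum_mono) (auto simp: mem_box_cart)
  finally have "norm x <= real CARD('d)" by simp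
  then have "\<bar>W \<bullet> x\<bar> <= 1 * real CARD('d)"
    using Cauchy_Schwarz_ineq2[of W x] mult_mono[OF assms(2), of "norm x" "real CARD('d)"] by auto
  then show ?thesis using assms(3) by linarith
qed

lemma norm_le_vec_norm: "i < n ==> norm (P i) <= vec_norm n P"
  unfolding vec_norm_def by (rule member_le_L2_set) auto

lemma network_bound:
  fixes x :: "real ^ 'd"
  assumes a: "\<And>j. j < m ==> norm (W j) <= 1 \<and> \<bar>b j\<bar> <= 1" and x: "x \<in> cube" and i: "i < n"
  shows "norm (network m c a W b x i) <= norm (c i) + 2 * (real CARD('d) + 1)^2 * (\<Sum>j<m. vec_norm n (a j))"
    "norm (net_deriv m a W b l x i) <= 2 * (real CARD('d) + 1)^2 * (\<Sum>j<m. vec_norm n (a j))"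
proof -
  let ?R = "real CARD('d) + 1"
  have relu: "0 <= relu (W j \<bullet> x + b j)" "relu (W j \<bullet> x + b j) <= ?R" if "j < m" for j
    using abs_neuron_le[OF x, of "W j" "b j"] a[OF that] by (auto simp: relu_def)
  have R: "?R <= ?R^2" by (simp add: power2_eq_square)
  have v: "norm (a j i) <= vec_norm n (a j)" for j by (rule norm_le_vec_norm[OF i])
  have "norm (\<Sum>j<m. ReQU (W j \<bullet> x + b j) *\<^sub>R a j i) <= (\<Sum>j<m. norm (ReQU (W j \<bullet> x + b j) *\<^sub>R a j i))" by (rule norm_sum)
  also have "... <= (\<Sum>j<m. 2 * ?R^2 * vec_norm n (a j))"
  proof (rule sum_mono)
    fix j assume j: "j \<in> {..<m}"
    have "(relu (W j \<bullet> x + b j))^2 <= ?R^2" using relu j by (intro power_mono) auto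
    then have "(relu (W j \<bullet> x + b j))^2 <= 2 * ?R^2" using zero_le_power2[of ?R] by argo
    then show "norm (ReQU (W j \<bullet> x + b j) *\<^sub>R a j i) <= 2 * ?R^2 * vec_norm n (a j)"
      using v[of j] by (simp add: ReQU_eq) (intro mult_mono; simp)
  qed
  finally have "norm (\<Sum>j<m. ReQU (W j \<bullet> x + b j) *\<^sub>R a j i) <= 2 * ?R^2 * (\<Sum>j<m. vec_norm n (a j))"
    by (simp add: sum_distrib_left)
  then show "norm (network m c a W b x i) <= norm (c i) + 2 * ?R^2 * (\<Sum>j<m. vec_norm n (a j))"
    unfolding network_def using norm_triangle_ineq[of "c i" "\<Sum>j<m. ReQU (W j \<bullet> x + b j) *\<^sub>R a j i"] by linarith
  have "norm (net_deriv m a W b l x i) <= (\<Sum>j<m. norm ((2 * relu (W j \<bullet> x + b j) * W j $ l) *\<^sub>R a j i))"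
    unfolding net_deriv_def by (rule norm_sum)
  also have "... <= (\<Sum>j<m. 2 * ?R^2 * vec_norm n (a j))"
  proof (rule sum_mono)
    fix j assume j: "j \<in> {..<m}"
    have W: "\<bar>W j $ l\<bar> <= 1" using component_le_norm_cart[of "W j" l] a[of j] j by auto
    have "\<bar>2 * relu (W j \<bullet> x + b j) * W j $ l\<bar> <= 2 * ?R^2 * 1"
      unfolding abs_mult using relu[of j] j R W by (intro mult_mono) auto
    then show "norm ((2 * relu (W j \<bullet> x + b j) * W j $ l) *\<^sub>R a j i) <= 2 * ?R^2 * vec_norm n (a j)"
      using v[of j] unfolding norm_scaleR by (intro mult_mono) auto
  qed
  finally show "norm (net_deriv m a W b l x i) <= 2 * ?R^2 * (\<Sum>j<m. vec_norm n (a j))"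
    by (simp add: sum_distrib_left)
qed

lemma vec_norm_eq_0: "P \<in> states n ==> vec_norm n P = 0 ==> P = (\<lambda>_. 0)"
proof
  fix i assume "P \<in> states n" "vec_norm n P = 0"
  then show "P i = 0" using norm_le_vec_norm[of i n P] by (cases "i < n") (auto simp: states_def)
qed

abbreviation network_loss where
  "network_loss \<alpha> n lam mu F DF m c a W b \<equiv> population_loss \<alpha> n lam mu
     (\<lambda>x i. network m c a W b x i - F x i) (\<lambda>l x i. net_deriv m a W b l x i - DF l x i)"

text \<open>A network of any width is a convex combination of single neurons; sampling from it gives
  width \<open>m\<close> at the Monte Carlo rate.\<close>

lemma network_reduce:
  fixes a :: "nat => 'd::finite state"
  assumes n: "n >= 1" and lam: "lam > 0" "mu > 0" and m: "m >= 1"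
    and a: "\<And>j. j < M ==> a j \<in> states n" and W: "\<And>j. j < M ==> norm (W j) <= 1 \<and> \<bar>b j\<bar> <= 1"
  defines "A \<equiv> (\<Sum>j<M. vec_norm n (a j))"
  obtains a' W' b' where "\<And>j. j < m ==> a' j \<in> states n" "\<And>j. j < m ==> norm (W' j) <= 1 \<and> \<bar>b' j\<bar> <= 1"
    "(\<Sum>j<m. vec_norm n (a' j)) <= A"
    "network_loss \<alpha> n lam mu (network M c a W b) (net_deriv M a W b) m c a' W' b' \<le>
      total_weight n (real CARD('d)) lam mu * (4 * ((2 * real CARD('d) + 2) * (2 * (real CARD('d) + 1)^2 * A))^2) / real m"
proof (cases "A = 0")
  case True
  have a0: "a j = (\<lambda>_. 0)" if "j < M" for j
  proof (rule vec_norm_eq_0[OF a[OF that]])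
    show "vec_norm n (a j) = 0"
      using True that vec_norm_nonneg[of n] unfolding A_def by (subst (asm) sum_nonneg_eq_0_iff) auto
  qed
  show ?thesis
  proof (rule that[of "\<lambda>_ _. 0" "\<lambda>_. 0" "\<lambda>_. 0"])
    have "C1_field n (\<lambda>x i. 0) (\<lambda>l x i. 0)"
      by (simp add: C1_field_def has_grad_const zero_vec_def[symmetric])
    then have "population_loss \<alpha> n lam mu (\<lambda>x i. 0) (\<lambda>l x i. 0 :: real \<times> (real ^ 'd)) <= total_weight n (real CARD('d)) lam mu * ((2 * real CARD('d) + 2) * 0)^2"
      by (rule population_loss_bound[OF _ n lam]) auto
    then show "population_loss \<alpha> n lam mu (\<lambda>x i. network m c (\<lambda>_ _. 0) (\<lambda>_. 0) (\<lambda>_. 0) x i - network M c a W b x i)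
      (\<lambda>l x i. net_deriv m (\<lambda>_ _. 0) (\<lambda>_. 0) (\<lambda>_. 0) l x i - net_deriv M a W b l x i) \<le>
      total_weight n (real CARD('d)) lam mu * (4 * ((2 * real CARD('d) + 2) * (2 * (real CARD('d) + 1)^2 * A))^2) / real m"
      by (simp add: network_def net_deriv_def a0 True)
  qed (simp_all add: states_def vec_norm_def True L2_set_def)
next
  case False
  have "A >= 0" unfolding A_def by (intro sum_nonneg vec_norm_nonneg)
  then have A0: "A > 0" using False by simp
  \<comment> \<open>All atoms are scaled to norm at most the total mass \<open>A\<close> and drawn
    with probability proportional to their original norm; an atom of norm zero has probability
    zero.\<close>
  define s where "s j = (\<lambda>i. (A / vec_norm n (a j)) *\<^sub>R a j i)" for j
  define p where "p j = vec_norm n (a j) / A" for j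
  have ps: "p j *\<^sub>R s j i = a j i" if "j < M" for j i
  proof (cases "vec_norm n (a j) = 0")
    case True
    then show ?thesis using vec_norm_eq_0[OF a[OF that] True] by (simp add: s_def)
  qed (use A0 in \<open>simp add: s_def p_def\<close>)
  have vs: "vec_norm n (s j) <= A" for j
    unfolding s_def vec_norm_scale using A0 vec_norm_nonneg[of n "a j"] by simp
  have ss: "s j \<in> states n" if "j < M" for j unfolding s_def by (rule states_scale[OF a[OF that]])
  define E where "E j = network 1 (\<lambda>_. 0) (\<lambda>_. s j) (\<lambda>_. W j) (\<lambda>_. b j)" for j
  define D where "D j = net_deriv 1 (\<lambda>_. s j) (\<lambda>_. W j) (\<lambda>_. b j)" for j
  have CE: "C1_field n (E j) (D j)" for j unfolding E_def D_def by (rule C1_field_network)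
  define K where "K = 2 * (real CARD('d) + 1)^2 * A"
  have K0: "K >= 0" using A0 by (simp add: K_def)
  have EK: "norm (E j x i) <= K" "norm (D j l x i) <= K" if "j < M" "x \<in> cube" "i < n" for j x i l
  proof -
    have "2 * (real CARD('d) + 1)^2 * vec_norm n (s j) <= K" unfolding K_def by (intro mult_left_mono vs) simp
    then show "norm (E j x i) <= K" "norm (D j l x i) <= K"
      using network_bound(1)[where m = 1 and W = "\<lambda>_. W j" and b = "\<lambda>_. b j" and n = n and a = "\<lambda>_. s j" and c = "\<lambda>_. 0", OF _ that(2,3)]
        network_bound(2)[where m = 1 and W = "\<lambda>_. W j" and b = "\<lambda>_. b j" and n = n and a = "\<lambda>_. s j" and l = l, OF _ that(2,3)] W[OF that(1)]
      by (simp_all add: E_def D_def)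
  qed
  have "\<exists>idx. (\<forall>k<m. idx k \<in> {..<M}) \<and> (\<Sum>r<2 * n + 1. feat_weight \<alpha> n (real CARD('d)) lam mu r *
    (LINT x|feat_measure n r. (norm ((\<Sum>k<m. (1 / real m) *\<^sub>R feat \<alpha> n (E (idx k)) (D (idx k)) r x) - (\<Sum>j<M. p j *\<^sub>R feat \<alpha> n (E j) (D j) r x)))^2))
     <= (\<Sum>r<2 * n + 1. feat_weight \<alpha> n (real CARD('d)) lam mu r) * (4 * ((2 * real CARD('d) + 2) * K)^2) / real m"
  proof (rule maurey_features[where f = "\<lambda>r j. feat \<alpha> n (E j) (D j) r"])
    show "0 <= p j" for j using vec_norm_nonneg[of n "a j"] A0 by (simp add: p_def)
    show "(\<Sum>j<M. p j) = 1" unfolding p_def sum_divide_distrib[symmetric] using A0 by (simp add: A_def)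
    show "norm (feat \<alpha> n (E j) (D j) r x) <= (2 * real CARD('d) + 2) * K" if "j \<in> {..<M}" "x \<in> cube" for r j x
      by (rule feat_bound[OF n K0 _ _ that(2)]) (use that EK in auto)
    show "AE x in feat_measure n r. x \<in> (cube :: (real ^ 'd) set)" for r by (rule feat_measure_props(3))
  qed (use m lam in \<open>auto simp: feat_measure_props feat_weight_nonneg intro!: measurable_feat[OF CE n]\<close>)
  then obtain idx where idx: "\<And>k. k < m ==> idx k < M" and le: "(\<Sum>r<2 * n + 1. feat_weight \<alpha> n (real CARD('d)) lam mu r *
    (LINT x|feat_measure n r. (norm ((\<Sum>k<m. (1 / real m) *\<^sub>R feat \<alpha> n (E (idx k)) (D (idx k)) r x) - (\<Sum>j<M. p j *\<^sub>R feat \<alpha> n (E j) (D j) r x)))^2))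
     <= (\<Sum>r<2 * n + 1. feat_weight \<alpha> n (real CARD('d)) lam mu r) * (4 * ((2 * real CARD('d) + 2) * K)^2) / real m" by auto
  let ?a = "\<lambda>k i. (1 / real m) *\<^sub>R s (idx k) i"
  let ?W = "\<lambda>k. W (idx k)" and ?b = "\<lambda>k. b (idx k)"
  show ?thesis
  proof (rule that[of ?a ?W ?b])
    show "?a j \<in> states n" if "j < m" for j by (rule states_scale[OF ss[OF idx[OF that]]])
    show "norm (?W j) <= 1 \<and> \<bar>?b j\<bar> <= 1" if "j < m" for j by (rule W[OF idx[OF that]])
    have "(\<Sum>j<m. vec_norm n (?a j)) <= (\<Sum>j<m. 1 / real m * A)"
      unfolding vec_norm_scale using vs by (intro sum_mono mult_mono vec_norm_nonneg) auto
    then show "(\<Sum>j<m. vec_norm n (?a j)) <= A" using m by simp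
    have F: "feat \<alpha> n (\<lambda>x i. network m c ?a ?W ?b x i - network M c a W b x i) (\<lambda>l x i. net_deriv m ?a ?W ?b l x i - net_deriv M a W b l x i) r x =
        (\<Sum>k<m. (1 / real m) *\<^sub>R feat \<alpha> n (E (idx k)) (D (idx k)) r x) - (\<Sum>j<M. p j *\<^sub>R feat \<alpha> n (E j) (D j) r x)" for r x
    proof -
      \<comment> \<open>Sampled and original network are merged into one signed combination of
        length \<open>m + M\<close>, as \<open>feat_lincomb\<close> applies to a single sum.\<close>
      define q where "q k = (if k < m then 1 / real m else - p (k - m))" for k
      define e where "e k = (if k < m then idx k else k - m)" for k
      have split: "(\<Sum>k<m + M. q k *\<^sub>R h (e k)) = (\<Sum>k<m. (1 / real m) *\<^sub>R h (idx k)) - (\<Sum>j<M. p j *\<^sub>R h j)" for h :: "nat => 'z::real_vector"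
      proof -
        have "(\<Sum>k<m + M. q k *\<^sub>R h (e k)) = (\<Sum>k<m + M. if k < m then (1 / real m) *\<^sub>R h (idx k) else - (p (k - m) *\<^sub>R h (k - m)))"
          by (rule sum.cong) (auto simp: q_def e_def)
        then show ?thesis unfolding sum_concat[where f = "\<lambda>k. (1 / real m) *\<^sub>R h (idx k)" and g = "\<lambda>j. - (p j *\<^sub>R h j)"] by (simp add: sum_negf)
      qed
      have E1: "network m c ?a ?W ?b x i - network M c a W b x i = (\<Sum>k<m + M. q k *\<^sub>R E (e k) x i)" for x i
      proof -
        have "(\<Sum>j<M. ReQU (W j \<bullet> x + b j) *\<^sub>R a j i) = (\<Sum>j<M. p j *\<^sub>R E j x i)"
          by (intro sum.cong refl) (simp add: E_def network_def ps[symmetric] mult.commute)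
        then show ?thesis unfolding split[of "\<lambda>j. E j x i"] by (simp add: network_def E_def mult.commute)
      qed
      have D1: "net_deriv m ?a ?W ?b l x i - net_deriv M a W b l x i = (\<Sum>k<m + M. q k *\<^sub>R D (e k) l x i)" for l x i
      proof -
        have "net_deriv M a W b l x i = (\<Sum>j<M. p j *\<^sub>R D j l x i)"
          unfolding net_deriv_def by (intro sum.cong refl) (simp add: D_def net_deriv_def ps[symmetric] mult.commute)
        then show ?thesis unfolding split[of "\<lambda>j. D j l x i"] by (simp add: net_deriv_def D_def mult.commute)
      qed
      show ?thesis
        unfolding E1 D1 by (subst feat_lincomb[OF _ CE n]) (simp_all add: split[of "\<lambda>j. feat \<alpha> n (E j) (D j) r x"])
    qed
    have "network_loss \<alpha> n lam mu (network M c a W b) (net_deriv M a W b) m c ?a ?W ?b \<le>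
        (\<Sum>r<2 * n + 1. feat_weight \<alpha> n (real CARD('d)) lam mu r) * (4 * ((2 * real CARD('d) + 2) * K)^2) / real m"
      unfolding population_loss_def F by (rule le)
    also have "... <= total_weight n (real CARD('d)) lam mu * (4 * ((2 * real CARD('d) + 2) * K)^2) / real m"
      by (intro divide_right_mono mult_right_mono sum_feat_weight lam) auto
    finally show "network_loss \<alpha> n lam mu (network M c a W b) (net_deriv M a W b) m c ?a ?W ?b \<le>
      total_weight n (real CARD('d)) lam mu * (4 * ((2 * real CARD('d) + 2) * (2 * (real CARD('d) + 1)^2 * A))^2) / real m"
      by (simp add: K_def)
  qed
qed

text \<open>A wide network from \<open>network_approximation\<close> comes arbitrarily close to the
  exact field and is then thinned out to width \<open>m\<close>. Splitting the squared error doubles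
  both parts; the slack \<open>\<delta>\<close> is what the wide network leaves.\<close>

lemma class_approximation:
  fixes u :: "real ^ 'd => real"
  assumes n: "n >= 1" and lam: "lam > 0" "mu > 0" and m: "m >= 1" and u: "u \<in> barron_space (2 * n + 2)" and \<delta>: "\<delta> > 0"
  defines "B \<equiv> barron_norm (2 * n + 2) u"
  obtains c a W b where "c \<in> states n" "\<forall>j<m. a j \<in> states n" "vec_norm n c <= 2 * B"
    "\<forall>j<m. norm (W j) <= 1 \<and> \<bar>b j\<bar> <= 1" "(\<Sum>j<m. vec_norm n (a j)) <= 4 * B"
    "network_loss \<alpha> n lam mu (U_field (barron_weight u) barron_freq) (U_deriv (barron_weight u) barron_freq) m c a W b \<le>
      total_weight n (real CARD('d)) lam mu * (8 * ((2 * real CARD('d) + 2) * (8 * (real CARD('d) + 1)^2))^2) * (B^2 / real m) + \<delta>"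
proof -
  let ?d = "real CARD('d)"
  let ?Wt = "total_weight n ?d lam mu"
  let ?w = "barron_weight u" and ?\<kappa> = "barron_freq :: (nat ^ 'd) \<times> 'd set => real ^ 'd"
  have Wt: "?Wt > 0" unfolding total_weight_def using lam by (intro add_nonneg_pos mult_nonneg_nonneg add_nonneg_nonneg) auto
  \<comment> \<open>Chosen so that the loss of the wide network, bounded by
    \<open>?Wt * ((2 * ?d + 2) * \<epsilon>)^2\<close>, contributes exactly \<open>\<delta>\<close>
    after doubling.\<close>
  define \<epsilon> where "\<epsilon> = sqrt (\<delta> / (2 * ?Wt)) / (2 * ?d + 2)"
  have \<epsilon>: "\<epsilon> > 0" unfolding \<epsilon>_def using Wt \<delta> by (intro divide_pos_pos real_sqrt_gt_zero) auto
  have e2: "((2 * ?d + 2) * \<epsilon>)^2 = \<delta> / (2 * ?Wt)"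
  proof -
    have "(2 * ?d + 2) * \<epsilon> = sqrt (\<delta> / (2 * ?Wt))" unfolding \<epsilon>_def by (simp add: add_nonneg_eq_0_iff)
    then show ?thesis using Wt \<delta> by simp
  qed
  note hs = barron_weights_has_sum[OF u, folded B_def]
  note mom = moments_barron[OF has_sum_imp_summable[OF hs]]
  obtain c where c: "c \<in> states n" "vec_norm n c <= 2 * B"
    "net_within n \<epsilon> (\<lambda>x i. U_field ?w ?\<kappa> x i - c i) (U_deriv ?w ?\<kappa>) (4 * B)"
    by (rule network_approximation[OF n hs barron_freq_norm \<epsilon>], rule that)
  then obtain M a W b where a: "\<And>j. j < M ==> a j \<in> states n" "\<And>j. j < M ==> norm (W j) <= 1 \<and> \<bar>b j\<bar> <= 1"
    "(\<Sum>j<M. vec_norm n (a j)) <= 4 * B"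
    and close: "\<And>x i. x \<in> cube ==> i < n ==> norm (U_field ?w ?\<kappa> x i - c i - net_sum M a W b x i) <= \<epsilon>"
      "\<And>x i l. x \<in> cube ==> i < n ==> norm (U_deriv ?w ?\<kappa> l x i - net_deriv M a W b l x i) <= \<epsilon>"
    unfolding net_within_def by blast
  define A where "A = (\<Sum>j<M. vec_norm n (a j))"
  have A: "0 <= A" "A <= 4 * B" using a(3) vec_norm_nonneg[of n] by (auto simp: A_def intro!: sum_nonneg)
  obtain a' W' b' where r: "\<And>j. j < m ==> a' j \<in> states n" "\<And>j. j < m ==> norm (W' j) <= 1 \<and> \<bar>b' j\<bar> <= 1"
    "(\<Sum>j<m. vec_norm n (a' j)) <= A"
    "network_loss \<alpha> n lam mu (network M c a W b) (net_deriv M a W b) m c a' W' b' \<le>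
      ?Wt * (4 * ((2 * ?d + 2) * (2 * (?d + 1)^2 * A))^2) / real m"
    by (rule network_reduce[where M = M and a = a and W = W and b = b and \<alpha> = \<alpha> and c = c, OF n lam m a(1,2), folded A_def], assumption, assumption, rule that, assumption+)
  have close1: "norm (network M c a W b x i - U_field ?w ?\<kappa> x i) <= \<epsilon>" if "x \<in> cube" "i < n" for x i
  proof -
    have "network M c a W b x i - U_field ?w ?\<kappa> x i = - (U_field ?w ?\<kappa> x i - c i - net_sum M a W b x i)"
      by (simp add: network_def net_sum_def)
    then show ?thesis using close(1)[OF that] by (simp only: norm_minus_cancel)
  qed
  have close2: "norm (net_deriv M a W b l x i - U_deriv ?w ?\<kappa> l x i) <= \<epsilon>" if "x \<in> cube" "i < n" for l x i
    using close(2)[OF that, of l] by (simp add: norm_minus_commute)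
  note CU = C1_field_U[OF mom]
  show ?thesis
  proof (rule that[of c a' W' b'])
    show "c \<in> states n" "vec_norm n c <= 2 * B" by (fact c)+
    show "\<forall>j<m. a' j \<in> states n" "\<forall>j<m. norm (W' j) <= 1 \<and> \<bar>b' j\<bar> <= 1" using r(1,2) by auto
    show "(\<Sum>j<m. vec_norm n (a' j)) <= 4 * B" using r(3) A(2) by (rule order_trans)
    have "population_loss \<alpha> n lam mu (\<lambda>x i. (network m c a' W' b' x i - network M c a W b x i) + (network M c a W b x i - U_field ?w ?\<kappa> x i))
      (\<lambda>l x i. (net_deriv m a' W' b' l x i - net_deriv M a W b l x i) + (net_deriv M a W b l x i - U_deriv ?w ?\<kappa> l x i)) \<le>
      2 * network_loss \<alpha> n lam mu (network M c a W b) (net_deriv M a W b) m c a' W' b' +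
      2 * network_loss \<alpha> n lam mu (U_field ?w ?\<kappa>) (U_deriv ?w ?\<kappa>) M c a W b"
      by (rule population_loss_add[OF C1_field_diff[OF C1_field_network C1_field_network] C1_field_diff[OF C1_field_network CU] n lam])
    also have "... <= 2 * (?Wt * (4 * ((2 * ?d + 2) * (2 * (?d + 1)^2 * A))^2) / real m) + 2 * (?Wt * ((2 * ?d + 2) * \<epsilon>)^2)"
      using \<epsilon> close1 close2
      by (intro add_mono mult_left_mono r(4) population_loss_bound[OF C1_field_diff[OF C1_field_network CU] n lam]) auto
    also have "2 * (?Wt * ((2 * ?d + 2) * \<epsilon>)^2) = \<delta>" unfolding e2 using Wt by simp
    also have "2 * (?Wt * (4 * ((2 * ?d + 2) * (2 * (?d + 1)^2 * A))^2) / real m) <= 2 * (?Wt * (4 * ((2 * ?d + 2) * (2 * (?d + 1)^2 * (4 * B)))^2) / real m)"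
      using A Wt by (intro mult_left_mono divide_right_mono power_mono) auto
    also have "... = ?Wt * (8 * ((2 * ?d + 2) * (8 * (?d + 1)^2))^2) * (B^2 / real m)"
      by (simp add: power_mult_distrib)
    finally show "network_loss \<alpha> n lam mu (U_field ?w ?\<kappa>) (U_deriv ?w ?\<kappa>) m c a' W' b' <= ?Wt * (8 * ((2 * ?d + 2) * (8 * (?d + 1)^2))^2) * (B^2 / real m) + \<delta>"
      by simp
  qed
qed

section \<open>Covering the class of networks\<close>

text \<open>The codes 0, 1 and 2 stand for constants, derivatives of neurons and neurons; together
  they express every term of a residual.\<close>

definition act :: "nat => real => real" where
  "act s t = (if s = 0 then 1 else if s = 1 then relu t else ReQU t)"

text \<open>The factor \<open>h\<close> is one of finitely many fixed functions, such as a component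
  of the normal. The indicator sets the argument to zero outside the cube, because
  \<open>nets\<close> demands bounds on the whole space.\<close>

definition neuron :: "(real ^ 'd => real) => nat => real ^ 'd => real => real ^ 'd => real" where
  "neuron h s W b x = h x * act s (indicator cube x * (W \<bullet> x + b))"

definition grid :: "nat => real set" where
  "grid J = (\<lambda>k :: int. of_int k / 2 ^ J) ` {- (2 ^ J)..2 ^ J}"

definition grid_vec :: "nat => (real ^ 'd) set" where
  "grid_vec J = (\<lambda>f. \<chi> l. f l) ` (UNIV \<rightarrow>\<^sub>E grid J)"

definition neuron_net :: "(real ^ 'd => real) set => nat => (real ^ 'd => real) set" where
  "neuron_net H J = (\<lambda>(h, s, W, b). neuron h s W b) ` (H \<times> {..<3} \<times> grid_vec J \<times> grid J)"

lemma finite_grid: "finite (grid J)"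
  by (simp add: grid_def)

lemma card_grid: "card (grid J) <= 4 ^ Suc J"
proof -
  have "card (grid J) <= card {- (2 ^ J)..2 ^ J :: int}" unfolding grid_def by (rule card_image_le) simp
  also have "... = 2 * 2 ^ J + 1" by (simp add: nat_add_distrib nat_mult_distrib nat_power_eq)
  also have "... <= 4 ^ Suc J"
  proof -
    have "(2 :: nat) ^ J <= 4 ^ J" by (rule power_mono) auto
    moreover have "(1 :: nat) <= 4 ^ J" by simp
    ultimately have "2 * 2 ^ J + 1 <= 4 * (4 :: nat) ^ J" by linarith
    then show ?thesis by simp
  qed
  finally show ?thesis .
qed

lemma grid_le_1: "g \<in> grid J ==> \<bar>g\<bar> <= 1"
proof -
  assume "g \<in> grid J"
  then obtain k :: int where k: "g = of_int k / 2 ^ J" "- (2 ^ J) <= k" "k <= 2 ^ J" by (auto simp: grid_def)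
  then have "real_of_int k <= 2 ^ J" "- (2 ^ J) <= real_of_int k"
    by (metis of_int_le_iff of_int_numeral of_int_power, metis of_int_le_iff of_int_numeral of_int_power of_int_minus)
  then show ?thesis by (simp add: k(1) abs_le_iff divide_le_eq le_divide_eq)
qed

lemma grid_approx:
  assumes "\<bar>t\<bar> <= 1"
  obtains g where "g \<in> grid J" "\<bar>t - g\<bar> <= 1 / 2 ^ J"
proof -
  define k where "k = \<lfloor>t * 2 ^ J\<rfloor>"
  have t: "t * 2 ^ J <= 2 ^ J" "- (2 ^ J) <= t * 2 ^ J"
    using mult_right_mono[of t 1 "2 ^ J"] mult_right_mono[of "-1" t "2 ^ J"] assms by auto
  have k2: "k <= 2 ^ J" unfolding k_def floor_le_iff using order_le_less_trans[OF t(1), of "2 ^ J + 1"] by simp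
  have k1: "- (2 ^ J) <= k" unfolding k_def using t(2) by (simp add: le_floor_iff)
  have "\<bar>t * 2 ^ J - of_int k\<bar> <= 1" unfolding k_def by linarith
  then have "\<bar>t * 2 ^ J - of_int k\<bar> / 2 ^ J <= 1 / 2 ^ J" by (intro divide_right_mono) auto
  moreover have "\<bar>t * 2 ^ J - of_int k\<bar> / 2 ^ J = \<bar>t - of_int k / 2 ^ J\<bar>"
  proof -
    have "t * 2 ^ J - of_int k = (t - of_int k / 2 ^ J) * 2 ^ J" by (simp add: field_simps)
    then show ?thesis by (simp add: abs_mult)
  qed
  ultimately show ?thesis using that[of "of_int k / 2 ^ J"] k1 k2 by (auto simp: grid_def)
qed

lemma finite_grid_vec: "finite (grid_vec J :: (real ^ 'd::finite) set)"
  unfolding grid_vec_def by (intro finite_imageI finite_PiE finite_grid) auto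

lemma card_grid_vec: "card (grid_vec J :: (real ^ 'd::finite) set) <= (4 ^ Suc J) ^ CARD('d)"
proof -
  have "card (grid_vec J :: (real ^ 'd) set) <= card ((UNIV :: 'd set) \<rightarrow>\<^sub>E grid J)"
    unfolding grid_vec_def by (intro card_image_le finite_PiE finite_grid) auto
  also have "... = card (grid J) ^ CARD('d)" by (simp add: card_PiE)
  also have "... <= (4 ^ Suc J) ^ CARD('d)" by (rule power_mono[OF card_grid]) simp
  finally show ?thesis .
qed

lemma grid_vec_le_1: "W \<in> grid_vec J ==> \<bar>W $ l\<bar> <= 1"
  by (auto simp: grid_vec_def intro!: grid_le_1)

lemma grid_vec_approx:
  fixes W :: "real ^ 'd::finite"
  assumes "\<And>l. \<bar>W $ l\<bar> <= 1"
  obtains V where "V \<in> grid_vec J" "\<And>l. \<bar>W $ l - V $ l\<bar> <= 1 / 2 ^ J"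
proof -
  have "\<exists>g. g \<in> grid J \<and> \<bar>W $ l - g\<bar> <= 1 / 2 ^ J" for l using grid_approx[OF assms] by metis
  then obtain g where "\<And>l. g l \<in> grid J" "\<And>l. \<bar>W $ l - g l\<bar> <= 1 / 2 ^ J" by metis
  then show ?thesis using that[of "\<chi> l. g l"] by (auto simp: grid_vec_def)
qed

text \<open>Serves with \<open>e = 1\<close> for the size of an argument and with
  \<open>e = 1 / 2 ^ J\<close> for the distance between two of them.\<close>

lemma affine_cube_le:
  fixes x :: "real ^ 'd"
  assumes W: "\<And>l. \<bar>W $ l\<bar> <= e" and b: "\<bar>b\<bar> <= e"
  shows "\<bar>indicator cube x * (W \<bullet> x + b)\<bar> <= (real CARD('d) + 1) * e"
proof (cases "x \<in> cube")
  case True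
  have "\<bar>W \<bullet> x\<bar> <= (\<Sum>l\<in>UNIV. \<bar>W $ l * x $ l\<bar>)" unfolding inner_vec_def by (simp add: sum_abs)
  also have "... <= (\<Sum>l\<in>(UNIV :: 'd set). e * 1)"
    unfolding abs_mult using True W order_trans[OF abs_ge_zero b] by (intro sum_mono mult_mono) (auto simp: mem_box_cart)
  finally have "\<bar>W \<bullet> x\<bar> <= real CARD('d) * e" by simp
  then show ?thesis using True b by (simp add: distrib_right)
next
  case False
  then show ?thesis using order_trans[OF abs_ge_zero b] by simp
qed

lemma act_bound: "\<bar>t\<bar> <= R ==> R >= 1 ==> \<bar>act s t\<bar> <= R^2"
proof -
  assume t: "\<bar>t\<bar> <= R" and R: "R >= 1"
  have r: "0 <= relu t" "relu t <= R" using t R by (auto simp: relu_def)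
  have "R <= R^2" using power_increasing[of 1 2 R] R by simp
  moreover have "(relu t)^2 <= R^2" using r by (intro power_mono) auto
  ultimately show ?thesis using r R by (auto simp: act_def ReQU_eq)
qed

lemma act_lipschitz:
  assumes t: "\<bar>t\<bar> <= R" and t': "\<bar>t'\<bar> <= R" and R: "R >= 1"
  shows "\<bar>act s t - act s t'\<bar> <= 2 * R * \<bar>t - t'\<bar>"
proof -
  have r: "\<bar>relu t - relu t'\<bar> <= \<bar>t - t'\<bar>" "\<bar>relu t + relu t'\<bar> <= 2 * R" using t t' by (auto simp: relu_def)
  have "1 * \<bar>t - t'\<bar> <= 2 * R * \<bar>t - t'\<bar>" using R by (intro mult_right_mono) auto
  then have 1: "\<bar>relu t - relu t'\<bar> <= 2 * R * \<bar>t - t'\<bar>" using order_trans[OF r(1)] by simp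
  have "(relu t)^2 - (relu t')\<^sup>2 = (relu t + relu t') * (relu t - relu t')" by (simp add: power2_eq_square algebra_simps)
  then have "\<bar>(relu t)\<^sup>2 - (relu t')\<^sup>2\<bar> <= 2 * R * \<bar>t - t'\<bar>"
    unfolding abs_mult using r R by (simp only: abs_mult) (intro mult_mono; simp)
  then show ?thesis using 1 R by (simp add: act_def ReQU_eq)
qed

lemma measurable_neuron:
  assumes "h \<in> borel_measurable borel"
  shows "neuron h s W b \<in> borel_measurable borel"
proof -
  have "continuous_on UNIV (act s)" unfolding act_def by (cases "s = 0"; cases "s = 1") (auto intro!: continuous_intros)
  then have "act s \<in> borel_measurable borel" by (intro borel_measurable_continuous_onI)
  then show ?thesis using assms unfolding neuron_def by measurable
qed

lemma neuron_bound:
  fixes x :: "real ^ 'd"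
  assumes "\<bar>h x\<bar> <= 1" "\<And>l. \<bar>W $ l\<bar> <= 1" "\<bar>b\<bar> <= 1"
  shows "\<bar>neuron h s W b x\<bar> <= 2 * (real CARD('d) + 1)^2"
proof -
  have "\<bar>neuron h s W b x\<bar> <= 1 * (real CARD('d) + 1)^2"
    unfolding neuron_def abs_mult using affine_cube_le[of W 1 b x, OF assms(2,3)]
    by (intro mult_mono assms(1) act_bound) (auto simp: abs_mult)
  then show ?thesis using zero_le_power2[of "real CARD('d) + 1"] by linarith
qed

lemma nets_neurons:
  fixes H :: "(real ^ 'd => real) set"
  assumes H: "finite H" "card H <= k" and h: "\<And>h. h \<in> H ==> h \<in> borel_measurable borel \<and> (\<forall>x. \<bar>h x\<bar> <= 1)"
  shows "nets (neuron_net H) (3 * k * 4 ^ (CARD('d) + 1)) (2 * (real CARD('d) + 1)^2)"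
  unfolding nets_def
proof (intro allI conjI ballI)
  fix J
  have fin: "finite (H \<times> {..<3 :: nat} \<times> (grid_vec J :: (real ^ 'd) set) \<times> grid J)"
    using H finite_grid finite_grid_vec by blast
  then show "finite (neuron_net H J)" unfolding neuron_net_def by blast
  have "card (neuron_net H J) <= card (H \<times> {..<3 :: nat} \<times> (grid_vec J :: (real ^ 'd) set) \<times> grid J)"
    unfolding neuron_net_def by (rule card_image_le[OF fin])
  also have "... = card H * (3 * (card (grid_vec J :: (real ^ 'd) set) * card (grid J)))" by (simp add: card_cartesian_product)
  also have "... <= k * (3 * ((4 ^ Suc J) ^ CARD('d) * 4 ^ Suc J))"
    by (intro mult_le_mono H card_grid_vec card_grid) simp
  also have "... = (3 * k) ^ 1 * (4 ^ (CARD('d) + 1)) ^ Suc J"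
  proof -
    have "((4 :: nat) ^ Suc J) ^ CARD('d) * 4 ^ Suc J = (4 ^ Suc J) ^ (CARD('d) + 1)" by (simp add: mult.commute)
    also have "... = (4 ^ (CARD('d) + 1)) ^ Suc J" by (simp only: power_mult[symmetric] mult.commute)
    finally show ?thesis by (simp only: power_one_right mult_ac)
  qed
  \<comment> \<open>The number of prefactors and activations does not grow with \<open>J\<close>;
    raising it to the same power merges everything into one base.\<close>
  also have "... <= (3 * k) ^ Suc J * (4 ^ (CARD('d) + 1)) ^ Suc J"
  proof (rule mult_le_mono1)
    show "(3 * k) ^ 1 <= (3 * k) ^ Suc J" by (cases "k = 0") (auto intro: power_increasing)
  qed
  also have "... = (3 * k * 4 ^ (CARD('d) + 1)) ^ Suc J" by (rule power_mult_distrib[symmetric])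
  finally show "card (neuron_net H J) <= (3 * k * 4 ^ (CARD('d) + 1)) ^ Suc J" .
  fix g assume "g \<in> neuron_net H J"
  then obtain h' s W b where g: "g = neuron h' s W b" "h' \<in> H" "W \<in> grid_vec J" "b \<in> grid J"
    by (auto simp: neuron_net_def)
  show "g \<in> borel_measurable borel" unfolding g(1) using h[OF g(2)] by (intro measurable_neuron) simp
  show "\<bar>g x\<bar> <= 2 * (real CARD('d) + 1)^2" for x
    unfolding g(1) using h[OF g(2)] grid_vec_le_1[OF g(3)] grid_le_1[OF g(4)] by (intro neuron_bound) auto
qed

text \<open>With \<open>R = real CARD('d) + 1\<close>, rounding the parameters to the grid moves the
  argument by at most \<open>R / 2 ^ J\<close>, and the activations are Lipschitz with constant
  \<open>2 * R\<close> there. The product \<open>2 * R^2\<close> is also the bound in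
  \<open>nets_neurons\<close>.\<close>

lemma net_limit_neuron:
  fixes H :: "(real ^ 'd => real) set"
  assumes h: "h \<in> H" "h \<in> borel_measurable borel" "\<And>x. \<bar>h x\<bar> <= 1"
    and s: "s < 3" and W: "\<And>l. \<bar>W $ l\<bar> <= 1" and b: "\<bar>b\<bar> <= 1"
  shows "net_limit (neuron_net H) (2 * (real CARD('d) + 1)^2) (neuron h s W b)"
  unfolding net_limit_def
proof (intro allI conjI measurable_neuron h(2) neuron_bound h(3) W b)
  fix J
  let ?R = "real CARD('d) + 1"
  obtain V where V: "V \<in> grid_vec J" "\<And>l. \<bar>W $ l - V $ l\<bar> <= 1 / 2 ^ J" using grid_vec_approx[OF W] by blast
  obtain c where c: "c \<in> grid J" "\<bar>b - c\<bar> <= 1 / 2 ^ J" using grid_approx[OF b] by blast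
  show "\<exists>g\<in>neuron_net H J. \<forall>x. \<bar>neuron h s W b x - g x\<bar> <= 2 * ?R^2 / 2 ^ J"
  proof (intro bexI[of _ "neuron h s V c"] allI)
    show "neuron h s V c \<in> neuron_net H J" using h(1) s V(1) c(1) by (force simp: neuron_net_def)
    fix x :: "real ^ 'd"
    let ?t = "indicator cube x * (W \<bullet> x + b)" and ?t' = "indicator cube x * (V \<bullet> x + c)"
    have t: "\<bar>?t\<bar> <= ?R" "\<bar>?t'\<bar> <= ?R"
      using affine_cube_le[of W 1 b x, OF W b] affine_cube_le[of V 1 c x, OF grid_vec_le_1[OF V(1)] grid_le_1[OF c(1)]] by simp_all
    have "\<bar>indicator cube x * ((W - V) \<bullet> x + (b - c))\<bar> <= ?R * (1 / 2 ^ J)"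
      by (rule affine_cube_le) (use V(2) c(2) in simp_all)
    moreover have "indicator cube x * ((W - V) \<bullet> x + (b - c)) = ?t - ?t'" by (simp add: inner_diff_left algebra_simps)
    ultimately have tt: "\<bar>?t - ?t'\<bar> <= ?R * (1 / 2 ^ J)" by simp
    have "\<bar>neuron h s W b x - neuron h s V c x\<bar> = \<bar>h x\<bar> * \<bar>act s ?t - act s ?t'\<bar>"
      unfolding neuron_def by (simp only: right_diff_distrib[symmetric] abs_mult)
    also have "... <= 1 * (2 * ?R * (?R * (1 / 2 ^ J)))"
    proof (intro mult_mono h(3))
      have "\<bar>act s ?t - act s ?t'\<bar> <= 2 * ?R * \<bar>?t - ?t'\<bar>" by (rule act_lipschitz[OF t]) simp
      also have "... <= 2 * ?R * (?R * (1 / 2 ^ J))" by (intro mult_left_mono tt) simp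
      finally show "\<bar>act s ?t - act s ?t'\<bar> <= 2 * ?R * (?R * (1 / 2 ^ J))" .
    qed auto
    also have "... = 2 * ?R^2 / 2 ^ J" by (simp add: power2_eq_square)
    finally show "\<bar>neuron h s W b x - neuron h s V c x\<bar> <= 2 * ?R^2 / 2 ^ J" .
  qed
qed

text \<open>The ball of radius \<open>C\<close> of the variation space of the dictionary.\<close>

definition atomic :: "(nat => (real ^ 'd => real) set) => real => real => (real ^ 'd => 'v::real_normed_vector) => bool" where
  "atomic G K C h \<longleftrightarrow> (\<exists>k q v. (\<forall>t<k :: nat. net_limit G K (q t)) \<and>
     (\<forall>x\<in>cube. h x = (\<Sum>t<k. q t x *\<^sub>R v t)) \<and> (\<Sum>t<k. norm (v t)) <= C)"

lemma atomic_single: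
  assumes "net_limit G K q" "norm v <= C" "\<And>x. x \<in> cube ==> h x = q x *\<^sub>R v"
  shows "atomic G K C h"
  unfolding atomic_def using assms by (intro exI[of _ 1] exI[of _ "\<lambda>_. q"] exI[of _ "\<lambda>_. v"]) simp

lemma atomic_mono: "atomic G K C h ==> C <= C' ==> atomic G K C' h"
  unfolding atomic_def by (elim exE conjE, intro exI conjI, assumption, assumption, rule order_trans)

lemma atomic_cong: "atomic G K C h ==> (\<And>x. x \<in> cube ==> h' x = h x) ==> atomic G K C h'"
  unfolding atomic_def by simp

lemma atomic_add:
  assumes "atomic G K C h" "atomic G K C' h'"
  shows "atomic G K (C + C') (\<lambda>x. h x + h' x)"
proof -
  obtain k q v where 1: "\<forall>t<k :: nat. net_limit G K (q t)" "\<forall>x\<in>cube. h x = (\<Sum>t<k. q t x *\<^sub>R v t)" "(\<Sum>t<k. norm (v t)) <= C"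
    using assms(1) unfolding atomic_def by blast
  obtain k' q' v' where 2: "\<forall>t<k' :: nat. net_limit G K (q' t)" "\<forall>x\<in>cube. h' x = (\<Sum>t<k'. q' t x *\<^sub>R v' t)" "(\<Sum>t<k'. norm (v' t)) <= C'"
    using assms(2) unfolding atomic_def by blast
  let ?q = "\<lambda>t. if t < k then q t else q' (t - k)" and ?v = "\<lambda>t. if t < k then v t else v' (t - k)"
  have s: "(\<Sum>t<k + k'. ?q t x *\<^sub>R ?v t) = (\<Sum>t<k. q t x *\<^sub>R v t) + (\<Sum>t<k'. q' t x *\<^sub>R v' t)" for x
    by (rule trans[OF sum.cong[OF refl] sum_concat[where f = "\<lambda>t. q t x *\<^sub>R v t" and g = "\<lambda>t. q' t x *\<^sub>R v' t"]]) auto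
  have n: "(\<Sum>t<k + k'. norm (?v t)) = (\<Sum>t<k. norm (v t)) + (\<Sum>t<k'. norm (v' t))"
    by (rule trans[OF sum.cong[OF refl] sum_concat[where f = "\<lambda>t. norm (v t)" and g = "\<lambda>t. norm (v' t)"]]) auto
  show ?thesis
    unfolding atomic_def
  proof (intro exI[of _ "k + k'"] exI[of _ ?q] exI[of _ ?v] conjI)
    show "\<forall>t<k + k'. net_limit G K (?q t)" using 1(1) 2(1) by auto
    show "\<forall>x\<in>cube. h x + h' x = (\<Sum>t<k + k'. ?q t x *\<^sub>R ?v t)" unfolding s using 1(2) 2(2) by simp
    show "(\<Sum>t<k + k'. norm (?v t)) <= C + C'" unfolding n using 1(3) 2(3) by simp
  qed
qed

lemma atomic_sum:
  assumes "finite T" "\<And>t. t \<in> T ==> atomic G K (C t) (h t)"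
  shows "atomic G K (\<Sum>t\<in>T. C t) (\<lambda>x. \<Sum>t\<in>T. h t x)"
  using assms
proof (induction T rule: finite_induct)
  case empty
  show ?case unfolding atomic_def by (intro exI[of _ 0]) simp
next
  case (insert t T)
  then show ?case using atomic_add[of G K "C t" "h t" "\<Sum>t\<in>T. C t"] by simp
qed

text \<open>Scalar features are embedded, so that one notion of majorant serves all features.\<close>

lemma atomic_Pair:
  assumes "atomic G K C h"
  shows "atomic G K C (\<lambda>x. (0, h x :: real))"
proof -
  obtain k q v where "\<forall>t<k :: nat. net_limit G K (q t)" "\<forall>x\<in>cube. h x = (\<Sum>t<k. q t x *\<^sub>R v t)" "(\<Sum>t<k. norm (v t)) <= C"
    using assms unfolding atomic_def by blast
  then show ?thesis
    unfolding atomic_def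
    by (intro exI[of _ k] exI[of _ q] exI[of _ "\<lambda>t. (0, v t)"]) (auto simp: norm_Pair prod_eq_iff fst_sum snd_sum)
qed

text \<open>A statement about one outcome that covers all features of the variation space at once,
  including those of a network selected by means of the sample. The scaling by \<open>C^2\<close>
  and \<open>C\<close> later produces the factor \<open>B^2\<close>.\<close>

definition majorant :: "'i set => ('i => 'w => real ^ 'd) => (real ^ 'd) measure => (nat => (real ^ 'd => real) set) => real => 'w => ennreal => bool" where
  "majorant I X \<rho> G K \<omega> z \<longleftrightarrow>
    (\<forall>C (h :: real ^ 'd => (real ^ 'd) \<times> real). atomic G K C h --> h \<in> borel_measurable borel -->
      ennreal \<bar>deviation I X \<rho> (\<lambda>x. (norm (h x))^2) \<omega>\<bar> <= ennreal (C^2) * z) \<and>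
    (\<forall>C (h :: real ^ 'd => real). atomic G K C h --> h \<in> borel_measurable borel -->
      ennreal \<bar>deviation I X \<rho> h \<omega>\<bar> <= ennreal C * z)"

lemma majorant_mono:
  assumes m: "majorant I X \<rho> G K \<omega> z" and z: "z <= z'"
  shows "majorant I X \<rho> G K \<omega> z'"
  unfolding majorant_def
  by (intro conjI allI impI; rule order_trans[OF _ mult_left_mono[OF z]]) (use m in \<open>auto simp: majorant_def\<close>)

lemma majorantD:
  fixes h :: "real ^ 'd => real" and h' :: "real ^ 'd => (real ^ 'd) \<times> real"
  assumes "majorant I X \<rho> G K \<omega> (ennreal z)" "z >= 0"
  shows "atomic G K C h' ==> h' \<in> borel_measurable borel ==> \<bar>deviation I X \<rho> (\<lambda>x. (norm (h' x))^2) \<omega>\<bar> <= C^2 * z"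
    and "atomic G K C h ==> h \<in> borel_measurable borel ==> C >= 0 ==> \<bar>deviation I X \<rho> h \<omega>\<bar> <= C * z"
  using assms(1)[unfolded majorant_def, THEN conjunct1, rule_format, of C h'] assms(1)[unfolded majorant_def, THEN conjunct2, rule_format, of C h] assms(2)
  by (simp_all add: ennreal_mult[symmetric])

context iid_sample
begin

lemma deviation_cong_AE:
  assumes "\<And>i. i \<in> I ==> h (X i \<omega>) = h' (X i \<omega>)" "AE x in \<rho>. h x = h' x"
    "h \<in> borel_measurable borel" "h' \<in> borel_measurable borel"
  shows "deviation I X \<rho> h \<omega> = deviation I X \<rho> h' \<omega>"
proof -
  have "(LINT x|\<rho>. h x) = (LINT x|\<rho>. h' x)"
    using assms(2-4) by (intro integral_cong_AE) (simp_all add: measurable_cong_sets[OF sets_rho refl])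
  then show ?thesis using assms(1) by (simp add: deviation_def)
qed

end

text \<open>\<open>Z\<close> is obtained before any feature is named. The representation of a
  feature holds only on the cube, hence the restriction to outcomes whose sample points lie
  there.\<close>

lemma atomic_deviation:
  fixes X :: "'i => 'w => real ^ 'd"
  assumes iid: "iid_sample M I X \<rho>" and cube: "AE x in \<rho>. x \<in> cube"
    and G: "nets G A K" and A: "A >= 1" and K: "K > 0" and one: "net_limit G K (\<lambda>_. 1)"
  shows "\<exists>Z\<in>borel_measurable M.
    (\<integral>\<^sup>+\<omega>. Z \<omega> \<partial>M) <= ennreal (2 * K^2 / sqrt (card I) * (40 + 80 * ln A)) \<and>
    (\<forall>\<omega>. (\<forall>i\<in>I. X i \<omega> \<in> cube) --> majorant I X \<rho> G K \<omega> (Z \<omega>))"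
proof -
  interpret iid_sample M I X \<rho> by (rule iid)
  obtain Z where Z1: "Z \<in> borel_measurable M" and Z: "(\<integral>\<^sup>+\<omega>. Z \<omega> \<partial>M) <= ennreal (2 * K^2 / sqrt (card I) * (40 + 80 * ln A)) \<and>
    (\<forall>(T :: nat set) q (v :: nat => (real ^ 'd) \<times> real). finite T --> (\<forall>t\<in>T. net_limit G K (q t)) -->
      (\<forall>\<omega>. ennreal \<bar>deviation I X \<rho> (\<lambda>x. (norm (\<Sum>t\<in>T. q t x *\<^sub>R v t))^2) \<omega>\<bar> <= ennreal ((\<Sum>t\<in>T. norm (v t))^2) * Z \<omega>)) \<and>
    (\<forall>(T :: nat set) q (c :: nat => real). finite T --> (\<forall>t\<in>T. net_limit G K (q t)) -->
      (\<forall>\<omega>. ennreal \<bar>deviation I X \<rho> (\<lambda>x. \<Sum>t\<in>T. q t x * c t) \<omega>\<bar> <= ennreal (\<Sum>t\<in>T. \<bar>c t\<bar>) * Z \<omega>))"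
    using quadratic_deviation[OF G A K one, where 't = nat and 'v = "(real ^ 'd) \<times> real"] by (rule bexE)
  note quad = Z[THEN conjunct2, THEN conjunct1, rule_format]
  note lin = Z[THEN conjunct2, THEN conjunct2, rule_format]
  have "majorant I X \<rho> G K \<omega> (Z \<omega>)" if \<omega>: "\<forall>i\<in>I. X i \<omega> \<in> cube" for \<omega>
    unfolding majorant_def
  proof (intro conjI allI impI)
    fix C and h :: "real ^ 'd => (real ^ 'd) \<times> real"
    assume h: "atomic G K C h" "h \<in> borel_measurable borel"
    obtain k q v where r: "\<forall>t<k :: nat. net_limit G K (q t)" "\<forall>x\<in>cube. h x = (\<Sum>t<k. q t x *\<^sub>R v t)" "(\<Sum>t<k. norm (v t)) <= C"
      using h(1) unfolding atomic_def by blast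
    have m: "(\<lambda>x. \<Sum>t<k. q t x *\<^sub>R v t) \<in> borel_measurable borel"
      using r(1) by (intro borel_measurable_sum borel_measurable_scaleR) (auto simp: net_limit_def)
    have "deviation I X \<rho> (\<lambda>x. (norm (h x))^2) \<omega> = deviation I X \<rho> (\<lambda>x. (norm (\<Sum>t<k. q t x *\<^sub>R v t))^2) \<omega>"
    proof (rule deviation_cong_AE)
      show "AE x in \<rho>. (norm (h x))^2 = (norm (\<Sum>t<k. q t x *\<^sub>R v t))^2"
        using cube by eventually_elim (simp add: r(2))
    qed (use r(2) \<omega> h(2) m in auto)
    then have "ennreal \<bar>deviation I X \<rho> (\<lambda>x. (norm (h x))^2) \<omega>\<bar> <= ennreal ((\<Sum>t<k. norm (v t))^2) * Z \<omega>"
      using quad[of "{..<k}" q v \<omega>] r(1) by (simp only: finite_lessThan lessThan_iff)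
    also have "... <= ennreal (C^2) * Z \<omega>"
      using r(3) by (intro mult_right_mono ennreal_leI power_mono sum_nonneg) auto
    finally show "ennreal \<bar>deviation I X \<rho> (\<lambda>x. (norm (h x))^2) \<omega>\<bar> <= ennreal (C^2) * Z \<omega>" .
  next
    fix C and h :: "real ^ 'd => real"
    assume h: "atomic G K C h" "h \<in> borel_measurable borel"
    obtain k q v where r: "\<forall>t<k :: nat. net_limit G K (q t)" "\<forall>x\<in>cube. h x = (\<Sum>t<k. q t x *\<^sub>R v t)" "(\<Sum>t<k. norm (v t)) <= C"
      using h(1) unfolding atomic_def by blast
    have m: "(\<lambda>x. \<Sum>t<k. q t x * v t) \<in> borel_measurable borel"
      using r(1) by (intro borel_measurable_sum borel_measurable_times) (auto simp: net_limit_def)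
    have "deviation I X \<rho> h \<omega> = deviation I X \<rho> (\<lambda>x. \<Sum>t<k. q t x * v t) \<omega>"
    proof (rule deviation_cong_AE)
      show "AE x in \<rho>. h x = (\<Sum>t<k. q t x * v t)"
        using cube by eventually_elim (simp add: r(2))
    qed (use r(2) \<omega> h(2) m in auto)
    then have "ennreal \<bar>deviation I X \<rho> h \<omega>\<bar> <= ennreal (\<Sum>t<k. \<bar>v t\<bar>) * Z \<omega>"
      using lin[of "{..<k}" q v \<omega>] r(1) by (simp only: finite_lessThan lessThan_iff)
    also have "... <= ennreal C * Z \<omega>"
      using r(3) by (intro mult_right_mono ennreal_leI) auto
    finally show "ennreal \<bar>deviation I X \<rho> h \<omega>\<bar> <= ennreal C * Z \<omega>" .
  qed
  then show ?thesis by (intro bexI[of _ Z] conjI allI impI Z1 Z[THEN conjunct1])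
qed

section \<open>The error of the trained network\<close>

lemma abs_divide_le_1: "\<bar>a\<bar> <= b ==> \<bar>a / b\<bar> <= (1 :: real)"
  by (cases "b = 0") (auto simp: abs_divide divide_le_eq)

text \<open>If the bound is zero then so is \<open>a\<close>, and \<open>0 / 0 * 0 = 0\<close>. The
  normalised data below are thus recovered even when the Barron norm vanishes.\<close>

lemma normalize_mult: "\<bar>a\<bar> <= b ==> a / b * b = (a :: real)"
  by (cases "b = 0") auto

locale barron_setting =
  fixes n :: nat and \<alpha> :: bc and lam mu d :: real and u :: "real ^ 'd::finite => real"
  assumes d_eq: "d = real CARD('d)" and n: "n >= 1" and lam: "lam > 0" and mu: "mu > 0" and u: "u \<in> barron_space (2 * n + 2)"
begin

abbreviation U :: "real ^ 'd => 'd state" where "U \<equiv> U_field (barron_weight u) barron_freq"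
abbreviation DU :: "'d => real ^ 'd => 'd state" where "DU \<equiv> U_deriv (barron_weight u) barron_freq"

definition B :: real where "B = barron_norm (2 * n + 2) u"

text \<open>The right-hand side \<open>f\<close> is prescribed only in the interior; this series is
  its continuous version on the whole space.\<close>

definition fbar :: "real ^ 'd => real" where
  "fbar = wave (\<lambda>j. barron_weight u j * (- (norm (barron_freq j))\<^sup>2) ^ n) barron_freq 0"

lemma moments_u: "moments (2 * n + 2) (barron_weight u) (barron_freq :: _ => real ^ 'd)"
  by (rule moments_barron[OF has_sum_imp_summable[OF barron_weights_has_sum[OF u]]])

lemma C1_U: "C1_field n U DU"
  by (rule C1_field_U[OF moments_u])

lemma B_nonneg: "B >= 0"
  unfolding B_def by (rule has_sum_nonneg[OF barron_weights_has_sum[OF u]]) (auto intro!: mult_nonneg_nonneg add_nonneg_nonneg zero_le_power sum_nonneg)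

text \<open>A multiplier of order at most \<open>2 * n + 2\<close> is dominated by the weight in the
  Barron norm, so the derivatives of the solution that occur are bounded by \<open>B\<close>
  itself.\<close>

lemma wave_le_B:
  assumes c: "\<And>j. \<bar>c j\<bar> <= norm (barron_freq j :: real ^ 'd) ^ q" and q: "q <= 2 * n + 2"
  shows "\<bar>wave (\<lambda>j. barron_weight u j * c j) (barron_freq :: _ => real ^ 'd) p x\<bar> <= B"
proof -
  have m: "moments 0 (\<lambda>j. barron_weight u j * c j) (barron_freq :: _ => real ^ 'd)"
    by (rule moments_mult[of 0 q]) (use moments_mono[OF moments_u, of q] q c in auto)
  have "\<bar>wave (\<lambda>j. barron_weight u j * c j) (barron_freq :: _ => real ^ 'd) p x\<bar> <= (\<Sum>\<^sub>\<infinity>j. \<bar>barron_weight u j * c j\<bar>)"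
    by (rule abs_wave_le[OF m])
  also have "... <= (\<Sum>\<^sub>\<infinity>j. \<bar>barron_weight u j\<bar> * (1 + (\<Sum>l\<in>UNIV. \<bar>(barron_freq j :: real ^ 'd) $ l\<bar>) ^ (2 * n + 2)))"
  proof (rule infsum_mono)
    show "(\<lambda>j. \<bar>barron_weight u j * c j\<bar>) summable_on UNIV" by (rule moments_abs_summable[OF m])
    show "(\<lambda>j. \<bar>barron_weight u j\<bar> * (1 + (\<Sum>l\<in>UNIV. \<bar>(barron_freq j :: real ^ 'd) $ l\<bar>) ^ (2 * n + 2))) summable_on UNIV"
      by (rule has_sum_imp_summable[OF barron_weights_has_sum[OF u]])
    show "\<bar>barron_weight u j * c j\<bar> <= \<bar>barron_weight u j\<bar> * (1 + (\<Sum>l\<in>UNIV. \<bar>(barron_freq j :: real ^ 'd) $ l\<bar>) ^ (2 * n + 2))" for j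
      unfolding abs_mult
      by (intro mult_left_mono order_trans[OF c power_le_one_plus[OF norm_ge_zero norm_le_l1_cart q]]) simp
  qed
  also have "... = B" unfolding B_def by (rule infsumI[OF barron_weights_has_sum[OF u]])
  finally show ?thesis .
qed

lemma fbar_le: "\<bar>fbar x\<bar> <= B"
  unfolding fbar_def by (rule wave_le_B[of _ "2 * n"]) (simp_all add: power_abs power_mult)

lemma fst_U_le: "i < n ==> \<bar>fst (U x i)\<bar> <= B"
  unfolding U_field_def fst_conv by (rule wave_le_B[of _ "2 * i"]) (simp_all add: power_abs power_mult)

lemma snd_U_le: "i < n ==> \<bar>snd (U x i) $ l\<bar> <= B"
  unfolding U_field_def snd_conv vec_lambda_beta mult.assoc
proof (rule wave_le_B[of _ "2 * i + 1"])
  fix j :: "(nat ^ 'd) \<times> 'd set"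
  let ?k = "barron_freq j :: real ^ 'd"
  have "\<bar>(- (norm ?k)\<^sup>2) ^ i * ?k $ l\<bar> = norm ?k ^ (2 * i) * \<bar>?k $ l\<bar>" by (simp add: abs_mult power_abs power_mult)
  also have "... <= norm ?k ^ (2 * i) * norm ?k" by (intro mult_left_mono component_le_norm_cart) simp
  finally show "\<bar>(- (norm ?k)\<^sup>2) ^ i * ?k $ l\<bar> <= norm ?k ^ (2 * i + 1)" by (simp add: mult.commute)
qed simp

lemma P_feat_U:
  assumes i: "i < n"
  shows "P_feat n U DU x i = (0, if Suc i = n then fbar x else 0)"
proof -
  have m4: "moments 4 (\<lambda>j. barron_weight u j * (- (norm (barron_freq j :: real ^ 'd))\<^sup>2) ^ i) barron_freq"
    by (rule moments_laplace, rule moments_mono[OF moments_u]) (use i in simp)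
  have "(\<Sum>l\<in>UNIV. snd (DU l x i) $ l) = wave (\<lambda>j. barron_weight u j * (- (norm (barron_freq j :: real ^ 'd))\<^sup>2) ^ i * - (norm (barron_freq j :: real ^ 'd))\<^sup>2) barron_freq 0 x"
    unfolding U_deriv_def snd_conv vec_lambda_beta by (rule wave_divergence[OF m4])
  also have "... = wave (\<lambda>j. barron_weight u j * (- (norm (barron_freq j :: real ^ 'd))\<^sup>2) ^ Suc i) barron_freq 0 x"
    by (simp add: mult_ac)
  finally have "(\<Sum>l\<in>UNIV. snd (DU l x i) $ l) = (if Suc i < n then fst (U x (Suc i)) else 0) + (if Suc i = n then fbar x else 0)"
    using i by (auto simp: U_field_def fbar_def)
  moreover have "(\<chi> l. fst (DU l x i)) = snd (U x i)" by (simp add: U_deriv_def U_field_def)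
  ultimately show ?thesis by (simp add: P_feat_def)
qed

definition SU :: "nat => real ^ 'd => real" where "SU i x = S_feat \<alpha> U (outer_normal x) x i"

lemma SU_le:
  assumes i: "i < n"
  shows "\<bar>SU i x\<bar> <= (1 + d) * B"
proof -
  have "\<bar>outer_normal x \<bullet> snd (U x i)\<bar> <= (\<Sum>l\<in>UNIV. \<bar>outer_normal x $ l * snd (U x i) $ l\<bar>)"
    unfolding inner_vec_def by (simp add: sum_abs)
  also have "... <= (\<Sum>l\<in>(UNIV :: 'd set). 1 * B)"
    unfolding abs_mult using snd_U_le[OF i] by (intro sum_mono mult_mono abs_outer_normal_le) auto
  finally have 1: "\<bar>outer_normal x \<bullet> snd (U x i)\<bar> <= d * B" by (simp add: d_eq)
  have "\<bar>SU i x\<bar> <= \<bar>bc0 \<alpha>\<bar> * \<bar>fst (U x i)\<bar> + \<bar>bc1 \<alpha>\<bar> * \<bar>outer_normal x \<bullet> snd (U x i)\<bar>"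
    unfolding SU_def S_feat_def abs_mult[symmetric] by (rule abs_triangle_ineq)
  also have "... <= 1 * B + 1 * (d * B)"
    using fst_U_le[OF i] 1 by (intro add_mono mult_mono bc_bounds) auto
  finally show ?thesis by (simp add: algebra_simps)
qed

lemma measurable_S:
  assumes E: "C1_field n E D" and i: "i < n"
  shows "(\<lambda>x. S_feat \<alpha> E (outer_normal x) x i) \<in> borel_measurable borel"
  unfolding S_feat_def inner_vec_def inner_real_def
  by (intro borel_measurable_add borel_measurable_times borel_measurable_sum borel_measurable_const measurable_outer_normal
    continuous_measurable[OF C1_field_continuous(1)[OF E i]] continuous_measurable[OF continuous_on_component[OF C1_field_continuous(2)[OF E i]]])

lemma continuous_fbar: "continuous_on UNIV fbar"
  unfolding fbar_def by (rule continuous_wave, rule moments_laplace, rule moments_mono[OF moments_u]) simp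

text \<open>Besides the constant and the components of the normal, the data of the problem have to
  be prefactors, since they occur in the residuals. Normalised by their bounds they lie in the unit
  ball, and their number does not depend on \<open>u\<close>.\<close>

definition dictionary :: "(real ^ 'd => real) set" where
  "dictionary = {\<lambda>_. 1, \<lambda>x. fbar x / B} \<union> range (\<lambda>l x. outer_normal x $ l) \<union> (\<lambda>i x. SU i x / ((1 + d) * B)) ` {..<n}"

lemma finite_dictionary: "finite dictionary"
  by (simp add: dictionary_def)

lemma card_dictionary: "card dictionary <= 2 + CARD('d) + n"
proof -
  have "card {\<lambda>_ :: real ^ 'd. 1 :: real, \<lambda>x. fbar x / B} <= 2" by (simp add: card_insert_if)
  moreover have "card (range (\<lambda>l (x :: real ^ 'd). outer_normal x $ l)) <= CARD('d)" by (rule card_image_le) simp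
  moreover have "card ((\<lambda>i x. SU i x / ((1 + d) * B)) ` {..<n}) <= n" using card_image_le[of "{..<n}"] by simp
  ultimately show ?thesis
    unfolding dictionary_def by (intro order_trans[OF card_Un_le] add_mono order_trans[OF card_Un_le])
qed

lemma dictionary_props: "h \<in> dictionary ==> h \<in> borel_measurable borel \<and> (\<forall>x. \<bar>h x\<bar> <= 1)"
  unfolding dictionary_def SU_def
  using measurable_S[OF C1_U] continuous_measurable[OF continuous_fbar] measurable_outer_normal
    abs_outer_normal_le abs_divide_le_1[OF fbar_le] abs_divide_le_1[OF SU_le, unfolded SU_def]
  by (auto intro!: borel_measurable_divide)

abbreviation G :: "nat => (real ^ 'd => real) set" where "G \<equiv> neuron_net dictionary"
abbreviation K :: real where "K \<equiv> 2 * (d + 1)^2"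

lemma limit_neuron:
  assumes h: "h \<in> dictionary" and s: "s < 3" and W: "norm W <= 1" and b: "\<bar>b\<bar> <= 1"
  shows "net_limit G K (neuron h s W b)"
proof (rule net_limit_neuron[OF h, folded d_eq])
  show "\<bar>W $ l\<bar> <= 1" for l using component_le_norm_cart[of W l] W by linarith
qed (use dictionary_props[OF h] s b in auto)

lemma limit_one: "net_limit G K (\<lambda>_. 1)"
proof -
  have "neuron (\<lambda>_. 1) 0 0 0 = (\<lambda>_ :: real ^ 'd. 1)" by (simp add: neuron_def act_def fun_eq_iff)
  then show ?thesis using limit_neuron[of "\<lambda>_. 1" 0 0 0] by (simp add: dictionary_def)
qed

lemma atomic_neuron:
  assumes "h \<in> dictionary" "s < 3" "norm W <= 1" "\<bar>b\<bar> <= 1" "norm v <= C"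
  shows "atomic G K C (\<lambda>x. (h x * act s (W \<bullet> x + b)) *\<^sub>R v)"
  by (rule atomic_single[OF limit_neuron[OF assms(1-4)] assms(5)]) (simp add: neuron_def)

lemma atomic_mult:
  assumes "h \<in> dictionary" "norm v <= C"
  shows "atomic G K C (\<lambda>x. h x *\<^sub>R v)"
  using atomic_neuron[OF assms(1), of 0 0 0 v C] assms(2) by (simp add: act_def)

end

locale class_member = barron_setting n \<alpha> lam mu d u
  for n \<alpha> lam mu d and u :: "real ^ 'd::finite => real" +
  fixes m :: nat and c :: "'d state" and a :: "nat => 'd state" and W :: "nat => real ^ 'd" and b :: "nat => real"
  assumes c: "vec_norm n c <= 2 * B" and W: "\<And>j. j < m ==> norm (W j) <= 1 \<and> \<bar>b j\<bar> <= 1"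
    and a: "(\<Sum>j<m. vec_norm n (a j)) <= 4 * B"
begin

abbreviation E :: "real ^ 'd => 'd state" where "E \<equiv> \<lambda>x i. network m c a W b x i - U x i"
abbreviation DE :: "'d => real ^ 'd => 'd state" where "DE \<equiv> \<lambda>l x i. net_deriv m a W b l x i - DU l x i"

lemma C1_E: "C1_field n E DE"
  by (rule C1_field_diff[OF C1_field_network C1_U])

lemma c_le: "i < n ==> \<bar>fst (c i)\<bar> <= 2 * B" "i < n ==> norm (snd (c i)) <= 2 * B"
  using norm_le_vec_norm[of i n c] c norm_fst_le[of "fst (c i)" "snd (c i)"] norm_snd_le[of "snd (c i)" "fst (c i)"] by auto

lemma a_le: "i < n ==> \<bar>fst (a j i)\<bar> <= vec_norm n (a j)" "i < n ==> norm (snd (a j i)) <= vec_norm n (a j)"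
  using norm_le_vec_norm[of i n "a j"] norm_fst_le[of "fst (a j i)" "snd (a j i)"] norm_snd_le[of "snd (a j i)" "fst (a j i)"] by auto

text \<open>The constraint on the outer weights of the class bounds the mass; \<open>r\<close> is
  the cost of the operation applied to each weight.\<close>

lemma atomic_layer:
  assumes h: "h \<in> dictionary" and s: "s < 3" and r: "r >= 0" and v: "\<And>j. j < m ==> norm (v j) <= r * vec_norm n (a j)"
  shows "atomic G K (r * (4 * B)) (\<lambda>x. \<Sum>j<m. (h x * act s (W j \<bullet> x + b j)) *\<^sub>R v j)"
proof (rule atomic_mono)
  show "atomic G K (\<Sum>j<m. r * vec_norm n (a j)) (\<lambda>x. \<Sum>j<m. (h x * act s (W j \<bullet> x + b j)) *\<^sub>R v j)"
    using W v by (intro atomic_sum atomic_neuron h s) auto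
  show "(\<Sum>j<m. r * vec_norm n (a j)) <= r * (4 * B)"
    unfolding sum_distrib_left[symmetric] by (intro mult_left_mono a r)
qed

text \<open>In units of \<open>B\<close> the mass is 4 from the constant \<open>c\<close>, 1 from
  the right-hand side, 16 from first derivatives of the neurons and 8 from their values.\<close>

lemma atomic_P:
  assumes i: "i < n"
  shows "atomic G K (29 * B) (\<lambda>x. P_feat n E DE x i)"
proof -
  let ?nx = "\<lambda>e :: 'd state. if Suc i < n then fst (e (Suc i)) else 0"
  let ?net = "\<lambda>x. (\<Sum>j<m. (1 * act 1 (W j \<bullet> x + b j)) *\<^sub>R ((2 * fst (a j i)) *\<^sub>R W j, 2 * (W j \<bullet> snd (a j i)))) +
      (\<Sum>j<m. (1 * act 2 (W j \<bullet> x + b j)) *\<^sub>R (- snd (a j i), - ?nx (a j)))"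
  let ?h = "\<lambda>x. 1 *\<^sub>R (- snd (c i), - ?nx c) + (fbar x / B) *\<^sub>R (0, if Suc i = n then - B else 0) + ?net x"
  have one: "(\<lambda>_. 1) \<in> dictionary" and fb: "(\<lambda>x. fbar x / B) \<in> dictionary" by (simp_all add: dictionary_def)
  have nx_c: "\<bar>?nx c\<bar> <= 2 * B" using c_le(1) B_nonneg by simp
  have nx_a: "\<bar>?nx (a j)\<bar> <= vec_norm n (a j)" for j using a_le(1) vec_norm_nonneg[of n "a j"] by simp
  have "atomic G K (4 * B + B + (4 * (4 * B) + 2 * (4 * B))) ?h"
  proof (intro atomic_add atomic_mult[OF one] atomic_mult[OF fb] atomic_layer[OF one])
    show "norm (- snd (c i), - ?nx c) <= 4 * B"
      using norm_Pair_le[of "- snd (c i)" "- ?nx c"] c_le(2)[OF i] nx_c by simp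
    show "norm (0 :: real ^ 'd, if Suc i = n then - B else 0) <= B" using B_nonneg by (simp add: norm_Pair)
    fix j assume j: "j < m"
    have "\<bar>W j \<bullet> snd (a j i)\<bar> <= 1 * vec_norm n (a j)"
      using W[OF j] a_le(2)[OF i, of j] by (intro order_trans[OF Cauchy_Schwarz_ineq2] mult_mono) auto
    moreover have "\<bar>fst (a j i)\<bar> * norm (W j) <= vec_norm n (a j) * 1"
      using W[OF j] a_le(1)[OF i, of j] vec_norm_nonneg[of n "a j"] by (intro mult_mono) auto
    ultimately show "norm ((2 * fst (a j i)) *\<^sub>R W j, 2 * (W j \<bullet> snd (a j i))) <= 4 * vec_norm n (a j)"
      using norm_Pair_le[of "(2 * fst (a j i)) *\<^sub>R W j" "2 * (W j \<bullet> snd (a j i))"] by (simp add: abs_mult)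
    show "norm (- snd (a j i), - ?nx (a j)) <= 2 * vec_norm n (a j)"
      using norm_Pair_le[of "- snd (a j i)" "- ?nx (a j)"] a_le(2)[OF i, of j] nx_a[of j] by simp
  qed simp_all
  then have "atomic G K (29 * B) ?h"
    by (rule atomic_mono) simp
  then show ?thesis
  proof (rule atomic_cong)
    fix x
    have diff: "P_feat n E DE x i = P_feat n (network m c a W b) (net_deriv m a W b) x i - P_feat n U DU x i"
      by (simp add: P_feat_def vec_eq_iff sum_subtractf)
    have l: "(\<Sum>l\<in>UNIV. \<Sum>j<m. 2 * (W j $ l * (snd (a j i) $ l * relu (W j \<bullet> x + b j)))) = (\<Sum>j<m. 2 * (W j \<bullet> snd (a j i) * relu (W j \<bullet> x + b j)))"
      by (subst sum.swap) (simp add: inner_vec_def sum_distrib_left sum_distrib_right mult_ac)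
    have "P_feat n (network m c a W b) (net_deriv m a W b) x i = (- snd (c i), - ?nx c) + ?net x"
      by (rule prod_eqI) (simp_all add: P_feat_def network_def net_deriv_def act_def fst_sum snd_sum vec_eq_iff l sum_negf mult_ac)
    then show "P_feat n E DE x i = ?h x"
      unfolding diff P_feat_U[OF i] using normalize_mult[OF fbar_le, of x] by (auto simp: prod_eq_iff)
  qed
qed

text \<open>In units of \<open>B\<close> the mass is \<open>2 + 2 * d\<close> from the constant,
  \<open>4 + 4 * d\<close> from the neurons and \<open>1 + d\<close> from the exact boundary data.
  Each normal component is a prefactor of its own, hence the sums over \<open>l\<close>.\<close>

lemma atomic_S:
  assumes i: "i < n"
  shows "atomic G K (7 * (1 + d) * B) (\<lambda>x. S_feat \<alpha> E (outer_normal x) x i)"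
proof -
  let ?net = "\<lambda>x. (\<Sum>l\<in>UNIV. (outer_normal x $ l) *\<^sub>R (bc1 \<alpha> * snd (c i) $ l)) +
      (\<Sum>j<m. (1 * act 2 (W j \<bullet> x + b j)) *\<^sub>R (bc0 \<alpha> * fst (a j i))) +
      (\<Sum>l\<in>UNIV. \<Sum>j<m. (outer_normal x $ l * act 2 (W j \<bullet> x + b j)) *\<^sub>R (bc1 \<alpha> * snd (a j i) $ l))"
  let ?h = "\<lambda>x. 1 *\<^sub>R (bc0 \<alpha> * fst (c i)) + ?net x + (SU i x / ((1 + d) * B)) *\<^sub>R (- ((1 + d) * B))"
  have one: "(\<lambda>_. 1) \<in> dictionary" and nu: "(\<lambda>x. outer_normal x $ l) \<in> dictionary"
    and su: "(\<lambda>x. SU i x / ((1 + d) * B)) \<in> dictionary" for l using i by (auto simp: dictionary_def)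
  have bc: "\<bar>bc0 \<alpha> * y\<bar> <= \<bar>y\<bar>" "\<bar>bc1 \<alpha> * y\<bar> <= \<bar>y\<bar>" for y
    using mult_right_mono[OF bc_bounds(1)[of \<alpha>], of "\<bar>y\<bar>"] mult_right_mono[OF bc_bounds(2)[of \<alpha>], of "\<bar>y\<bar>"] by (simp_all add: abs_mult)
  have "atomic G K (2 * B + ((\<Sum>l\<in>(UNIV :: 'd set). 2 * B) + 1 * (4 * B) + (\<Sum>l\<in>(UNIV :: 'd set). 1 * (4 * B))) + (1 + d) * B) ?h"
  proof (intro atomic_add atomic_sum atomic_mult[OF one] atomic_mult[OF nu] atomic_mult[OF su] atomic_layer[OF one] atomic_layer[OF nu])
    show "norm (bc0 \<alpha> * fst (c i)) <= 2 * B" using bc(1)[of "fst (c i)"] c_le(1)[OF i] by simp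
    show "norm (bc1 \<alpha> * snd (c i) $ l) <= 2 * B" for l
      using bc(2)[of "snd (c i) $ l"] c_le(2)[OF i] component_le_norm_cart[of "snd (c i)" l] by simp
    show "norm (bc0 \<alpha> * fst (a j i)) <= 1 * vec_norm n (a j)" for j using bc(1)[of "fst (a j i)"] a_le(1)[OF i, of j] by simp
    show "norm (bc1 \<alpha> * snd (a j i) $ l) <= 1 * vec_norm n (a j)" for j l
      using bc(2)[of "snd (a j i) $ l"] a_le(2)[OF i, of j] component_le_norm_cart[of "snd (a j i)" l] by simp
    show "norm (- ((1 + d) * B)) <= (1 + d) * B" using B_nonneg by (simp add: abs_mult d_eq)
  qed simp_all
  then have "atomic G K (7 * (1 + d) * B) ?h"
    by (rule atomic_mono) (simp add: d_eq algebra_simps)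
  then show ?thesis
  proof (rule atomic_cong)
    fix x
    have "S_feat \<alpha> E (outer_normal x) x i = S_feat \<alpha> (network m c a W b) (outer_normal x) x i - SU i x"
      by (simp add: S_feat_def SU_def inner_diff_right algebra_simps)
    moreover have "S_feat \<alpha> (network m c a W b) (outer_normal x) x i = bc0 \<alpha> * fst (c i) + ?net x"
      by (simp add: S_feat_def network_def act_def fst_sum snd_sum inner_vec_def sum_distrib_left distrib_left sum.distrib mult_ac)
    ultimately show "S_feat \<alpha> E (outer_normal x) x i = ?h x"
      using normalize_mult[OF SU_le[OF i, of x]] by simp
  qed
qed

lemma atomic_mean: "atomic G K (6 * B) (\<lambda>x. fst (network m c a W b x 0))"
proof -
  have n0: "0 < n" using n by simp
  have one: "(\<lambda>_. 1) \<in> dictionary" by (simp add: dictionary_def)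
  have "atomic G K (2 * B + 1 * (4 * B)) (\<lambda>x. 1 *\<^sub>R fst (c 0) + (\<Sum>j<m. (1 * act 2 (W j \<bullet> x + b j)) *\<^sub>R fst (a j 0)))"
    using c_le(1)[OF n0] a_le(1)[OF n0] by (intro atomic_add atomic_mult[OF one] atomic_layer[OF one]) auto
  then have "atomic G K (6 * B) (\<lambda>x. 1 *\<^sub>R fst (c 0) + (\<Sum>j<m. (1 * act 2 (W j \<bullet> x + b j)) *\<^sub>R fst (a j 0)))"
    by (rule atomic_mono) simp
  then show ?thesis by (rule atomic_cong) (simp add: network_def act_def fst_sum)
qed

lemma network_le: "x \<in> cube ==> i < n ==> norm (network m c a W b x i) <= (2 + 8 * (d + 1)^2) * B"
proof -
  assume x: "x \<in> cube" and i: "i < n"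
  have "norm (network m c a W b x i) <= norm (c i) + 2 * (d + 1)^2 * (\<Sum>j<m. vec_norm n (a j))"
    unfolding d_eq by (rule network_bound(1)[OF W x i])
  also have "... <= 2 * B + 2 * (d + 1)^2 * (4 * B)"
    using norm_le_vec_norm[OF i, of c] c a by (intro add_mono mult_left_mono) auto
  finally show ?thesis by (simp add: algebra_simps)
qed

end

section \<open>Loss and error norms of a network in terms of its error field\<close>

lemma AE_cube_measure_interior: "AE x in cube_measure. x \<in> (interior cube :: (real ^ 'd) set)"
proof -
  interpret prob_space "cube_measure :: (real ^ 'd) measure" by (rule prob_space_cube_measure)
  have "emeasure lborel (cube :: (real ^ 'd) set) = emeasure lborel (box 0 1 :: (real ^ 'd) set)"
    by (simp add: emeasure_lborel_box_eq emeasure_lborel_cbox_eq)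
  moreover have "cube \<inter> box 0 1 = (box 0 1 :: (real ^ 'd) set)" using box_subset_cbox by blast
  ultimately have "emeasure cube_measure (box 0 1 :: (real ^ 'd) set) = 1"
    by (simp add: emeasure_cube_measure emeasure_lborel_cube)
  then have "prob (box 0 1) = 1" by (simp add: measure_def)
  then have "AE x in cube_measure. x \<in> (box 0 1 :: (real ^ 'd) set)" by (rule AE_prob_1)
  then show ?thesis by simp
qed

lemma L2_norm_cube:
  fixes F :: "real ^ 'd => 'b::real_normed_vector"
  assumes F: "continuous_on UNIV F" and h: "\<And>x. x \<in> cube ==> h x = F x"
  shows "(L2_norm h)^2 = cint (\<lambda>x. (norm (F x))^2)"
proof -
  have "(LINT x:cube|lborel. (norm (h x))^2) = (LINT x:cube|lborel. (norm (F x))^2)"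
    by (rule set_lebesgue_integral_cong) (auto simp: h)
  also have "... = cint (\<lambda>x. (norm (F x))^2)"
    by (intro set_integral_cube continuous_measurable continuous_intros F)
  finally have eq: "(LINT x:cube|lborel. (norm (h x))^2) = cint (\<lambda>x. (norm (F x))^2)" .
  have "0 <= cint (\<lambda>x. (norm (F x))^2)" by simp
  then show ?thesis unfolding L2_norm_def eq by simp
qed

lemma vec_norm_square: "(vec_norm n P)^2 = (\<Sum>i<n. (norm (P i))^2)"
  by (simp add: vec_norm_def L2_set_def sum_nonneg)

context barron_setting
begin

lemma solution_wave:
  assumes "is_solution \<alpha> n f g u" "x \<in> cube"
  shows "u x = wave (barron_weight u) barron_freq 0 x"
  using assms n by (intro barron_representation[OF u]) (auto simp: is_solution_def)

lemma laplacian_solution: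
  assumes sol: "is_solution \<alpha> n f g u" and x: "x \<in> cube"
  shows "k < n ==> (laplacian ^^ k) u x = fst (U x k)" "(laplacian ^^ n) u x = fbar x"
  using laplacian_power_wave[OF solution_wave[OF sol] moments_u _ x] by (simp_all add: U_field_def fbar_def)

lemma gradient_solution:
  assumes sol: "is_solution \<alpha> n f g u" and x: "x \<in> cube" and k: "k < n"
  shows "gradient ((laplacian ^^ k) u) x = snd (U x k)"
proof -
  have "gradient ((laplacian ^^ k) u) x = (\<chi> l. fst (DU l x k))"
    by (rule gradient_cube[OF C1_field_fst[OF C1_U k] _ x]) (rule laplacian_solution(1)[OF sol _ k])
  then show ?thesis by (simp add: U_deriv_def U_field_def)
qed

lemma mean_solution:
  assumes sol: "is_solution \<alpha> n f g u" and N: "\<alpha> = Neumann"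
  shows "cint (\<lambda>x. fst (U x 0)) = 0"
proof -
  have n0: "0 < n" using n by simp
  have "(LINT x:cube|lborel. fst (U x 0)) = cint (\<lambda>x. fst (U x 0))"
    by (intro set_integral_cube continuous_measurable C1_field_continuous(1)[OF C1_U n0])
  moreover have "(LINT x:cube|lborel. fst (U x 0)) = (LINT x:cube|lborel. u x)"
    using laplacian_solution(1)[OF sol _ n0] by (intro set_lebesgue_integral_cong) auto
  ultimately show ?thesis using sol N by (simp add: is_solution_def)
qed

lemma boundary_data:
  assumes sol: "is_solution \<alpha> n f g u" and x: "x \<in> smooth_boundary" and k: "k < n"
  shows "g x k = S_feat \<alpha> U (outer_normal x) x k"
proof -
  have "x \<in> bc_points \<alpha>" using x smooth_boundary_frontier by (auto simp: bc_points_def)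
  then have "g x k = bc_trace \<alpha> ((laplacian ^^ k) u) x" using sol k by (auto simp: is_solution_def)
  moreover have "x \<in> cube" using x by (simp add: smooth_boundary_def)
  ultimately show ?thesis
    by (cases \<alpha>) (simp_all add: S_feat_def normal_deriv_def laplacian_solution(1)[OF sol _ k] gradient_solution[OF sol _ k])
qed

end

context class_member
begin

abbreviation V :: "real ^ 'd => 'd state" where "V \<equiv> network m c a W b"

text \<open>By linearity, subtracting the equation of the exact field removes \<open>f\<close>. The
  equation is imposed in the interior, so this is done at interior points.\<close>

lemma interior_residual:
  assumes sol: "is_solution \<alpha> n f g u" and x: "x \<in> interior cube" and i: "i < n"
  shows "P_op n V x i - rhs n f x i = P_feat n E DE x i"
proof -
  have xc: "x \<in> cube" using x interior_subset by blast
  have "f x = fbar x" using sol x laplacian_solution(2)[OF sol xc] by (auto simp: is_solution_def)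
  moreover have "P_feat n E DE x i = P_feat n V (net_deriv m a W b) x i - P_feat n U DU x i"
    by (simp add: P_feat_def vec_eq_iff sum_subtractf)
  ultimately show ?thesis
    unfolding P_op_feat[OF C1_field_network i xc] P_feat_U[OF i] by (simp add: rhs_def)
qed

lemma boundary_residual:
  assumes "is_solution \<alpha> n f g u" "x \<in> smooth_boundary" "i < n"
  shows "S_op \<alpha> V x i - g x i = S_feat \<alpha> E (outer_normal x) x i"
  unfolding S_op_feat boundary_data[OF assms] by (simp add: S_feat_def inner_diff_right algebra_simps)

lemma mean_error:
  assumes "is_solution \<alpha> n f g u" "\<alpha> = Neumann"
  shows "cint (\<lambda>x. fst (E x 0)) = cint (\<lambda>x. fst (V x 0))"
proof -
  have n0: "0 < n" using n by simp
  have "cint (\<lambda>x. fst (V x 0) - fst (U x 0)) = cint (\<lambda>x. fst (V x 0)) - cint (\<lambda>x. fst (U x 0))"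
    by (intro Bochner_Integration.integral_diff integrable_cube_continuous C1_field_continuous(1)[OF C1_U n0] C1_field_continuous(1)[OF C1_field_network n0])
  then show ?thesis using mean_solution[OF assms] by simp
qed

lemma error_norms:
  assumes sol: "is_solution \<alpha> n f g u" and k: "k < n"
  shows "(H1_norm (\<lambda>x. fst (V x k) - (laplacian ^^ k) u x))^2 <= field_error E DE k"
    "(Hdiv_norm (\<lambda>x. snd (V x k) - gradient ((laplacian ^^ k) u) x))^2 <= field_error E DE k"
proof -
  note c = C1_field_continuous[OF C1_E k]
  have 1: "(L2_norm (\<lambda>x. fst (V x k) - (laplacian ^^ k) u x))^2 = cint (\<lambda>x. (norm (fst (E x k)))^2)"
    by (rule L2_norm_cube[OF c(1)]) (simp add: laplacian_solution(1)[OF sol _ k])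
  have 2: "(L2_norm (gradient (\<lambda>x. fst (V x k) - (laplacian ^^ k) u x)))^2 = cint (\<lambda>x. (norm (\<chi> l. fst (DE l x k)))^2)"
  proof (rule L2_norm_cube)
    show "continuous_on UNIV (\<lambda>x. \<chi> l. fst (DE l x k))" by (rule has_grad_continuous_grad[OF C1_field_fst[OF C1_E k]])
    show "gradient (\<lambda>x. fst (V x k) - (laplacian ^^ k) u x) x = (\<chi> l. fst (DE l x k))" if "x \<in> cube" for x
      by (rule gradient_cube[OF C1_field_fst[OF C1_E k] _ that]) (simp add: laplacian_solution(1)[OF sol _ k])
  qed
  have 3: "(L2_norm (\<lambda>x. snd (V x k) - gradient ((laplacian ^^ k) u) x))^2 = cint (\<lambda>x. (norm (snd (E x k)))^2)"
    by (rule L2_norm_cube[OF c(2)]) (simp add: gradient_solution[OF sol _ k])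
  have 4: "(L2_norm (divergence (\<lambda>x. snd (V x k) - gradient ((laplacian ^^ k) u) x)))^2 = cint (\<lambda>x. (norm (\<Sum>l\<in>UNIV. snd (DE l x k) $ l))^2)"
  proof (rule L2_norm_cube)
    show "continuous_on UNIV (\<lambda>x. \<Sum>l\<in>UNIV. snd (DE l x k) $ l)" by (intro continuous_intros c)
    show "divergence (\<lambda>x. snd (V x k) - gradient ((laplacian ^^ k) u) x) x = (\<Sum>l\<in>UNIV. snd (DE l x k) $ l)" if x: "x \<in> cube" for x
      unfolding divergence_def
    proof (rule sum.cong[OF refl])
      fix l
      have "partial l (\<lambda>y. (snd (V y k) - gradient ((laplacian ^^ k) u) y) $ l) x = (\<chi> l'. snd (DE l' x k) $ l) $ l"
        by (rule partial_cube[OF C1_field_snd[OF C1_E k] _ x]) (simp add: gradient_solution[OF sol _ k])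
      then show "partial l (\<lambda>y. (snd (V y k) - gradient ((laplacian ^^ k) u) y) $ l) x = snd (DE l x k) $ l" by simp
    qed
  qed
  have nn: "cint (\<lambda>x. (norm (fst (E x k)))^2) >= 0" "cint (\<lambda>x. (norm (\<chi> l. fst (DE l x k)))^2) >= 0"
    "cint (\<lambda>x. (norm (snd (E x k)))^2) >= 0" "cint (\<lambda>x. (norm (\<Sum>l\<in>UNIV. snd (DE l x k) $ l))^2) >= 0"
    by simp_all
  have fe: "field_error E DE k = cint (\<lambda>x. (norm (fst (E x k)))^2) + cint (\<lambda>x. (norm (\<chi> l. fst (DE l x k)))^2) +
      cint (\<lambda>x. (norm (snd (E x k)))^2) + cint (\<lambda>x. (norm (\<Sum>l\<in>UNIV. snd (DE l x k) $ l))^2)"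
    by (simp add: field_error_def pair_error_def)
  show "(H1_norm (\<lambda>x. fst (V x k) - (laplacian ^^ k) u x))^2 <= field_error E DE k"
    unfolding H1_norm_def 1 2 fe using nn by simp
  show "(Hdiv_norm (\<lambda>x. snd (V x k) - gradient ((laplacian ^^ k) u) x))^2 <= field_error E DE k"
    unfolding Hdiv_norm_def 3 4 fe using nn by simp
qed

lemma empirical_loss_residuals:
  assumes sol: "is_solution \<alpha> n f g u" and X: "\<And>j. j < N ==> X j \<in> interior cube" and Y: "\<And>j. j < N' ==> Y j \<in> smooth_boundary"
  shows "empirical_loss \<alpha> n lam mu f g N N' X Y V =
    (\<Sum>i<n. (\<Sum>j<N. (norm (P_feat n E DE (X j) i))^2) / real N) +
    (\<Sum>i<n. lam * (2 * d * ((\<Sum>j<N'. (S_feat \<alpha> E (outer_normal (Y j)) (Y j) i)^2) / real N'))) +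
    (if \<alpha> = Neumann then mu * ((\<Sum>j<N. fst (V (X j) 0)) / real N)^2 else 0)"
proof -
  have cube: "measure lborel (cube :: (real ^ 'd) set) = 1" by (simp add: measure_def emeasure_lborel_cube)
  have p: "(\<Sum>j<N. (vec_norm n (\<lambda>i. P_op n V (X j) i - rhs n f (X j) i))^2) = (\<Sum>i<n. \<Sum>j<N. (norm (P_feat n E DE (X j) i))^2)"
    unfolding vec_norm_square using interior_residual[OF sol X] by (subst sum.swap) simp
  have s: "(\<Sum>j<N'. lam * (vec_norm n (\<lambda>i. S_op \<alpha> V (Y j) i - g (Y j) i))^2) = (\<Sum>i<n. \<Sum>j<N'. lam * (S_feat \<alpha> E (outer_normal (Y j)) (Y j) i)^2)"
    unfolding vec_norm_square sum_distrib_left using boundary_residual[OF sol Y] by (subst sum.swap) simp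
  show ?thesis
    unfolding empirical_loss_def cube measure_surface_frontier p s d_eq
    by (simp add: sum_divide_distrib sum_distrib_left mult_ac)
qed

end

text \<open>\<open>841 = 29^2\<close> and \<open>98 = 2 * 7^2\<close> come from the masses in
  \<open>atomic_P\<close> and \<open>atomic_S\<close>, the latter with the surface area
  \<open>2 * d\<close>. In the last term 12 is twice the mass 6 of \<open>atomic_mean\<close>, and
  the bracket is the supremum bound of \<open>network_le\<close>.\<close>

definition deviation_const :: "nat => real => real => real => real" where
  "deviation_const n d lam mu = real n * 841 + 98 * lam * d * real n * (1 + d)^2 + 12 * mu * (2 + 8 * (d + 1)^2)"

definition approximation_const :: "nat => real => real => real => real" where
  "approximation_const n d lam mu = total_weight n d lam mu * (8 * ((2 * d + 2) * (8 * (d + 1)^2))^2)"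

text \<open>One outcome at which all points avoid the exceptional null sets and a finite number
  \<open>z\<close> bounds the deviations. Everything in this locale is deterministic.\<close>

locale good_sample = barron_setting n \<alpha> lam mu d u
  for n \<alpha> lam mu d and u :: "real ^ 'd::finite => real" +
  fixes f g and N N' :: nat and X Y :: "nat => 'w => real ^ 'd" and \<omega> :: 'w and z :: real
  assumes sol: "is_solution \<alpha> n f g u" and N: "N >= 1" "N' >= 1" and z: "z >= 0"
    and X: "\<And>j. j < N ==> X j \<omega> \<in> interior cube" and Y: "\<And>j. j < N' ==> Y j \<omega> \<in> smooth_boundary"
    and major_X: "majorant {..<N} X cube_measure G K \<omega> (ennreal z)" and major_Y: "majorant {..<N'} Y boundary_measure G K \<omega> (ennreal z)"
begin

abbreviation C0 :: real where "C0 \<equiv> deviation_const n d lam mu"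
abbreviation C1 :: real where "C1 \<equiv> approximation_const n d lam mu"

lemma loss_deviation:
  assumes "class_member n lam mu d u m c a W b"
  shows "\<bar>empirical_loss \<alpha> n lam mu f g N N' (\<lambda>j. X j \<omega>) (\<lambda>j. Y j \<omega>) (network m c a W b) -
    network_loss \<alpha> n lam mu U DU m c a W b\<bar> <= C0 * B^2 * z"
proof -
  interpret class_member n \<alpha> lam mu d u m c a W b by (rule assms)
  have n0: "0 < n" using n by simp
  note B0 = B_nonneg
  have d0: "d >= 0" by (simp add: d_eq)
  define p where "p i = deviation {..<N} X cube_measure (\<lambda>x. (norm (P_feat n E DE x i))^2) \<omega>" for i
  define s where "s i = deviation {..<N'} Y boundary_measure (\<lambda>x. (norm (S_feat \<alpha> E (outer_normal x) x i))^2) \<omega>" for i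
  define A where "A = (\<Sum>j<N. fst (V (X j \<omega>) 0)) / real N"
  define M where "M = cint (\<lambda>x. fst (V x 0))"
  have p: "\<bar>p i\<bar> <= 841 * B^2 * z" if "i < n" for i
    unfolding p_def using majorantD(1)[OF major_X z atomic_P[OF that] continuous_measurable[OF continuous_P_feat[OF C1_E that]]] by (simp add: power_mult_distrib)
  have s: "\<bar>s i\<bar> <= 49 * (1 + d)^2 * B^2 * z" if "i < n" for i
  proof -
    have "(7 * (1 + d) * B)^2 = 49 * (1 + d)^2 * B^2" by (simp only: power_mult_distrib) simp
    then show ?thesis unfolding s_def using majorantD(1)[OF major_Y z atomic_Pair[OF atomic_S[OF that]] borel_measurable_Pair[OF borel_measurable_const measurable_S[OF C1_E that]]] by (simp add: norm_Pair)
  qed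
  have cV: "continuous_on UNIV (\<lambda>x. fst (V x 0))" by (rule C1_field_continuous(1)[OF C1_field_network n0])
  have dev: "\<bar>A - M\<bar> <= 6 * B * z"
    using majorantD(2)[OF major_X z atomic_mean continuous_measurable[OF cV]] B0 by (simp add: deviation_def A_def M_def)
  define H where "H = (2 + 8 * (d + 1)^2) * B"
  have Vle: "\<bar>fst (V x 0)\<bar> <= H" if "x \<in> cube" for x
    using network_le[OF that n0] norm_fst_le[of "fst (V x 0)" "snd (V x 0)"] by (simp add: H_def)
  have A_le: "\<bar>A\<bar> <= H"
  proof -
    have "\<bar>\<Sum>j<N. fst (V (X j \<omega>) 0)\<bar> <= real N * H"
      using sum_norm_bound[of "{..<N}" "\<lambda>j. fst (V (X j \<omega>) 0)" H] Vle X interior_subset by fastforce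
    then show ?thesis using N(1) by (simp add: A_def abs_divide divide_le_eq mult.commute)
  qed
  have M_le: "\<bar>M\<bar> <= H"
  proof -
    interpret P: prob_space "cube_measure :: (real ^ 'd) measure" by (rule prob_space_cube_measure)
    have "\<bar>M\<bar> <= cint (\<lambda>x. \<bar>fst (V x 0)\<bar>)" unfolding M_def by simp
    also have "... <= cint (\<lambda>x :: real ^ 'd. H)"
      using AE_cube_measure Vle by (intro integral_mono_AE integrable_cube_continuous continuous_intros cV) auto
    finally show ?thesis by (simp add: P.prob_space)
  qed
  \<comment> \<open>The mean enters the loss squared, not as a mean of squares, so its deviation is
    a linear deviation times a supremum bound.\<close>
  have sq: "\<bar>A\<^sup>2 - M\<^sup>2\<bar> <= 12 * (2 + 8 * (d + 1)^2) * B^2 * z"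
  proof -
    have "A^2 - M\<^sup>2 = (A - M) * (A + M)" by (simp add: power2_eq_square algebra_simps)
    then have "\<bar>A\<^sup>2 - M\<^sup>2\<bar> = \<bar>A - M\<bar> * \<bar>A + M\<bar>" by (simp add: abs_mult)
    also have "... <= (6 * B * z) * (2 * H)"
      using dev A_le M_le B0 z by (intro mult_mono) auto
    also have "... = 12 * (2 + 8 * (d + 1)^2) * B^2 * z" by (simp add: H_def power2_eq_square)
    finally show ?thesis .
  qed
  have el: "empirical_loss \<alpha> n lam mu f g N N' (\<lambda>j. X j \<omega>) (\<lambda>j. Y j \<omega>) V =
    (\<Sum>i<n. (\<Sum>j<N. (norm (P_feat n E DE (X j \<omega>) i))^2) / real N) +
    (\<Sum>i<n. lam * (2 * d * ((\<Sum>j<N'. (S_feat \<alpha> E (outer_normal (Y j \<omega>)) (Y j \<omega>) i)^2) / real N'))) +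
    (if \<alpha> = Neumann then mu * ((\<Sum>j<N. fst (V (X j \<omega>) 0)) / real N)^2 else 0)"
    by (rule empirical_loss_residuals[OF sol]) (use X Y in auto)
  have eq: "empirical_loss \<alpha> n lam mu f g N N' (\<lambda>j. X j \<omega>) (\<lambda>j. Y j \<omega>) V - population_loss \<alpha> n lam mu E DE =
    (\<Sum>i<n. p i) + (\<Sum>i<n. lam * (2 * d * s i)) + (if \<alpha> = Neumann then mu * (A^2 - M\<^sup>2) else 0)"
    unfolding el population_loss_split p_def s_def deviation_def A_def M_def
    using mean_error[OF sol] by (simp add: d_eq sum_subtractf right_diff_distrib)
  have "\<bar>\<Sum>i<n. p i\<bar> <= real n * (841 * B^2 * z)" using sum_norm_bound[of "{..<n}" p "841 * B^2 * z"] p by simp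
  moreover have "\<bar>\<Sum>i<n. lam * (2 * d * s i)\<bar> <= real n * (lam * (2 * d * (49 * (1 + d)^2 * B^2 * z)))"
  proof -
    have "norm (lam * (2 * d * s i)) <= lam * (2 * d * (49 * (1 + d)^2 * B^2 * z))" if "i \<in> {..<n}" for i
      using s[of i] that lam d0 unfolding real_norm_def abs_mult by (intro mult_mono) auto
    from sum_norm_bound[of "{..<n}", OF this] show ?thesis by simp
  qed
  moreover have "\<bar>if \<alpha> = Neumann then mu * (A^2 - M\<^sup>2) else 0\<bar> <= mu * (12 * (2 + 8 * (d + 1)^2) * B^2 * z)"
  proof -
    have "\<bar>mu * (A^2 - M\<^sup>2)\<bar> <= mu * (12 * (2 + 8 * (d + 1)^2) * B^2 * z)"
      using sq mu unfolding abs_mult by (intro mult_mono) auto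
    then show ?thesis using order_trans[OF abs_ge_zero sq] mu by simp
  qed
  ultimately have "\<bar>empirical_loss \<alpha> n lam mu f g N N' (\<lambda>j. X j \<omega>) (\<lambda>j. Y j \<omega>) V - population_loss \<alpha> n lam mu E DE\<bar> \<le>
    real n * (841 * B^2 * z) + real n * (lam * (2 * d * (49 * (1 + d)^2 * B^2 * z))) + mu * (12 * (2 + 8 * (d + 1)^2) * B^2 * z)"
    unfolding eq by (intro order_trans[OF abs_triangle_ineq] add_mono)
  also have "... = C0 * B^2 * z" by (simp add: deviation_const_def algebra_simps)
  finally show ?thesis .
qed

lemma class_memberI:
  assumes "c \<in> states n" "vec_norm n c <= 2 * barron_norm (2 * n + 2) u" "\<forall>j<m. norm (W j) <= 1 \<and> \<bar>b j\<bar> <= 1"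
    "(\<Sum>j<m. vec_norm n (a j)) <= 4 * barron_norm (2 * n + 2) u"
  shows "class_member n lam mu d u m c a W b"
  using assms by unfold_locales (auto simp: B_def)

lemma class_memberE:
  assumes "v \<in> ReQU_class n m u"
  obtains c a W b where "v = network m c a W b" "class_member n lam mu d u m c a W b"
  using assms class_memberI unfolding ReQU_class_def by blast

text \<open>Passing from population to empirical loss and back costs two deviations, and in between
  the minimiser is no worse than the competitor of \<open>class_approximation\<close>. The slack of
  the competitor is arbitrary and is removed in the limit.\<close>

lemma trained_loss:
  assumes m: "m >= 1"
    and v: "is_arg_min (empirical_loss \<alpha> n lam mu f g N N' (\<lambda>j. X j \<omega>) (\<lambda>j. Y j \<omega>)) (\<lambda>w. w \<in> ReQU_class n m u) v"
  obtains c a W b where "v = network m c a W b" "class_member n lam mu d u m c a W b"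
    "network_loss \<alpha> n lam mu U DU m c a W b \<le>
      B\<^sup>2 * (C1 / real m + 2 * C0 * z)"
proof -
  let ?L = "empirical_loss \<alpha> n lam mu f g N N' (\<lambda>j. X j \<omega>) (\<lambda>j. Y j \<omega>)"
  have "v \<in> ReQU_class n m u" using v by (simp add: is_arg_min_def)
  then obtain c a W b where r: "v = network m c a W b" "class_member n lam mu d u m c a W b"
    by (rule class_memberE)
  have "network_loss \<alpha> n lam mu U DU m c a W b \<le>
      B\<^sup>2 * (C1 / real m + 2 * C0 * z)" (is "?P <= _")
  proof (rule field_le_epsilon)
    fix e :: real assume e: "e > 0"
    obtain c' a' W' b' where a: "c' \<in> states n" "\<forall>j<m. a' j \<in> states n" "vec_norm n c' <= 2 * B"
      "\<forall>j<m. norm (W' j) <= 1 \<and> \<bar>b' j\<bar> <= 1" "(\<Sum>j<m. vec_norm n (a' j)) <= 4 * B"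
      "network_loss \<alpha> n lam mu U DU m c' a' W' b' \<le>
        C1 * (B^2 / real m) + e"
      by (rule class_approximation[OF n lam mu m u e, of \<alpha>, folded d_eq B_def, folded approximation_const_def], rule that)
    have w: "network m c' a' W' b' \<in> ReQU_class n m u" unfolding ReQU_class_def using a(1-5)[unfolded B_def] by blast
    have "?L v <= ?L (network m c' a' W' b')" using v w by (auto simp: is_arg_min_def not_less)
    then have "?P <= C1 * (B^2 / real m) + e + 2 * (C0 * B^2 * z)"
      using loss_deviation[OF r(2)] loss_deviation[OF class_memberI[OF a(1,3-5)[unfolded B_def]]] a(6) unfolding r(1)
      by (simp only: abs_le_iff) argo
    then show "?P <= B^2 * (C1 / real m + 2 * C0 * z) + e" by (simp add: algebra_simps)
  qed
  then show ?thesis using that r by blast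
qed

end

context good_sample
begin

text \<open>In the Neumann and Robin cases the error is at most a multiple of the loss. In the
  Dirichlet case \<open>\<tau> = B^2 * s\<close> is taken; as the flux error is bounded by a
  multiple of \<open>B\<close>, the ratio \<open>T^2 / \<tau>\<close> then does not depend on
  \<open>u\<close>.\<close>

lemma error_bound:
  assumes Cc: "Cc > 0" and cc: "\<And>(E :: real ^ 'd => 'd state) D k. C1_field n E D ==> k < n ==>
    (\<forall>\<alpha>\<in>{Neumann, Robin}. field_error E D k <= Cc * population_loss \<alpha> n lam mu E D) \<and>
    (\<forall>T \<tau>. (\<forall>i<n. \<forall>x\<in>cube. \<forall>l. \<bar>snd (E x i) $ l\<bar> <= T) --> \<tau> > 0 -->
      field_error E D k <= Cc * ((1 + T^2 / \<tau>) * population_loss Dirichlet n lam mu E D + \<tau>))"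
    and m: "m >= 1" and k: "k < n"
    and v: "is_arg_min (empirical_loss \<alpha> n lam mu f g N N' (\<lambda>j. X j \<omega>) (\<lambda>j. Y j \<omega>)) (\<lambda>w. w \<in> ReQU_class n m u) v"
    and R: "\<alpha> \<in> {Neumann, Robin} \<and> R = B^2 * (C1 / real m + 2 * C0 * z) \<or>
      \<alpha> = Dirichlet \<and> s > 0 \<and> R = B^2 * ((1 + (3 + 8 * (d + 1)^2)^2 / s) * (C1 / real m + 2 * C0 * z) + s)"
  shows "(H1_norm (\<lambda>x. fst (v x k) - (laplacian ^^ k) u x))^2 <= Cc * R"
    "(Hdiv_norm (\<lambda>x. snd (v x k) - gradient ((laplacian ^^ k) u) x))^2 <= Cc * R"
proof -
  obtain c a W b where r: "v = network m c a W b" and member: "class_member n lam mu d u m c a W b"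
    and loss: "network_loss \<alpha> n lam mu U DU m c a W b \<le>
      B\<^sup>2 * (C1 / real m + 2 * C0 * z)"
    by (rule trained_loss[OF m v], rule that)
  interpret class_member n \<alpha> lam mu d u m c a W b by (rule member)
  have "field_error E DE k <= Cc * R"
    using R
  proof (elim disjE conjE)
    assume \<alpha>: "\<alpha> \<in> {Neumann, Robin}" and R: "R = B^2 * (C1 / real m + 2 * C0 * z)"
    have "field_error E DE k <= Cc * population_loss \<alpha> n lam mu E DE" using cc[OF C1_E k] \<alpha> by blast
    also have "... <= Cc * R" unfolding R using Cc loss by (intro mult_left_mono) auto
    finally show ?thesis .
  next
    assume \<alpha>: "\<alpha> = Dirichlet" and s: "s > 0"
      and R: "R = B^2 * ((1 + (3 + 8 * (d + 1)^2)^2 / s) * (C1 / real m + 2 * C0 * z) + s)"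
    let ?P = "population_loss Dirichlet n lam mu E DE"
    define T where "T = (3 + 8 * (d + 1)^2) * B"
    have T: "\<forall>i<n. \<forall>x\<in>cube. \<forall>l. \<bar>snd (E x i) $ l\<bar> <= T"
    proof (intro allI impI ballI)
      fix i x l assume i: "i < n" and x: "x \<in> (cube :: (real ^ 'd) set)"
      have "\<bar>snd (V x i) $ l\<bar> <= (2 + 8 * (d + 1)^2) * B"
        using network_le[OF x i] norm_snd_le[of "snd (V x i)" "fst (V x i)"] component_le_norm_cart[of "snd (V x i)" l] by simp
      moreover have "\<bar>snd (U x i) $ l\<bar> <= B" by (rule snd_U_le[OF i])
      moreover have "T = (2 + 8 * (d + 1)^2) * B + B" by (simp add: T_def algebra_simps)
      ultimately show "\<bar>snd (E x i) $ l\<bar> <= T"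
        using abs_triangle_ineq4[of "snd (V x i) $ l" "snd (U x i) $ l"] by simp
    qed
    have main: "field_error E DE k <= Cc * ((1 + T^2 / \<tau>) * ?P + \<tau>)" if "\<tau> > 0" for \<tau>
      using cc[OF C1_E k] T that by blast
    have P: "?P <= B^2 * (C1 / real m + 2 * C0 * z)" using loss \<alpha> by simp
    show ?thesis
    proof (cases "B = 0")
      case True
      then have P0: "?P <= 0" using P by simp
      \<comment> \<open>For \<open>B = 0\<close> the choice \<open>\<tau> = B^2 * s\<close> is not
        positive. Instead \<open>T = 0\<close>, and \<open>\<tau>\<close> may tend to zero.\<close>
      have "field_error E DE k <= 0"
      proof (rule field_le_epsilon)
        fix e :: real assume e: "e > 0"
        have "field_error E DE k <= Cc * (?P + e / Cc)" using main[of "e / Cc"] e Cc True by (simp add: T_def)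
        also have "... <= Cc * (0 + e / Cc)" using Cc P0 by (intro mult_left_mono add_right_mono) auto
        finally show "field_error E DE k <= 0 + e" using Cc by simp
      qed
      then show ?thesis using R True by simp
    next
      case False
      then have B2: "B^2 > 0" by simp
      have "T^2 / (B^2 * s) = (3 + 8 * (d + 1)^2)^2 / s" unfolding T_def power_mult_distrib using B2 by simp
      then have "field_error E DE k <= Cc * ((1 + (3 + 8 * (d + 1)^2)^2 / s) * ?P + B^2 * s)"
        using main[of "B^2 * s"] B2 s by simp
      also have "... <= Cc * ((1 + (3 + 8 * (d + 1)^2)^2 / s) * (B^2 * (C1 / real m + 2 * C0 * z)) + B^2 * s)"
        using Cc s by (intro mult_left_mono add_right_mono P) auto
      also have "... = Cc * R" unfolding R by (simp add: distrib_left mult.left_commute)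
      finally show ?thesis .
    qed
  qed
  then show "(H1_norm (\<lambda>x. fst (v x k) - (laplacian ^^ k) u x))^2 <= Cc * R"
    "(Hdiv_norm (\<lambda>x. snd (v x k) - gradient ((laplacian ^^ k) u) x))^2 <= Cc * R"
    unfolding r using error_norms[OF sol k] by linarith+
qed

end

section \<open>Expectation over the training points\<close>

definition sampling_const :: "nat => nat => real" where
  "sampling_const n d = 2 * (2 * (real d + 1)^2)^2 * (40 + 80 * ln (real (3 * (2 + d + n) * 4 ^ (d + 1))))"

lemma sampling_const_nonneg: "sampling_const n d >= 0"
proof -
  have "(1 :: nat) <= 3 * (2 + d + n) * 4 ^ (d + 1)" using mult_le_mono[of 1 "3 * (2 + d + n)" 1 "4 ^ (d + 1)"] by simp
  then have "1 <= real (3 * (2 + d + n) * 4 ^ (d + 1))" by linarith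
  then show ?thesis unfolding sampling_const_def by (intro mult_nonneg_nonneg add_nonneg_nonneg) auto
qed

text \<open>Joint independence is stated over a disjoint sum of index sets. Reindexing along
  \<open>Inl\<close> and \<open>Inr\<close> yields the independence of the interior and of the
  boundary points.\<close>

lemma (in prob_space) indep_vars_image:
  assumes f: "inj_on f I" and ind: "indep_vars M' X (f ` I)"
  shows "indep_vars (\<lambda>i. M' (f i)) (\<lambda>i. X (f i)) I"
proof -
  define F where "F i = {X i -` A \<inter> space M | A. A \<in> sets (M' i)}" for i
  have rv: "\<And>i. i \<in> f ` I ==> random_variable (M' i) (X i)" and sets: "indep_sets F (f ` I)"
    using ind unfolding indep_vars_def2 F_def by auto
  have "indep_sets (\<lambda>i. F (f i)) I"
  proof (rule indep_setsI)
    show "F (f i) \<subseteq> events" if "i \<in> I" for i using sets that by (auto simp: indep_sets_def)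
    fix A J assume J: "J ~= {}" "J \<subseteq> I" "finite J" and A: "\<forall>j\<in>J. A j \<in> F (f j)"
    have inj: "inj_on f J" using f J(2) by (rule inj_on_subset)
    define A' where "A' = A \<circ> the_inv_into J f"
    have A': "A' (f j) = A j" if "j \<in> J" for j using inj that by (simp add: A'_def the_inv_into_f_f)
    have "prob (\<Inter>j\<in>f ` J. A' j) = (\<Prod>j\<in>f ` J. prob (A' j))"
      by (rule indep_setsD[OF sets]) (use J A A' in auto)
    then show "prob (\<Inter>j\<in>J. A j) = (\<Prod>j\<in>J. prob (A j))"
      using A' by (simp add: prod.reindex[OF inj])
  qed
  then show ?thesis unfolding indep_vars_def2 F_def using rv by auto
qed

context barron_setting
begin

text \<open>\<open>Z\<close> is the sum of the majorants for interior and boundary points. Its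
  finite expectation makes it finite almost everywhere, which provides the number \<open>z\<close>
  of \<open>good_sample\<close>.\<close>

lemma training_samples:
  assumes sol: "is_solution \<alpha> n f g u" and N: "N >= 1" "N' >= 1" and sample: "training_sample M N N' X Y"
  shows "\<exists>Z\<in>borel_measurable M.
    (\<integral>\<^sup>+\<omega>. Z \<omega> \<partial>M) <= ennreal (sampling_const n CARD('d) / sqrt (real N) + sampling_const n CARD('d) / sqrt (real N')) \<and>
    (AE \<omega> in M. \<exists>z. z >= 0 \<and> Z \<omega> = ennreal z \<and> good_sample n \<alpha> lam mu d u f g N N' X Y \<omega> z)"
proof -
  let ?\<kappa> = "sampling_const n CARD('d)"
  define A :: nat where "A = 3 * (2 + CARD('d) + n) * 4 ^ (CARD('d) + 1)"
  have A: "A >= 1" unfolding A_def using mult_le_mono[of 1 "3 * (2 + CARD('d) + n)" 1 "4 ^ (CARD('d) + 1)"] by simp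
  have K: "K > 0" by (simp add: d_eq add_nonneg_eq_0_iff)
  have nets: "nets G A K"
    by (rule nets_neurons[OF finite_dictionary card_dictionary dictionary_props, folded d_eq A_def])
  interpret M: prob_space M using sample by (simp add: training_sample_def)
  have indep: "M.indep_vars (\<lambda>_. borel) (case_sum X Y) ({..<N} <+> {..<N'})" using sample by (simp add: training_sample_def)
  have iX: "iid_sample M {..<N} X cube_measure"
  proof unfold_locales
    have "M.indep_vars (\<lambda>_. borel) (case_sum X Y) (Inl ` {..<N})" by (rule M.indep_vars_subset[OF indep]) auto
    from M.indep_vars_image[OF _ this] show "M.indep_vars (\<lambda>_. borel) X {..<N}" by (simp add: comp_def)
    show "distr M borel (X i) = cube_measure" if "i \<in> {..<N}" for i
      using sample that by (simp add: training_sample_def cube_measure_def)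
    show "{..<N} ~= {}" using N(1) by (auto simp: lessThan_empty_iff)
  qed simp
  have iY: "iid_sample M {..<N'} Y boundary_measure"
  proof unfold_locales
    have "M.indep_vars (\<lambda>_. borel) (case_sum X Y) (Inr ` {..<N'})" by (rule M.indep_vars_subset[OF indep]) auto
    from M.indep_vars_image[OF _ this] show "M.indep_vars (\<lambda>_. borel) Y {..<N'}" by (simp add: comp_def)
    show "distr M borel (Y i) = boundary_measure" if "i \<in> {..<N'}" for i
      using sample that by (simp add: training_sample_def boundary_measure_def)
    show "{..<N'} ~= {}" using N(2) by (auto simp: lessThan_empty_iff)
  qed simp
  obtain ZX where ZX: "ZX \<in> borel_measurable M" "(\<integral>\<^sup>+\<omega>. ZX \<omega> \<partial>M) <= ennreal (2 * K^2 / sqrt (card {..<N}) * (40 + 80 * ln A)) \<and>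
    (\<forall>\<omega>. (\<forall>i\<in>{..<N}. X i \<omega> \<in> cube) --> majorant {..<N} X cube_measure G K \<omega> (ZX \<omega>))"
    using atomic_deviation[OF iX AE_cube_measure nets A K limit_one] by (rule bexE)
  note major_X = ZX(2)[THEN conjunct2, rule_format]
  obtain ZY where ZY: "ZY \<in> borel_measurable M" "(\<integral>\<^sup>+\<omega>. ZY \<omega> \<partial>M) <= ennreal (2 * K^2 / sqrt (card {..<N'}) * (40 + 80 * ln A)) \<and>
    (\<forall>\<omega>. (\<forall>i\<in>{..<N'}. Y i \<omega> \<in> cube) --> majorant {..<N'} Y boundary_measure G K \<omega> (ZY \<omega>))"
    using atomic_deviation[OF iY AE_boundary_measure_cube nets A K limit_one] by (rule bexE)
  note major_Y = ZY(2)[THEN conjunct2, rule_format]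
  define Z where "Z \<omega> = ZX \<omega> + ZY \<omega>" for \<omega>
  have Zm: "Z \<in> borel_measurable M" unfolding Z_def using ZX(1) ZY(1) by measurable
  \<comment> \<open>\<open>sampling_const\<close> is the factor of \<open>atomic_deviation\<close>
    for the bound \<open>K\<close> and the base \<open>A\<close> counted in
    \<open>nets_neurons\<close>.\<close>
  have const: "2 * K^2 / sqrt t * (40 + 80 * ln A) = ?\<kappa> / sqrt t" for t
    by (simp add: sampling_const_def A_def d_eq)
  have EZ: "(\<integral>\<^sup>+\<omega>. Z \<omega> \<partial>M) <= ennreal (?\<kappa> / sqrt (real N) + ?\<kappa> / sqrt (real N'))"
  proof -
    have "(\<integral>\<^sup>+\<omega>. Z \<omega> \<partial>M) = (\<integral>\<^sup>+\<omega>. ZX \<omega> \<partial>M) + (\<integral>\<^sup>+\<omega>. ZY \<omega> \<partial>M)"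
      unfolding Z_def by (rule nn_integral_add[OF ZX(1) ZY(1)])
    also have "... <= ennreal (?\<kappa> / sqrt (real N)) + ennreal (?\<kappa> / sqrt (real N'))"
      using ZX(2)[THEN conjunct1] ZY(2)[THEN conjunct1] unfolding const by (intro add_mono) auto
    also have "... = ennreal (?\<kappa> / sqrt (real N) + ?\<kappa> / sqrt (real N'))"
      by (rule ennreal_plus[symmetric]) (simp_all add: sampling_const_nonneg)
    finally show ?thesis .
  qed
  have fin: "AE \<omega> in M. Z \<omega> ~= \<infinity>"
    by (rule nn_integral_PInf_AE[OF Zm]) (use EZ in \<open>auto simp: top_unique\<close>)
  \<comment> \<open>The equation holds in the interior and normals exist off the edges; both
    restrictions exclude only null sets of the sampling laws.\<close>
  have AX: "AE \<omega> in M. \<forall>j\<in>{..<N}. X j \<omega> \<in> interior cube"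
  proof (rule AE_finite_allI)
    fix j assume j: "j \<in> {..<N}"
    have "AE x in distr M borel (X j). x \<in> interior cube"
      unfolding iid_sample.distr_X[OF iX j] by (rule AE_cube_measure_interior)
    then show "AE \<omega> in M. X j \<omega> \<in> interior cube" by (rule AE_distrD[OF iid_sample.measurable_X[OF iX j]])
  qed simp
  have AY: "AE \<omega> in M. \<forall>j\<in>{..<N'}. Y j \<omega> \<in> smooth_boundary"
  proof (rule AE_finite_allI)
    fix j assume j: "j \<in> {..<N'}"
    have "AE x in distr M borel (Y j). x \<in> smooth_boundary"
      unfolding iid_sample.distr_X[OF iY j] by (rule AE_boundary_measure)
    then show "AE \<omega> in M. Y j \<omega> \<in> smooth_boundary" by (rule AE_distrD[OF iid_sample.measurable_X[OF iY j]])
  qed simp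
  have "AE \<omega> in M. \<exists>z. z >= 0 \<and> Z \<omega> = ennreal z \<and> good_sample n \<alpha> lam mu d u f g N N' X Y \<omega> z"
    using fin AX AY
  proof eventually_elim
    case (elim \<omega>)
    obtain z where z: "z >= 0" "Z \<omega> = ennreal z" using elim(1) by (cases "Z \<omega>") auto
    have ZXle: "ZX \<omega> <= ennreal z" and ZYle: "ZY \<omega> <= ennreal z" using z(2) by (auto simp: Z_def add_increasing add_increasing2 simp flip: z(2))
    have Xc: "\<forall>i\<in>{..<N}. X i \<omega> \<in> cube" using elim(2) interior_subset by blast
    have Yc: "\<forall>i\<in>{..<N'}. Y i \<omega> \<in> cube" using elim(3) by (simp add: smooth_boundary_def)
    have "good_sample n \<alpha> lam mu d u f g N N' X Y \<omega> z"
    proof unfold_locales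
      show "majorant {..<N} X cube_measure G K \<omega> (ennreal z)" by (rule majorant_mono[OF major_X ZXle]) (use Xc in blast)
      show "majorant {..<N'} Y boundary_measure G K \<omega> (ennreal z)" by (rule majorant_mono[OF major_Y ZYle]) (use Yc in blast)
    qed (use sol N z elim in auto)
    then show ?case using z by blast
  qed
  then show ?thesis using Zm EZ by blast
qed

end

text \<open>\<open>e\<close> is the error of an arbitrarily selected minimiser, for which
  measurability is not at hand. The nonnegative integral is monotone all the same, and the affine
  majorant in \<open>Z\<close> is measurable.\<close>

lemma nn_integral_affine_bound:
  assumes M: "prob_space M" and Z: "Z \<in> borel_measurable M" "(\<integral>\<^sup>+\<omega>. Z \<omega> \<partial>M) <= ennreal q" and q: "q >= 0" and ab: "a >= 0" "b >= 0"
    and e: "AE \<omega> in M. \<exists>z. z >= 0 \<and> Z \<omega> = ennreal z \<and> e \<omega> <= a + b * z"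
  shows "(\<integral>\<^sup>+\<omega>. ennreal (e \<omega>) \<partial>M) <= ennreal (a + b * q)"
proof -
  interpret prob_space M by (rule M)
  have "(\<integral>\<^sup>+\<omega>. ennreal (e \<omega>) \<partial>M) <= (\<integral>\<^sup>+\<omega>. ennreal a + ennreal b * Z \<omega> \<partial>M)"
  proof (rule nn_integral_mono_AE)
    show "AE \<omega> in M. ennreal (e \<omega>) <= ennreal a + ennreal b * Z \<omega>"
      using e
    proof eventually_elim
      case (elim \<omega>)
      then obtain z where "z >= 0" "Z \<omega> = ennreal z" "e \<omega> <= a + b * z" by blast
      then show ?case using ab by (simp add: ennreal_mult[symmetric] ennreal_plus[symmetric] ennreal_leI del: ennreal_plus)
    qed
  qed
  also have "... = ennreal a + ennreal b * (\<integral>\<^sup>+\<omega>. Z \<omega> \<partial>M)"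
    using Z(1) by (simp add: nn_integral_add nn_integral_cmult emeasure_space_1)
  also have "... <= ennreal a + ennreal b * ennreal q" by (intro add_left_mono mult_left_mono Z(2)) simp
  also have "... = ennreal (a + b * q)" using ab q by (simp add: ennreal_mult)
  finally show ?thesis .
qed

text \<open>Through the lower bound on the number of boundary points their rate becomes that of the
  interior points.\<close>

lemma inverse_sqrt_le:
  fixes c d :: real
  assumes c: "c > 0" and d: "d > 0" and N: "N > 0" and N': "c * N / d^2 <= N'"
  shows "1 / sqrt N' <= d / sqrt c * (1 / sqrt N)"
proof -
  have pos: "c * N / d^2 > 0" using assms by simp
  have "sqrt (c * N / d^2) <= sqrt N'" using N' by simp
  then have "1 / sqrt N' <= 1 / sqrt (c * N / d^2)" using pos by (intro divide_left_mono) (auto intro!: mult_pos_pos)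
  also have "... = d / sqrt c * (1 / sqrt N)" using d by (simp add: real_sqrt_divide real_sqrt_mult)
  finally show ?thesis .
qed

text \<open>The theorem uses this with \<open>N\<close> the fourth root of the sample size and
  \<open>z\<close> the value of the majorant, whose mean is of order \<open>1 / N^2\<close>. The
  choice of \<open>s\<close> gives both \<open>1 / s <= sqrt m\<close>, applied to the approximation
  error, and \<open>1 / s <= N\<close>, applied to the sampling error. It does not involve
  \<open>z\<close>, so the bound is affine in \<open>z\<close>.\<close>

lemma dirichlet_balance:
  fixes m N t A Q z :: real
  assumes m: "m >= 1" and N: "N >= 1" and nonneg: "t >= 0" "A >= 0" "Q >= 0" "z >= 0"
  defines "s \<equiv> 1 / sqrt m + 1 / N"
  shows "(1 + t / s) * (A / m + Q * z) + s <= ((1 + t) * A + 1) / sqrt m + 1 / N + (1 + t) * Q * N * z"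
proof -
  have sm: "sqrt m >= 1" using m by simp
  have s: "s > 0" "1 / sqrt m <= s" "1 / N <= s" using sm N by (auto simp: s_def add_pos_pos)
  have s1: "1 / s <= sqrt m" using s sm by (simp add: field_simps)
  have s2: "1 / s <= N" using s N by (simp add: field_simps)
  have "(1 + t / s) * (A / m) <= ((1 + t) * sqrt m) * (A / m)"
  proof (rule mult_right_mono)
    have "t * (1 / s) <= t * sqrt m" by (rule mult_left_mono[OF s1 nonneg(1)])
    then have "1 + t * (1 / s) <= sqrt m + t * sqrt m" using sm by linarith
    then show "1 + t / s <= (1 + t) * sqrt m" by (simp add: algebra_simps)
    show "A / m >= 0" using nonneg m by simp
  qed
  also have "... = (1 + t) * A / sqrt m"
  proof -
    have "sqrt m / m = 1 / sqrt m" using m by (simp add: real_div_sqrt field_simps)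
    then show ?thesis by (metis (no_types, lifting) mult.assoc mult.commute times_divide_eq_left times_divide_eq_right mult_1)
  qed
  finally have 1: "(1 + t / s) * (A / m) <= (1 + t) * A / sqrt m" .
  have 2: "(1 + t / s) * (Q * z) <= (1 + t) * N * (Q * z)"
  proof (rule mult_right_mono)
    have "t * (1 / s) <= t * N" by (rule mult_left_mono[OF s2 nonneg(1)])
    then show "1 + t / s <= (1 + t) * N" using N by (simp add: algebra_simps)
    show "Q * z >= 0" using nonneg by simp
  qed
  have "(1 + t / s) * (A / m + Q * z) + s = (1 + t / s) * (A / m) + (1 + t / s) * (Q * z) + (1 / sqrt m + 1 / N)"
    by (simp add: distrib_left s_def)
  also have "... <= (1 + t) * A / sqrt m + (1 + t) * N * (Q * z) + (1 / sqrt m + 1 / N)" by (intro add_mono 1 2 order_refl)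
  also have "... = ((1 + t) * A + 1) / sqrt m + 1 / N + (1 + t) * Q * N * z" by (simp add: add_divide_distrib)
  finally show ?thesis .
qed

theorem theorem2p1:
  fixes n :: nat and lam mu c1 c2 :: real
  assumes "n \<ge> 1" "lam > 0" "mu > 0" "c1 > 0" "c2 > 0"
  shows "\<exists>C>0. \<forall>(\<alpha>::bc) (u :: real ^ 'd \<Rightarrow> real) f g (m::nat) (N::nat) (N'::nat) (M :: 'w measure) X Y v.
     is_solution \<alpha> n f g u \<and> m \<ge> 1 \<and> N \<ge> 1 \<and>
     c1 * real N / (real CARD('d))\<^sup>2 \<le> real N' \<and> real N' \<le> c2 * real N / (real CARD('d))\<^sup>2 \<and>
     training_sample M N N' X Y \<and>
     (\<forall>\<omega>\<in>space M.
        is_arg_min (empirical_loss \<alpha> n lam mu f g N N' (\<lambda>j. X j \<omega>) (\<lambda>j. Y j \<omega>))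
          (\<lambda>w. w \<in> ReQU_class n m u) (v \<omega>)) \<longrightarrow>
     (\<alpha> \<in> {Neumann, Robin} \<longrightarrow>
        expected_error M n u v \<le>
          ennreal (C * ((barron_norm (2 * n + 2) u)\<^sup>2 / real m +
                        (barron_norm (2 * n + 2) u)\<^sup>2 / sqrt (real N)))) \<and>
     (\<alpha> = Dirichlet \<longrightarrow>
        expected_error M n u v \<le>
          ennreal (C * ((barron_norm (2 * n + 2) u)\<^sup>2 / sqrt (real m) +
                        (barron_norm (2 * n + 2) u)\<^sup>2 / root 4 (real N))))"
proof -
  define d where "d = real CARD('d)"
  obtain Cc where Cc: "Cc > 0" and cc: "\<forall>(E :: real ^ 'd => 'd state) D k. C1_field n E D --> k < n -->
    (\<forall>\<alpha>\<in>{Neumann, Robin}. field_error E D k <= Cc * population_loss \<alpha> n lam mu E D) \<and>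
    (\<forall>T \<tau>. (\<forall>i<n. \<forall>x\<in>cube. \<forall>l. \<bar>snd (E x i) $ l\<bar> <= T) --> \<tau> > 0 -->
      field_error E D k <= Cc * ((1 + T^2 / \<tau>) * population_loss Dirichlet n lam mu E D + \<tau>))"
    using coercivity[OF assms(2,3), of n] by blast
  define C0 where "C0 = deviation_const n d lam mu"
  define C1 where "C1 = approximation_const n d lam mu"
  define q where "q = sampling_const n CARD('d) * (1 + d / sqrt c1)"
  define t where "t = (3 + 8 * (d + 1)^2)^2"
  \<comment> \<open>One number dominating the coefficients of all cases; the factor
    \<open>2 * real n\<close> in \<open>C\<close> counts two norms on each of \<open>n\<close>
    levels.\<close>
  define w where "w = (1 + t) * (C1 + 2 * C0 * q) + 1"
  define C where "C = 2 * real n * Cc * w"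
  have d: "d > 0" by (simp add: d_def)
  have C0: "C0 >= 0" using assms d unfolding C0_def deviation_const_def by (intro add_nonneg_nonneg mult_nonneg_nonneg) auto
  have C1: "C1 >= 0" using assms d unfolding C1_def approximation_const_def total_weight_def
    by (intro mult_nonneg_nonneg add_nonneg_nonneg) auto
  have q: "q >= 0" using sampling_const_nonneg[of n "CARD('d)"] d assms(4) by (simp add: q_def)
  have t: "t >= 0" by (simp add: t_def)
  have inner: "(1 + t) * (C1 + 2 * C0 * q) >= 0" using t C0 C1 q by (intro mult_nonneg_nonneg add_nonneg_nonneg) auto
  have C: "C > 0" unfolding C_def w_def using assms(1) Cc inner by (intro mult_pos_pos) auto
  show ?thesis
  proof (intro exI[of _ C] conjI C allI impI)
    fix \<alpha> and u :: "real ^ 'd => real" and f g and m N N' :: nat and M :: "'w measure" and X Y v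
    assume H: "is_solution \<alpha> n f g u \<and> m >= 1 \<and> N >= 1 \<and>
     c1 * real N / (real CARD('d))^2 <= real N' \<and> real N' <= c2 * real N / (real CARD('d))^2 \<and>
     training_sample M N N' X Y \<and>
     (\<forall>\<omega>\<in>space M.
        is_arg_min (empirical_loss \<alpha> n lam mu f g N N' (\<lambda>j. X j \<omega>) (\<lambda>j. Y j \<omega>))
          (\<lambda>w. w \<in> ReQU_class n m u) (v \<omega>))"
    then have sol: "is_solution \<alpha> n f g u" and m: "m >= 1" and N: "N >= 1" and N': "c1 * real N / d^2 <= real N'"
      and sample: "training_sample M N N' X Y"
      and v: "\<And>\<omega>. \<omega> \<in> space M ==> is_arg_min (empirical_loss \<alpha> n lam mu f g N N' (\<lambda>j. X j \<omega>) (\<lambda>j. Y j \<omega>)) (\<lambda>w. w \<in> ReQU_class n m u) (v \<omega>)"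
      by (auto simp: d_def)
    have "0 < c1 * real N / d^2" using assms(4) N d by simp
    then have N'1: "N' >= 1" using N' by (cases N') auto
    interpret barron_setting n \<alpha> lam mu d u
      by unfold_locales (use sol assms in \<open>auto simp: d_def is_solution_def\<close>)
    note B0 = B_nonneg
    obtain Z where Z: "Z \<in> borel_measurable M"
      "(\<integral>\<^sup>+\<omega>. Z \<omega> \<partial>M) <= ennreal (sampling_const n CARD('d) / sqrt (real N) + sampling_const n CARD('d) / sqrt (real N'))"
      "AE \<omega> in M. \<exists>z. z >= 0 \<and> Z \<omega> = ennreal z \<and> good_sample n \<alpha> lam mu d u f g N N' X Y \<omega> z"
      using training_samples[OF sol N N'1 sample] by blast
    have EZ: "(\<integral>\<^sup>+\<omega>. Z \<omega> \<partial>M) <= ennreal (q / sqrt (real N))"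
    proof (rule order_trans[OF Z(2) ennreal_leI])
      have "sampling_const n CARD('d) * (1 / sqrt (real N')) <= sampling_const n CARD('d) * (d / sqrt c1 * (1 / sqrt (real N)))"
        using N by (intro mult_left_mono inverse_sqrt_le assms d N' sampling_const_nonneg) simp
      then show "sampling_const n CARD('d) / sqrt (real N) + sampling_const n CARD('d) / sqrt (real N') <= q / sqrt (real N)"
        by (simp add: q_def algebra_simps add_divide_distrib)
    qed
    let ?H = "\<lambda>\<omega> k. (H1_norm (\<lambda>x. fst (v \<omega> x k) - (laplacian ^^ k) u x))^2"
    let ?D = "\<lambda>\<omega> k. (Hdiv_norm (\<lambda>x. snd (v \<omega> x k) - gradient ((laplacian ^^ k) u) x))^2"
    let ?N = "q / sqrt (real N)"
    have q': "?N >= 0" using q by simp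
    \<comment> \<open>Pointwise bounds affine in \<open>z\<close> become bounds on the expected
      error, with \<open>z\<close> replaced by the bound on the mean of the majorant.\<close>
    have error: "expected_error M n u v <= ennreal (2 * real n * (a + b * ?N))"
      if ab: "a >= 0" "b >= 0"
        and bound: "\<And>\<omega> z k. \<omega> \<in> space M ==> z >= 0 ==> good_sample n \<alpha> lam mu d u f g N N' X Y \<omega> z ==> k < n ==>
          ?H \<omega> k <= a + b * z \<and>
          ?D \<omega> k <= a + b * z" for a b
    proof -
      have M: "prob_space M" using sample by (simp add: training_sample_def)
      have int: "(\<integral>\<^sup>+\<omega>. ennreal (e \<omega>) \<partial>M) <= ennreal (a + b * ?N)"
        if "\<And>\<omega> z. \<omega> \<in> space M ==> z >= 0 ==> good_sample n \<alpha> lam mu d u f g N N' X Y \<omega> z ==> e \<omega> <= a + b * z" for e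
      proof (rule nn_integral_affine_bound[OF M Z(1) EZ q' ab])
        show "AE \<omega> in M. \<exists>z. z >= 0 \<and> Z \<omega> = ennreal z \<and> e \<omega> <= a + b * z"
          using Z(3) AE_space by eventually_elim (use that in blast)
      qed
      have nn: "a + b * ?N >= 0" using ab q' by (intro add_nonneg_nonneg mult_nonneg_nonneg)
      have "expected_error M n u v <= (\<Sum>k<n. ennreal (a + b * ?N) + ennreal (a + b * ?N))"
        unfolding expected_error_def using bound by (intro sum_mono add_mono int) auto
      also have "... = ennreal (\<Sum>k<n. (a + b * ?N) + (a + b * ?N))"
        unfolding ennreal_plus[OF nn nn, symmetric] by (rule sum_ennreal) (use nn in simp)
      also have "... = ennreal (2 * real n * (a + b * ?N))" by (simp add: algebra_simps)
      finally show ?thesis .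
    qed
    have sN: "sqrt (real N) >= 1" using N by simp
    {
      assume \<alpha>: "\<alpha> \<in> {Neumann, Robin}"
      have "expected_error M n u v <= ennreal (2 * real n * (Cc * (B^2 * (C1 / real m)) + Cc * (B^2 * (2 * C0)) * ?N))"
      proof (rule error)
        fix \<omega> z k assume \<omega>: "\<omega> \<in> space M" and "good_sample n \<alpha> lam mu d u f g N N' X Y \<omega> z" and k: "k < n"
        then interpret good_sample n \<alpha> lam mu d u f g N N' X Y \<omega> z by simp
        have "Cc * (B^2 * (C1 / real m + 2 * C0 * z)) = Cc * (B^2 * (C1 / real m)) + Cc * (B^2 * (2 * C0)) * z"
          by (simp add: algebra_simps)
        then show "?H \<omega> k <= Cc * (B^2 * (C1 / real m)) + Cc * (B^2 * (2 * C0)) * z \<and>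
          ?D \<omega> k <= Cc * (B^2 * (C1 / real m)) + Cc * (B^2 * (2 * C0)) * z"
          using error_bound[OF Cc cc[rule_format] m k v[OF \<omega>], of "B^2 * (C1 / real m + 2 * C0 * z)" 1] \<alpha>
          by (simp only: C0_def C1_def simp_thms)
      qed (use Cc C0 C1 in auto)
      also have "... <= ennreal (C * (B^2 / real m + B^2 / sqrt (real N)))"
      proof (rule ennreal_leI)
        have c1: "C1 <= w" "2 * C0 * q <= w"
        proof -
          have nn: "2 * C0 * q >= 0" using C0 q by simp
          have "1 * (C1 + 2 * C0 * q) <= (1 + t) * (C1 + 2 * C0 * q)" using t C1 nn by (intro mult_right_mono) auto
          then show "C1 <= w" "2 * C0 * q <= w" unfolding w_def using C1 nn by argo+
        qed
        have "2 * real n * (Cc * (B^2 * (C1 / real m)) + Cc * (B^2 * (2 * C0)) * ?N) =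
            2 * real n * Cc * (C1 * (B^2 / real m) + (2 * C0 * q) * (B^2 / sqrt (real N)))" by (simp add: algebra_simps)
        also have "... <= 2 * real n * Cc * (w * (B^2 / real m) + w * (B^2 / sqrt (real N)))"
          using Cc by (intro mult_left_mono add_mono mult_right_mono c1) auto
        also have "... = C * (B^2 / real m + B^2 / sqrt (real N))" by (simp only: C_def distrib_left mult.assoc)
        finally show "2 * real n * (Cc * (B^2 * (C1 / real m)) + Cc * (B^2 * (2 * C0)) * ?N) <= C * (B^2 / real m + B^2 / sqrt (real N))" .
      qed
      finally show "expected_error M n u v <= ennreal (C * ((barron_norm (2 * n + 2) u)^2 / real m + (barron_norm (2 * n + 2) u)^2 / sqrt (real N)))"
        by (simp only: B_def)
    }
    {
      assume \<alpha>: "\<alpha> = Dirichlet"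
      let ?r = "root 4 (real N)"
      have r1: "?r >= 1" using N by simp
      have rr: "?r * ?r = sqrt (real N)"
      proof -
        have "?r = sqrt (sqrt (real N))" using real_root_mult_exp[of 2 2 "real N"] by (simp add: sqrt_def)
        then show ?thesis by simp
      qed
      \<comment> \<open>Up to a constant this is the square root of the rate
        \<open>1 / real m + 1 / sqrt (real N)\<close> of the loss, which balances the loss divided
        by \<open>s\<close> against \<open>s\<close>.\<close>
      define s where "s = 1 / sqrt (real m) + 1 / ?r"
      have s: "s > 0" using m r1 by (auto simp: s_def intro!: add_pos_pos)
      define a where "a = Cc * (B^2 * (((1 + t) * C1 + 1) / sqrt (real m) + 1 / ?r))"
      define b where "b = Cc * (B^2 * ((1 + t) * (2 * C0) * ?r))"
      have "expected_error M n u v <= ennreal (2 * real n * (a + b * ?N))"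
      proof (rule error)
        show "a >= 0" "b >= 0" using Cc C0 C1 t r1 by (auto simp: a_def b_def intro!: mult_nonneg_nonneg add_nonneg_nonneg divide_nonneg_nonneg)
        fix \<omega> z k assume \<omega>: "\<omega> \<in> space M" and z: "z >= 0" and "good_sample n \<alpha> lam mu d u f g N N' X Y \<omega> z" and k: "k < n"
        then interpret good_sample n \<alpha> lam mu d u f g N N' X Y \<omega> z by simp
        define R where "R = B^2 * ((1 + t / s) * (C1 / real m + 2 * C0 * z) + s)"
        have "R <= B^2 * (((1 + t) * C1 + 1) / sqrt (real m) + 1 / ?r + (1 + t) * (2 * C0) * ?r * z)"
          unfolding R_def s_def using m by (intro mult_left_mono dirichlet_balance r1 t C1 z mult_nonneg_nonneg C0) auto
        then have "Cc * R <= Cc * (B^2 * (((1 + t) * C1 + 1) / sqrt (real m) + 1 / ?r + (1 + t) * (2 * C0) * ?r * z))"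
          using Cc by (intro mult_left_mono) auto
        also have "... = a + b * z" by (simp add: a_def b_def distrib_left mult.assoc)
        finally have R: "Cc * R <= a + b * z" .
        have "?H \<omega> k <= Cc * R"
          "?D \<omega> k <= Cc * R"
          using error_bound[OF Cc cc[rule_format] m k v[OF \<omega>], of R s] \<alpha> s
          by (simp_all only: R_def t_def C0_def C1_def simp_thms)
        then show "?H \<omega> k <= a + b * z \<and>
          ?D \<omega> k <= a + b * z"
          using R by linarith
      qed
      also have "... <= ennreal (C * (B^2 / sqrt (real m) + B^2 / ?r))"
      proof (rule ennreal_leI)
        have c1: "(1 + t) * C1 + 1 <= w" "1 + (1 + t) * (2 * C0 * q) <= w"
          unfolding w_def using t C0 C1 q by (auto simp: distrib_left)
        \<comment> \<open>The mean of the majorant is of order \<open>1 / ?r^2\<close>, so the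
          factor \<open>?r\<close> paid for the balance leaves the rate
          \<open>1 / ?r\<close>.\<close>
        have "?r * ?N = q / ?r" using r1 unfolding rr[symmetric] by simp
        then have "b * ?N = Cc * (B^2 * ((1 + t) * (2 * C0) * (q / ?r)))" by (simp only: b_def mult.assoc)
        then have "2 * real n * (a + b * ?N) = 2 * real n * Cc *
            (((1 + t) * C1 + 1) * (B^2 / sqrt (real m)) + (1 + (1 + t) * (2 * C0 * q)) * (B^2 / ?r))"
          by (simp add: a_def algebra_simps add_divide_distrib)
        also have "... <= 2 * real n * Cc * (w * (B^2 / sqrt (real m)) + w * (B^2 / ?r))"
          using Cc r1 by (intro mult_left_mono add_mono mult_right_mono c1) auto
        also have "... = C * (B^2 / sqrt (real m) + B^2 / ?r)" by (simp only: C_def distrib_left mult.assoc)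
        finally show "2 * real n * (a + b * ?N) <= C * (B^2 / sqrt (real m) + B^2 / ?r)" .
      qed
      finally show "expected_error M n u v <= ennreal (C * ((barron_norm (2 * n + 2) u)^2 / sqrt (real m) + (barron_norm (2 * n + 2) u)^2 / ?r))"
        by (simp only: B_def)
    }
  qed
qed

end
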